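(* Let $\mathcal{D}$ be a separable Hilbert space, let $B \in \mathcal{S}(\mathcal{D}, \mathbb{C})$ be such that $\log (1- BB^* ) \in L^1(\mathbb{T})$, and let $a$ be the mate of $B$. Suppose $\dim \mathcal{D} < \infty$, $\dim (aH^2)^\perp < \infty$, and $\overline{\lambda_1}, \overline{\lambda_2}, \ldots, \overline{\lambda_s}$ are the distinct eigenvalues of $M_z^*$ on $(aH^2)^\perp$. Then each $\overline{\lambda_j}$ is in $\mathbb{T}$, and $f \in \mathcal{H}(B)$ is cyclic in $\mathcal{H}(B)$ if and only if $f$ is outer and $f(\lambda_j) \neq 0$ for $j = 1, 2, \ldots, s$.
   Context: $\mathbb{D}$ is the open unit disc and $\mathbb{T}$ the unit circle. For separable Hilbert spaces $\mathcal{D},\mathcal{E}$, $H^2(\mathcal{D})$ is the Hardy space of power series on $\mathbb{D}$ with square summable coefficients in $\mathcal{D}$, $H^2=H^2(\mathbb{C})$, and $\mathcal{S}(\mathcal{D},\mathcal{E})$ is the Schur class: analytic functions on $\mathbb{D}$ whose values are contractive operators from $\mathcal{D}$ to $\mathcal{E}$. For $B\in\mathcal{S}(\mathcal{D},\mathbb{C})$, $T_B:H^2(\mathcal{D})\to H^2$ is multiplication by $B$, and on $\mathbb{T}$, $B(z)$ denotes the boundary values, so that $BB^*$ is the scalar function $z\mapsto B(z)B(z)^*$ defined a.e. on $\mathbb{T}$. For a bounded operator $A$, $\mathcal{M}(A)$ is the range of $A$ with the Hilbert space norm making $A$ a coisometry onto $\mathcal{M}(A)$ (i.e. $\|Ax\|_{\mathcal{M}(A)}=\|x\|$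 for $x\perp\ker A$). The de Branges-Rovnyak space is $\mathcal{H}(B)=\mathcal{M}((I-T_BT_B^* )^{1/2})$; it is contractively contained in $H^2$ and has reproducing kernel $K^B_w(z)=\frac{1-B(z)B(w)^*}{1-z\overline{w}}$. If $\log(1-BB^* )\in L^1(\mathbb{T})$, the mate of $B$ is the unique (scalar) outer function $a$ with $a(0)>0$ and $|a(z)|^2+B(z)B(z)^*=1$ for a.e. $z\in\mathbb{T}$. Under the hypotheses of the claim it is known that $aH^2\subseteq\mathcal{H}(B)$, that $\mathcal{H}(B)$ is invariant under the operator $M_z$ of multiplication by $z$ (which is then bounded on $\mathcal{H}(B)$), and that the polynomials are dense in $\mathcal{H}(B)$. $(aH^2)^\perp$ is the orthogonal complement of $aH^2$ in $\mathcal{H}(B)$, and $M_z^*$ is the adjoint of $M_z$ on $\mathcal{H}(B)$ (it leaves $(aH^2)^\perp$ invariant). For $f\in\mathcal{H}(B)$, $[f]$ denotes the closure in $\mathcal{H}(B)$ of the polynomial multiples of $f$, and $f$ is cyclic in $\mathcal{H}(B)$ if $[f]=\mathcal{H}(B)$. The value $f(\lambda_j)$ denotes the non-tangential limit of $f$ at $\lambda_j\in\mathbb{T}$, which exists for every $f\in\mathcal{H}(B)$ when $\overline{\lambda_j}\in\mathbb{T}$ is an eigenvalue of $M_z^*$; equivalently it is the value at $f$ of the bounded extension to $\mathcal{H}(B)$ of the functional $p\mapsto p(\lambda_j)$ on polynomials. *)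

theory Defs
  imports "HOL-Complex_Analysis.Complex_Analysis"
begin

class complex_vector = ab_group_add +
  fixes scaleC :: "complex \<Rightarrow> 'a \<Rightarrow> 'a"  (infixr \<open>*\<^sub>C\<close> 75)
  assumes scaleC_add_right: "c *\<^sub>C (x + y) = c *\<^sub>C x + c *\<^sub>C y"
    and scaleC_add_left: "(c + d) *\<^sub>C x = c *\<^sub>C x + d *\<^sub>C x"
    and scaleC_scaleC: "c *\<^sub>C d *\<^sub>C x = (c * d) *\<^sub>C x"
    and scaleC_one: "1 *\<^sub>C x = x"

global_interpretation cvec: vector_space "scaleC :: complex \<Rightarrow> 'a \<Rightarrow> 'a::complex_vector"
  by unfold_locales (auto simp: scaleC_add_right scaleC_add_left scaleC_scaleC scaleC_one)

text \<open>Inner products are linear in the first and conjugate linear in the second argument.\<close>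

class complex_inner = complex_vector + real_normed_vector +
  fixes cinner :: "'a \<Rightarrow> 'a \<Rightarrow> complex"
  assumes scaleC_of_real: "complex_of_real r *\<^sub>C x = r *\<^sub>R x"
    and cinner_add_left: "cinner (x + y) z = cinner x z + cinner y z"
    and cinner_scaleC_left: "cinner (c *\<^sub>C x) y = c * cinner x y"
    and cinner_commute: "cinner x y = cnj (cinner y x)"
    and cinner_self: "cinner x x = complex_of_real ((norm x)\<^sup>2)"

class complex_hilbert = complex_inner + complete_space

instantiation complex :: complex_hilbert
begin
definition "scaleC_complex (c::complex) (x::complex) = c * x"
definition "cinner_complex (x::complex) (y::complex) = x * cnj y"
instance
proof
  fix x y z c d :: complex and r :: real
  show "c *\<^sub>C (x + y) = c *\<^sub>C x + c *\<^sub>C y" "(c + d) *\<^sub>C x = c *\<^sub>C x + d *\<^sub>C x"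
    "c *\<^sub>C d *\<^sub>C x = (c * d) *\<^sub>C x" "1 *\<^sub>C x = x"
    by (simp_all add: scaleC_complex_def distrib_left distrib_right)
  show "complex_of_real r *\<^sub>C x = r *\<^sub>R x"
    by (simp add: scaleC_complex_def scaleR_conv_of_real)
  show "cinner (x + y) z = cinner x z + cinner y z" "cinner (c *\<^sub>C x) y = c * cinner x y"
    "cinner x y = cnj (cinner y x)"
    by (simp_all add: scaleC_complex_def cinner_complex_def distrib_right)
  show "cinner x x = complex_of_real ((norm x)\<^sup>2)"
    unfolding cinner_complex_def by (rule complex_norm_square[symmetric])
qed
end

instantiation fps :: (complex_vector) complex_vector
begin
definition "scaleC_fps c (f::'a fps) = Abs_fps (\<lambda>n. c *\<^sub>C fps_nth f n)"
instance
  by standard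
    (auto simp: scaleC_fps_def fps_eq_iff scaleC_add_right scaleC_add_left scaleC_scaleC scaleC_one)
end

definition finite_dimensional :: "'a::complex_vector set \<Rightarrow> bool" where
  "finite_dimensional V \<longleftrightarrow> (\<exists>S. finite S \<and> module.span scaleC S = V)"

text \<open>
  The space \<open>\<H>(B)\<close> depends on a term, so Hilbert spaces of functions are given
  by a carrier and an inner product; the latter is only meaningful on the carrier.
\<close>

record 'v hspace =
  hcarrier :: "'v set"
  hinner :: "'v \<Rightarrow> 'v \<Rightarrow> complex"

definition hnorm :: "'v hspace \<Rightarrow> 'v \<Rightarrow> real" where
  "hnorm H x = sqrt (Re (hinner H x x))"

definition type_hspace :: "'d::complex_inner hspace" where
  "type_hspace = \<lparr>hcarrier = UNIV, hinner = cinner\<rparr>"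

definition bounded_op ::
  "'v::complex_vector hspace \<Rightarrow> 'w::complex_vector hspace \<Rightarrow> ('v \<Rightarrow> 'w) \<Rightarrow> bool" where
  "bounded_op H K A \<longleftrightarrow>
     A ` hcarrier H \<subseteq> hcarrier K \<and>
     (\<forall>x\<in>hcarrier H. \<forall>y\<in>hcarrier H. A (x + y) = A x + A y) \<and>
     (\<forall>c. \<forall>x\<in>hcarrier H. A (c *\<^sub>C x) = c *\<^sub>C A x) \<and>
     (\<exists>C. \<forall>x\<in>hcarrier H. hnorm K (A x) \<le> C * hnorm H x)"

definition adj :: "'v hspace \<Rightarrow> 'w hspace \<Rightarrow> ('v \<Rightarrow> 'w) \<Rightarrow> 'w \<Rightarrow> 'v" where
  "adj H K A y =
     (THE x. x \<in> hcarrier H \<and> (\<forall>u\<in>hcarrier H. hinner K (A u) y = hinner H u x))"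

definition positive_op :: "'v::complex_vector hspace \<Rightarrow> ('v \<Rightarrow> 'v) \<Rightarrow> bool" where
  "positive_op H P \<longleftrightarrow> bounded_op H H P \<and> (\<forall>x\<in>hcarrier H. hinner H (P x) x \<in> \<real>\<^sub>\<ge>\<^sub>0)"

text \<open>Extensionality makes the positive square root unique as a function on the whole type.\<close>

definition sqrt_op :: "'v::complex_vector hspace \<Rightarrow> ('v \<Rightarrow> 'v) \<Rightarrow> 'v \<Rightarrow> 'v" where
  "sqrt_op H P =
     (THE Q. Q \<in> extensional (hcarrier H) \<and> positive_op H Q \<and> (\<forall>x\<in>hcarrier H. Q (Q x) = P x))"

definition orth_compl :: "'v hspace \<Rightarrow> 'v set \<Rightarrow> 'v set" where
  "orth_compl H S = {x\<in>hcarrier H. \<forall>s\<in>S. hinner H x s = 0}"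

definition hclosure :: "'v::complex_vector hspace \<Rightarrow> 'v set \<Rightarrow> 'v set" where
  "hclosure H S = {x\<in>hcarrier H. \<forall>e>0. \<exists>s\<in>S. hnorm H (x - s) < e}"

definition eigenvalues_on :: "'v::complex_vector set \<Rightarrow> ('v \<Rightarrow> 'v) \<Rightarrow> complex set" where
  "eigenvalues_on V A = {\<mu>. \<exists>x\<in>V. x \<noteq> 0 \<and> A x = \<mu> *\<^sub>C x}"

text \<open>
  \<open>coker_preimage H A y\<close> is the preimage of \<open>y\<close> in \<open>(ker A)\<^sup>\<bottom>\<close>; transporting the inner
  product along it makes \<open>A\<close> a coisometry from \<open>H\<close> onto \<open>range_space H A\<close>.
\<close>

definition coker_preimage :: "'v hspace \<Rightarrow> ('v \<Rightarrow> 'w::zero) \<Rightarrow> 'w \<Rightarrow> 'v" where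
  "coker_preimage H A y = (THE x. x \<in> orth_compl H {k\<in>hcarrier H. A k = 0} \<and> A x = y)"

definition range_space :: "'v hspace \<Rightarrow> ('v \<Rightarrow> 'w::zero) \<Rightarrow> 'w hspace" where
  "range_space H A =
     \<lparr>hcarrier = A ` hcarrier H,
      hinner = (\<lambda>y y'. hinner H (coker_preimage H A y) (coker_preimage H A y'))\<rparr>"

text \<open>
  A function analytic in the unit disc is identified with its power series at \<open>0\<close>. Members of
  \<open>H2\<close> converge in the disc because their coefficients are square summable.
\<close>

definition H2 :: "'d::complex_inner fps hspace" where
  "H2 = \<lparr>hcarrier = {f. summable (\<lambda>n. (norm (fps_nth f n))\<^sup>2)},
         hinner = (\<lambda>f g. \<Sum>n. cinner (fps_nth f n) (fps_nth g n))\<rparr>"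

definition eval_vfps :: "'d::complex_inner fps \<Rightarrow> complex \<Rightarrow> 'd" where
  "eval_vfps f z = (\<Sum>n. z ^ n *\<^sub>C fps_nth f n)"

definition stolz :: "real \<Rightarrow> complex \<Rightarrow> complex set" where
  "stolz \<alpha> \<zeta> = {z. cmod z < 1 \<and> cmod (z - \<zeta>) < \<alpha> * (1 - cmod z)}"

definition has_nt_limit :: "(complex \<Rightarrow> complex) \<Rightarrow> complex \<Rightarrow> complex \<Rightarrow> bool" where
  "has_nt_limit f \<zeta> l \<longleftrightarrow> (\<forall>\<alpha>>1. (f \<longlongrightarrow> l) (at \<zeta> within stolz \<alpha> \<zeta>))"

definition nt_lim :: "(complex \<Rightarrow> complex) \<Rightarrow> complex \<Rightarrow> complex" where
  "nt_lim f \<zeta> = (THE l. has_nt_limit f \<zeta> l)"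

text \<open>
  The integrable function \<open>u\<close> is \<open>log \<bar>f\<bar>\<close> on the circle, where the circle is parametrised by
  \<open>cis\<close> on \<open>[0, 2\<pi>]\<close>.
\<close>

definition outer_fps :: "complex fps \<Rightarrow> bool" where
  "outer_fps f \<longleftrightarrow> fps_conv_radius f \<ge> 1 \<and>
     (\<exists>c u. cmod c = 1 \<and> integrable (lebesgue_on {0..2*pi}) (u :: real \<Rightarrow> real) \<and>
       (\<forall>z\<in>ball 0 1. eval_fps f z =
          c * exp (1 / (2 * of_real pi) *
            (LINT t|lebesgue_on {0..2*pi}. (cis t + z) / (cis t - z) * complex_of_real (u t)))))"

text \<open>
  Analyticity of \<open>B\<close> is stated pointwise, which for bounded operator-valued functions agrees
  with analyticity in operator norm.
\<close>

definition schur_class :: "(complex \<Rightarrow> 'd::complex_inner \<Rightarrow> complex) set" where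
  "schur_class = {B.
     (\<forall>z\<in>ball 0 1. Vector_Spaces.linear scaleC scaleC (B z) \<and> (\<forall>x. cmod (B z x) \<le> norm x)) \<and>
     (\<forall>x. (\<lambda>z. B z x) holomorphic_on ball 0 1)}"

definition bdry_val :: "(complex \<Rightarrow> 'd \<Rightarrow> complex) \<Rightarrow> complex \<Rightarrow> 'd \<Rightarrow> complex" where
  "bdry_val B \<zeta> = (\<lambda>x. nt_lim (\<lambda>z. B z x) \<zeta>)"

text \<open>The operator \<open>B(\<zeta>)B(\<zeta>)\<^sup>*\<close> on the scalars is identified with its value at \<open>1\<close>.\<close>

definition BBstar :: "(complex \<Rightarrow> 'd::complex_inner \<Rightarrow> complex) \<Rightarrow> complex \<Rightarrow> complex" where
  "BBstar B \<zeta> = bdry_val B \<zeta> (adj type_hspace type_hspace (bdry_val B \<zeta>) 1)"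

text \<open>
  Since \<open>ln 0 = 0\<close> in HOL, the condition \<open>BB\<^sup>* < 1\<close> almost everywhere, which is implicit
  in integrability of the logarithm, has to be spelled out.
\<close>

definition log_integrable :: "(complex \<Rightarrow> 'd::complex_inner \<Rightarrow> complex) \<Rightarrow> bool" where
  "log_integrable B \<longleftrightarrow>
     (AE t in lebesgue_on {0..2*pi}. Re (BBstar B (cis t)) < 1) \<and>
     integrable (lebesgue_on {0..2*pi}) (\<lambda>t. ln (1 - Re (BBstar B (cis t))))"

definition is_mate :: "(complex \<Rightarrow> 'd::complex_inner \<Rightarrow> complex) \<Rightarrow> complex fps \<Rightarrow> bool" where
  "is_mate B a \<longleftrightarrow> outer_fps a \<and> eval_fps a 0 \<in> \<real> \<and> Re (eval_fps a 0) > 0 \<and>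
     (AE t in lebesgue_on {0..2*pi}.
        complex_of_real ((cmod (nt_lim (eval_fps a) (cis t)))\<^sup>2) + BBstar B (cis t) = 1)"

definition toeplitz :: "(complex \<Rightarrow> 'd::complex_inner \<Rightarrow> complex) \<Rightarrow> 'd fps \<Rightarrow> complex fps" where
  "toeplitz B h = fps_expansion (\<lambda>z. B z (eval_vfps h z)) 0"

definition dBR :: "(complex \<Rightarrow> 'd::complex_inner \<Rightarrow> complex) \<Rightarrow> complex fps hspace" where
  "dBR B = range_space H2 (sqrt_op H2 (\<lambda>f. f - toeplitz B (adj H2 H2 (toeplitz B) f)))"

definition Mz :: "complex fps \<Rightarrow> complex fps" where
  "Mz f = fps_X * f"

definition Mz_adj :: "(complex \<Rightarrow> 'd::complex_inner \<Rightarrow> complex) \<Rightarrow> complex fps \<Rightarrow> complex fps" where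
  "Mz_adj B = adj (dBR B) (dBR B) Mz"

definition aH2_perp ::
  "(complex \<Rightarrow> 'd::complex_inner \<Rightarrow> complex) \<Rightarrow> complex fps \<Rightarrow> complex fps set" where
  "aH2_perp B a = orth_compl (dBR B) {a * f |f. f \<in> hcarrier H2}"

definition cyclic_in :: "complex fps hspace \<Rightarrow> complex fps \<Rightarrow> bool" where
  "cyclic_in H f \<longleftrightarrow> hclosure H {fps_of_poly p * f |p. True} = hcarrier H"

end

theory Submission
  imports Defs
begin

text \<open>
  Write \<open>T\<close> for multiplication by \<open>B\<close> and \<open>N h = \<bar>h\<bar>\<^sup>2 - \<bar>T\<^sup>* h\<bar>\<^sup>2\<close>. Then \<open>\<H>(B)\<close> consists of the
  \<open>f\<close> with \<open>\<bar>\<langle>f, h\<rangle>\<bar>\<^sup>2 \<le> C\<^sup>2 N h\<close> for all \<open>h\<close> in the Hardy space, and the norm of \<open>f\<close> is the least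
  \<open>C \<ge> 0\<close>. The mate enters through the inequality \<open>\<bar>a(z) c + B(z) x\<bar>\<^sup>2 \<le> \<bar>c\<bar>\<^sup>2 + \<bar>x\<bar>\<^sup>2\<close>, which holds on the
  circle and passes to the disc by Poisson integrals. It bounds polynomial multipliers of \<open>\<H>(B)\<close> by the
  growth of the polynomial relative to \<open>\<bar>a\<bar>\<close>: the powers of \<open>M\<^sub>z\<close> grow subexponentially, and \<open>a f\<close> lies
  in \<open>[f]\<close> because the partial sums of dilations of \<open>a\<close> are uniformly bounded multipliers.

  If \<open>f\<close> is cyclic in the Hardy space, then the orthogonal complement of \<open>[f]\<close> is therefore contained in
  \<open>(a H\<^sup>2)\<^sup>\<bottom>\<close>; it is finite-dimensional and \<open>M\<^sub>z\<^sup>*\<close>-invariant, so unless it vanishes it contains an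
  eigenvector of \<open>M\<^sub>z\<^sup>*\<close>, which is evaluation at a point \<open>\<lambda>\<^sub>j\<close> up to a factor, and \<open>f(\<lambda>\<^sub>j) = 0\<close>. The
  eigenvalues are unimodular: they are bounded by the spectral radius of \<open>M\<^sub>z\<close>, and evaluation at an
  interior point does not annihilate \<open>a\<close>.

  Outer functions are cyclic in the Hardy space by truncating \<open>log \<bar>f\<bar>\<close> from below. Conversely, if
  \<open>p\<^sub>n f \<longlongrightarrow> 1\<close> and \<open>F\<close> is the outer function with \<open>\<bar>F\<bar> = \<bar>f\<bar>\<close> on the circle, then \<open>\<bar>f\<bar> \<le> \<bar>F\<bar>\<close> and
  \<open>p\<^sub>n F\<close> and \<open>p\<^sub>n f\<close> have the same norm, which forces \<open>\<bar>f(0)\<bar> \<ge> \<bar>F(0)\<bar>\<close>, so \<open>f / F\<close> is constant.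
\<close>

section \<open>Hilbert spaces with a carrier\<close>

text \<open>The obstacle is that multiplication by a polynomial does not commute with the adjoint of
  \<open>T\<close>. Comparing coefficients isolates the failure: the adjoint applied to
  \<open>z^j x\<close> is a shift of \<open>Ts x\<close> plus a finite reversed block of one fixed
  sequence \<open>hankel x\<close>, whose norm is at most the square root of \<open>N x\<close>. The
  shifted part is controlled by the supremum of the polynomial, the Hankel part by its size relative
  to \<open>a\<close>. The latter is measured on a circle of radius \<open>s < 1\<close>, where a
  bound for \<open>\<psi>\<close> becomes one for the dilated polynomial
  \<open>\<psi>(s^2 z)\<close>; this is why the multiplier estimates involve pairs of polynomials.
  Working inside the disc avoids boundary values of vector-valued functions. Boundary theory is
  confined to scalar functions, and finite dimension of the coefficient space enters where the
  boundary values of \<open>B\<close> are assembled from a spanning set. Density of the polynomials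
  and existence of the values at the points \<open>\<Lambda> j\<close> are derived. Such a value is
  \<open><f, k> / <1, k>\<close> for an eigenvector \<open>k\<close>, so \<open><1, k>\<close> must
  first be shown to be nonzero; density of the polynomials is what excludes its vanishing.\<close>

lemma le_mult_of_amgm:
  fixes a b c :: real
  assumes "0 \<le> a" "0 \<le> b" and amgm: "\<And>l. l > 0 \<Longrightarrow> 2 * c \<le> l * a\<^sup>2 + b\<^sup>2 / l"
  shows "c \<le> a * b"
proof (rule field_le_epsilon)
  fix e :: real assume e: "e > 0"
  show "c \<le> a * b + e"
  proof (cases "a = 0")
    case True
    \<comment> \<open>For \<open>a = 0\<close> the weight is taken so large that
      \<open>b^2 / l\<close> is at most \<open>e\<close>.\<close>
    have "2 * c \<le> ((b\<^sup>2 + 1) / e) * a\<^sup>2 + b\<^sup>2 / ((b\<^sup>2 + 1) / e)"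
      using e by (intro amgm) (simp add: add_nonneg_pos)
    also have "b\<^sup>2 / ((b\<^sup>2 + 1) / e) \<le> e"
    proof -
      have "b\<^sup>2 / ((b\<^sup>2 + 1) / e) = e * (b\<^sup>2 / (b\<^sup>2 + 1))" by simp
      also have "\<dots> \<le> e * 1" using e by (intro mult_left_mono) (auto simp: divide_le_eq add_nonneg_pos)
      finally show ?thesis by simp
    qed
    finally show ?thesis using True e by simp
  next
    case False
    hence a: "a > 0" using assms by simp
    \<comment> \<open>The minimising weight is \<open>l = b / a\<close>; adding \<open>d\<close> to
      \<open>b\<close> keeps it positive when \<open>b = 0\<close> and costs exactly
      \<open>a * d = e\<close>.\<close>
    define d where "d = e / a"
    have d: "d > 0" using a e by (simp add: d_def)
    have "2 * c \<le> ((b + d) / a) * a\<^sup>2 + b\<^sup>2 / ((b + d) / a)"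
      using a d assms by (intro amgm) (simp add: add_nonneg_pos)
    also have "((b + d) / a) * a\<^sup>2 = a * b + a * d"
      using a by (simp add: power2_eq_square field_simps)
    also have "b\<^sup>2 / ((b + d) / a) \<le> a * b"
      using a d assms by (simp add: divide_simps add_nonneg_pos power2_eq_square algebra_simps)
    also have "a * d = e" using a by (simp add: d_def)
    finally show ?thesis using e by simp
  qed
qed

text \<open>Inner products in \<open>hform\<close> may be degenerate.\<close>

locale hform =
  fixes H :: "'v::complex_vector hspace"
  assumes zero_mem: "0 \<in> hcarrier H"
    and add_mem: "x \<in> hcarrier H \<Longrightarrow> y \<in> hcarrier H \<Longrightarrow> x + y \<in> hcarrier H"
    and scale_mem: "x \<in> hcarrier H \<Longrightarrow> c *\<^sub>C x \<in> hcarrier H"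
    and inner_add_left: "x \<in> hcarrier H \<Longrightarrow> y \<in> hcarrier H \<Longrightarrow> z \<in> hcarrier H \<Longrightarrow>
        hinner H (x + y) z = hinner H x z + hinner H y z"
    and inner_scale_left: "x \<in> hcarrier H \<Longrightarrow> y \<in> hcarrier H \<Longrightarrow>
        hinner H (c *\<^sub>C x) y = c * hinner H x y"
    and inner_commute: "x \<in> hcarrier H \<Longrightarrow> y \<in> hcarrier H \<Longrightarrow> hinner H x y = cnj (hinner H y x)"
    and inner_ge0: "x \<in> hcarrier H \<Longrightarrow> Re (hinner H x x) \<ge> 0"
begin

lemma uminus_mem: "x \<in> hcarrier H \<Longrightarrow> - x \<in> hcarrier H"
  using scale_mem[of x "-1"] by simp

lemma diff_mem: "x \<in> hcarrier H \<Longrightarrow> y \<in> hcarrier H \<Longrightarrow> x - y \<in> hcarrier H"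
  using add_mem[of x "-y"] uminus_mem[of y] by simp

lemma sum_mem: "(\<And>i. i \<in> I \<Longrightarrow> f i \<in> hcarrier H) \<Longrightarrow> sum f I \<in> hcarrier H"
  by (induction I rule: infinite_finite_induct) (auto intro: zero_mem add_mem)

lemmas mem_intros = zero_mem add_mem scale_mem uminus_mem diff_mem sum_mem

lemma inner_add_right:
  assumes "x \<in> hcarrier H" "y \<in> hcarrier H" "z \<in> hcarrier H"
  shows "hinner H x (y + z) = hinner H x y + hinner H x z"
  using assms by (metis add_mem complex_cnj_add inner_add_left inner_commute)

lemma inner_scale_right:
  assumes "x \<in> hcarrier H" "y \<in> hcarrier H"
  shows "hinner H x (c *\<^sub>C y) = cnj c * hinner H x y"
  using assms by (metis scale_mem complex_cnj_mult inner_scale_left inner_commute)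

lemma inner_minus_left: "x \<in> hcarrier H \<Longrightarrow> y \<in> hcarrier H \<Longrightarrow> hinner H (- x) y = - hinner H x y"
  using inner_scale_left[of x y "-1"] by simp

lemma inner_minus_right: "x \<in> hcarrier H \<Longrightarrow> y \<in> hcarrier H \<Longrightarrow> hinner H x (- y) = - hinner H x y"
  using inner_scale_right[of x y "-1"] by simp

lemma inner_diff_left:
  assumes "x \<in> hcarrier H" "y \<in> hcarrier H" "z \<in> hcarrier H"
  shows "hinner H (x - y) z = hinner H x z - hinner H y z"
  using inner_add_left[of x "-y" z] inner_minus_left[of y z] uminus_mem[of y] assms by simp

lemma inner_diff_right:
  assumes "x \<in> hcarrier H" "y \<in> hcarrier H" "z \<in> hcarrier H"
  shows "hinner H x (y - z) = hinner H x y - hinner H x z"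
  using inner_add_right[of x y "-z"] inner_minus_right[of x z] uminus_mem[of z] assms by simp

lemma inner_zero_left [simp]: "x \<in> hcarrier H \<Longrightarrow> hinner H 0 x = 0"
  using inner_diff_left[of x x x] by simp

lemma inner_zero_right [simp]: "x \<in> hcarrier H \<Longrightarrow> hinner H x 0 = 0"
  using inner_diff_right[of x x x] by simp

lemma inner_sum_left:
  assumes "\<And>i. i \<in> I \<Longrightarrow> f i \<in> hcarrier H" "x \<in> hcarrier H"
  shows "hinner H (sum f I) x = (\<Sum>i\<in>I. hinner H (f i) x)"
  using assms
  by (induction I rule: infinite_finite_induct) (auto simp: inner_add_left sum_mem)

lemma hnorm_sq: "x \<in> hcarrier H \<Longrightarrow> (hnorm H x)\<^sup>2 = Re (hinner H x x)"
  by (simp add: hnorm_def inner_ge0)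

lemma hnorm_ge0: "x \<in> hcarrier H \<Longrightarrow> hnorm H x \<ge> 0"
  by (simp add: hnorm_def inner_ge0)

lemma inner_self: "x \<in> hcarrier H \<Longrightarrow> hinner H x x = complex_of_real ((hnorm H x)\<^sup>2)"
  using inner_commute[of x x] by (simp add: hnorm_sq complex_eq_iff)

lemma hnorm_zero [simp]: "hnorm H 0 = 0"
  using zero_mem by (simp add: hnorm_def)

lemma hnorm_scale: "x \<in> hcarrier H \<Longrightarrow> hnorm H (c *\<^sub>C x) = cmod c * hnorm H x"
proof (rule power2_eq_imp_eq)
  assume x: "x \<in> hcarrier H"
  have "hinner H (c *\<^sub>C x) (c *\<^sub>C x) = (c * cnj c) * hinner H x x"
    using x by (simp add: inner_scale_left inner_scale_right scale_mem)
  also have "\<dots> = complex_of_real ((cmod c)\<^sup>2 * (hnorm H x)\<^sup>2)"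
    using x by (simp only: inner_self complex_norm_square of_real_mult)
  finally show "(hnorm H (c *\<^sub>C x))\<^sup>2 = (cmod c * hnorm H x)\<^sup>2"
    using x by (simp add: hnorm_sq[OF scale_mem] power_mult_distrib)
qed (auto simp: hnorm_ge0 scale_mem)

lemma hnorm_minus: "x \<in> hcarrier H \<Longrightarrow> hnorm H (- x) = hnorm H x"
  using hnorm_scale[of x "-1"] by simp

lemma hnorm_minus_commute:
  assumes "x \<in> hcarrier H" "y \<in> hcarrier H" shows "hnorm H (x - y) = hnorm H (y - x)"
  using hnorm_minus[of "x - y"] assms by (simp add: diff_mem)

lemma hnorm_add_sq:
  assumes "x \<in> hcarrier H" "y \<in> hcarrier H"
  shows "(hnorm H (x + y))\<^sup>2 = (hnorm H x)\<^sup>2 + (hnorm H y)\<^sup>2 + 2 * Re (hinner H x y)"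
  using assms inner_commute[of y x]
  by (simp add: hnorm_sq add_mem inner_add_left inner_add_right)

lemma hnorm_diff_sq:
  assumes "x \<in> hcarrier H" "y \<in> hcarrier H"
  shows "(hnorm H (x - y))\<^sup>2 = (hnorm H x)\<^sup>2 + (hnorm H y)\<^sup>2 - 2 * Re (hinner H x y)"
  using assms inner_commute[of y x]
  by (simp add: hnorm_sq diff_mem inner_diff_left inner_diff_right)

lemma cauchy_schwarz:
  assumes x: "x \<in> hcarrier H" and y: "y \<in> hcarrier H"
  shows "cmod (hinner H x y) \<le> hnorm H x * hnorm H y"
proof (rule le_mult_of_amgm)
  show "0 \<le> hnorm H x" "0 \<le> hnorm H y" using assms by (auto simp: hnorm_ge0)
  fix l :: real assume l: "l > 0"
  define u where "u = (if hinner H x y = 0 then 1 else sgn (hinner H x y))"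
  have u: "cmod u = 1" by (simp add: u_def norm_sgn)
  have cu: "cnj u * hinner H x y = complex_of_real (cmod (hinner H x y))"
  proof (cases "hinner H x y = 0")
    case False
    hence "cnj u * hinner H x y = hinner H x y * cnj (hinner H x y) / cmod (hinner H x y)"
      by (simp add: u_def sgn_div_norm scaleR_conv_of_real divide_inverse)
    also have "\<dots> = complex_of_real ((cmod (hinner H x y))\<^sup>2) / cmod (hinner H x y)"
      by (simp only: complex_norm_square)
    finally show ?thesis using False by (simp add: power2_eq_square)
  qed simp
  define X where "X = complex_of_real (sqrt l) *\<^sub>C x"
  define Y where "Y = (complex_of_real (1 / sqrt l) * u) *\<^sub>C y"
  have XY: "X \<in> hcarrier H" "Y \<in> hcarrier H" by (simp_all add: X_def Y_def x y scale_mem)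
  have "(hnorm H X)\<^sup>2 = l * (hnorm H x)\<^sup>2"
    using l by (simp add: X_def hnorm_scale x power_mult_distrib)
  moreover have "(hnorm H Y)\<^sup>2 = (hnorm H y)\<^sup>2 / l"
    using l by (simp add: Y_def hnorm_scale y power_mult_distrib norm_mult u power_divide norm_divide)
  moreover have "hinner H X Y = complex_of_real (sqrt l) * complex_of_real (1 / sqrt l) * (cnj u * hinner H x y)"
    by (simp add: X_def Y_def inner_scale_left inner_scale_right scale_mem x y)
  hence "hinner H X Y = cmod (hinner H x y)"
    using l cu by (simp flip: of_real_mult)
  ultimately show "2 * cmod (hinner H x y) \<le> l * (hnorm H x)\<^sup>2 + (hnorm H y)\<^sup>2 / l"
    using hnorm_diff_sq[OF XY] zero_le_power2[of "hnorm H (X - Y)"] by simp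
qed

lemma hnorm_triangle:
  assumes "x \<in> hcarrier H" "y \<in> hcarrier H"
  shows "hnorm H (x + y) \<le> hnorm H x + hnorm H y"
proof (rule power2_le_imp_le)
  have "Re (hinner H x y) \<le> hnorm H x * hnorm H y"
    using cauchy_schwarz[OF assms] complex_Re_le_cmod order_trans by blast
  thus "(hnorm H (x + y))\<^sup>2 \<le> (hnorm H x + hnorm H y)\<^sup>2"
    by (simp add: hnorm_add_sq assms power2_sum)
qed (use assms in \<open>simp add: hnorm_ge0\<close>)

lemma hnorm_diff_triangle:
  assumes "x \<in> hcarrier H" "y \<in> hcarrier H" "z \<in> hcarrier H"
  shows "hnorm H (x - z) \<le> hnorm H (x - y) + hnorm H (y - z)"
  using hnorm_triangle[of "x - y" "y - z"] assms by (simp add: diff_mem)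

lemma hnorm_triangle_diff:
  assumes "x \<in> hcarrier H" "y \<in> hcarrier H"
  shows "hnorm H (x - y) \<le> hnorm H x + hnorm H y"
  using hnorm_triangle[of x "- y"] assms by (simp add: uminus_mem hnorm_minus)

lemma hnorm_reverse_triangle:
  assumes "x \<in> hcarrier H" "y \<in> hcarrier H"
  shows "\<bar>hnorm H x - hnorm H y\<bar> \<le> hnorm H (x - y)"
  using hnorm_triangle[of "x - y" y] hnorm_triangle[of "y - x" x] hnorm_minus_commute[of x y] assms
  by (simp add: diff_mem)

lemma parallelogram:
  assumes "x \<in> hcarrier H" "y \<in> hcarrier H"
  shows "(hnorm H (x - y))\<^sup>2 = 2 * (hnorm H x)\<^sup>2 + 2 * (hnorm H y)\<^sup>2 - (hnorm H (x + y))\<^sup>2"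
  using assms by (simp add: hnorm_add_sq hnorm_diff_sq)

lemma tendsto_inner_left:
  assumes "\<And>n. X n \<in> hcarrier H" "x \<in> hcarrier H" "y \<in> hcarrier H"
    and "((\<lambda>n. hnorm H (X n - x)) \<longlongrightarrow> 0) F"
  shows "((\<lambda>n. hinner H (X n) y) \<longlongrightarrow> hinner H x y) F"
proof (rule Lim_transform2)
  show "((\<lambda>n. hinner H x y) \<longlongrightarrow> hinner H x y) F" by simp
  show "((\<lambda>n. hinner H x y - hinner H (X n) y) \<longlongrightarrow> 0) F"
  proof (rule Lim_null_comparison)
    show "\<forall>\<^sub>F n in F. norm (hinner H x y - hinner H (X n) y) \<le> hnorm H (X n - x) * hnorm H y"
    proof (intro always_eventually allI)
      fix n
      have "hinner H x y - hinner H (X n) y = - hinner H (X n - x) y"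
        using assms by (simp add: inner_diff_left)
      thus "norm (hinner H x y - hinner H (X n) y) \<le> hnorm H (X n - x) * hnorm H y"
        using cauchy_schwarz[of "X n - x" y] assms by (simp add: diff_mem)
    qed
    show "((\<lambda>n. hnorm H (X n - x) * hnorm H y) \<longlongrightarrow> 0) F"
      using tendsto_mult_right[OF assms(4), of "hnorm H y"] by simp
  qed
qed

lemma tendsto_hnorm:
  assumes "\<And>n. X n \<in> hcarrier H" "x \<in> hcarrier H"
    and "((\<lambda>n. hnorm H (X n - x)) \<longlongrightarrow> 0) F"
  shows "((\<lambda>n. hnorm H (X n)) \<longlongrightarrow> hnorm H x) F"
proof (rule Lim_transform2)
  show "((\<lambda>n. hnorm H x) \<longlongrightarrow> hnorm H x) F" by simp
  show "((\<lambda>n. hnorm H x - hnorm H (X n)) \<longlongrightarrow> 0) F"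
    using hnorm_reverse_triangle[OF assms(2,1)] hnorm_minus_commute[OF assms(1,2)]
    by (intro Lim_null_comparison[OF _ assms(3)] always_eventually) auto
qed

end

locale prehilbert = hform H for H :: "'v::complex_vector hspace" +
  assumes inner_definite: "x \<in> hcarrier H \<Longrightarrow> hinner H x x = 0 \<Longrightarrow> x = 0"
begin

lemma hnorm_eq0: "x \<in> hcarrier H \<Longrightarrow> hnorm H x = 0 \<longleftrightarrow> x = 0"
  using inner_definite[of x] by (auto simp: inner_self)

lemma inner_eqI:
  assumes "x \<in> hcarrier H" "y \<in> hcarrier H"
    and "\<And>z. z \<in> hcarrier H \<Longrightarrow> hinner H z x = hinner H z y"
  shows "x = y"
  using assms(3)[of "x - y"] inner_definite[of "x - y"] assms(1,2)
  by (auto simp: diff_mem inner_diff_right)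

lemma limit_unique:
  assumes "\<And>n. X n \<in> hcarrier H" "x \<in> hcarrier H" "y \<in> hcarrier H"
    and "(\<lambda>n. hnorm H (X n - x)) \<longlonglongrightarrow> 0" "(\<lambda>n. hnorm H (X n - y)) \<longlonglongrightarrow> 0"
  shows "x = y"
proof -
  have "hinner H x z = hinner H y z" if "z \<in> hcarrier H" for z
    using LIMSEQ_unique[OF tendsto_inner_left[OF assms(1,2) that assms(4)]
        tendsto_inner_left[OF assms(1,3) that assms(5)]] .
  hence "hinner H z x = hinner H z y" if "z \<in> hcarrier H" for z
    using that assms by (metis inner_commute)
  thus ?thesis using inner_eqI assms by blast
qed

end

locale hilbert = prehilbert H for H :: "'v::complex_vector hspace" +
  assumes complete: "(\<And>n. X n \<in> hcarrier H) \<Longrightarrow>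
      (\<And>e. e > 0 \<Longrightarrow> \<exists>N. \<forall>m\<ge>N. \<forall>n\<ge>N. hnorm H (X m - X n) < e) \<Longrightarrow>
      \<exists>x\<in>hcarrier H. (\<lambda>n. hnorm H (X n - x)) \<longlonglongrightarrow> 0"

section \<open>Riesz representation, orthogonal projections and adjoints\<close>

definition closed_subspace :: "'v::complex_vector hspace \<Rightarrow> 'v set \<Rightarrow> bool" where
  "closed_subspace H K \<longleftrightarrow> K \<subseteq> hcarrier H \<and> cvec.subspace K \<and> hclosure H K \<subseteq> K"

text \<open>The representing vector is the limit of \<open>Q x\<^sub>n\<close> for a sequence minimising \<open>\<bar>Q x\<bar>\<^sup>2 - 2 Re (\<phi> x)\<close>.\<close>

lemma (in hilbert) riesz_range:
  fixes Q :: "'u::complex_vector \<Rightarrow> 'v"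
  assumes D: "cvec.subspace D"
    and Q: "\<And>x. x \<in> D \<Longrightarrow> Q x \<in> hcarrier H" "\<And>x y. x \<in> D \<Longrightarrow> y \<in> D \<Longrightarrow> Q (x + y) = Q x + Q y"
      "\<And>c x. x \<in> D \<Longrightarrow> Q (c *\<^sub>C x) = c *\<^sub>C Q x"
    and \<phi>: "\<And>x y. x \<in> D \<Longrightarrow> y \<in> D \<Longrightarrow> \<phi> (x + y) = \<phi> x + \<phi> y"
      "\<And>c x. x \<in> D \<Longrightarrow> \<phi> (c *\<^sub>C x) = c * \<phi> x"
    and M: "0 \<le> M" "\<And>x. x \<in> D \<Longrightarrow> cmod (\<phi> x) \<le> M * hnorm H (Q x)"
  obtains y where "y \<in> hclosure H (Q ` D)" "\<And>x. x \<in> D \<Longrightarrow> \<phi> x = hinner H (Q x) y" "hnorm H y \<le> M"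
proof -
  note sub = cvec.subspace_0[OF D] cvec.subspace_add[OF D] cvec.subspace_scale[OF D]
  define J where "J x = (hnorm H (Q x))\<^sup>2 - 2 * Re (\<phi> x)" for x
  have J_ge: "- M\<^sup>2 \<le> J x" if "x \<in> D" for x
  proof -
    have "Re (\<phi> x) \<le> M * hnorm H (Q x)" using M(2)[OF that] complex_Re_le_cmod[of "\<phi> x"] by linarith
    thus ?thesis using zero_le_power2[of "hnorm H (Q x) - M"] by (simp add: J_def power2_diff algebra_simps)
  qed
  define d where "d = (INF x\<in>D. J x)"
  have bdd: "bdd_below (J ` D)" using J_ge by (intro bdd_belowI[of _ "- M\<^sup>2"]) auto
  have d_le: "d \<le> J x" if "x \<in> D" for x
    unfolding d_def using bdd that by (rule cINF_lower)
  have "\<exists>x\<in>D. J x < d + inverse (real (Suc n))" for n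
    using cINF_less_iff[OF _ bdd, of "d + inverse (real (Suc n))"] sub(1) by (auto simp: d_def)
  then obtain x where xD: "\<And>n. x n \<in> D" and xJ: "\<And>n. J (x n) < d + inverse (real (Suc n))"
    by metis
  note C = Q(1)[OF xD]
  \<comment> \<open>At the midpoint \<open>J\<close> is still at least \<open>d\<close>, and the
    parallelogram law turns this into closeness of the images \<open>Q (x n)\<close>; the vectors
    \<open>x n\<close> live in a space without a norm of its own.\<close>
  have dist: "(hnorm H (Q (x m) - Q (x n)))\<^sup>2 \<le> 2 * inverse (real (Suc m)) + 2 * inverse (real (Suc n))" for m n
  proof -
    let ?m = "(1/2) *\<^sub>C (x m + x n)"
    have "(hnorm H (Q ?m))\<^sup>2 = (hnorm H (Q (x m) + Q (x n)))\<^sup>2 / 4"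
      using xD C by (simp add: sub Q(2,3) mem_intros hnorm_scale power_divide)
    moreover have "Re (\<phi> ?m) = (Re (\<phi> (x m)) + Re (\<phi> (x n))) / 2" using xD by (simp add: \<phi> sub)
    ultimately have "4 * J ?m = (hnorm H (Q (x m) + Q (x n)))\<^sup>2 - 4 * Re (\<phi> (x m)) - 4 * Re (\<phi> (x n))"
      by (simp add: J_def algebra_simps)
    with parallelogram[OF C C, of m n]
    have "(hnorm H (Q (x m) - Q (x n)))\<^sup>2 = 2 * J (x m) + 2 * J (x n) - 4 * J ?m"
      by (simp add: J_def)
    moreover have "d \<le> J ?m" using xD by (intro d_le sub)
    ultimately show ?thesis using xJ[of m] xJ[of n] by simp
  qed
  obtain y where y: "y \<in> hcarrier H" "(\<lambda>n. hnorm H (Q (x n) - y)) \<longlonglongrightarrow> 0"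
  proof -
    have "\<exists>N. \<forall>m\<ge>N. \<forall>n\<ge>N. hnorm H (Q (x m) - Q (x n)) < e" if e: "e > 0" for e
    proof -
      obtain N where N: "inverse (real (Suc N)) < e\<^sup>2 / 4" using reals_Archimedean[of "e\<^sup>2/4"] e by auto
      have "hnorm H (Q (x m) - Q (x n)) < e" if "m \<ge> N" "n \<ge> N" for m n
      proof (rule power2_less_imp_less)
        have "inverse (real (Suc m)) \<le> inverse (real (Suc N))" "inverse (real (Suc n)) \<le> inverse (real (Suc N))"
          using that by (auto intro!: le_imp_inverse_le)
        thus "(hnorm H (Q (x m) - Q (x n)))\<^sup>2 < e\<^sup>2" using dist[of m n] N by linarith
      qed (use e in simp)
      thus ?thesis by blast
    qed
    thus ?thesis using complete[of "\<lambda>n. Q (x n)"] C that by blast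
  qed
  have "\<exists>s\<in>Q ` D. hnorm H (y - s) < e" if e: "e > 0" for e
  proof -
    obtain n where "hnorm H (Q (x n) - y) < e"
      using order_tendstoD(2)[OF y(2) e] by (auto simp: eventually_sequentially)
    thus ?thesis using xD hnorm_minus_commute[OF C y(1), of n] by auto
  qed
  hence cl: "y \<in> hclosure H (Q ` D)" using y(1) by (auto simp: hclosure_def)
  \<comment> \<open>First variation at the minimum: the error \<open>E\<close> is the linear
    coefficient of a quadratic in \<open>t\<close> that stays nonnegative. Testing with
    \<open>\<i> *\<^sub>C v\<close> later recovers the imaginary part.\<close>
  have key: "Re (\<phi> v) = Re (hinner H (Q v) y)" if v: "v \<in> D" for v
  proof -
    define A where "A = (hnorm H (Q v))\<^sup>2"
    define E where "E = Re (hinner H y (Q v)) - Re (\<phi> v)"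
    have A: "A \<ge> 0" by (simp add: A_def)
    have *: "0 \<le> t\<^sup>2 * A + 2 * t * E" for t :: real
    proof (rule LIMSEQ_le_const)
      let ?g = "\<lambda>n. inverse (real (Suc n)) + (t\<^sup>2 * A + 2 * t * (Re (hinner H (Q (x n)) (Q v)) - Re (\<phi> v)))"
      have "(\<lambda>n. hinner H (Q (x n)) (Q v)) \<longlonglongrightarrow> hinner H y (Q v)"
        by (rule tendsto_inner_left[OF C y(1) Q(1)[OF v] y(2)])
      hence "?g \<longlonglongrightarrow> 0 + (t\<^sup>2 * A + 2 * t * E)"
        unfolding E_def by (intro tendsto_intros LIMSEQ_inverse_real_of_nat)
      thus "?g \<longlonglongrightarrow> t\<^sup>2 * A + 2 * t * E" by simp
      have "0 \<le> ?g n" for n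
      proof -
        let ?tv = "complex_of_real t *\<^sub>C v"
        have "J (x n + ?tv) = J (x n) + (t\<^sup>2 * A + 2 * t * (Re (hinner H (Q (x n)) (Q v)) - Re (\<phi> v)))"
          using xD[of n] v C[of n] Q(1)[OF v]
          by (simp add: J_def A_def Q(2,3) \<phi> sub hnorm_add_sq scale_mem hnorm_scale power_mult_distrib
              inner_scale_right algebra_simps)
        moreover have "d \<le> J (x n + ?tv)" using xD v by (intro d_le sub)
        ultimately show ?thesis using xJ[of n] by linarith
      qed
      thus "\<exists>N. \<forall>n\<ge>N. 0 \<le> ?g n" by blast
    qed
    \<comment> \<open>The vertex of the parabola is at \<open>- E / A\<close>; the denominator
      \<open>A + 1\<close> also covers \<open>A = 0\<close>.\<close>
    have "0 \<le> (- E / (A + 1))\<^sup>2 * A + 2 * (- E / (A + 1)) * E" by (rule *)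
    also have "\<dots> = - (E\<^sup>2 * (A + 2)) / (A + 1)\<^sup>2"
      using A by (simp add: field_simps power2_eq_square add_nonneg_eq_0_iff)
    finally have "E\<^sup>2 * (A + 2) \<le> 0" using A by (simp add: divide_le_0_iff zero_le_divide_iff add_nonneg_eq_0_iff)
    hence "E = 0" using A by (simp add: mult_le_0_iff)
    thus ?thesis using inner_commute[OF y(1) Q(1)[OF v]] by (simp add: E_def)
  qed
  have rep: "\<phi> v = hinner H (Q v) y" if v: "v \<in> D" for v
    using key[OF v] key[OF sub(3)[OF v], of \<i>] v y Q(1)[OF v]
    by (simp add: complex_eq_iff Q(3) \<phi>(2) inner_scale_left)
  \<comment> \<open>Since \<open>y\<close> is the limit of \<open>Q (x n)\<close>, its squared norm
    is the limit of \<open>\<phi> (x n)\<close>, which is bounded by \<open>M\<close> times the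
    norms of \<open>Q (x n)\<close>.\<close>
  have "(hnorm H y)\<^sup>2 \<le> M * hnorm H y"
  proof (rule LIMSEQ_le)
    have "(\<lambda>n. cmod (hinner H (Q (x n)) y)) \<longlonglongrightarrow> cmod (hinner H y y)"
      by (rule tendsto_norm[OF tendsto_inner_left[OF C y(1) y(1) y(2)]])
    thus "(\<lambda>n. cmod (\<phi> (x n))) \<longlonglongrightarrow> (hnorm H y)\<^sup>2" using y xD by (simp add: rep inner_self norm_power)
    show "(\<lambda>n. M * hnorm H (Q (x n))) \<longlonglongrightarrow> M * hnorm H y"
      by (rule tendsto_mult_left[OF tendsto_hnorm[OF C y]])
    show "\<exists>N. \<forall>n\<ge>N. cmod (\<phi> (x n)) \<le> M * hnorm H (Q (x n))" using M(2)[OF xD] by blast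
  qed
  hence "hnorm H y \<le> M"
    using hnorm_ge0[OF y(1)] M(1) by (cases "hnorm H y = 0") (auto simp: power2_eq_square)
  with cl rep show thesis using that by blast
qed

text \<open>Riesz representation on \<open>K\<close> of the functional induced by \<open>x\<close>;
  closedness places the representing vector, a priori only in the closure, into
  \<open>K\<close>.\<close>

lemma (in hilbert) orthogonal_projection:
  assumes K: "closed_subspace H K" and x: "x \<in> hcarrier H"
  obtains k where "k \<in> K" "\<And>s. s \<in> K \<Longrightarrow> hinner H (x - k) s = 0"
proof -
  have sub: "cvec.subspace K" and KC: "\<And>k. k \<in> K \<Longrightarrow> k \<in> hcarrier H" and cl: "hclosure H K \<subseteq> K"
    using K by (auto simp: closed_subspace_def)
  have "cmod (hinner H s x) \<le> hnorm H x * hnorm H s" if "s \<in> K" for s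
    using cauchy_schwarz[OF KC[OF that] x] by (simp add: mult.commute)
  then obtain k where k: "k \<in> hclosure H ((\<lambda>s. s) ` K)" "\<And>s. s \<in> K \<Longrightarrow> hinner H s x = hinner H s k"
    using x KC by (rule_tac riesz_range[of K "\<lambda>s. s" "\<lambda>s. hinner H s x" "hnorm H x", OF sub])
      (auto simp: inner_add_left inner_scale_left hnorm_ge0)
  have kK: "k \<in> K" using k(1) cl by auto
  have "hinner H (x - k) s = 0" if s: "s \<in> K" for s
    using k(2)[OF s] inner_commute[OF x KC[OF s]] inner_commute[OF KC[OF kK] KC[OF s]] x KC[OF kK] KC[OF s]
    by (simp add: inner_diff_left)
  with kK show thesis using that by blast
qed

lemma (in hform) inner_hclosure_eq0:
  assumes S: "S \<subseteq> hcarrier H" and x: "x \<in> hclosure H S" and g: "g \<in> hcarrier H"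
    and 0: "\<And>s. s \<in> S \<Longrightarrow> hinner H s g = 0"
  shows "hinner H x g = 0"
proof -
  have xC: "x \<in> hcarrier H" using x by (simp add: hclosure_def)
  have "cmod (hinner H x g) \<le> e" if e: "e > 0" for e
  proof -
    have "e / (hnorm H g + 1) > 0" using e hnorm_ge0[OF g] by simp
    then obtain s where s: "s \<in> S" "hnorm H (x - s) < e / (hnorm H g + 1)"
      using x unfolding hclosure_def by auto
    have sC: "s \<in> hcarrier H" using s S by blast
    have "hinner H x g = hinner H (x - s) g" using 0[OF s(1)] xC sC g by (simp add: inner_diff_left)
    also have "cmod \<dots> \<le> hnorm H (x - s) * hnorm H g"
      using xC sC g by (intro cauchy_schwarz) (auto simp: diff_mem)
    also have "\<dots> \<le> hnorm H (x - s) * (hnorm H g + 1)"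
      using xC sC by (intro mult_left_mono) (auto simp: hnorm_ge0 diff_mem)
    also have "\<dots> \<le> e" using s(2) hnorm_ge0[OF g] by (simp add: field_simps)
    finally show ?thesis .
  qed
  hence "cmod (hinner H x g) \<le> 0" by (rule dense_ge)
  thus ?thesis by simp
qed

lemma (in prehilbert) orth_compl_closed_subspace:
  assumes S: "S \<subseteq> hcarrier H"
  shows "closed_subspace H (orth_compl H S)"
proof -
  have "cvec.subspace (orth_compl H S)"
    using S by (intro cvec.subspaceI)
      (auto simp: orth_compl_def mem_intros subsetD inner_add_left inner_scale_left)
  moreover have "hclosure H (orth_compl H S) \<subseteq> orth_compl H S"
  proof
    fix x assume x: "x \<in> hclosure H (orth_compl H S)"
    have "hinner H x s = 0" if "s \<in> S" for s
      by (rule inner_hclosure_eq0[OF _ x]) (use S that in \<open>auto simp: orth_compl_def\<close>)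
    thus "x \<in> orth_compl H S" using x by (simp add: orth_compl_def hclosure_def)
  qed
  ultimately show ?thesis by (auto simp: closed_subspace_def orth_compl_def)
qed

lemma (in hilbert) riesz_representation:
  assumes add: "\<And>x y. x \<in> hcarrier H \<Longrightarrow> y \<in> hcarrier H \<Longrightarrow> f (x + y) = f x + f y"
    and scale: "\<And>c x. x \<in> hcarrier H \<Longrightarrow> f (c *\<^sub>C x) = c * f x"
    and bound: "\<And>x. x \<in> hcarrier H \<Longrightarrow> cmod (f x) \<le> M * hnorm H x"
  obtains y where "y \<in> hcarrier H" "\<And>x. x \<in> hcarrier H \<Longrightarrow> f x = hinner H x y"
proof (rule riesz_range[of "hcarrier H" "\<lambda>x. x" f "\<bar>M\<bar>"])
  show "cvec.subspace (hcarrier H)" by (intro cvec.subspaceI mem_intros)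
  show "cmod (f x) \<le> \<bar>M\<bar> * hnorm H x" if "x \<in> hcarrier H" for x
    using bound[OF that] mult_right_mono[OF abs_ge_self hnorm_ge0[OF that], of M] by linarith
qed (use add scale that in \<open>auto simp: hclosure_def\<close>)

text \<open>\<open>adj\<close> is a definite description: Riesz representation provides the
  candidate, definiteness of the form its uniqueness. Adjoints are accessed through these two
  facts.\<close>

lemma adj_exists:
  assumes H: "hilbert H" and K: "prehilbert K" and A: "bounded_op H K A" and y: "y \<in> hcarrier K"
  shows "adj H K A y \<in> hcarrier H"
    and "u \<in> hcarrier H \<Longrightarrow> hinner K (A u) y = hinner H u (adj H K A y)"
proof -
  interpret H: hilbert H by fact
  interpret K: prehilbert K by fact
  have AK: "\<And>x. x \<in> hcarrier H \<Longrightarrow> A x \<in> hcarrier K"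
    and Aadd: "\<And>x y. x \<in> hcarrier H \<Longrightarrow> y \<in> hcarrier H \<Longrightarrow> A (x + y) = A x + A y"
    and Ascale: "\<And>c x. x \<in> hcarrier H \<Longrightarrow> A (c *\<^sub>C x) = c *\<^sub>C A x"
    using A by (auto simp: bounded_op_def)
  obtain C where C: "\<And>x. x \<in> hcarrier H \<Longrightarrow> hnorm K (A x) \<le> C * hnorm H x"
    using A unfolding bounded_op_def by blast
  obtain x where x: "x \<in> hcarrier H" "\<And>u. u \<in> hcarrier H \<Longrightarrow> hinner K (A u) y = hinner H u x"
  proof (rule H.riesz_representation[of "\<lambda>u. hinner K (A u) y" "C * hnorm K y"])
    fix u assume u: "u \<in> hcarrier H"
    have "cmod (hinner K (A u) y) \<le> hnorm K (A u) * hnorm K y"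
      using u y AK by (intro K.cauchy_schwarz) auto
    also have "\<dots> \<le> C * hnorm H u * hnorm K y"
      using C[OF u] K.hnorm_ge0[OF y] by (intro mult_right_mono) auto
    finally show "cmod (hinner K (A u) y) \<le> C * hnorm K y * hnorm H u" by (simp add: mult_ac)
  qed (use AK Aadd Ascale y in \<open>auto simp: K.inner_add_left K.inner_scale_left\<close>)
  have "\<exists>!x. x \<in> hcarrier H \<and> (\<forall>u\<in>hcarrier H. hinner K (A u) y = hinner H u x)"
  proof (rule ex1I[of _ x])
    fix x' assume "x' \<in> hcarrier H \<and> (\<forall>u\<in>hcarrier H. hinner K (A u) y = hinner H u x')"
    thus "x' = x" using x by (intro H.inner_eqI) auto
  qed (use x in auto)
  from theI'[OF this, folded adj_def]
  show "adj H K A y \<in> hcarrier H"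
    "u \<in> hcarrier H \<Longrightarrow> hinner K (A u) y = hinner H u (adj H K A y)" by auto
qed

section \<open>The Hardy space\<close>

instance complex_hilbert \<subseteq> banach ..

lemma hcarrier_type_hspace [simp]: "hcarrier type_hspace = UNIV"
  and hinner_type_hspace [simp]: "hinner type_hspace = cinner"
  by (simp_all add: type_hspace_def)

lemma hnorm_type_hspace [simp]: "hnorm type_hspace = norm"
  by (auto simp: hnorm_def type_hspace_def cinner_self fun_eq_iff)

interpretation cinner: prehilbert "type_hspace :: 'd::complex_inner hspace"
  rewrites "hcarrier (type_hspace :: 'd hspace) = UNIV"
    and "hinner (type_hspace :: 'd hspace) = cinner"
    and "hnorm (type_hspace :: 'd hspace) = norm"
proof -
  show "prehilbert (type_hspace :: 'd hspace)"
  proof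
    fix x y :: 'd
    show "hinner type_hspace x y = cnj (hinner type_hspace y x)"
      using cinner_commute[of x y] by simp
  qed (auto simp: cinner_add_left cinner_scaleC_left cinner_self)
qed auto

lemma hilbert_type_hspace: "hilbert (type_hspace :: 'd::complex_hilbert hspace)"
proof -
  interpret prehilbert "type_hspace :: 'd hspace" by (rule cinner.prehilbert_axioms)
  show ?thesis
  proof
    fix X :: "nat \<Rightarrow> 'd"
    assume "\<And>e. e > 0 \<Longrightarrow> \<exists>N. \<forall>m\<ge>N. \<forall>n\<ge>N. hnorm type_hspace (X m - X n) < e"
    hence "Cauchy X" by (simp add: Cauchy_iff)
    then obtain x where "X \<longlonglongrightarrow> x" using Cauchy_convergent_iff convergent_def by blast
    thus "\<exists>x\<in>hcarrier type_hspace. (\<lambda>n. hnorm type_hspace (X n - x)) \<longlonglongrightarrow> 0"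
      by (auto simp: tendsto_norm_zero_iff simp flip: LIM_zero_iff[of X])
  qed
qed

lemma norm_scaleC: "norm (c *\<^sub>C x) = cmod c * norm (x::'d::complex_inner)"
  using cinner.hnorm_scale[of x c] by simp

lemma scaleC_scaleR_left: "(r *\<^sub>R c) *\<^sub>C x = r *\<^sub>R (c *\<^sub>C (x::'d::complex_inner))"
  by (metis scaleC_of_real scaleC_scaleC scaleR_conv_of_real)

lemma scaleC_scaleR_right: "c *\<^sub>C (r *\<^sub>R x) = r *\<^sub>R (c *\<^sub>C (x::'d::complex_inner))"
  by (metis scaleC_of_real scaleC_scaleC mult.commute)

interpretation scaleC: bounded_bilinear "scaleC :: complex \<Rightarrow> 'd \<Rightarrow> 'd::complex_inner"
  by standard
    (auto simp: scaleC_add_left scaleC_add_right scaleC_scaleR_left scaleC_scaleR_right norm_scaleC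
      intro: exI[of _ 1])

interpretation cinner: bounded_bilinear "cinner :: 'd \<Rightarrow> 'd \<Rightarrow> complex" for dummy :: "'d::complex_inner"
proof
  fix r :: real and x y :: 'd
  show "cinner (r *\<^sub>R x) y = r *\<^sub>R cinner x y"
    by (simp add: cinner_scaleC_left scaleR_conv_of_real flip: scaleC_of_real)
  show "cinner x (r *\<^sub>R y) = r *\<^sub>R cinner x y"
    by (simp add: cinner.inner_scale_right scaleR_conv_of_real flip: scaleC_of_real)
qed (auto simp: cinner_add_left cinner.inner_add_right intro!: exI[of _ 1] cinner.cauchy_schwarz)

lemma fps_nth_scaleC [simp]: "fps_nth (c *\<^sub>C f) n = c *\<^sub>C fps_nth f n"
  by (simp add: scaleC_fps_def)

lemma scaleC_complex [simp]: "c *\<^sub>C x = c * (x::complex)"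
  by (simp add: scaleC_complex_def)

lemma cinner_complex [simp]: "cinner x y = x * cnj (y::complex)"
  by (simp add: cinner_complex_def)

lemma scaleC_fps_complex: "c *\<^sub>C f = fps_const c * (f::complex fps)"
  by (simp add: fps_eq_iff)

lemma mem_H2_iff: "f \<in> hcarrier H2 \<longleftrightarrow> summable (\<lambda>n. (norm (fps_nth f n))\<^sup>2)"
  by (simp add: H2_def)

lemma hinner_H2: "hinner H2 f g = (\<Sum>n. cinner (fps_nth f n) (fps_nth g n))"
  by (simp add: H2_def)

lemma summable_norm_cinner:
  assumes "f \<in> hcarrier H2" "g \<in> hcarrier H2"
  shows "summable (\<lambda>n. norm (cinner (fps_nth f n) (fps_nth g n)))"
proof (rule summable_comparison_test')
  show "summable (\<lambda>n. (norm (fps_nth f n))\<^sup>2 + (norm (fps_nth g n))\<^sup>2)"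
    using assms by (intro summable_add) (simp_all add: mem_H2_iff)
  fix n
  have "norm (cinner (fps_nth f n) (fps_nth g n)) \<le> norm (fps_nth f n) * norm (fps_nth g n)"
    by (rule cinner.cauchy_schwarz) auto
  also have "\<dots> \<le> (norm (fps_nth f n))\<^sup>2 + (norm (fps_nth g n))\<^sup>2"
    using sum_squares_bound[of "norm (fps_nth f n)" "norm (fps_nth g n)"]
      mult_nonneg_nonneg[OF norm_ge_zero[of "fps_nth f n"] norm_ge_zero[of "fps_nth g n"]]
    by linarith
  finally show "norm (norm (cinner (fps_nth f n) (fps_nth g n)))
      \<le> (norm (fps_nth f n))\<^sup>2 + (norm (fps_nth g n))\<^sup>2" by simp
qed

lemma summable_cinner:
  assumes "f \<in> hcarrier H2" "g \<in> hcarrier H2"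
  shows "summable (\<lambda>n. cinner (fps_nth f n) (fps_nth g n))"
  using summable_norm_cinner[OF assms] by (rule summable_norm_cancel)

lemma mem_H2_add:
  assumes "f \<in> hcarrier H2" "g \<in> hcarrier H2" shows "f + g \<in> hcarrier H2"
  unfolding mem_H2_iff
proof (rule summable_comparison_test')
  show "summable (\<lambda>n. 2 * (norm (fps_nth f n))\<^sup>2 + 2 * (norm (fps_nth g n))\<^sup>2)"
    using assms by (intro summable_add summable_mult) (simp_all add: mem_H2_iff)
  fix n
  have "(norm (fps_nth f n + fps_nth g n))\<^sup>2 \<le> (norm (fps_nth f n) + norm (fps_nth g n))\<^sup>2"
    by (intro power_mono norm_triangle_ineq) auto
  also have "\<dots> \<le> 2 * (norm (fps_nth f n))\<^sup>2 + 2 * (norm (fps_nth g n))\<^sup>2"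
    using sum_squares_bound[of "norm (fps_nth f n)" "norm (fps_nth g n)"] by (simp add: power2_sum)
  finally show "norm ((norm (fps_nth (f + g) n))\<^sup>2) \<le> 2 * (norm (fps_nth f n))\<^sup>2 + 2 * (norm (fps_nth g n))\<^sup>2"
    by simp
qed

lemma hinner_H2_self:
  assumes "f \<in> hcarrier H2"
  shows "hinner H2 f f = complex_of_real (\<Sum>n. (norm (fps_nth f n))\<^sup>2)"
  using assms unfolding hinner_H2 cinner_self mem_H2_iff by (rule suminf_of_real[symmetric])

interpretation H2: prehilbert "H2 :: 'd::complex_inner fps hspace"
proof
  fix f g h :: "'d fps" and c :: complex
  show "(0::'d fps) \<in> hcarrier H2" by (simp add: mem_H2_iff)
  show "f + g \<in> hcarrier H2" if "f \<in> hcarrier H2" "g \<in> hcarrier H2" using that by (rule mem_H2_add)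
  show "c *\<^sub>C f \<in> hcarrier H2" if "f \<in> hcarrier H2"
    using that by (simp add: mem_H2_iff norm_scaleC power_mult_distrib summable_mult)
  show "hinner H2 (f + g) h = hinner H2 f h + hinner H2 g h"
    if "f \<in> hcarrier H2" "g \<in> hcarrier H2" "h \<in> hcarrier H2"
    using that by (simp add: hinner_H2 cinner_add_left suminf_add summable_cinner)
  show "hinner H2 (c *\<^sub>C f) g = c * hinner H2 f g" if "f \<in> hcarrier H2" "g \<in> hcarrier H2"
    using that by (simp add: hinner_H2 cinner_scaleC_left suminf_mult summable_cinner)
  show "hinner H2 f g = cnj (hinner H2 g f)" if "f \<in> hcarrier H2" "g \<in> hcarrier H2"
  proof -
    have "cnj (hinner H2 g f) = (\<Sum>n. cnj (cinner (fps_nth g n) (fps_nth f n)))"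
      unfolding hinner_H2 using that
      by (intro bounded_linear.suminf[OF bounded_linear_cnj] summable_cinner)
    also have "\<dots> = hinner H2 f g" by (simp add: hinner_H2 flip: cinner_commute)
    finally show ?thesis ..
  qed
  note * = hinner_H2_self
  show "Re (hinner H2 f f) \<ge> 0" if "f \<in> hcarrier H2"
    using that by (simp add: * mem_H2_iff suminf_nonneg)
  show "f = 0" if "f \<in> hcarrier H2" "hinner H2 f f = 0"
  proof -
    have "(\<Sum>n. (norm (fps_nth f n))\<^sup>2) = 0"
      using that(2) unfolding *[OF that(1)] by (simp only: of_real_eq_0_iff)
    hence "fps_nth f n = 0" for n
      using suminf_eq_zero_iff[of "\<lambda>n. (norm (fps_nth f n))\<^sup>2"] that(1) by (simp add: mem_H2_iff)
    thus ?thesis by (simp add: fps_eq_iff)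
  qed
qed

lemma hnorm_H2_sq:
  assumes "f \<in> hcarrier H2" shows "(hnorm H2 f)\<^sup>2 = (\<Sum>n. (norm (fps_nth f n))\<^sup>2)"
  using assms by (simp add: H2.hnorm_sq hinner_H2_self)

lemma sums_H2:
  assumes "f \<in> hcarrier H2" shows "(\<lambda>n. (norm (fps_nth f n))\<^sup>2) sums (hnorm H2 f)\<^sup>2"
  using assms by (simp add: hnorm_H2_sq mem_H2_iff summable_sums)

lemma sum_le_hnorm_H2:
  assumes "f \<in> hcarrier H2" "finite I" shows "(\<Sum>n\<in>I. (norm (fps_nth f n))\<^sup>2) \<le> (hnorm H2 f)\<^sup>2"
  using assms by (simp add: hnorm_H2_sq mem_H2_iff sum_le_suminf)

lemma norm_nth_le_hnorm_H2:
  assumes "f \<in> hcarrier H2" shows "norm (fps_nth f n) \<le> hnorm H2 f"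
  using sum_le_hnorm_H2[OF assms, of "{n}"] by (rule_tac power2_le_imp_le) (auto simp: H2.hnorm_ge0 assms)

lemma H2_boundI:
  assumes "0 \<le> C" "\<And>M. (\<Sum>n<M. (norm (fps_nth f n))\<^sup>2) \<le> C\<^sup>2"
  shows "f \<in> hcarrier H2" "hnorm H2 f \<le> C"
proof -
  show f: "f \<in> hcarrier H2"
    unfolding mem_H2_iff using assms(2) by (intro summableI_nonneg_bounded) auto
  have "(hnorm H2 f)\<^sup>2 \<le> C\<^sup>2"
    unfolding hnorm_H2_sq[OF f] using f assms(2) by (intro suminf_le_const) (auto simp: mem_H2_iff)
  thus "hnorm H2 f \<le> C" using assms(1) by (rule power2_le_imp_le)
qed

lemma hilbert_H2: "hilbert (H2 :: 'd::complex_hilbert fps hspace)"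
proof
  fix X :: "nat \<Rightarrow> 'd fps"
  assume X: "\<And>n. X n \<in> hcarrier H2"
    and C: "\<And>e. e > 0 \<Longrightarrow> \<exists>N. \<forall>m\<ge>N. \<forall>n\<ge>N. hnorm H2 (X m - X n) < e"
  have "Cauchy (\<lambda>m. fps_nth (X m) k)" for k
    unfolding Cauchy_iff
  proof (intro allI impI)
    fix e :: real assume "e > 0"
    then obtain N where N: "\<And>m n. m \<ge> N \<Longrightarrow> n \<ge> N \<Longrightarrow> hnorm H2 (X m - X n) < e" using C by blast
    have "norm (fps_nth (X m) k - fps_nth (X n) k) < e" if "m \<ge> N" "n \<ge> N" for m n
      using norm_nth_le_hnorm_H2[of "X m - X n" k] N[OF that] X by (simp add: H2.diff_mem)
    thus "\<exists>N. \<forall>m\<ge>N. \<forall>n\<ge>N. norm (fps_nth (X m) k - fps_nth (X n) k) < e" by blast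
  qed
  hence "\<exists>l. (\<lambda>m. fps_nth (X m) k) \<longlonglongrightarrow> l" for k
    by (simp add: Cauchy_convergent_iff convergent_def)
  then obtain l where l: "\<And>k. (\<lambda>m. fps_nth (X m) k) \<longlonglongrightarrow> l k" by metis
  define x where "x = Abs_fps l"
  \<comment> \<open>Membership of the coefficientwise limit is not known in advance. Bounding finite
    coefficient sums of \<open>X m - X n\<close> and letting \<open>n\<close> grow gives membership
    and the distance estimate together.\<close>
  have bd: "X m - x \<in> hcarrier H2 \<and> hnorm H2 (X m - x) \<le> e"
    if e: "e > 0" and N: "\<And>n. n \<ge> N \<Longrightarrow> hnorm H2 (X m - X n) < e" for m e N
  proof -
    have "(\<Sum>k<M. (norm (fps_nth (X m - x) k))\<^sup>2) \<le> e\<^sup>2" for M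
    proof (rule LIMSEQ_le_const2)
      show "(\<lambda>n. \<Sum>k<M. (norm (fps_nth (X m - X n) k))\<^sup>2)
          \<longlonglongrightarrow> (\<Sum>k<M. (norm (fps_nth (X m - x) k))\<^sup>2)"
        by (auto intro!: tendsto_intros l simp: x_def)
      have "(\<Sum>k<M. (norm (fps_nth (X m - X n) k))\<^sup>2) \<le> e\<^sup>2" if "n \<ge> N" for n
      proof -
        have "(\<Sum>k<M. (norm (fps_nth (X m - X n) k))\<^sup>2) \<le> (hnorm H2 (X m - X n))\<^sup>2"
          by (rule sum_le_hnorm_H2) (auto simp: X H2.diff_mem)
        also have "\<dots> \<le> e\<^sup>2"
          using N[OF that] X by (intro power_mono) (auto simp: H2.hnorm_ge0 H2.diff_mem)
        finally show ?thesis .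
      qed
      thus "\<exists>N. \<forall>n\<ge>N. (\<Sum>k<M. (norm (fps_nth (X m - X n) k))\<^sup>2) \<le> e\<^sup>2" by blast
    qed
    from H2_boundI[OF _ this] e show ?thesis by auto
  qed
  obtain N where "\<And>m n. m \<ge> N \<Longrightarrow> n \<ge> N \<Longrightarrow> hnorm H2 (X m - X n) < 1" using C[of 1] by auto
  hence "X N - x \<in> hcarrier H2" using bd[of 1 N N] by auto
  from H2.diff_mem[OF X[of N] this] have x: "x \<in> hcarrier H2" by simp
  moreover have "(\<lambda>n. hnorm H2 (X n - x)) \<longlonglongrightarrow> 0"
  proof (rule LIMSEQ_I)
    fix e :: real assume "e > 0"
    then obtain N where N: "\<And>m n. m \<ge> N \<Longrightarrow> n \<ge> N \<Longrightarrow> hnorm H2 (X m - X n) < e / 2"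
      using C[of "e/2"] by auto
    have "norm (hnorm H2 (X m - x) - 0) < e" if "m \<ge> N" for m
      using bd[of "e/2" N m] N[OF that] \<open>e > 0\<close> X x by (auto simp: H2.hnorm_ge0 H2.diff_mem)
    thus "\<exists>N. \<forall>n\<ge>N. norm (hnorm H2 (X n - x) - 0) < e" by blast
  qed
  ultimately show "\<exists>x\<in>hcarrier H2. (\<lambda>n. hnorm H2 (X n - x)) \<longlonglongrightarrow> 0" by blast
qed

lemma cutoff_mem_H2 [simp]: "fps_cutoff n f \<in> hcarrier H2"
  unfolding mem_H2_iff by (rule summable_finite[of "{..<n}"]) (auto simp: fps_cutoff_def)

lemma hnorm_H2_cutoff_tendsto:
  assumes f: "f \<in> hcarrier H2"
  shows "(\<lambda>n. hnorm H2 (f - fps_cutoff n f)) \<longlonglongrightarrow> 0"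
proof -
  have "(hnorm H2 (f - fps_cutoff n f))\<^sup>2 = (hnorm H2 f)\<^sup>2 - (\<Sum>k<n. (norm (fps_nth f k))\<^sup>2)" for n
  proof -
    have "(\<lambda>k. if k \<in> {..<n} then (norm (fps_nth f k))\<^sup>2 else 0) sums (\<Sum>k<n. (norm (fps_nth f k))\<^sup>2)"
      by (rule sums_If_finite_set) auto
    from sums_diff[OF sums_H2[OF f] this]
    have "(\<lambda>k. (norm (fps_nth (f - fps_cutoff n f) k))\<^sup>2)
        sums ((hnorm H2 f)\<^sup>2 - (\<Sum>k<n. (norm (fps_nth f k))\<^sup>2))"
      by (rule sums_cong[THEN iffD1, rotated]) (auto simp: fps_cutoff_def)
    moreover have "(\<lambda>k. (norm (fps_nth (f - fps_cutoff n f) k))\<^sup>2) sums (hnorm H2 (f - fps_cutoff n f))\<^sup>2"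
      by (rule sums_H2) (simp add: f H2.diff_mem)
    ultimately show ?thesis using sums_unique2 by blast
  qed
  moreover have "(\<lambda>n. (hnorm H2 f)\<^sup>2 - (\<Sum>k<n. (norm (fps_nth f k))\<^sup>2)) \<longlonglongrightarrow> (hnorm H2 f)\<^sup>2 - (hnorm H2 f)\<^sup>2"
    using sums_H2[OF f] unfolding sums_def by (intro tendsto_diff tendsto_const)
  ultimately have "(\<lambda>n. sqrt ((hnorm H2 (f - fps_cutoff n f))\<^sup>2)) \<longlonglongrightarrow> sqrt 0"
    by (intro tendsto_real_sqrt) simp
  thus ?thesis using f by (simp add: H2.hnorm_ge0 H2.diff_mem)
qed

text \<open>Truncating \<open>g\<close> leaves a finite sum of coefficients, and the tail is
  uniformly small because of the norm bound. This stands in for norm convergence wherever only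
  uniform bounds are at hand.\<close>

lemma H2_weak_limit:
  assumes X: "\<And>n. X n \<in> hcarrier H2" "\<And>n. hnorm H2 (X n) \<le> C"
    and l: "\<And>k. (\<lambda>n. fps_nth (X n) k) \<longlonglongrightarrow> fps_nth x k"
  shows "x \<in> hcarrier H2" "hnorm H2 x \<le> C"
    and "g \<in> hcarrier H2 \<Longrightarrow> (\<lambda>n. hinner H2 (X n) g) \<longlonglongrightarrow> hinner H2 x g"
proof -
  have C0: "C \<ge> 0" using H2.hnorm_ge0[OF X(1)[of 0]] X(2)[of 0] by linarith
  have "(\<Sum>k<M. (norm (fps_nth x k))\<^sup>2) \<le> C\<^sup>2" for M
  proof (rule LIMSEQ_le_const2)
    show "(\<lambda>n. \<Sum>k<M. (norm (fps_nth (X n) k))\<^sup>2) \<longlonglongrightarrow> (\<Sum>k<M. (norm (fps_nth x k))\<^sup>2)"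
      by (intro tendsto_intros l)
    have "(\<Sum>k<M. (norm (fps_nth (X n) k))\<^sup>2) \<le> C\<^sup>2" for n
      using sum_le_hnorm_H2[OF X(1)[of n], of "{..<M}"] power_mono[OF X(2)[of n] H2.hnorm_ge0[OF X(1)], of 2]
      by simp
    thus "\<exists>N. \<forall>n\<ge>N. (\<Sum>k<M. (norm (fps_nth (X n) k))\<^sup>2) \<le> C\<^sup>2" by blast
  qed
  from H2_boundI[OF C0 this] show x: "x \<in> hcarrier H2" "hnorm H2 x \<le> C" by auto
  assume g: "g \<in> hcarrier H2"
  show "(\<lambda>n. hinner H2 (X n) g) \<longlonglongrightarrow> hinner H2 x g"
  proof (rule LIMSEQ_I)
    fix e :: real assume e: "e > 0"
    have "e / (4 * (C + 1)) > 0" using e C0 by simp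
    then obtain M where M: "hnorm H2 (g - fps_cutoff M g) < e / (4 * (C + 1))"
      using order_tendstoD(2)[OF hnorm_H2_cutoff_tendsto[OF g]] by (auto simp: eventually_sequentially)
    let ?g = "fps_cutoff M g"
    have fin: "hinner H2 f ?g = (\<Sum>k<M. cinner (fps_nth f k) (fps_nth g k))" for f
      unfolding hinner_H2 by (subst suminf_finite[of "{..<M}"]) (auto simp: fps_cutoff_def)
    have "(\<lambda>n. hinner H2 (X n) ?g) \<longlonglongrightarrow> hinner H2 x ?g"
      unfolding fin by (intro tendsto_intros cinner.tendsto l)
    then obtain N where N: "\<And>n. n \<ge> N \<Longrightarrow> norm (hinner H2 (X n) ?g - hinner H2 x ?g) < e / 2"
      using LIMSEQ_D[of _ _ "e/2"] e by (metis half_gt_zero)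
    have "norm (hinner H2 (X n) g - hinner H2 x g) < e" if "n \<ge> N" for n
    proof -
      have small: "norm (hinner H2 f (g - ?g)) \<le> e / 4" if f: "f \<in> hcarrier H2" "hnorm H2 f \<le> C" for f
      proof -
        have "norm (hinner H2 f (g - ?g)) \<le> hnorm H2 f * hnorm H2 (g - ?g)"
          using f g by (intro H2.cauchy_schwarz) (auto simp: H2.diff_mem)
        also have "\<dots> \<le> (C + 1) * (e / (4 * (C + 1)))"
          using M f g C0 by (intro mult_mono) (auto simp: H2.hnorm_ge0 H2.diff_mem)
        also have "\<dots> = e / 4" using C0 by (simp add: field_simps add_nonneg_eq_0_iff)
        finally show ?thesis .
      qed
      have split: "hinner H2 f g = hinner H2 f ?g + hinner H2 f (g - ?g)" if "f \<in> hcarrier H2" for f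
        using that g by (simp add: H2.inner_diff_right)
      have "hinner H2 (X n) g - hinner H2 x g = (hinner H2 (X n) ?g - hinner H2 x ?g)
          + (hinner H2 (X n) (g - ?g) - hinner H2 x (g - ?g))"
        using split[OF X(1)[of n]] split[OF x(1)] by simp
      also have "norm \<dots> < e / 2 + (e / 4 + e / 4)"
        using N[OF that] small[OF X] small[OF x]
        by (intro order.strict_trans1[OF norm_triangle_ineq] add_less_le_mono
            order_trans[OF norm_triangle_ineq4] add_mono)
      finally show ?thesis by simp
    qed
    thus "\<exists>N. \<forall>n\<ge>N. norm (hinner H2 (X n) g - hinner H2 x g) < e" by blast
  qed
qed

subsection \<open>Evaluation in the disc\<close>

lemma summable_norm_H2:
  assumes f: "f \<in> hcarrier H2" and s: "0 \<le> s" "s < 1"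
  shows "summable (\<lambda>n. s ^ n * norm (fps_nth f n))"
proof (rule summable_comparison_test')
  show "summable (\<lambda>n. s ^ n * hnorm H2 f)"
    using s by (intro summable_mult2 summable_geometric) simp
  show "norm (s ^ n * norm (fps_nth f n)) \<le> s ^ n * hnorm H2 f" for n
    using s norm_nth_le_hnorm_H2[OF f, of n] by (simp add: mult_left_mono)
qed

lemma eval_vfps_complex: "eval_vfps f z = eval_fps f z" for f :: "complex fps"
  by (simp add: eval_vfps_def eval_fps_def mult.commute)

lemma fps_conv_radius_H2:
  fixes f :: "complex fps"
  assumes f: "f \<in> hcarrier H2" shows "fps_conv_radius f \<ge> 1"
  unfolding fps_conv_radius_def one_ereal_def
proof (rule conv_radius_geI_ex')
  fix r :: real assume "0 < r" "ereal r < ereal 1"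
  hence "summable (\<lambda>n. norm (fps_nth f n * of_real r ^ n))"
    using summable_norm_H2[OF f, of r] by (simp add: norm_mult norm_power mult.commute)
  thus "summable (\<lambda>n. fps_nth f n * of_real r ^ n)" by (rule summable_norm_cancel)
qed

lemma eval_vfps_sums:
  fixes f :: "'d::complex_hilbert fps"
  assumes "f \<in> hcarrier H2" "cmod z < 1"
  shows "(\<lambda>n. z ^ n *\<^sub>C fps_nth f n) sums eval_vfps f z"
proof -
  have "summable (\<lambda>n. norm (z ^ n *\<^sub>C fps_nth f n))"
    using summable_norm_H2[of f "cmod z"] assms by (simp add: norm_scaleC norm_power)
  from summable_sums[OF summable_norm_cancel[OF this]] show ?thesis by (simp add: eval_vfps_def)
qed

section \<open>Dense subspaces, square roots and operator ranges\<close>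

context hform begin

lemma hclosure_subset: "S \<subseteq> hcarrier H \<Longrightarrow> S \<subseteq> hclosure H S"
  by (auto simp: hclosure_def intro!: bexI)

lemma hclosure_carrier: "hclosure H S \<subseteq> hcarrier H"
  by (auto simp: hclosure_def)

lemma closed_subspace_hclosure:
  assumes V: "cvec.subspace V" "V \<subseteq> hcarrier H"
  shows "closed_subspace H (hclosure H V)"
proof -
  have VC: "v \<in> hcarrier H" if "v \<in> V" for v using that V by blast
  have "cvec.subspace (hclosure H V)"
  proof (rule cvec.subspaceI)
    show "0 \<in> hclosure H V" using hclosure_subset[OF V(2)] cvec.subspace_0[OF V(1)] by blast
  next
    fix x y assume xy: "x \<in> hclosure H V" "y \<in> hclosure H V"
    hence C: "x \<in> hcarrier H" "y \<in> hcarrier H" by (auto simp: hclosure_def)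
    have "\<exists>s\<in>V. hnorm H (x + y - s) < e" if e: "e > 0" for e
    proof -
      obtain s t where st: "s \<in> V" "t \<in> V" "hnorm H (x - s) < e / 2" "hnorm H (y - t) < e / 2"
        using xy e unfolding hclosure_def by (auto dest!: spec[of _ "e/2"])
      have "hnorm H (x + y - (s + t)) = hnorm H ((x - s) + (y - t))" by (simp add: algebra_simps)
      also have "\<dots> \<le> hnorm H (x - s) + hnorm H (y - t)"
        using st C VC by (intro hnorm_triangle) (auto simp: diff_mem)
      finally have "hnorm H (x + y - (s + t)) < e" using st by linarith
      thus ?thesis using st V cvec.subspace_add by blast
    qed
    thus "x + y \<in> hclosure H V" using C by (auto simp: hclosure_def add_mem)
  next
    fix c x assume x: "x \<in> hclosure H V"
    hence C: "x \<in> hcarrier H" by (auto simp: hclosure_def)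
    have "\<exists>s\<in>V. hnorm H (c *\<^sub>C x - s) < e" if e: "e > 0" for e
    proof -
      have "e / (cmod c + 1) > 0" using e by (simp add: add_nonneg_pos)
      then obtain s where s: "s \<in> V" "hnorm H (x - s) < e / (cmod c + 1)"
        using x unfolding hclosure_def by auto
      have "hnorm H (c *\<^sub>C x - c *\<^sub>C s) = cmod c * hnorm H (x - s)"
        using s C VC hnorm_scale[of "x - s" c] by (simp add: diff_mem cvec.scale_right_diff_distrib)
      also have "\<dots> \<le> (cmod c + 1) * hnorm H (x - s)"
        using s C VC by (intro mult_right_mono) (auto simp: hnorm_ge0 diff_mem)
      also have "\<dots> < e" using s(2) pos_less_divide_eq[of "cmod c + 1" "hnorm H (x - s)" e]
        by (simp add: add_nonneg_pos mult.commute)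
      finally show ?thesis using s V cvec.subspace_scale by blast
    qed
    thus "c *\<^sub>C x \<in> hclosure H V" using C by (auto simp: hclosure_def scale_mem)
  qed
  moreover have "hclosure H (hclosure H V) \<subseteq> hclosure H V"
  proof
    fix x assume x: "x \<in> hclosure H (hclosure H V)"
    hence C: "x \<in> hcarrier H" by (auto simp: hclosure_def)
    have "\<exists>s\<in>V. hnorm H (x - s) < e" if e: "e > 0" for e
    proof -
      obtain y where y: "y \<in> hclosure H V" "hnorm H (x - y) < e / 2"
        using x e unfolding hclosure_def[of H "hclosure H V"] by (auto dest!: spec[of _ "e/2"])
      obtain s where s: "s \<in> V" "hnorm H (y - s) < e / 2"
        using y(1) e unfolding hclosure_def by (auto dest!: spec[of _ "e/2"])
      have "hnorm H (x - s) \<le> hnorm H (x - y) + hnorm H (y - s)"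
        using C s VC y hclosure_carrier by (intro hnorm_diff_triangle) auto
      thus ?thesis using s y by (intro bexI[of _ s]) auto
    qed
    thus "x \<in> hclosure H V" using C by (auto simp: hclosure_def)
  qed
  ultimately show ?thesis by (auto simp: closed_subspace_def hclosure_carrier)
qed

end

text \<open>\<open>g\<close> is the component of \<open>x\<close> orthogonal to the closure of
  \<open>V\<close>, whence \<open><x, g> = <g, g>\<close>.\<close>

lemma (in hilbert) not_dense_obtain:
  assumes V: "cvec.subspace V" "V \<subseteq> hcarrier H" and x: "x \<in> hcarrier H" "x \<notin> hclosure H V"
  obtains g where "g \<in> hcarrier H" "g \<noteq> 0" "\<And>v. v \<in> V \<Longrightarrow> hinner H g v = 0" "hinner H x g \<noteq> 0"
proof -
  obtain k where k: "k \<in> hclosure H V" "\<And>s. s \<in> hclosure H V \<Longrightarrow> hinner H (x - k) s = 0"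
    using orthogonal_projection[OF closed_subspace_hclosure[OF V] x(1)] by blast
  have kC: "k \<in> hcarrier H" using k(1) hclosure_carrier by blast
  have gC: "x - k \<in> hcarrier H" using kC x by (simp add: diff_mem)
  have nz: "x - k \<noteq> 0" using k x by auto
  have "hinner H k (x - k) = 0" using k inner_commute[OF kC gC] by simp
  hence "hinner H x (x - k) = hinner H (x - k) (x - k)" using kC x gC by (simp add: inner_diff_left)
  hence "hinner H x (x - k) \<noteq> 0" using inner_definite[OF gC] nz by auto
  thus thesis using that[of "x - k"] gC nz k(2) hclosure_subset[OF V(2)] by blast
qed

lemma (in hilbert) dense_if_orthogonal_trivial:
  assumes V: "cvec.subspace V" "V \<subseteq> hcarrier H"
    and 0: "\<And>g. g \<in> hcarrier H \<Longrightarrow> (\<And>v. v \<in> V \<Longrightarrow> hinner H g v = 0) \<Longrightarrow> g = 0"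
  shows "hclosure H V = hcarrier H"
  using not_dense_obtain[OF V] 0 hclosure_carrier by (metis subsetI subset_antisym)

subsection \<open>The positive square root\<close>

definition linear_on :: "'v::complex_vector hspace \<Rightarrow> ('v \<Rightarrow> 'v) \<Rightarrow> bool" where
  "linear_on H A \<longleftrightarrow> A ` hcarrier H \<subseteq> hcarrier H \<and>
     (\<forall>x\<in>hcarrier H. \<forall>y\<in>hcarrier H. A (x + y) = A x + A y) \<and>
     (\<forall>c. \<forall>x\<in>hcarrier H. A (c *\<^sub>C x) = c *\<^sub>C A x)"

definition selfadjoint_on :: "'v::complex_vector hspace \<Rightarrow> ('v \<Rightarrow> 'v) \<Rightarrow> bool" where
  "selfadjoint_on H A \<longleftrightarrow> (\<forall>x\<in>hcarrier H. \<forall>y\<in>hcarrier H. hinner H (A x) y = hinner H x (A y))"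

text \<open>Operators of norm at most \<open>c\<close> in the von Neumann algebra generated by the self-adjoint operator \<open>T\<close>.\<close>

definition generated_op ::
  "'v::complex_vector hspace \<Rightarrow> ('v \<Rightarrow> 'v) \<Rightarrow> real \<Rightarrow> ('v \<Rightarrow> 'v) \<Rightarrow> bool" where
  "generated_op H T c A \<longleftrightarrow> linear_on H A \<and> selfadjoint_on H A \<and> 0 \<le> c \<and>
     (\<forall>x\<in>hcarrier H. hnorm H (A x) \<le> c * hnorm H x) \<and>
     (\<forall>R. bounded_op H H R \<longrightarrow> (\<forall>x\<in>hcarrier H. R (T x) = T (R x)) \<longrightarrow>
        (\<forall>x\<in>hcarrier H. R (A x) = A (R x)))"

lemma linear_onD:
  assumes "linear_on H A"
  shows "x \<in> hcarrier H \<Longrightarrow> A x \<in> hcarrier H"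
    and "x \<in> hcarrier H \<Longrightarrow> y \<in> hcarrier H \<Longrightarrow> A (x + y) = A x + A y"
    and "x \<in> hcarrier H \<Longrightarrow> A (c *\<^sub>C x) = c *\<^sub>C A x"
  using assms by (auto simp: linear_on_def)

lemma bounded_opI:
  assumes "linear_on H A" "\<And>x. x \<in> hcarrier H \<Longrightarrow> hnorm H (A x) \<le> c * hnorm H x"
  shows "bounded_op H H A"
  using assms unfolding linear_on_def bounded_op_def by blast

lemma bounded_op_linear_on: "bounded_op H H A \<Longrightarrow> linear_on H A"
  by (simp add: linear_on_def bounded_op_def)

context hform begin

lemma linear_on_diff:
  assumes "linear_on H A" "x \<in> hcarrier H" "y \<in> hcarrier H"
  shows "A (x - y) = A x - A y"
  using linear_onD(2)[OF assms(1), of x "-y"] linear_onD(3)[OF assms(1), of y "-1"] assms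
  by (simp add: uminus_mem)

lemma linear_on_zero: "linear_on H A \<Longrightarrow> A 0 = 0"
  using linear_on_diff[of A 0 0] zero_mem by simp

text \<open>Double commutant argument: \<open>T\<close> commutes with itself, so \<open>B\<close>
  commutes with \<open>T\<close>, and then \<open>B\<close> is one of the operators with which
  \<open>A\<close> has to commute.\<close>

lemma generated_op_commute:
  assumes A: "generated_op H T c A" and B: "generated_op H T d B" and T: "bounded_op H H T"
    and x: "x \<in> hcarrier H"
  shows "A (B x) = B (A x)"
proof -
  have "bounded_op H H B" using B by (auto simp: generated_op_def intro: bounded_opI)
  moreover have "\<forall>x\<in>hcarrier H. B (T x) = T (B x)"
    using B T unfolding generated_op_def by (metis (no_types, lifting))
  ultimately show ?thesis using A x unfolding generated_op_def by metis
qed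

text \<open>Self-adjointness of the product rests on commutation of the factors.\<close>

lemma generated_op_comp:
  assumes A: "generated_op H T c A" and B: "generated_op H T d B" and T: "bounded_op H H T"
  shows "generated_op H T (c * d) (\<lambda>x. A (B x))"
  unfolding generated_op_def
proof (intro conjI ballI allI impI)
  note A' = A[unfolded generated_op_def] and B' = B[unfolded generated_op_def]
  have mem: "A x \<in> hcarrier H" "B x \<in> hcarrier H" if "x \<in> hcarrier H" for x
    using A' B' that by (auto simp: linear_on_def)
  show "linear_on H (\<lambda>x. A (B x))" using A' B' mem by (auto simp: linear_on_def)
  show "selfadjoint_on H (\<lambda>x. A (B x))"
    using A' B' mem by (auto simp: selfadjoint_on_def generated_op_commute[OF A B T])
  show "0 \<le> c * d" using A' B' by simp
  show "hnorm H (A (B x)) \<le> c * d * hnorm H x" if "x \<in> hcarrier H" for x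
  proof -
    have "hnorm H (A (B x)) \<le> c * hnorm H (B x)" using A' mem that by blast
    also have "\<dots> \<le> c * (d * hnorm H x)" using A' B' that by (intro mult_left_mono) auto
    finally show ?thesis by simp
  qed
  show "R (A (B x)) = A (B (R x))"
    if R: "bounded_op H H R" "\<forall>x\<in>hcarrier H. R (T x) = T (R x)" and x: "x \<in> hcarrier H" for R x
  proof -
    have "R (A (B x)) = A (R (B x))" using A' R mem(2)[OF x] by blast
    also have "R (B x) = B (R x)" using B' R x by blast
    finally show ?thesis .
  qed
qed

lemma generated_op_add:
  assumes A: "generated_op H T c A" and B: "generated_op H T d B"
  shows "generated_op H T (c + d) (\<lambda>x. A x + B x)"
  unfolding generated_op_def
proof (intro conjI ballI allI impI)
  note A' = A[unfolded generated_op_def] and B' = B[unfolded generated_op_def]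
  have mem: "A x \<in> hcarrier H" "B x \<in> hcarrier H" if "x \<in> hcarrier H" for x
    using A' B' that by (auto simp: linear_on_def)
  show "linear_on H (\<lambda>x. A x + B x)"
    using A' B' mem by (auto simp: linear_on_def scaleC_add_right add_mem)
  show "selfadjoint_on H (\<lambda>x. A x + B x)"
    using A' B' mem by (auto simp: selfadjoint_on_def inner_add_left inner_add_right)
  show "0 \<le> c + d" using A' B' by simp
  show "hnorm H (A x + B x) \<le> (c + d) * hnorm H x" if x: "x \<in> hcarrier H" for x
  proof -
    have "hnorm H (A x + B x) \<le> hnorm H (A x) + hnorm H (B x)" using mem[OF x] by (rule hnorm_triangle)
    also have "\<dots> \<le> c * hnorm H x + d * hnorm H x" using A' B' x by (intro add_mono) auto
    finally show ?thesis by (simp add: algebra_simps)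
  qed
  show "R (A x + B x) = A (R x) + B (R x)"
    if R: "bounded_op H H R" "\<forall>x\<in>hcarrier H. R (T x) = T (R x)" and x: "x \<in> hcarrier H" for R x
  proof -
    have "R (A x + B x) = R (A x) + R (B x)" using R mem[OF x] by (auto simp: bounded_op_def)
    also have "R (A x) = A (R x)" using A' R x by blast
    also have "R (B x) = B (R x)" using B' R x by blast
    finally show ?thesis .
  qed
qed

lemma generated_op_half:
  assumes A: "generated_op H T c A"
  shows "generated_op H T (c / 2) (\<lambda>x. (1 / 2) *\<^sub>C A x)"
  unfolding generated_op_def
proof (intro conjI ballI allI impI)
  note A' = A[unfolded generated_op_def]
  have mem: "A x \<in> hcarrier H" if "x \<in> hcarrier H" for x
    using A' that by (auto simp: linear_on_def)
  show "linear_on H (\<lambda>x. (1 / 2) *\<^sub>C A x)"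
    using A' mem by (auto simp: linear_on_def scaleC_add_right scaleC_scaleC scale_mem)
  show "selfadjoint_on H (\<lambda>x. (1 / 2) *\<^sub>C A x)"
    using A' mem by (auto simp: selfadjoint_on_def inner_scale_left inner_scale_right)
  show "0 \<le> c / 2" using A' by simp
  show "hnorm H ((1 / 2) *\<^sub>C A x) \<le> c / 2 * hnorm H x" if x: "x \<in> hcarrier H" for x
    using A' x mem[OF x] by (simp add: hnorm_scale)
  show "R ((1 / 2) *\<^sub>C A x) = (1 / 2) *\<^sub>C A (R x)"
    if R: "bounded_op H H R" "\<forall>x\<in>hcarrier H. R (T x) = T (R x)" and x: "x \<in> hcarrier H" for R x
  proof -
    have "R ((1 / 2) *\<^sub>C A x) = (1/2) *\<^sub>C R (A x)" using R mem[OF x] by (auto simp: bounded_op_def)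
    also have "R (A x) = A (R x)" using A' R x by blast
    finally show ?thesis .
  qed
qed

lemma generated_op_cong:
  assumes A: "generated_op H T c A" and eq: "\<And>x. x \<in> hcarrier H \<Longrightarrow> B x = A x" and "c = d"
  shows "generated_op H T d B"
  unfolding generated_op_def
proof (intro conjI ballI allI impI)
  note A' = A[unfolded generated_op_def]
  show "linear_on H B" using A' eq by (auto simp: linear_on_def add_mem scale_mem)
  show "selfadjoint_on H B" using A' eq by (auto simp: selfadjoint_on_def)
  show "0 \<le> d" "\<And>x. x \<in> hcarrier H \<Longrightarrow> hnorm H (B x) \<le> d * hnorm H x"
    using A' eq \<open>c = d\<close> by auto
  show "R (B x) = B (R x)"
    if R: "bounded_op H H R" "\<forall>x\<in>hcarrier H. R (T x) = T (R x)" and x: "x \<in> hcarrier H" for R x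
  proof -
    have "R x \<in> hcarrier H" using R x by (auto simp: bounded_op_def)
    thus ?thesis using A' R x eq by (metis (no_types, lifting))
  qed
qed

end

text \<open>The iterates converge to \<open>Y\<close> with \<open>2Y = T + Y\<^sup>2\<close>, so that \<open>(1 - Y)\<^sup>2 = 1 - T\<close>; as polynomials in
  \<open>T\<close> the iterates and their increments have nonnegative coefficients with sums \<open>sqrt_bd\<close>.\<close>

primrec sqrt_iter :: "('v::complex_vector \<Rightarrow> 'v) \<Rightarrow> nat \<Rightarrow> 'v \<Rightarrow> 'v" where
  "sqrt_iter T 0 = (\<lambda>x. 0)"
| "sqrt_iter T (Suc n) = (\<lambda>x. (1 / 2) *\<^sub>C (T x + sqrt_iter T n (sqrt_iter T n x)))"

primrec sqrt_bd :: "nat \<Rightarrow> real" where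
  "sqrt_bd 0 = 0"
| "sqrt_bd (Suc n) = (1 + sqrt_bd n * sqrt_bd n) / 2"

lemma sqrt_bd_le: "0 \<le> sqrt_bd n \<and> sqrt_bd n \<le> 1 \<and> sqrt_bd n \<le> sqrt_bd (Suc n)"
proof (induction n)
  case (Suc n)
  have "sqrt_bd n * sqrt_bd n \<le> 1" using Suc mult_mono[of "sqrt_bd n" 1 "sqrt_bd n" 1] by simp
  moreover have "sqrt_bd n * sqrt_bd n \<le> sqrt_bd (Suc n) * sqrt_bd (Suc n)"
    using Suc by (intro mult_mono) auto
  ultimately show ?case by simp
qed simp

context hilbert begin

context
  fixes T :: "'v \<Rightarrow> 'v"
  assumes T_lin: "linear_on H T" and T_sa: "selfadjoint_on H T"
    and T_contr: "\<And>x. x \<in> hcarrier H \<Longrightarrow> hnorm H (T x) \<le> hnorm H x"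
begin

lemma T_bdd: "bounded_op H H T"
  using T_lin T_contr by (intro bounded_opI[of _ _ 1]) auto

lemma generated_op_self: "generated_op H T 1 T"
  using T_lin T_sa T_contr by (auto simp: generated_op_def)

text \<open>Bounding the increments by those of the scalar recursion makes the operators converge
  along with \<open>sqrt_bd\<close>. The induction uses
  \<open>Y^2 - Z^2 = (Y - Z) Y + Z (Y - Z)\<close> for consecutive iterates, where all factors on
  the right are already controlled.\<close>

lemma generated_op_sqrt_iter:
  "generated_op H T (sqrt_bd n) (sqrt_iter T n) \<and>
   generated_op H T (sqrt_bd (Suc n) - sqrt_bd n) (\<lambda>x. sqrt_iter T (Suc n) x - sqrt_iter T n x)"
proof (induction n)
  case 0
  have "generated_op H T 0 (\<lambda>x. 0)"
    using zero_mem
    by (auto simp: generated_op_def linear_on_def selfadjoint_on_def bounded_op_def)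
      (metis cvec.scale_zero_left)
  thus ?case using generated_op_half[OF generated_op_self] by simp
next
  case (Suc n)
  let ?Y = "sqrt_iter T" and ?D = "\<lambda>x. sqrt_iter T (Suc n) x - sqrt_iter T n x"
  have Y: "generated_op H T (sqrt_bd n) (?Y n)"
    and D: "generated_op H T (sqrt_bd (Suc n) - sqrt_bd n) ?D" using Suc by auto
  have Y': "generated_op H T (sqrt_bd (Suc n)) (?Y (Suc n))"
    using generated_op_half[OF generated_op_add[OF generated_op_self generated_op_comp[OF Y Y T_bdd]]]
    by simp
  have lin: "linear_on H (?Y n)" "linear_on H (?Y (Suc n))"
    using Y Y' by (auto simp: generated_op_def simp del: sqrt_iter.simps)
  have "generated_op H T (((sqrt_bd (Suc n) - sqrt_bd n) * sqrt_bd (Suc n)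
      + sqrt_bd n * (sqrt_bd (Suc n) - sqrt_bd n)) / 2)
      (\<lambda>x. (1/2) *\<^sub>C (?D (?Y (Suc n) x) + ?Y n (?D x)))"
    by (intro generated_op_half generated_op_add generated_op_comp[OF D Y' T_bdd]
        generated_op_comp[OF Y D T_bdd])
  hence "generated_op H T (sqrt_bd (Suc (Suc n)) - sqrt_bd (Suc n)) (\<lambda>x. ?Y (Suc (Suc n)) x - ?Y (Suc n) x)"
  proof (rule generated_op_cong)
    fix x assume x: "x \<in> hcarrier H"
    have "?Y (Suc (Suc n)) x - ?Y (Suc n) x = (1/2) *\<^sub>C (T x + ?Y (Suc n) (?Y (Suc n) x))
        - (1/2) *\<^sub>C (T x + ?Y n (?Y n x))" by simp
    also have "\<dots> = (1/2) *\<^sub>C (?Y (Suc n) (?Y (Suc n) x) - ?Y n (?Y n x))"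
      by (simp only: cvec.scale_right_diff_distrib[symmetric] add_diff_cancel_left)
    also have "?Y (Suc n) (?Y (Suc n) x) - ?Y n (?Y n x) = ?D (?Y (Suc n) x) + ?Y n (?D x)"
      using x linear_onD(1)[OF lin(1)] linear_onD(1)[OF lin(2)]
      by (simp add: linear_on_diff[OF lin(1)] del: sqrt_iter.simps)
    finally show "?Y (Suc (Suc n)) x - ?Y (Suc n) x = (1/2) *\<^sub>C (?D (?Y (Suc n) x) + ?Y n (?D x))" .
  next
    show "((sqrt_bd (Suc n) - sqrt_bd n) * sqrt_bd (Suc n)
      + sqrt_bd n * (sqrt_bd (Suc n) - sqrt_bd n)) / 2 = sqrt_bd (Suc (Suc n)) - sqrt_bd (Suc n)"
      by (simp add: field_simps)
  qed
  thus ?case using Y' by simp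
qed

lemma sqrt_iter_diff:
  assumes x: "x \<in> hcarrier H" and "n \<le> m"
  shows "hnorm H (sqrt_iter T m x - sqrt_iter T n x) \<le> (sqrt_bd m - sqrt_bd n) * hnorm H x"
  using \<open>n \<le> m\<close>
proof (induction m rule: dec_induct)
  case (step m)
  have mem: "sqrt_iter T k x \<in> hcarrier H" for k
    using generated_op_sqrt_iter[of k] x by (auto simp: generated_op_def linear_on_def)
  have "hnorm H (sqrt_iter T (Suc m) x - sqrt_iter T n x) \<le>
      hnorm H (sqrt_iter T (Suc m) x - sqrt_iter T m x) + hnorm H (sqrt_iter T m x - sqrt_iter T n x)"
    by (intro hnorm_diff_triangle mem)
  also have "\<dots> \<le> (sqrt_bd (Suc m) - sqrt_bd m) * hnorm H x + (sqrt_bd m - sqrt_bd n) * hnorm H x"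
    using generated_op_sqrt_iter[of m] x step.IH by (intro add_mono) (auto simp: generated_op_def)
  finally show ?case by (simp add: algebra_simps)
qed simp

lemma sqrt_iter_limit:
  obtains Y where "generated_op H T 1 Y" "\<And>x. x \<in> hcarrier H \<Longrightarrow> 2 *\<^sub>C Y x = T x + Y (Y x)"
proof -
  have mem: "sqrt_iter T k x \<in> hcarrier H" if "x \<in> hcarrier H" for k x
    using generated_op_sqrt_iter[of k] that by (auto simp: generated_op_def linear_on_def)
  have "incseq sqrt_bd" using sqrt_bd_le by (intro incseq_SucI) auto
  then obtain L where L: "sqrt_bd \<longlonglongrightarrow> L"
  proof (rule incseq_convergent[of sqrt_bd 1])
    show "\<forall>i. sqrt_bd i \<le> 1" using sqrt_bd_le by blast
  qed blast
  hence Cau: "Cauchy sqrt_bd" by (rule LIMSEQ_imp_Cauchy)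
  have "\<exists>y\<in>hcarrier H. (\<lambda>n. hnorm H (sqrt_iter T n x - y)) \<longlonglongrightarrow> 0" if x: "x \<in> hcarrier H" for x
  proof (rule complete)
    fix e :: real assume e: "e > 0"
    have "e / (hnorm H x + 1) > 0" using e hnorm_ge0[OF x] by simp
    then obtain N where N: "\<And>m n. m \<ge> N \<Longrightarrow> n \<ge> N \<Longrightarrow> \<bar>sqrt_bd m - sqrt_bd n\<bar> < e / (hnorm H x + 1)"
      using Cau[unfolded Cauchy_iff] by (metis real_norm_def)
    have *: "hnorm H (sqrt_iter T m x - sqrt_iter T n x) < e" if "m \<ge> n" "n \<ge> N" for m n
    proof -
      have "hnorm H (sqrt_iter T m x - sqrt_iter T n x) \<le> (sqrt_bd m - sqrt_bd n) * hnorm H x"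
        using sqrt_iter_diff[OF x that(1)] .
      also have "\<dots> \<le> \<bar>sqrt_bd m - sqrt_bd n\<bar> * (hnorm H x + 1)"
        using hnorm_ge0[OF x] by (intro mult_mono) auto
      also have "\<dots> < e" using N[of m n] that hnorm_ge0[OF x] by (simp add: field_simps)
      finally show ?thesis .
    qed
    have "hnorm H (sqrt_iter T m x - sqrt_iter T n x) < e" if "m \<ge> N" "n \<ge> N" for m n
    proof (cases "m \<ge> n")
      case False
      thus ?thesis using *[of m n] that hnorm_minus_commute[OF mem[OF x] mem[OF x], of m n] by simp
    qed (use * that in blast)
    thus "\<exists>N. \<forall>m\<ge>N. \<forall>n\<ge>N. hnorm H (sqrt_iter T m x - sqrt_iter T n x) < e" by blast
  qed (use mem x in auto)
  then obtain Y where YC: "\<And>x. x \<in> hcarrier H \<Longrightarrow> Y x \<in> hcarrier H"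
    and Y: "\<And>x. x \<in> hcarrier H \<Longrightarrow> (\<lambda>n. hnorm H (sqrt_iter T n x - Y x)) \<longlonglongrightarrow> 0"
    by metis
  have lim_sum: "(\<lambda>n. hnorm H (u n + v n - (a + b))) \<longlonglongrightarrow> 0"
    if "\<And>n. u n \<in> hcarrier H" "\<And>n. v n \<in> hcarrier H" "a \<in> hcarrier H" "b \<in> hcarrier H"
      "(\<lambda>n. hnorm H (u n - a)) \<longlonglongrightarrow> 0" "(\<lambda>n. hnorm H (v n - b)) \<longlonglongrightarrow> 0" for u v a b
  proof (rule Lim_null_comparison)
    show "\<forall>\<^sub>F n in sequentially. norm (hnorm H (u n + v n - (a + b))) \<le> hnorm H (u n - a) + hnorm H (v n - b)"
    proof (intro always_eventually allI)
      fix n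
      have "hnorm H (u n + v n - (a + b)) = hnorm H ((u n - a) + (v n - b))" by (simp add: algebra_simps)
      also have "\<dots> \<le> hnorm H (u n - a) + hnorm H (v n - b)"
        using that by (intro hnorm_triangle) (auto simp: diff_mem)
      finally show "norm (hnorm H (u n + v n - (a + b))) \<le> hnorm H (u n - a) + hnorm H (v n - b)"
        using that by (simp add: hnorm_ge0 mem_intros)
    qed
    show "(\<lambda>n. hnorm H (u n - a) + hnorm H (v n - b)) \<longlonglongrightarrow> 0"
      using tendsto_add[OF that(5,6)] by simp
  qed
  have lim_scale: "(\<lambda>n. hnorm H (c *\<^sub>C u n - c *\<^sub>C a)) \<longlonglongrightarrow> 0"
    if "\<And>n. u n \<in> hcarrier H" "a \<in> hcarrier H" "(\<lambda>n. hnorm H (u n - a)) \<longlonglongrightarrow> 0" for u a c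
    using tendsto_mult_right[OF that(3), of "cmod c"] that(1,2)
    by (simp add: hnorm_scale diff_mem mult.commute flip: cvec.scale_right_diff_distrib)
  have Ylin: "linear_on H Y"
    unfolding linear_on_def
  proof (intro conjI ballI allI)
    show "Y ` hcarrier H \<subseteq> hcarrier H" using YC by blast
    fix x y assume xy: "x \<in> hcarrier H" "y \<in> hcarrier H"
    have "sqrt_iter T n (x + y) = sqrt_iter T n x + sqrt_iter T n y" for n
      using generated_op_sqrt_iter[of n] xy by (auto simp: generated_op_def linear_on_def)
    thus "Y (x + y) = Y x + Y y"
      using lim_sum[of "\<lambda>n. sqrt_iter T n x" "\<lambda>n. sqrt_iter T n y" "Y x" "Y y"] Y[of "x + y"] Y[OF xy(1)] Y[OF xy(2)]
      by (intro limit_unique[of "\<lambda>n. sqrt_iter T n (x + y)"]) (use xy mem YC in \<open>auto simp: add_mem\<close>)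
  next
    fix c x assume x: "x \<in> hcarrier H"
    have "sqrt_iter T n (c *\<^sub>C x) = c *\<^sub>C sqrt_iter T n x" for n
      using generated_op_sqrt_iter[of n] x by (auto simp: generated_op_def linear_on_def)
    thus "Y (c *\<^sub>C x) = c *\<^sub>C Y x"
      using lim_scale[of "\<lambda>n. sqrt_iter T n x" "Y x" c] Y[of "c *\<^sub>C x"] Y[OF x]
      by (intro limit_unique[of "\<lambda>n. sqrt_iter T n (c *\<^sub>C x)"]) (use x mem YC in \<open>auto simp: scale_mem\<close>)
  qed
  have Yle: "hnorm H (Y x) \<le> 1 * hnorm H x" if x: "x \<in> hcarrier H" for x
  proof (rule LIMSEQ_le_const2)
    show "(\<lambda>n. hnorm H (sqrt_iter T n x)) \<longlonglongrightarrow> hnorm H (Y x)"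
      using x mem YC Y by (intro tendsto_hnorm) auto
    have "hnorm H (sqrt_iter T n x) \<le> sqrt_bd n * hnorm H x" for n
      using generated_op_sqrt_iter[of n] x by (auto simp: generated_op_def)
    also have "sqrt_bd n * hnorm H x \<le> 1 * hnorm H x" for n
      using sqrt_bd_le[of n] hnorm_ge0[OF x] by (intro mult_right_mono) auto
    finally show "\<exists>N. \<forall>n\<ge>N. hnorm H (sqrt_iter T n x) \<le> 1 * hnorm H x" by blast
  qed
  have bdd_lim: "(\<lambda>n. hnorm H (R (u n) - R a)) \<longlonglongrightarrow> 0"
    if R: "bounded_op H H R" and "\<And>n. u n \<in> hcarrier H" "a \<in> hcarrier H" "(\<lambda>n. hnorm H (u n - a)) \<longlonglongrightarrow> 0"
    for R u a
  proof -
    have Rlin: "linear_on H R" using R by (rule bounded_op_linear_on)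
    obtain C where C: "\<And>x. x \<in> hcarrier H \<Longrightarrow> hnorm H (R x) \<le> C * hnorm H x"
      using R unfolding bounded_op_def by blast
    show ?thesis
    proof (rule Lim_null_comparison)
      show "\<forall>\<^sub>F n in sequentially. norm (hnorm H (R (u n) - R a)) \<le> C * hnorm H (u n - a)"
        using that C[OF diff_mem[OF that(2,3)]] linear_onD(1)[OF Rlin]
        by (intro always_eventually)
           (auto simp: linear_on_diff[OF Rlin that(2,3), symmetric] hnorm_ge0 diff_mem)
      show "(\<lambda>n. C * hnorm H (u n - a)) \<longlonglongrightarrow> 0" using tendsto_mult_left[OF that(4), of C] by simp
    qed
  qed
  have "generated_op H T 1 Y"
    unfolding generated_op_def
  proof (intro conjI ballI allI impI)
    show "selfadjoint_on H Y"
      unfolding selfadjoint_on_def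
    proof (intro ballI)
      fix x y assume xy: "x \<in> hcarrier H" "y \<in> hcarrier H"
      have "(\<lambda>n. hinner H (sqrt_iter T n x) y) \<longlonglongrightarrow> hinner H (Y x) y"
        using xy mem YC Y by (intro tendsto_inner_left) auto
      moreover have "(\<lambda>n. cnj (hinner H (sqrt_iter T n y) x)) \<longlonglongrightarrow> cnj (hinner H (Y y) x)"
        using xy mem YC Y by (intro tendsto_cnj tendsto_inner_left) auto
      moreover have "cnj (hinner H (sqrt_iter T n y) x) = hinner H (sqrt_iter T n x) y" for n
        using generated_op_sqrt_iter[of n] xy mem inner_commute[of x "sqrt_iter T n y"]
        by (auto simp: generated_op_def selfadjoint_on_def)
      ultimately have "hinner H (Y x) y = cnj (hinner H (Y y) x)" using LIMSEQ_unique by simp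
      thus "hinner H (Y x) y = hinner H x (Y y)" using inner_commute[of x "Y y"] xy YC by simp
    qed
    fix R x assume R: "bounded_op H H R" "\<forall>x\<in>hcarrier H. R (T x) = T (R x)" and x: "x \<in> hcarrier H"
    have RC: "R x \<in> hcarrier H" if "x \<in> hcarrier H" for x using R that by (auto simp: bounded_op_def)
    have "R (sqrt_iter T n x) = sqrt_iter T n (R x)" for n
      using generated_op_sqrt_iter[of n] R x unfolding generated_op_def by blast
    thus "R (Y x) = Y (R x)"
      using bdd_lim[OF R(1), of "\<lambda>n. sqrt_iter T n x" "Y x"] Y[OF x] Y[OF RC[OF x]]
      by (intro limit_unique[of "\<lambda>n. R (sqrt_iter T n x)"]) (use x mem YC RC in auto)
  qed (use Ylin Yle in auto)
  moreover have "2 *\<^sub>C Y x = T x + Y (Y x)" if x: "x \<in> hcarrier H" for x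
  proof (rule limit_unique[of "\<lambda>n. 2 *\<^sub>C sqrt_iter T (Suc n) x"])
    have TC: "T x \<in> hcarrier H" using T_lin x by (auto simp: linear_on_def)
    show "(\<lambda>n. hnorm H (2 *\<^sub>C sqrt_iter T (Suc n) x - 2 *\<^sub>C Y x)) \<longlonglongrightarrow> 0"
      using x mem YC LIMSEQ_Suc[OF Y[OF x]] by (intro lim_scale) (auto simp del: sqrt_iter.simps)
    have eq: "2 *\<^sub>C sqrt_iter T (Suc n) x = T x + sqrt_iter T n (sqrt_iter T n x)" for n
      by (simp add: scaleC_scaleC)
    \<comment> \<open>Operator and argument both vary with \<open>n\<close>: the bound
      \<open>sqrt_bd n \<le> 1\<close> handles the moving argument, pointwise convergence at
      \<open>Y x\<close> the moving operator.\<close>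
    have "(\<lambda>n. hnorm H (sqrt_iter T n (sqrt_iter T n x) - Y (Y x))) \<longlonglongrightarrow> 0"
    proof (rule Lim_null_comparison)
      show "\<forall>\<^sub>F n in sequentially. norm (hnorm H (sqrt_iter T n (sqrt_iter T n x) - Y (Y x)))
          \<le> hnorm H (sqrt_iter T n x - Y x) + hnorm H (sqrt_iter T n (Y x) - Y (Y x))"
      proof (intro always_eventually allI)
        fix n
        have g: "generated_op H T (sqrt_bd n) (sqrt_iter T n)" using generated_op_sqrt_iter by blast
        hence lin: "linear_on H (sqrt_iter T n)" by (auto simp: generated_op_def)
        have "hnorm H (sqrt_iter T n (sqrt_iter T n x) - Y (Y x)) \<le>
           hnorm H (sqrt_iter T n (sqrt_iter T n x) - sqrt_iter T n (Y x)) + hnorm H (sqrt_iter T n (Y x) - Y (Y x))"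
          using x mem YC by (intro hnorm_diff_triangle) auto
        also have "sqrt_iter T n (sqrt_iter T n x) - sqrt_iter T n (Y x) = sqrt_iter T n (sqrt_iter T n x - Y x)"
          using x mem YC by (simp add: linear_on_diff[OF lin])
        also have "hnorm H \<dots> \<le> sqrt_bd n * hnorm H (sqrt_iter T n x - Y x)"
          using g x mem YC by (auto simp: generated_op_def diff_mem)
        also have "\<dots> \<le> 1 * hnorm H (sqrt_iter T n x - Y x)"
          using sqrt_bd_le[of n] x mem YC by (intro mult_right_mono) (auto simp: hnorm_ge0 diff_mem)
        finally show "norm (hnorm H (sqrt_iter T n (sqrt_iter T n x) - Y (Y x)))
          \<le> hnorm H (sqrt_iter T n x - Y x) + hnorm H (sqrt_iter T n (Y x) - Y (Y x))"
          using x mem YC by (simp add: hnorm_ge0 diff_mem)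
      qed
      show "(\<lambda>n. hnorm H (sqrt_iter T n x - Y x) + hnorm H (sqrt_iter T n (Y x) - Y (Y x))) \<longlonglongrightarrow> 0"
        using tendsto_add[OF Y[OF x] Y[OF YC[OF x]]] by simp
    qed
    thus "(\<lambda>n. hnorm H (2 *\<^sub>C sqrt_iter T (Suc n) x - (T x + Y (Y x)))) \<longlonglongrightarrow> 0"
      unfolding eq using x TC mem YC by (intro lim_sum) auto
  qed (use x mem YC linear_onD(1)[OF T_lin] in \<open>auto simp: mem_intros simp del: sqrt_iter.simps\<close>)
  ultimately show thesis using that by blast
qed

text \<open>A sesquilinear form with real diagonal is Hermitian by polarisation. The form of
  \<open>Q\<close> may be degenerate; as an instance of \<open>hform\<close> it has a Cauchy-Schwarz
  inequality.\<close>

lemma positive_form: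
  assumes Q: "positive_op H Q"
  shows "hform \<lparr>hcarrier = hcarrier H, hinner = (\<lambda>x y. hinner H (Q x) y)\<rparr>" "selfadjoint_on H Q"
proof -
  have lin: "linear_on H Q" and pos: "\<And>x. x \<in> hcarrier H \<Longrightarrow> hinner H (Q x) x \<in> \<real>\<^sub>\<ge>\<^sub>0"
    using Q by (auto simp: positive_op_def bounded_op_linear_on)
  have QC: "Q x \<in> hcarrier H" if "x \<in> hcarrier H" for x using lin that by (auto simp: linear_on_def)
  show sa: "selfadjoint_on H Q"
    unfolding selfadjoint_on_def
  proof (intro ballI)
    fix x y assume xy: "x \<in> hcarrier H" "y \<in> hcarrier H"
    have Im0: "Im (hinner H (Q x) x) = 0" if "x \<in> hcarrier H" for x
      using pos[OF that] by (simp add: complex_nonneg_Reals_iff)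
    \<comment> \<open>Polarisation: the imaginary part at \<open>x + z\<close> vanishes. Using this
      for \<open>y\<close> and for \<open>\<i> *\<^sub>C y\<close> settles imaginary and real part
      of the inner product.\<close>
    have *: "Im (hinner H (Q x) z) + Im (hinner H (Q z) x) = 0" if "z \<in> hcarrier H" for z
      using Im0[of "x + z"] Im0[of x] Im0[of z] xy that QC
      by (simp add: linear_onD[OF lin] inner_add_left inner_add_right add_mem)
    from *[OF xy(2)] *[OF scale_mem[OF xy(2)], of \<i>]
    have "hinner H (Q x) y = cnj (hinner H (Q y) x)"
      using xy QC by (simp add: linear_onD[OF lin] inner_scale_left inner_scale_right complex_eq_iff)
    thus "hinner H (Q x) y = hinner H x (Q y)" using inner_commute[of x "Q y"] xy QC by simp
  qed
  show "hform \<lparr>hcarrier = hcarrier H, hinner = (\<lambda>x y. hinner H (Q x) y)\<rparr>"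
  proof (unfold_locales, goal_cases)
    case (6 x y) thus ?case using sa QC inner_commute[of "Q y" x] by (auto simp: selfadjoint_on_def)
  next
    case (7 x) thus ?case using pos[of x] by (simp add: complex_nonneg_Reals_iff)
  qed (use QC in \<open>auto simp: mem_intros linear_onD[OF lin] inner_add_left inner_scale_left\<close>)
qed

text \<open>Cauchy-Schwarz for the form \<open><Q x, y>\<close>, with \<open>Q d\<close> as second
  vector.\<close>

lemma positive_op_eq0:
  assumes Q: "positive_op H Q" and d: "d \<in> hcarrier H" "hinner H (Q d) d = 0"
  shows "Q d = 0"
proof -
  interpret F: hform "\<lparr>hcarrier = hcarrier H, hinner = (\<lambda>x y. hinner H (Q x) y)\<rparr>"
    by (rule positive_form(1)[OF Q])
  have QC: "Q d \<in> hcarrier H" using Q d by (auto simp: positive_op_def bounded_op_def)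
  have "cmod (hinner H (Q d) (Q d)) \<le> 0"
    using F.cauchy_schwarz[of d "Q d"] d QC by (simp add: hnorm_def)
  thus ?thesis using inner_definite[OF QC] by simp
qed

text \<open>The root is \<open>1 - Y\<close>. The definite description also demands uniqueness: a
  positive root \<open>R\<close> of \<open>1 - T\<close> commutes with \<open>T\<close>, hence with
  \<open>Y\<close>, because \<open>Y\<close> commutes with every bounded operator commuting with
  \<open>T\<close>.\<close>

lemma sqrt_op_properties:
  fixes P :: "'v \<Rightarrow> 'v"
  assumes P: "\<And>x. x \<in> hcarrier H \<Longrightarrow> P x = x - T x"
  shows "linear_on H (sqrt_op H P)" "selfadjoint_on H (sqrt_op H P)" "bounded_op H H (sqrt_op H P)"
    and "x \<in> hcarrier H \<Longrightarrow> sqrt_op H P (sqrt_op H P x) = x - T x"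
proof -
  obtain Y where Y: "generated_op H T 1 Y" and YY: "\<And>x. x \<in> hcarrier H \<Longrightarrow> 2 *\<^sub>C Y x = T x + Y (Y x)"
    using sqrt_iter_limit by blast
  have Ylin: "linear_on H Y" and Ysa: "selfadjoint_on H Y"
    and Yle: "\<And>x. x \<in> hcarrier H \<Longrightarrow> hnorm H (Y x) \<le> hnorm H x"
    using Y by (auto simp: generated_op_def)
  note YC = linear_onD(1)[OF Ylin]
  have Ycomm: "R (Y x) = Y (R x)"
    if "bounded_op H H R" "\<forall>x\<in>hcarrier H. R (T x) = T (R x)" "x \<in> hcarrier H" for R x
    using Y that unfolding generated_op_def by blast
  \<comment> \<open>The restriction serves the extensionality clause in
    \<open>sqrt_op\<close>.\<close>
  define Q where "Q = restrict (\<lambda>x. x - Y x) (hcarrier H)"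
  have Q: "Q x = x - Y x" if "x \<in> hcarrier H" for x using that by (simp add: Q_def)
  have QC: "Q x \<in> hcarrier H" if "x \<in> hcarrier H" for x using that by (simp add: Q YC diff_mem)
  have Qbdd: "bounded_op H H Q"
  proof (rule bounded_opI)
    show "linear_on H Q"
      using QC by (auto simp: linear_on_def Q linear_onD[OF Ylin] mem_intros cvec.scale_right_diff_distrib)
    show "hnorm H (Q x) \<le> 2 * hnorm H x" if "x \<in> hcarrier H" for x
      using hnorm_triangle_diff[OF that YC[OF that]] Yle[OF that] that by (simp add: Q)
  qed
  have Qpos: "positive_op H Q"
    unfolding positive_op_def
  proof (intro conjI ballI Qbdd)
    fix x assume x: "x \<in> hcarrier H"
    have "hinner H (Y x) x = cnj (hinner H (Y x) x)"
      using Ysa x inner_commute[OF x YC[OF x]] by (auto simp: selfadjoint_on_def)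
    hence "Im (hinner H (Y x) x) = 0" by (simp add: complex_eq_iff)
    moreover have "Re (hinner H (Y x) x) \<le> (hnorm H x)\<^sup>2"
    proof -
      have "Re (hinner H (Y x) x) \<le> cmod (hinner H (Y x) x)" by (rule complex_Re_le_cmod)
      also have "\<dots> \<le> hnorm H (Y x) * hnorm H x" using x YC by (intro cauchy_schwarz)
      also have "\<dots> \<le> hnorm H x * hnorm H x" using x Yle by (intro mult_right_mono) (auto simp: hnorm_ge0)
      finally show ?thesis by (simp add: power2_eq_square)
    qed
    ultimately show "hinner H (Q x) x \<in> \<real>\<^sub>\<ge>\<^sub>0"
      using x YC by (simp add: Q inner_diff_left inner_self complex_nonneg_Reals_iff)
  qed
  have QQ: "Q (Q x) = P x" if x: "x \<in> hcarrier H" for x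
  proof -
    have "Q (Q x) = x - Y x - (Y x - Y (Y x))"
      using x YC by (simp add: Q diff_mem linear_on_diff[OF Ylin])
    also have "\<dots> = x - 2 *\<^sub>C Y x + Y (Y x)"
      using scaleC_add_left[of 1 1 "Y x"] by (simp add: algebra_simps)
    also have "\<dots> = x - T x" by (simp add: YY[OF x])
    finally show ?thesis by (simp add: P x)
  qed
  have uniq: "R = Q"
    if R: "R \<in> extensional (hcarrier H)" "positive_op H R" "\<forall>x\<in>hcarrier H. R (R x) = P x" for R
  proof (rule extensionalityI[OF R(1)])
    show "Q \<in> extensional (hcarrier H)" by (simp add: Q_def)
    fix x assume x: "x \<in> hcarrier H"
    have Rbdd: "bounded_op H H R" and Rlin: "linear_on H R"
      using R(2) by (auto simp: positive_op_def bounded_op_linear_on)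
    note RC = linear_onD(1)[OF Rlin]
    have Qlin: "linear_on H Q" using Qbdd by (rule bounded_op_linear_on)
    have TC: "T x \<in> hcarrier H" if "x \<in> hcarrier H" for x using T_lin that by (rule linear_onD)
    have "R (T x) = T (R x)" if "x \<in> hcarrier H" for x
    proof -
      have RR: "R (R y) = y - T y" if "y \<in> hcarrier H" for y using R(3) P that by simp
      have "R (x - T x) = R (R (R x))" by (simp only: RR[OF that])
      also have "\<dots> = R x - T (R x)" by (rule RR[OF RC[OF that]])
      finally show ?thesis using that TC RC by (simp add: linear_on_diff[OF Rlin])
    qed
    hence RQ: "R (Q x) = Q (R x)" if "x \<in> hcarrier H" for x
      using that Ycomm[OF Rbdd _ that] YC RC by (simp add: Q linear_on_diff[OF Rlin])
    \<comment> \<open>As \<open>Q\<close> and \<open>R\<close> commute,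
      \<open>(Q + R) d = Q (Q x) - R (R x) = 0\<close>. Two nonnegative forms with sum zero both
      vanish at \<open>d\<close>, so \<open>Q d = R d = 0\<close> and
      \<open><d, d> = <x, Q d - R d> = 0\<close>.\<close>
    define d where "d = Q x - R x"
    have d: "d \<in> hcarrier H" using x QC RC by (simp add: d_def diff_mem)
    have "Q d + R d = 0"
      using x QC RC RQ QQ R(3) by (simp add: d_def linear_on_diff[OF Rlin] linear_on_diff[OF Qlin])
    hence "hinner H (Q d) d + hinner H (R d) d = 0"
      using d QC RC by (simp add: inner_add_left[symmetric])
    moreover have "hinner H (Q d) d \<in> \<real>\<^sub>\<ge>\<^sub>0" "hinner H (R d) d \<in> \<real>\<^sub>\<ge>\<^sub>0"
      using Qpos R(2) d by (auto simp: positive_op_def)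
    ultimately have "hinner H (Q d) d = 0" "hinner H (R d) d = 0"
      by (auto simp: complex_nonneg_Reals_iff complex_eq_iff)
    hence 0: "Q d = 0" "R d = 0" using positive_op_eq0 Qpos R(2) d by auto
    have "hinner H d d = hinner H (Q x) d - hinner H (R x) d"
      using x QC RC d by (simp add: d_def inner_diff_left)
    also have "\<dots> = hinner H x (Q d) - hinner H x (R d)"
      using positive_form(2)[OF Qpos] positive_form(2)[OF R(2)] x d by (auto simp: selfadjoint_on_def)
    also have "\<dots> = 0" using 0 x by simp
    finally have "d = 0" using inner_definite d by blast
    thus "R x = Q x" by (simp add: d_def)
  qed
  have "sqrt_op H P = Q"
    unfolding sqrt_op_def
  proof (rule the_equality)
    show "Q \<in> extensional (hcarrier H) \<and> positive_op H Q \<and> (\<forall>x\<in>hcarrier H. Q (Q x) = P x)"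
      using Qpos QQ by (simp add: Q_def)
  qed (use uniq in blast)
  thus "linear_on H (sqrt_op H P)" "selfadjoint_on H (sqrt_op H P)" "bounded_op H H (sqrt_op H P)"
    "x \<in> hcarrier H \<Longrightarrow> sqrt_op H P (sqrt_op H P x) = x - T x"
    using Qbdd positive_form(2)[OF Qpos] QQ P by (auto intro: bounded_op_linear_on)
qed

end

end

subsection \<open>Operator ranges\<close>

context hilbert begin

context
  fixes Q :: "'v \<Rightarrow> 'v"
  assumes Q_bdd: "bounded_op H H Q" and Q_sa: "selfadjoint_on H Q"
begin

abbreviation Rng where "Rng \<equiv> range_space H Q"
abbreviation Init where "Init \<equiv> orth_compl H {k\<in>hcarrier H. Q k = 0}"

lemma Q_lin: "linear_on H Q" using Q_bdd by (rule bounded_op_linear_on)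

lemmas Q_mem = linear_onD(1)[OF Q_lin]
lemmas Q_diff = linear_on_diff[OF Q_lin]

lemma Init_closed: "closed_subspace H Init"
  by (rule orth_compl_closed_subspace) auto

lemma Init_sub: "cvec.subspace Init" and Init_mem: "x \<in> Init \<Longrightarrow> x \<in> hcarrier H"
  using Init_closed by (auto simp: closed_subspace_def)

lemma Init_inj: "x \<in> Init \<Longrightarrow> y \<in> Init \<Longrightarrow> Q x = Q y \<Longrightarrow> x = y"
proof -
  assume *: "x \<in> Init" "y \<in> Init" "Q x = Q y"
  hence C: "x \<in> hcarrier H" "y \<in> hcarrier H" by (auto simp: Init_mem)
  have d: "x - y \<in> Init" using * Init_sub by (rule_tac cvec.subspace_diff)
  have "Q (x - y) = 0" using * C by (simp add: Q_diff)
  hence "hinner H (x - y) (x - y) = 0" using d C by (auto simp: orth_compl_def diff_mem)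
  hence "x - y = 0" by (rule inner_definite[OF diff_mem[OF C]])
  thus "x = y" by simp
qed

lemma range_Init: "x \<in> Init \<Longrightarrow> Q x \<in> hcarrier Rng"
  by (auto simp: range_space_def Init_mem)

lemma coker_preimage_Q: "x \<in> Init \<Longrightarrow> coker_preimage H Q (Q x) = x"
  unfolding coker_preimage_def by (rule the_equality) (auto intro: Init_inj)

text \<open>Subtracting from a preimage its projection to the kernel gives a preimage in
  \<open>Init\<close>. The kernel is closed because, \<open>Q\<close> being self-adjoint, it is the
  orthogonal complement of the range.\<close>

lemma rangeE:
  assumes "f \<in> hcarrier Rng"
  obtains x where "x \<in> Init" "f = Q x"
proof -
  obtain z where z: "z \<in> hcarrier H" "f = Q z" using assms by (auto simp: range_space_def)
  let ?K = "{k\<in>hcarrier H. Q k = 0}"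
  have "closed_subspace H ?K"
    unfolding closed_subspace_def
  proof (intro conjI)
    show "cvec.subspace ?K"
      by (intro cvec.subspaceI) (auto simp: mem_intros linear_on_zero[OF Q_lin] linear_onD[OF Q_lin])
    show "hclosure H ?K \<subseteq> ?K"
    proof
      fix x assume x: "x \<in> hclosure H ?K"
      hence xC: "x \<in> hcarrier H" by (simp add: hclosure_def)
      have "hinner H x (Q y) = 0" if "y \<in> hcarrier H" for y
      proof (rule inner_hclosure_eq0[OF _ x])
        fix s assume s: "s \<in> ?K"
        hence "hinner H (Q s) y = hinner H s (Q y)" using Q_sa that by (auto simp: selfadjoint_on_def)
        thus "hinner H s (Q y) = 0" using s that by simp
      qed (use that in \<open>auto simp: Q_mem\<close>)
      hence "hinner H (Q x) y = 0" if "y \<in> hcarrier H" for y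
        using that xC Q_sa by (auto simp: selfadjoint_on_def)
      from this[OF Q_mem[OF xC]] have "Q x = 0" using inner_definite Q_mem xC by blast
      thus "x \<in> ?K" using xC by simp
    qed
  qed auto
  then obtain k where k: "k \<in> ?K" "\<And>s. s \<in> ?K \<Longrightarrow> hinner H (z - k) s = 0"
    using orthogonal_projection[OF _ z(1)] by blast
  hence "z - k \<in> Init" using z by (auto simp: orth_compl_def diff_mem)
  moreover have "f = Q (z - k)" using k z by (simp add: Q_diff)
  ultimately show thesis using that by blast
qed

lemma hinner_range: "x \<in> Init \<Longrightarrow> y \<in> Init \<Longrightarrow> hinner Rng (Q x) (Q y) = hinner H x y"
  by (simp add: range_space_def coker_preimage_Q)

lemma hnorm_range: "x \<in> Init \<Longrightarrow> hnorm Rng (Q x) = hnorm H x"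
  by (simp add: hnorm_def hinner_range)

lemma Q_Init: "x \<in> hcarrier H \<Longrightarrow> Q x \<in> Init"
  using Q_sa by (auto simp: orth_compl_def Q_mem selfadjoint_on_def)

text \<open>\<open>Q\<close> is an isometry from the closed subspace \<open>Init\<close> onto the
  range space, so the axioms and completeness are transported along it.\<close>

lemma hilbert_range: "hilbert Rng"
proof -
  have add: "Q x + Q y = Q (x + y)" if "x \<in> Init" "y \<in> Init" for x y
    using that by (simp add: linear_onD[OF Q_lin] Init_mem)
  have scale: "c *\<^sub>C Q x = Q (c *\<^sub>C x)" if "x \<in> Init" for x c
    using that by (simp add: linear_onD[OF Q_lin] Init_mem)
  have sub: "0 \<in> Init" "\<And>x y. x \<in> Init \<Longrightarrow> y \<in> Init \<Longrightarrow> x + y \<in> Init"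
    "\<And>x c. x \<in> Init \<Longrightarrow> c *\<^sub>C x \<in> Init"
    using Init_sub by (auto simp: cvec.subspace_def)
  note s = sub Init_mem
  have pre: "prehilbert Rng"
  proof
    show "0 \<in> hcarrier Rng" using range_Init[OF s(1)] by (simp add: linear_on_zero[OF Q_lin])
    fix f g h c
    show "f + g \<in> hcarrier Rng" if f: "f \<in> hcarrier Rng" and g: "g \<in> hcarrier Rng"
    proof -
      obtain x where x: "x \<in> Init" "f = Q x" using f by (rule rangeE)
      obtain y where y: "y \<in> Init" "g = Q y" using g by (rule rangeE)
      show ?thesis using x y range_Init[OF s(2)] by (simp add: add)
    qed
    show "c *\<^sub>C f \<in> hcarrier Rng" if f: "f \<in> hcarrier Rng"
    proof -
      obtain x where x: "x \<in> Init" "f = Q x" using f by (rule rangeE)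
      show ?thesis using x range_Init[OF s(3)] by (simp add: scale)
    qed
    show "hinner Rng (f + g) h = hinner Rng f h + hinner Rng g h"
      if f: "f \<in> hcarrier Rng" and g: "g \<in> hcarrier Rng" and h: "h \<in> hcarrier Rng"
    proof -
      obtain x where x: "x \<in> Init" "f = Q x" using f by (rule rangeE)
      obtain y where y: "y \<in> Init" "g = Q y" using g by (rule rangeE)
      obtain z where z: "z \<in> Init" "h = Q z" using h by (rule rangeE)
      show ?thesis using x y z by (simp add: add hinner_range s inner_add_left)
    qed
    show "hinner Rng (c *\<^sub>C f) g = c * hinner Rng f g"
      if f: "f \<in> hcarrier Rng" and g: "g \<in> hcarrier Rng"
    proof -
      obtain x where x: "x \<in> Init" "f = Q x" using f by (rule rangeE)
      obtain y where y: "y \<in> Init" "g = Q y" using g by (rule rangeE)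
      show ?thesis using x y by (simp add: scale hinner_range s inner_scale_left)
    qed
    show "hinner Rng f g = cnj (hinner Rng g f)"
      if f: "f \<in> hcarrier Rng" and g: "g \<in> hcarrier Rng"
    proof -
      obtain x where x: "x \<in> Init" "f = Q x" using f by (rule rangeE)
      obtain y where y: "y \<in> Init" "g = Q y" using g by (rule rangeE)
      show ?thesis using x y by (simp add: hinner_range inner_commute[of x y] s)
    qed
    show "0 \<le> Re (hinner Rng f f)" if f: "f \<in> hcarrier Rng"
    proof -
      obtain x where x: "x \<in> Init" "f = Q x" using f by (rule rangeE)
      show ?thesis using x by (simp add: hinner_range inner_ge0 s)
    qed
    show "f = 0" if f: "f \<in> hcarrier Rng" and 0: "hinner Rng f f = 0"
    proof -
      obtain x where x: "x \<in> Init" "f = Q x" using f by (rule rangeE)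
      thus ?thesis using 0 inner_definite[of x] by (simp add: hinner_range s linear_on_zero[OF Q_lin])
    qed
  qed
  interpret R: prehilbert Rng by fact
  show ?thesis
  proof
    fix F :: "nat \<Rightarrow> 'v" assume F: "\<And>n. F n \<in> hcarrier Rng"
      and C: "\<And>e. e > 0 \<Longrightarrow> \<exists>N. \<forall>m\<ge>N. \<forall>n\<ge>N. hnorm Rng (F m - F n) < e"
    have "\<exists>x. x \<in> Init \<and> F n = Q x" for n using rangeE[OF F[of n]] by blast
    then obtain X where X: "\<And>n. X n \<in> Init" "\<And>n. F n = Q (X n)" by metis
    have dI: "x - y \<in> Init" if "x \<in> Init" "y \<in> Init" for x y
      using that Init_sub by (rule_tac cvec.subspace_diff)
    have dist: "hnorm Rng (Q x - Q y) = hnorm H (x - y)" if "x \<in> Init" "y \<in> Init" for x y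
      using hnorm_range[OF dI[OF that]] that by (simp add: Q_diff Init_mem)
    have "\<exists>x\<in>hcarrier H. (\<lambda>n. hnorm H (X n - x)) \<longlonglongrightarrow> 0"
      using C X by (intro complete) (auto simp: dist Init_mem)
    then obtain x where x: "x \<in> hcarrier H" "(\<lambda>n. hnorm H (X n - x)) \<longlonglongrightarrow> 0" by blast
    have "\<exists>s\<in>Init. hnorm H (x - s) < e" if e: "e > 0" for e
    proof -
      obtain n where "hnorm H (X n - x) < e"
        using order_tendstoD(2)[OF x(2) e] by (auto simp: eventually_sequentially)
      thus ?thesis using X(1)[of n] hnorm_minus_commute[of "X n" x] x(1) by (auto simp: Init_mem)
    qed
    hence xI: "x \<in> Init" using Init_closed x(1) unfolding closed_subspace_def hclosure_def by blast
    have "hnorm Rng (F n - Q x) = hnorm H (X n - x)" for n using X xI by (simp add: dist)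
    thus "\<exists>f\<in>hcarrier Rng. (\<lambda>n. hnorm Rng (F n - f)) \<longlonglongrightarrow> 0"
      using x(2) range_Init[OF xI] by (intro bexI[of _ "Q x"]) auto
  qed
qed

text \<open>For \<open>f = Q x\<close> the vector on the right has preimage \<open>Q h\<close>, and
  \<open><x, Q h> = <f, h>\<close>. When \<open>Q\<close> squares to the identity minus
  \<open>T\<close> times its adjoint, this is the reproducing property extended from kernel
  functions to arbitrary \<open>h\<close>.\<close>

lemma range_inner_Q2:
  assumes "f \<in> hcarrier Rng" "h \<in> hcarrier H"
  shows "hinner Rng f (Q (Q h)) = hinner H f h" and "Q (Q h) \<in> hcarrier Rng"
proof -
  obtain x where x: "x \<in> Init" "f = Q x" using assms(1) by (rule rangeE)
  show "hinner Rng f (Q (Q h)) = hinner H f h" "Q (Q h) \<in> hcarrier Rng"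
    using x assms(2) Q_sa range_Init by (auto simp: hinner_range Q_Init selfadjoint_on_def Init_mem)
qed

lemma hnorm_range_Q2:
  assumes "h \<in> hcarrier H" shows "hnorm Rng (Q (Q h)) = hnorm H (Q h)"
  using assms by (simp add: hnorm_range Q_Init)

lemma range_carrier: "f \<in> hcarrier Rng \<Longrightarrow> f \<in> hcarrier H"
  by (auto simp: range_space_def Q_mem)

lemma range_bound:
  assumes "f \<in> hcarrier Rng" "h \<in> hcarrier H"
  shows "cmod (hinner H f h) \<le> hnorm Rng f * hnorm H (Q h)"
proof -
  obtain x where x: "x \<in> Init" "f = Q x" using assms(1) by (rule rangeE)
  have "hinner H f h = hinner H x (Q h)"
    using x assms(2) Q_sa by (auto simp: selfadjoint_on_def Init_mem)
  thus ?thesis using cauchy_schwarz[of x "Q h"] x assms(2) by (simp add: hnorm_range Init_mem Q_mem)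
qed

text \<open>The hypothesis says that \<open>Q h -> <h, f>\<close> is a bounded functional on the
  range of \<open>Q\<close>. Its Riesz vector \<open>y\<close> lies in the closure of that range,
  hence in \<open>Init\<close>, and satisfies \<open>f = Q y\<close> with norm at most
  \<open>K\<close>. With \<open>range_bound\<close> this is the dual description of the range
  norm.\<close>

lemma range_boundI:
  assumes f: "f \<in> hcarrier H" and K: "0 \<le> K"
    and bd: "\<And>h. h \<in> hcarrier H \<Longrightarrow> cmod (hinner H f h) \<le> K * hnorm H (Q h)"
  shows "f \<in> hcarrier Rng" "hnorm Rng f \<le> K"
proof -
  have sub: "cvec.subspace (hcarrier H)" by (intro cvec.subspaceI mem_intros)
  have bd': "cmod (hinner H h f) \<le> K * hnorm H (Q h)" if "h \<in> hcarrier H" for h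
    using bd[OF that] inner_commute[OF that f] by simp
  have "\<exists>y\<in>hclosure H (Q ` hcarrier H). (\<forall>h\<in>hcarrier H. hinner H h f = hinner H (Q h) y) \<and> hnorm H y \<le> K"
  proof (rule riesz_range[of "hcarrier H" Q "\<lambda>h. hinner H h f" K])
    fix y assume "y \<in> hclosure H (Q ` hcarrier H)" "\<And>h. h \<in> hcarrier H \<Longrightarrow> hinner H h f = hinner H (Q h) y"
      "hnorm H y \<le> K"
    thus ?thesis by blast
  qed (use sub bd' f K in \<open>simp_all add: linear_onD[OF Q_lin] inner_add_left inner_scale_left\<close>)
  then obtain y where y: "y \<in> hclosure H (Q ` hcarrier H)" "\<forall>h\<in>hcarrier H. hinner H h f = hinner H (Q h) y"
    "hnorm H y \<le> K" by blast
  have "y \<in> hclosure H Init" using y(1) Q_Init unfolding hclosure_def by blast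
  hence yI: "y \<in> Init" using Init_closed by (auto simp: closed_subspace_def)
  note yC = Init_mem[OF yI]
  have "hinner H h f = hinner H h (Q y)" if "h \<in> hcarrier H" for h
    using bspec[OF y(2) that] Q_sa that yC by (simp add: selfadjoint_on_def)
  hence fQ: "f = Q y" using f yC Q_mem by (intro inner_eqI) auto
  show "f \<in> hcarrier Rng" using fQ range_Init[OF yI] by simp
  show "hnorm Rng f \<le> K" using fQ hnorm_range[OF yI] y(3) by simp
qed

end

end

section \<open>Circle means\<close>

definition circ_mean :: "(complex \<Rightarrow> 'b::euclidean_space) \<Rightarrow> 'b" where
  "circ_mean g = (1 / (2 * pi)) *\<^sub>R (LINT t|lebesgue_on {0..2*pi}. g (cis t))"

abbreviation circle :: "real measure" where
  "circle \<equiv> lebesgue_on {0..2*pi}"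

interpretation circle: finite_measure circle
  by (rule finite_measureI) (simp add: emeasure_restrict_space)

lemma integrable_circle:
  fixes g :: "complex \<Rightarrow> 'b::euclidean_space"
  assumes "continuous_on (sphere 0 1) g"
  shows "integrable circle (\<lambda>t. g (cis t))"
  by (intro continuous_imp_integrable_real continuous_on_compose2[OF assms] continuous_intros) auto

lemma circ_mean_const [simp]: "circ_mean (\<lambda>_. c) = c"
  by (simp add: circ_mean_def measure_restrict_space)

lemma circ_mean_add:
  fixes f g :: "complex \<Rightarrow> 'b::euclidean_space"
  assumes "continuous_on (sphere 0 1) f" "continuous_on (sphere 0 1) g"
  shows "circ_mean (\<lambda>z. f z + g z) = circ_mean f + circ_mean g"
  using assms[THEN integrable_circle] by (simp add: circ_mean_def scaleR_add_right)

lemma circ_mean_diff: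
  fixes f g :: "complex \<Rightarrow> 'b::euclidean_space"
  assumes "continuous_on (sphere 0 1) f" "continuous_on (sphere 0 1) g"
  shows "circ_mean (\<lambda>z. f z - g z) = circ_mean f - circ_mean g"
  using assms[THEN integrable_circle] by (simp add: circ_mean_def scaleR_diff_right)

lemma circ_mean_sum:
  fixes f :: "'i \<Rightarrow> complex \<Rightarrow> 'b::euclidean_space"
  assumes "\<And>i. i \<in> I \<Longrightarrow> continuous_on (sphere 0 1) (f i)"
  shows "circ_mean (\<lambda>z. \<Sum>i\<in>I. f i z) = (\<Sum>i\<in>I. circ_mean (f i))"
  using assms[THEN integrable_circle] by (simp add: circ_mean_def scaleR_sum_right)

lemma circ_mean_cmult:
  fixes f :: "complex \<Rightarrow> complex"
  shows "circ_mean (\<lambda>z. c * f z) = c * circ_mean f"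
  by (simp add: circ_mean_def)

lemma circ_mean_rmult:
  fixes f :: "complex \<Rightarrow> real"
  shows "circ_mean (\<lambda>z. c * f z) = c * circ_mean f"
  by (simp add: circ_mean_def)

lemma circ_mean_of_real:
  fixes f :: "complex \<Rightarrow> real"
  shows "circ_mean (\<lambda>z. complex_of_real (f z)) = complex_of_real (circ_mean f)"
  by (simp add: circ_mean_def scaleR_conv_of_real)

lemma circ_mean_mono:
  fixes f g :: "complex \<Rightarrow> real"
  assumes "continuous_on (sphere 0 1) f" "continuous_on (sphere 0 1) g"
    and "\<And>z. cmod z = 1 \<Longrightarrow> f z \<le> g z"
  shows "circ_mean f \<le> circ_mean g"
  unfolding circ_mean_def using assms
  by (intro scaleR_left_mono integral_mono integrable_circle) auto

lemma circ_mean_norm_le: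
  fixes f :: "complex \<Rightarrow> 'b::euclidean_space"
  shows "norm (circ_mean f) \<le> circ_mean (\<lambda>z. norm (f z))"
  unfolding circ_mean_def by (simp add: divide_right_mono integral_norm_bound)

lemma circ_mean_lim:
  fixes f :: "nat \<Rightarrow> complex \<Rightarrow> 'b::euclidean_space"
  assumes cont: "\<And>n. continuous_on (sphere 0 1) (f n)"
    and lim: "\<And>z. cmod z = 1 \<Longrightarrow> (\<lambda>n. f n z) \<longlonglongrightarrow> g z"
    and bd: "\<And>n z. cmod z = 1 \<Longrightarrow> norm (f n z) \<le> C"
  shows "(\<lambda>n. circ_mean (f n)) \<longlonglongrightarrow> circ_mean g"
proof -
  have meas: "(\<lambda>t. f n (cis t)) \<in> borel_measurable circle" for n
    using integrable_circle[OF cont] by (rule borel_measurable_integrable)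
  have "(\<lambda>n. LINT t|circle. f n (cis t)) \<longlonglongrightarrow> (LINT t|circle. g (cis t))"
  proof (rule integral_dominated_convergence[where w = "\<lambda>_. C"])
    show "(\<lambda>t. g (cis t)) \<in> borel_measurable circle"
      by (rule borel_measurable_LIMSEQ_metric[OF meas]) (auto intro: lim)
  qed (use meas lim bd in auto)
  thus ?thesis unfolding circ_mean_def by (intro tendsto_scaleR tendsto_const)
qed

lemma circ_mean_cis:
  "circ_mean (\<lambda>z. z ^ m * cnj z ^ n) = (if m = n then 1 else 0)"
proof (cases "m = n")
  case True
  have "circ_mean (\<lambda>z. z ^ m * cnj z ^ n) = circ_mean (\<lambda>z. 1::complex)"
    unfolding circ_mean_def using True
    by (simp flip: power_mult_distrib complex_norm_square cis_cnj)
  thus ?thesis using True by simp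
next
  case False
  define k where "k = of_nat m - (of_nat n :: real)"
  have k: "k \<noteq> 0" using False by (simp add: k_def)
  have eq: "cis t ^ m * cnj (cis t) ^ n = cis (k * t)" for t
    by (simp only: cis_cnj Complex.DeMoivre cis_mult k_def) (simp add: algebra_simps)
  have "((\<lambda>t. cis (k * t)) has_integral (cis (k * (2 * pi)) / (\<i> * k) - cis (k * 0) / (\<i> * k))) {0..2*pi}"
    using k by (intro fundamental_theorem_of_calculus)
      (auto intro!: derivative_eq_intros simp: has_vector_derivative_def scaleR_conv_of_real field_simps)
  moreover have "cis (k * (2 * pi)) = 1"
  proof -
    have "k = of_int (int m - int n)" by (simp add: k_def)
    thus ?thesis using cis_multiple_2pi[of k] by (simp add: mult_ac)
  qed
  ultimately have "((\<lambda>t. cis (k * t)) has_integral 0) {0..2*pi}" by simp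
  hence "integral {0..2*pi} (\<lambda>t. cis (k * t)) = 0" by (rule integral_unique)
  moreover have "integrable circle (\<lambda>t. cis (k * t))"
    by (intro continuous_imp_integrable_real continuous_intros)
  ultimately have "(LINT t|circle. cis (k * t)) = 0"
    by (simp add: lebesgue_integral_eq_integral)
  thus ?thesis using False by (simp add: circ_mean_def eq)
qed

lemma continuous_on_cball_sphere:
  fixes f :: "complex \<Rightarrow> 'b::topological_space"
  assumes "continuous_on (cball 0 s) f" "0 \<le> s"
  shows "continuous_on (sphere 0 1) (\<lambda>z. f (of_real s * z))"
  using assms(2)
  by (intro continuous_on_compose2[OF assms(1)] continuous_intros) (auto simp: norm_mult)

lemma continuous_eval_vfps:
  fixes f :: "'d::complex_hilbert fps"
  assumes "summable (\<lambda>n. s ^ n * norm (fps_nth f n))"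
  shows "continuous_on (cball 0 s) (eval_vfps f)"
proof -
  have "uniform_limit (cball 0 s) (\<lambda>n z. \<Sum>i<n. z ^ i *\<^sub>C fps_nth f i) (eval_vfps f) sequentially"
    unfolding eval_vfps_def
  proof (rule Weierstrass_m_test[OF _ assms])
    fix n and z :: complex assume "z \<in> cball 0 s"
    thus "norm (z ^ n *\<^sub>C fps_nth f n) \<le> s ^ n * norm (fps_nth f n)"
      by (auto simp: norm_scaleC norm_power intro!: mult_right_mono power_mono)
  qed
  moreover have "continuous_on (cball 0 s) (\<lambda>z. \<Sum>i<n. z ^ i *\<^sub>C fps_nth f i)" for n
    by (intro continuous_on_sum scaleC.continuous_on continuous_intros)
  ultimately show ?thesis by (intro uniform_limit_theorem[where F = sequentially]) auto
qed

lemma norm_partial_sum_le: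
  fixes f :: "'d::complex_hilbert fps"
  assumes "summable (\<lambda>n. s ^ n * norm (fps_nth f n))" "cmod z \<le> s"
  shows "norm (\<Sum>i<n. z ^ i *\<^sub>C fps_nth f i) \<le> (\<Sum>n. s ^ n * norm (fps_nth f n))"
proof -
  have s: "s \<ge> 0" using assms(2) norm_ge_zero order_trans by blast
  have "norm (\<Sum>i<n. z ^ i *\<^sub>C fps_nth f i) \<le> (\<Sum>i<n. norm (z ^ i *\<^sub>C fps_nth f i))"
    by (rule norm_sum)
  also have "\<dots> \<le> (\<Sum>i<n. s ^ i * norm (fps_nth f i))"
    using assms(2) by (intro sum_mono) (auto simp: norm_scaleC norm_power intro!: mult_right_mono power_mono)
  also have "\<dots> \<le> (\<Sum>n. s ^ n * norm (fps_nth f n))"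
    using assms(1) s by (intro sum_le_suminf) auto
  finally show ?thesis .
qed

lemma partial_sum_tendsto:
  fixes f :: "'d::complex_hilbert fps"
  assumes "summable (\<lambda>n. s ^ n * norm (fps_nth f n))" "cmod z \<le> s"
  shows "(\<lambda>n. \<Sum>i<n. z ^ i *\<^sub>C fps_nth f i) \<longlonglongrightarrow> eval_vfps f z"
proof -
  have "summable (\<lambda>n. norm (z ^ n *\<^sub>C fps_nth f n))"
    by (rule summable_comparison_test'[OF assms(1)])
       (use assms(2) in \<open>auto simp: norm_scaleC norm_power intro!: mult_right_mono power_mono\<close>)
  from summable_LIMSEQ[OF summable_norm_cancel[OF this]] show ?thesis by (simp add: eval_vfps_def)
qed

lemma norm_eval_vfps_le:
  fixes f :: "'d::complex_hilbert fps"
  assumes "summable (\<lambda>n. s ^ n * norm (fps_nth f n))" "cmod z \<le> s"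
  shows "norm (eval_vfps f z) \<le> (\<Sum>n. s ^ n * norm (fps_nth f n))"
  using tendsto_norm[OF partial_sum_tendsto[OF assms]] norm_partial_sum_le[OF assms]
  by (intro LIMSEQ_le_const2) auto

lemma cinner_sum_left: "cinner (sum f I) y = (\<Sum>i\<in>I. cinner (f i) y)"
  by (rule cinner.sum_left)

lemma cinner_sum_right: "cinner x (sum f I) = (\<Sum>i\<in>I. cinner x (f i))"
  by (rule cinner.sum_right)

text \<open>Orthogonality of the monomials settles the partial sums; absolute summability at radius
  \<open>s\<close> supplies the constant that dominates them in the limit.\<close>

lemma parseval_sums:
  fixes f g :: "'d::complex_hilbert fps"
  assumes s: "0 \<le> s" and f: "summable (\<lambda>n. s ^ n * norm (fps_nth f n))"
    and g: "summable (\<lambda>n. s ^ n * norm (fps_nth g n))"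
  shows "(\<lambda>n. of_real (s ^ (2 * n)) * cinner (fps_nth f n) (fps_nth g n)) sums
    circ_mean (\<lambda>z. cinner (eval_vfps f (of_real s * z)) (eval_vfps g (of_real s * z)))"
proof -
  define F where "F = (\<lambda>N (z::complex). \<Sum>i<N. (of_real s * z) ^ i *\<^sub>C fps_nth f i)"
  define G where "G = (\<lambda>N (z::complex). \<Sum>i<N. (of_real s * z) ^ i *\<^sub>C fps_nth g i)"
  have z: "cmod (complex_of_real s * z) \<le> s" if "cmod z = 1" for z using that s by (simp add: norm_mult)
  have "(\<lambda>N. circ_mean (\<lambda>z. cinner (F N z) (G N z))) \<longlonglongrightarrow>
      circ_mean (\<lambda>z. cinner (eval_vfps f (of_real s * z)) (eval_vfps g (of_real s * z)))"
  proof (rule circ_mean_lim)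
    fix N show "continuous_on (sphere 0 1) (\<lambda>z. cinner (F N z) (G N z))"
      unfolding F_def G_def by (intro cinner.continuous_on continuous_on_sum scaleC.continuous_on continuous_intros)
    fix z assume z1: "cmod z = 1"
    show "norm (cinner (F N z) (G N z)) \<le> (\<Sum>n. s ^ n * norm (fps_nth f n)) * (\<Sum>n. s ^ n * norm (fps_nth g n))"
      unfolding F_def G_def using norm_partial_sum_le[OF f z[OF z1]] norm_partial_sum_le[OF g z[OF z1]]
      by (intro order_trans[OF cinner.cauchy_schwarz] mult_mono)
         (auto intro: order_trans[OF norm_ge_zero])
  next
    fix z assume z1: "cmod z = 1"
    show "(\<lambda>n. cinner (F n z) (G n z)) \<longlonglongrightarrow> cinner (eval_vfps f (of_real s * z)) (eval_vfps g (of_real s * z))"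
      unfolding F_def G_def
      by (intro cinner.tendsto partial_sum_tendsto[OF f z[OF z1]] partial_sum_tendsto[OF g z[OF z1]])
  qed
  moreover have "circ_mean (\<lambda>z. cinner (F N z) (G N z)) = (\<Sum>n<N. of_real (s ^ (2 * n)) * cinner (fps_nth f n) (fps_nth g n))" for N
  proof -
    have "circ_mean (\<lambda>z. cinner (F N z) (G N z)) =
      circ_mean (\<lambda>z. \<Sum>i<N. \<Sum>j<N. (of_real (s ^ (i + j)) * cinner (fps_nth f i) (fps_nth g j)) * (z ^ i * cnj z ^ j))"
      unfolding F_def G_def
      unfolding cinner_sum_left unfolding cinner_sum_right
      by (simp add: cinner_scaleC_left cinner.inner_scale_right power_add power_mult_distrib mult_ac)
    also have "\<dots> = (\<Sum>i<N. \<Sum>j<N. (of_real (s ^ (i + j)) * cinner (fps_nth f i) (fps_nth g j)) * (if i = j then 1 else 0))"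
      by (simp add: circ_mean_sum continuous_intros circ_mean_cmult circ_mean_cis)
    also have "\<dots> = (\<Sum>i<N. of_real (s ^ (2 * i)) * cinner (fps_nth f i) (fps_nth g i))"
      by (intro sum.cong refl) (simp add: mult_2 if_distrib cong: if_cong)
    finally show ?thesis .
  qed
  ultimately show ?thesis by (simp add: sums_def)
qed

lemma parseval_norm_sums:
  fixes f :: "'d::complex_hilbert fps"
  assumes s: "0 \<le> s" and f: "summable (\<lambda>n. s ^ n * norm (fps_nth f n))"
  shows "(\<lambda>n. s ^ (2 * n) * (norm (fps_nth f n))\<^sup>2) sums circ_mean (\<lambda>z. (norm (eval_vfps f (of_real s * z)))\<^sup>2)"
proof -
  have "(\<lambda>n. of_real (s ^ (2 * n) * (norm (fps_nth f n))\<^sup>2)) sums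
      complex_of_real (circ_mean (\<lambda>z. (norm (eval_vfps f (of_real s * z)))\<^sup>2))"
    using parseval_sums[OF s f f] unfolding cinner_self by (simp add: circ_mean_of_real flip: of_real_power)
  thus ?thesis by (simp only: sums_of_real_iff)
qed

lemma summable_fps_disc:
  fixes f :: "complex fps"
  assumes "fps_conv_radius f \<ge> 1" "0 \<le> s" "s < 1"
  shows "summable (\<lambda>n. s ^ n * norm (fps_nth f n))"
proof -
  have "norm (complex_of_real s) < fps_conv_radius f"
    using assms by (intro less_le_trans[OF _ assms(1)]) (simp add: one_ereal_def)
  from norm_summable_fps[OF this] show ?thesis using assms by (simp add: norm_mult norm_power mult.commute)
qed

text \<open>One sequence of radii serves all radial limits; the summand 2 keeps \<open>rad 0\<close>
  positive.\<close>

definition rad :: "nat \<Rightarrow> real" where "rad n = 1 - 1 / (real n + 2)"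

lemma rad_bounds: "0 < rad n" "rad n < 1" "0 \<le> rad n" "rad n \<le> 1"
  by (simp_all add: rad_def field_simps)

lemma rad_tendsto: "rad \<longlonglongrightarrow> 1"
proof -
  have "(\<lambda>n. 1 - inverse (real (Suc (Suc n)))) \<longlonglongrightarrow> 1 - 0"
    by (intro tendsto_diff tendsto_const LIMSEQ_Suc[OF LIMSEQ_inverse_real_of_nat])
  thus ?thesis by (simp add: rad_def[abs_def] divide_inverse add.commute)
qed

text \<open>A finite coefficient sum is the limit of damped sums, each dominated by a circle mean
  through Parseval. This is the route by which pointwise estimates in the disc become norm
  estimates.\<close>

lemma H2_circ_mean_boundI:
  fixes f :: "'d::complex_hilbert fps"
  assumes "\<And>s. 0 \<le> s \<Longrightarrow> s < 1 \<Longrightarrow> summable (\<lambda>n. s ^ n * norm (fps_nth f n))" "0 \<le> C"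
    and bd: "\<And>n. circ_mean (\<lambda>z. (norm (eval_vfps f (of_real (rad n) * z)))\<^sup>2) \<le> C\<^sup>2"
  shows "f \<in> hcarrier H2" "hnorm H2 f \<le> C"
proof -
  have "(\<Sum>k<M. (norm (fps_nth f k))\<^sup>2) \<le> C\<^sup>2" for M
  proof (rule LIMSEQ_le_const2)
    show "(\<lambda>n. \<Sum>k<M. rad n ^ (2 * k) * (norm (fps_nth f k))\<^sup>2) \<longlonglongrightarrow> (\<Sum>k<M. (norm (fps_nth f k))\<^sup>2)"
      by (auto intro!: tendsto_eq_intros rad_tendsto)
    have "(\<Sum>k<M. rad n ^ (2 * k) * (norm (fps_nth f k))\<^sup>2) \<le> C\<^sup>2" for n
    proof -
      have "(\<Sum>k<M. rad n ^ (2 * k) * (norm (fps_nth f k))\<^sup>2) \<le> (\<Sum>k. rad n ^ (2 * k) * (norm (fps_nth f k))\<^sup>2)"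
        using parseval_norm_sums[of "rad n" f] assms(1) rad_bounds[of n]
        by (intro sum_le_suminf) (auto simp: sums_iff)
      also have "\<dots> \<le> C\<^sup>2"
        using parseval_norm_sums[of "rad n" f] assms(1) rad_bounds[of n] bd[of n] by (auto simp: sums_iff)
      finally show ?thesis .
    qed
    thus "\<exists>N. \<forall>n\<ge>N. (\<Sum>k<M. rad n ^ (2 * k) * (norm (fps_nth f k))\<^sup>2) \<le> C\<^sup>2" by blast
  qed
  from H2_boundI[OF \<open>0 \<le> C\<close> this] show "f \<in> hcarrier H2" "hnorm H2 f \<le> C" by auto
qed

lemma circ_mean_le_hnorm_H2:
  fixes f :: "'d::complex_hilbert fps"
  assumes f: "f \<in> hcarrier H2" and s: "0 \<le> s" "s < 1"
  shows "circ_mean (\<lambda>z. (norm (eval_vfps f (of_real s * z)))\<^sup>2) \<le> (hnorm H2 f)\<^sup>2"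
proof (rule sums_le[OF _ parseval_norm_sums sums_H2[OF f]])
  show "s ^ (2 * n) * (norm (fps_nth f n))\<^sup>2 \<le> (norm (fps_nth f n))\<^sup>2" for n
    using s by (intro mult_left_le_one_le power_le_one) auto
qed (use s f in \<open>auto intro: summable_norm_H2\<close>)

definition dilate :: "real \<Rightarrow> 'd::complex_vector fps \<Rightarrow> 'd fps" where
  "dilate r f = Abs_fps (\<lambda>n. complex_of_real (r ^ n) *\<^sub>C fps_nth f n)"

lemma dilate_H2:
  fixes f :: "'d::complex_inner fps"
  assumes f: "f \<in> hcarrier H2" and r: "0 \<le> r" "r \<le> 1"
  shows "dilate r f \<in> hcarrier H2" "hnorm H2 (dilate r f) \<le> hnorm H2 f"
proof -
  have "(\<Sum>n<M. (norm (fps_nth (dilate r f) n))\<^sup>2) \<le> (hnorm H2 f)\<^sup>2" for M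
  proof -
    have "(\<Sum>n<M. (norm (fps_nth (dilate r f) n))\<^sup>2) \<le> (\<Sum>n<M. (norm (fps_nth f n))\<^sup>2)"
      using r by (intro sum_mono power_mono)
        (auto simp: dilate_def norm_scaleC norm_power intro!: mult_left_le_one_le power_le_one)
    also have "\<dots> \<le> (hnorm H2 f)\<^sup>2" using f by (intro sum_le_hnorm_H2) auto
    finally show ?thesis .
  qed
  from H2_boundI[OF H2.hnorm_ge0[OF f] this] show "dilate r f \<in> hcarrier H2" "hnorm H2 (dilate r f) \<le> hnorm H2 f"
    by auto
qed

text \<open>The mean over radius \<open>r\<close> is the inner product of
  \<open>dilate (r^2) f\<close> with \<open>g\<close>, since each factor contributes
  \<open>r^n\<close>. These dilations are contractive and converge coefficientwise, so
  \<open>H2_weak_limit\<close> applies.\<close>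

lemma circ_mean_cinner_tendsto:
  fixes f g :: "'d::complex_hilbert fps"
  assumes f: "f \<in> hcarrier H2" and g: "g \<in> hcarrier H2"
  shows "(\<lambda>k. circ_mean (\<lambda>z. cinner (eval_vfps f (of_real (rad k) * z)) (eval_vfps g (of_real (rad k) * z)))) \<longlonglongrightarrow> hinner H2 f g"
proof -
  have "(\<lambda>k. hinner H2 (dilate ((rad k)\<^sup>2) f) g) \<longlonglongrightarrow> hinner H2 f g"
  proof (rule H2_weak_limit(3)[OF _ _ _ g])
    have "0 \<le> (rad n)\<^sup>2 \<and> (rad n)\<^sup>2 \<le> 1" for n using rad_bounds[of n] by (simp add: power_le_one)
    thus "dilate ((rad n)\<^sup>2) f \<in> hcarrier H2" "hnorm H2 (dilate ((rad n)\<^sup>2) f) \<le> hnorm H2 f" for n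
      using dilate_H2[OF f] by auto
    fix k
    have "(\<lambda>n. complex_of_real (((rad n)\<^sup>2) ^ k) *\<^sub>C fps_nth f k) \<longlonglongrightarrow> complex_of_real ((1\<^sup>2) ^ k) *\<^sub>C fps_nth f k"
      by (intro scaleC.tendsto tendsto_intros rad_tendsto)
    thus "(\<lambda>n. fps_nth (dilate ((rad n)\<^sup>2) f) k) \<longlonglongrightarrow> fps_nth f k" by (simp add: dilate_def)
  qed
  moreover have "hinner H2 (dilate ((rad k)\<^sup>2) f) g =
      circ_mean (\<lambda>z. cinner (eval_vfps f (of_real (rad k) * z)) (eval_vfps g (of_real (rad k) * z)))" for k
  proof (rule sums_unique2)
    show "(\<lambda>n. of_real (rad k ^ (2 * n)) * cinner (fps_nth f n) (fps_nth g n)) sums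
        circ_mean (\<lambda>z. cinner (eval_vfps f (of_real (rad k) * z)) (eval_vfps g (of_real (rad k) * z)))"
      using rad_bounds[of k] f g by (intro parseval_sums summable_norm_H2) auto
    have "dilate ((rad k)\<^sup>2) f \<in> hcarrier H2" using rad_bounds[of k] by (intro dilate_H2 f) (auto simp: power_le_one)
    from summable_sums[OF summable_cinner[OF this g]]
    show "(\<lambda>n. of_real (rad k ^ (2 * n)) * cinner (fps_nth f n) (fps_nth g n)) sums hinner H2 (dilate ((rad k)\<^sup>2) f) g"
      by (simp add: hinner_H2 dilate_def cinner_scaleC_left power_mult)
  qed
  ultimately show ?thesis by simp
qed

lemma circ_mean_norm_tendsto:
  fixes f :: "'d::complex_hilbert fps"
  assumes f: "f \<in> hcarrier H2"
  shows "(\<lambda>k. circ_mean (\<lambda>z. (norm (eval_vfps f (of_real (rad k) * z)))\<^sup>2)) \<longlonglongrightarrow> (hnorm H2 f)\<^sup>2"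
proof -
  have "(\<lambda>k. Re (circ_mean (\<lambda>z. cinner (eval_vfps f (of_real (rad k) * z)) (eval_vfps f (of_real (rad k) * z))))) \<longlonglongrightarrow> Re (hinner H2 f f)"
    by (intro tendsto_Re circ_mean_cinner_tendsto f)
  thus ?thesis unfolding cinner_self circ_mean_of_real by (simp add: H2.hnorm_sq f)
qed

lemma continuous_eval_H2:
  fixes f :: "'d::complex_hilbert fps"
  assumes "f \<in> hcarrier H2" "0 \<le> s" "s < 1"
  shows "continuous_on (sphere 0 1) (\<lambda>z. eval_vfps f (of_real s * z))"
  using assms by (intro continuous_on_cball_sphere continuous_eval_vfps summable_norm_H2)

lemma fps_eqI_disc:
  fixes f g :: "complex fps"
  assumes "fps_conv_radius f \<ge> 1" "fps_conv_radius g \<ge> 1"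
    and "\<And>z. cmod z < 1 \<Longrightarrow> eval_fps f z = eval_fps g z"
  shows "f = g"
proof (rule eval_fps_eqD)
  show "fps_conv_radius f > 0" "fps_conv_radius g > 0"
    using assms(1,2) by (auto intro: less_le_trans[of 0 1])
  have "eventually (\<lambda>z::complex. z \<in> ball 0 1) (nhds 0)" by (rule eventually_nhds_in_open) auto
  thus "\<forall>\<^sub>F z in nhds 0. eval_fps f z = eval_fps g z" by eventually_elim (auto intro: assms(3))
qed

lemma fps_expansion_disc:
  assumes "F holomorphic_on ball 0 1"
  shows "fps_conv_radius (fps_expansion F 0) \<ge> 1"
    and "cmod z < 1 \<Longrightarrow> eval_fps (fps_expansion F 0) z = F z"
proof -
  have *: "F holomorphic_on eball 0 1" using assms by (simp add: one_ereal_def)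
  show "fps_conv_radius (fps_expansion F 0) \<ge> 1" by (rule conv_radius_fps_expansion[OF *])
  show "cmod z < 1 \<Longrightarrow> eval_fps (fps_expansion F 0) z = F z"
    using eval_fps_expansion'[OF *, of z] by (simp add: one_ereal_def)
qed

lemma eval_vfps_add:
  fixes f g :: "'d::complex_hilbert fps"
  assumes "f \<in> hcarrier H2" "g \<in> hcarrier H2" "cmod z < 1"
  shows "eval_vfps (f + g) z = eval_vfps f z + eval_vfps g z"
  using sums_add[OF eval_vfps_sums[OF assms(1,3)] eval_vfps_sums[OF assms(2,3)]]
    eval_vfps_sums[OF H2.add_mem[OF assms(1,2)] assms(3)]
  by (intro sums_unique2) (auto simp: scaleC_add_right)

lemma eval_vfps_scale:
  fixes f :: "'d::complex_hilbert fps"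
  assumes "f \<in> hcarrier H2" "cmod z < 1"
  shows "eval_vfps (c *\<^sub>C f) z = c *\<^sub>C eval_vfps f z"
proof -
  have "(\<lambda>n. c *\<^sub>C (z ^ n *\<^sub>C fps_nth f n)) sums (c *\<^sub>C eval_vfps f z)"
    by (intro bounded_linear.sums[OF scaleC.bounded_linear_right] eval_vfps_sums assms)
  with eval_vfps_sums[OF H2.scale_mem[OF assms(1)] assms(2), of c] show ?thesis
    by (intro sums_unique2) (auto simp: scaleC_scaleC mult.commute)
qed

section \<open>Multiplication by a Schur function\<close>

lemma schur_classD:
  assumes "B \<in> schur_class" "cmod z < 1"
  shows "B z (x + y) = B z x + B z y" "B z (c *\<^sub>C x) = c * B z x" "cmod (B z x) \<le> norm x"
proof -
  have lin: "Vector_Spaces.linear scaleC scaleC (B z)" and "\<forall>x. cmod (B z x) \<le> norm x"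
    using assms by (auto simp: schur_class_def)
  thus "cmod (B z x) \<le> norm x" by blast
  show "B z (x + y) = B z x + B z y" using lin by (rule Vector_Spaces.linear.axioms(3)[THEN module_hom.add])
  show "B z (c *\<^sub>C x) = c * B z x"
    using lin Vector_Spaces.linear.axioms(3)[THEN module_hom.scale, of scaleC scaleC "B z" c x] by simp
qed

lemma schur_class_bounded_linear:
  assumes "B \<in> schur_class" "cmod z < 1"
  shows "bounded_linear (B z)"
proof (rule bounded_linear_intro)
  fix x y r
  show "B z (x + y) = B z x + B z y" using schur_classD[OF assms] by blast
  show "B z (r *\<^sub>R x) = r *\<^sub>R B z x"
    using schur_classD(2)[OF assms, of "of_real r" x] by (simp add: scaleC_of_real scaleR_conv_of_real)
  show "norm (B z x) \<le> norm x * 1" using schur_classD[OF assms] by simp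
qed

lemma schur_class_holomorphic:
  "B \<in> schur_class \<Longrightarrow> (\<lambda>z. B z x) holomorphic_on ball 0 1"
  by (auto simp: schur_class_def)

text \<open>The function is locally the uniform limit of the sums of
  \<open>z ^ i * B z (fps_nth g i)\<close>; contractivity of \<open>B z\<close> makes the
  Weierstrass test uniform in \<open>z\<close>.\<close>

lemma holomorphic_toeplitz:
  fixes g :: "'d::complex_hilbert fps"
  assumes B: "B \<in> schur_class" and g: "g \<in> hcarrier H2"
  shows "(\<lambda>z. B z (eval_vfps g z)) holomorphic_on ball 0 1"
proof (rule holomorphic_uniform_sequence[where f = "\<lambda>N z. \<Sum>i<N. z ^ i * B z (fps_nth g i)"])
  show "(\<lambda>z. \<Sum>i<n. z ^ i * B z (fps_nth g i)) holomorphic_on ball 0 1" for n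
    by (intro holomorphic_intros schur_class_holomorphic B)
  fix w :: complex assume w: "w \<in> ball 0 1"
  define d where "d = (1 - cmod w) / 2"
  have d: "0 < d" "cmod w + d < 1" using w by (auto simp: d_def field_simps)
  have sub: "cmod z \<le> cmod w + d" if "z \<in> cball w d" for z
    using that norm_triangle_ineq[of w "z - w"] by (auto simp: dist_norm norm_minus_commute)
  have "uniform_limit (cball w d) (\<lambda>n z. \<Sum>i<n. z ^ i * B z (fps_nth g i)) (\<lambda>z. \<Sum>i. z ^ i * B z (fps_nth g i)) sequentially"
  proof (rule Weierstrass_m_test)
    show "summable (\<lambda>n. (cmod w + d) ^ n * norm (fps_nth g n))"
      using g d by (intro summable_norm_H2) auto
    fix n z assume z: "z \<in> cball w d"
    have "cmod (B z (fps_nth g n)) \<le> norm (fps_nth g n)"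
      using sub[OF z] d by (intro schur_classD[OF B]) simp
    thus "norm (z ^ n * B z (fps_nth g n)) \<le> (cmod w + d) ^ n * norm (fps_nth g n)"
      using sub[OF z] d by (auto simp: norm_mult norm_power intro!: mult_mono power_mono)
  qed
  moreover have "(\<Sum>i. z ^ i * B z (fps_nth g i)) = B z (eval_vfps g z)" if z: "z \<in> cball w d" for z
  proof -
    have z1: "cmod z < 1" using sub[OF z] d by simp
    interpret Bz: bounded_linear "B z" by (rule schur_class_bounded_linear[OF B z1])
    have "(\<lambda>i. B z (z ^ i *\<^sub>C fps_nth g i)) sums B z (eval_vfps g z)"
      by (intro Bz.sums eval_vfps_sums g z1)
    thus ?thesis by (simp add: schur_classD(2)[OF B z1] sums_iff)
  qed
  ultimately have "uniform_limit (cball w d) (\<lambda>n z. \<Sum>i<n. z ^ i * B z (fps_nth g i)) (\<lambda>z. B z (eval_vfps g z)) sequentially"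
    by (subst uniform_limit_cong'[where g = "\<lambda>n z. \<Sum>i<n. z ^ i * B z (fps_nth g i)"
          and i = "\<lambda>z. \<Sum>i. z ^ i * B z (fps_nth g i)"]) auto
  moreover have "cball w d \<subseteq> ball 0 1" using sub d by (force simp: )
  ultimately show "\<exists>d>0. cball w d \<subseteq> ball 0 1 \<and> uniform_limit (cball w d) (\<lambda>n z. \<Sum>i<n. z ^ i * B z (fps_nth g i))
      (\<lambda>z. B z (eval_vfps g z)) sequentially"
    using d by blast
qed auto

context
  fixes B :: "complex \<Rightarrow> 'd::complex_hilbert \<Rightarrow> complex"
  assumes B: "B \<in> schur_class"
begin

lemma eval_toeplitz:
  assumes "g \<in> hcarrier H2"
  shows "fps_conv_radius (toeplitz B g) \<ge> 1"
    and "cmod z < 1 \<Longrightarrow> eval_fps (toeplitz B g) z = B z (eval_vfps g z)"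
  unfolding toeplitz_def using fps_expansion_disc[OF holomorphic_toeplitz[OF B assms]] by auto

text \<open>\<open>B z\<close> is contractive at every point, so the estimate holds for the mean
  over every circle.\<close>

lemma toeplitz_H2:
  assumes g: "g \<in> hcarrier H2"
  shows "toeplitz B g \<in> hcarrier H2" "hnorm H2 (toeplitz B g) \<le> hnorm H2 g"
proof -
  have sm: "summable (\<lambda>n. s ^ n * norm (fps_nth (toeplitz B g) n))" if "0 \<le> s" "s < 1" for s
    using that by (intro summable_fps_disc eval_toeplitz g)
  have bd: "circ_mean (\<lambda>z. (norm (eval_vfps (toeplitz B g) (of_real (rad n) * z)))\<^sup>2) \<le> (hnorm H2 g)\<^sup>2" for n
  proof -
    have s: "0 \<le> rad n" "rad n < 1" using rad_bounds by auto
    have "circ_mean (\<lambda>z. (norm (eval_vfps (toeplitz B g) (of_real (rad n) * z)))\<^sup>2) \<le>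
        circ_mean (\<lambda>z. (norm (eval_vfps g (of_real (rad n) * z)))\<^sup>2)"
    proof (rule circ_mean_mono)
      show "continuous_on (sphere 0 1) (\<lambda>z. (norm (eval_vfps (toeplitz B g) (of_real (rad n) * z)))\<^sup>2)"
        using s by (intro continuous_intros continuous_on_cball_sphere continuous_eval_vfps sm)
      show "continuous_on (sphere 0 1) (\<lambda>z. (norm (eval_vfps g (of_real (rad n) * z)))\<^sup>2)"
        by (intro continuous_intros continuous_eval_H2 g s)
      fix z :: complex assume "cmod z = 1"
      hence "cmod (of_real (rad n) * z) < 1" using s by (simp add: norm_mult)
      thus "(norm (eval_vfps (toeplitz B g) (of_real (rad n) * z)))\<^sup>2 \<le> (norm (eval_vfps g (of_real (rad n) * z)))\<^sup>2"
        using schur_classD(3)[OF B] eval_toeplitz(2)[OF g]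
        by (intro power_mono) (auto simp: eval_vfps_complex)
    qed
    also have "\<dots> \<le> (hnorm H2 g)\<^sup>2" by (intro circ_mean_le_hnorm_H2 g s)
    finally show ?thesis .
  qed
  from H2_circ_mean_boundI[OF sm H2.hnorm_ge0[OF g] bd]
  show "toeplitz B g \<in> hcarrier H2" "hnorm H2 (toeplitz B g) \<le> hnorm H2 g" by auto
qed

lemma toeplitz_add:
  assumes "f \<in> hcarrier H2" "g \<in> hcarrier H2"
  shows "toeplitz B (f + g) = toeplitz B f + toeplitz B g"
proof (rule fps_eqI_disc)
  show "fps_conv_radius (toeplitz B (f + g)) \<ge> 1" by (intro eval_toeplitz H2.add_mem assms)
  show "fps_conv_radius (toeplitz B f + toeplitz B g) \<ge> 1"
    by (intro fps_conv_radius_H2 H2.add_mem toeplitz_H2 assms)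
  fix z :: complex assume z: "cmod z < 1"
  have "cmod z < fps_conv_radius (toeplitz B h)" if "h \<in> hcarrier H2" for h
    using z by (intro less_le_trans[OF _ eval_toeplitz(1)[OF that]]) (simp add: one_ereal_def)
  thus "eval_fps (toeplitz B (f + g)) z = eval_fps (toeplitz B f + toeplitz B g) z"
    using z assms by (simp add: eval_toeplitz H2.add_mem eval_fps_add eval_vfps_add schur_classD[OF B])
qed

lemma toeplitz_scale:
  assumes "f \<in> hcarrier H2"
  shows "toeplitz B (c *\<^sub>C f) = c *\<^sub>C toeplitz B f"
proof (rule fps_eqI_disc)
  show "fps_conv_radius (toeplitz B (c *\<^sub>C f)) \<ge> 1" by (intro eval_toeplitz H2.scale_mem assms)
  show "fps_conv_radius (c *\<^sub>C toeplitz B f) \<ge> 1"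
    by (intro fps_conv_radius_H2 H2.scale_mem toeplitz_H2 assms)
  fix z :: complex assume z: "cmod z < 1"
  show "eval_fps (toeplitz B (c *\<^sub>C f)) z = eval_fps (c *\<^sub>C toeplitz B f) z"
    using z assms eval_vfps_scale[OF toeplitz_H2(1)[OF assms] z, of c]
    by (simp add: eval_toeplitz H2.scale_mem eval_vfps_scale schur_classD[OF B] eval_vfps_complex)
qed

lemma bounded_op_toeplitz: "bounded_op H2 H2 (toeplitz B)"
  unfolding bounded_op_def
  by (intro conjI ballI allI toeplitz_add toeplitz_scale exI[of _ 1])
     (auto simp: toeplitz_H2)

end

section \<open>The space of a Schur function\<close>

text \<open>Multiplication by \<open>z^k\<close>, written on coefficients so that it makes sense for
  vector-valued series.\<close>

definition upshift :: "nat \<Rightarrow> 'd::zero fps \<Rightarrow> 'd fps" where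
  "upshift k f = Abs_fps (\<lambda>n. if n < k then 0 else fps_nth f (n - k))"

lemma fps_nth_upshift [simp]: "fps_nth (upshift k f) n = (if n < k then 0 else fps_nth f (n - k))"
  by (simp add: upshift_def)

lemma upshift_complex: "upshift k f = fps_X ^ k * (f::complex fps)"
  by (simp add: fps_eq_iff fps_X_power_mult_nth)

lemma sums_upshift:
  fixes f :: "'d::complex_inner fps"
  assumes "f \<in> hcarrier H2"
  shows "(\<lambda>n. (norm (fps_nth (upshift k f) n))\<^sup>2) sums (hnorm H2 f)\<^sup>2"
proof -
  have "(\<lambda>n. (norm (fps_nth (upshift k f) (n + k)))\<^sup>2) sums (hnorm H2 f)\<^sup>2"
    using sums_H2[OF assms] by simp
  from sums_iff_shift[THEN iffD1, OF this] show ?thesis by simp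
qed

lemma upshift_H2:
  fixes f :: "'d::complex_inner fps"
  assumes "f \<in> hcarrier H2"
  shows "upshift k f \<in> hcarrier H2" "hnorm H2 (upshift k f) = hnorm H2 f"
proof -
  show *: "upshift k f \<in> hcarrier H2" using sums_upshift[OF assms] by (simp add: mem_H2_iff sums_iff)
  have "(hnorm H2 (upshift k f))\<^sup>2 = (hnorm H2 f)\<^sup>2"
    using sums_unique2[OF sums_H2[OF *] sums_upshift[OF assms]] .
  thus "hnorm H2 (upshift k f) = hnorm H2 f" by (rule power2_eq_imp_eq) (use * assms in \<open>auto simp: H2.hnorm_ge0\<close>)
qed

lemma fps_X_power_H2:
  assumes "f \<in> hcarrier H2"
  shows "fps_X ^ k * f \<in> hcarrier H2" "hnorm H2 (fps_X ^ k * f) = hnorm H2 (f :: complex fps)"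
  using upshift_H2[OF assms, of k] by (simp_all add: upshift_complex)

lemma shift_H2:
  fixes f :: "'d::complex_inner fps"
  assumes f: "f \<in> hcarrier H2"
  shows "fps_shift k f \<in> hcarrier H2"
    and "(hnorm H2 f)\<^sup>2 = (\<Sum>n<k. (norm (fps_nth f n))\<^sup>2) + (hnorm H2 (fps_shift k f))\<^sup>2"
    and "hnorm H2 (fps_shift k f) \<le> hnorm H2 f"
proof -
  have s: "(\<lambda>n. (norm (fps_nth (fps_shift k f) n))\<^sup>2) sums ((hnorm H2 f)\<^sup>2 - (\<Sum>n<k. (norm (fps_nth f n))\<^sup>2))"
    using sums_split_initial_segment[OF sums_H2[OF f], of k] by simp
  thus *: "fps_shift k f \<in> hcarrier H2" by (simp add: mem_H2_iff sums_iff)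
  show eq: "(hnorm H2 f)\<^sup>2 = (\<Sum>n<k. (norm (fps_nth f n))\<^sup>2) + (hnorm H2 (fps_shift k f))\<^sup>2"
    using sums_unique2[OF sums_H2[OF *] s] by simp
  have "(hnorm H2 (fps_shift k f))\<^sup>2 \<le> (hnorm H2 f)\<^sup>2" unfolding eq by (simp add: sum_nonneg)
  thus "hnorm H2 (fps_shift k f) \<le> hnorm H2 f" using H2.hnorm_ge0[OF f] by (rule power2_le_imp_le)
qed

lemma hinner_upshift:
  fixes f g :: "'d::complex_inner fps"
  assumes f: "f \<in> hcarrier H2" and g: "g \<in> hcarrier H2"
  shows "hinner H2 (upshift k f) g = hinner H2 f (fps_shift k g)"
proof -
  have "(\<lambda>n. cinner (fps_nth (upshift k f) (n + k)) (fps_nth g (n + k))) sums hinner H2 f (fps_shift k g)"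
    using summable_sums[OF summable_cinner[OF f shift_H2(1)[OF g, of k]]] by (simp add: hinner_H2)
  from sums_iff_shift[THEN iffD1, OF this]
  have "(\<lambda>n. cinner (fps_nth (upshift k f) n) (fps_nth g n)) sums hinner H2 f (fps_shift k g)" by simp
  thus ?thesis by (simp add: hinner_H2 sums_iff)
qed

lemma eval_upshift:
  fixes f :: "'d::complex_hilbert fps"
  assumes f: "f \<in> hcarrier H2" and z: "cmod z < 1"
  shows "eval_vfps (upshift k f) z = z ^ k *\<^sub>C eval_vfps f z"
proof -
  have "(\<lambda>n. z ^ k *\<^sub>C (z ^ n *\<^sub>C fps_nth f n)) sums (z ^ k *\<^sub>C eval_vfps f z)"
    by (intro bounded_linear.sums[OF scaleC.bounded_linear_right] eval_vfps_sums assms)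
  hence "(\<lambda>n. z ^ (n + k) *\<^sub>C fps_nth (upshift k f) (n + k)) sums (z ^ k *\<^sub>C eval_vfps f z)"
    by (simp add: scaleC_scaleC power_add mult.commute)
  from sums_iff_shift[THEN iffD1, OF this]
  have "(\<lambda>n. z ^ n *\<^sub>C fps_nth (upshift k f) n) sums (z ^ k *\<^sub>C eval_vfps f z)" by simp
  thus ?thesis using eval_vfps_sums[OF upshift_H2(1)[OF f] z] sums_unique2 by blast
qed

lemma conv_radius_gt: "fps_conv_radius f \<ge> 1 \<Longrightarrow> cmod z < 1 \<Longrightarrow> cmod z < fps_conv_radius (f::complex fps)"
  by (rule less_le_trans[of _ 1]) (auto simp: one_ereal_def)

lemma one_H2: "(1::complex fps) \<in> hcarrier H2"
  unfolding mem_H2_iff by (rule summable_finite[of "{0}"]) auto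

lemma hinner_one: "hinner H2 1 h = cnj (fps_nth (h::complex fps) 0)"
  unfolding hinner_H2 by (subst suminf_finite[of "{0}"]) auto

lemma hnorm_H2_one: "hnorm H2 (1 :: complex fps) = 1"
  by (simp add: hnorm_def hinner_one)

lemma H2_mult_bounded:
  fixes f F :: "complex fps"
  assumes f: "f \<in> hcarrier H2" and F: "fps_conv_radius F \<ge> 1"
    and M: "\<And>z. cmod z < 1 \<Longrightarrow> cmod (eval_fps F z) \<le> M"
  shows "F * f \<in> hcarrier H2" "hnorm H2 (F * f) \<le> M * hnorm H2 f"
proof -
  have M0: "M \<ge> 0" using order_trans[OF norm_ge_zero M[of 0]] by simp
  have r: "fps_conv_radius (F * f) \<ge> 1"
    by (rule fps_conv_radius_mult_ge[OF F fps_conv_radius_H2[OF f]])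
  have sm: "summable (\<lambda>n. s ^ n * norm (fps_nth (F * f) n))" if "0 \<le> s" "s < 1" for s
    using that by (intro summable_fps_disc r)
  have bd: "circ_mean (\<lambda>z. (norm (eval_vfps (F * f) (of_real (rad n) * z)))\<^sup>2) \<le> (M * hnorm H2 f)\<^sup>2" for n
  proof -
    have s: "0 \<le> rad n" "rad n < 1" using rad_bounds by auto
    have "circ_mean (\<lambda>z. (norm (eval_vfps (F * f) (of_real (rad n) * z)))\<^sup>2) \<le>
        circ_mean (\<lambda>z. M\<^sup>2 * (norm (eval_vfps f (of_real (rad n) * z)))\<^sup>2)"
    proof (rule circ_mean_mono)
      show "continuous_on (sphere 0 1) (\<lambda>z. (norm (eval_vfps (F * f) (of_real (rad n) * z)))\<^sup>2)"
        using s by (intro continuous_intros continuous_on_cball_sphere continuous_eval_vfps sm)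
      show "continuous_on (sphere 0 1) (\<lambda>z. M\<^sup>2 * (norm (eval_vfps f (of_real (rad n) * z)))\<^sup>2)"
        by (intro continuous_intros continuous_eval_H2 f s)
      fix z :: complex assume "cmod z = 1"
      hence w: "cmod (of_real (rad n) * z) < 1" using s by (simp add: norm_mult)
      have "norm (eval_vfps (F * f) (of_real (rad n) * z)) \<le> M * norm (eval_vfps f (of_real (rad n) * z))"
        unfolding eval_vfps_complex eval_fps_mult[OF conv_radius_gt[OF F w] conv_radius_gt[OF fps_conv_radius_H2[OF f] w]]
          norm_mult[of "eval_fps F _"] by (intro mult_right_mono M w) auto
      from power_mono[OF this, of 2]
      show "(norm (eval_vfps (F * f) (of_real (rad n) * z)))\<^sup>2 \<le> M\<^sup>2 * (norm (eval_vfps f (of_real (rad n) * z)))\<^sup>2"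
        by (simp add: power_mult_distrib)
    qed
    also have "\<dots> \<le> M\<^sup>2 * (hnorm H2 f)\<^sup>2"
      unfolding circ_mean_rmult by (intro mult_left_mono circ_mean_le_hnorm_H2 f s) auto
    finally show ?thesis by (simp add: power_mult_distrib)
  qed
  have "0 \<le> M * hnorm H2 f" using M0 H2.hnorm_ge0[OF f] by simp
  from H2_circ_mean_boundI[OF sm this bd]
  show "F * f \<in> hcarrier H2" "hnorm H2 (F * f) \<le> M * hnorm H2 f" by auto
qed

definition toeplitz_adj :: "(complex \<Rightarrow> 'd::complex_inner \<Rightarrow> complex) \<Rightarrow> complex fps \<Rightarrow> 'd fps" where
  "toeplitz_adj B = adj H2 H2 (toeplitz B)"

section \<open>The space H(B) through the quadratic form of its defect operator\<close>

locale schur =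
  fixes B :: "complex \<Rightarrow> 'd::complex_hilbert \<Rightarrow> complex"
  assumes B: "B \<in> schur_class"
begin

abbreviation HB where "HB \<equiv> dBR B"
abbreviation T where "T \<equiv> toeplitz B"
abbreviation Ts where "Ts \<equiv> toeplitz_adj B"

lemmas T_mem = toeplitz_H2(1)[OF B] and T_norm = toeplitz_H2(2)[OF B]
lemmas T_add = toeplitz_add[OF B] and T_scale = toeplitz_scale[OF B]

lemma Ts_mem: "y \<in> hcarrier H2 \<Longrightarrow> Ts y \<in> hcarrier H2"
  unfolding toeplitz_adj_def
  by (rule adj_exists(1)[OF hilbert_H2 H2.prehilbert_axioms bounded_op_toeplitz[OF B]])

lemma Ts_adj: "u \<in> hcarrier H2 \<Longrightarrow> y \<in> hcarrier H2 \<Longrightarrow> hinner H2 (T u) y = hinner H2 u (Ts y)"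
  unfolding toeplitz_adj_def
  by (rule adj_exists(2)[OF hilbert_H2 H2.prehilbert_axioms bounded_op_toeplitz[OF B]])

lemma Ts_add: "x \<in> hcarrier H2 \<Longrightarrow> y \<in> hcarrier H2 \<Longrightarrow> Ts (x + y) = Ts x + Ts y"
  by (rule H2.inner_eqI)
     (auto simp: Ts_mem H2.add_mem H2.inner_add_right T_mem simp flip: Ts_adj)

lemma Ts_scale: "x \<in> hcarrier H2 \<Longrightarrow> Ts (c *\<^sub>C x) = c *\<^sub>C Ts x"
  by (rule H2.inner_eqI)
     (auto simp: Ts_mem H2.scale_mem H2.inner_scale_right T_mem simp flip: Ts_adj)

lemma Ts_norm: assumes y: "y \<in> hcarrier H2" shows "hnorm H2 (Ts y) \<le> hnorm H2 y"
proof -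
  have "(hnorm H2 (Ts y))\<^sup>2 = cmod (hinner H2 (T (Ts y)) y)"
    using y by (simp add: Ts_adj Ts_mem H2.inner_self norm_power)
  also have "\<dots> \<le> hnorm H2 (T (Ts y)) * hnorm H2 y"
    using y by (intro H2.cauchy_schwarz T_mem Ts_mem)
  also have "\<dots> \<le> hnorm H2 (Ts y) * hnorm H2 y"
    using y by (intro mult_right_mono T_norm Ts_mem H2.hnorm_ge0)
  finally show ?thesis using H2.hnorm_ge0[OF Ts_mem[OF y]] H2.hnorm_ge0[OF y]
    by (cases "hnorm H2 (Ts y) = 0") (auto simp: power2_eq_square)
qed

lemma TTs: "linear_on H2 (\<lambda>f. T (Ts f))" "selfadjoint_on H2 (\<lambda>f. T (Ts f))"
  "x \<in> hcarrier H2 \<Longrightarrow> hnorm H2 (T (Ts x)) \<le> hnorm H2 x"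
proof -
  show "linear_on H2 (\<lambda>f. T (Ts f))"
    by (auto simp: linear_on_def T_mem Ts_mem Ts_add Ts_scale T_add T_scale)
  show "selfadjoint_on H2 (\<lambda>f. T (Ts f))"
    unfolding selfadjoint_on_def
  proof (intro ballI)
    fix x y :: "complex fps" assume xy: "x \<in> hcarrier H2" "y \<in> hcarrier H2"
    have "hinner H2 x (T (Ts y)) = cnj (hinner H2 (T (Ts y)) x)"
      using xy by (intro H2.inner_commute T_mem Ts_mem)
    also have "\<dots> = cnj (hinner H2 (Ts y) (Ts x))" using xy by (simp add: Ts_adj Ts_mem)
    also have "\<dots> = hinner H2 (Ts x) (Ts y)" using xy H2.inner_commute[of "Ts x" "Ts y"] by (simp add: Ts_mem)
    finally show "hinner H2 (T (Ts x)) y = hinner H2 x (T (Ts y))" using xy by (simp add: Ts_adj Ts_mem)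
  qed
  show "hnorm H2 (T (Ts x)) \<le> hnorm H2 x" if "x \<in> hcarrier H2"
    by (rule order_trans[OF T_norm[OF Ts_mem[OF that]] Ts_norm[OF that]])
qed

definition defect :: "complex fps \<Rightarrow> complex fps" where "defect h = h - T (Ts h)"
definition N :: "complex fps \<Rightarrow> real" where "N h = (hnorm H2 h)\<^sup>2 - (hnorm H2 (Ts h))\<^sup>2"
definition Q :: "complex fps \<Rightarrow> complex fps" where "Q = sqrt_op H2 (\<lambda>f. f - T (Ts f))"

lemma dBR_eq: "dBR B = range_space H2 Q"
  by (simp add: dBR_def Q_def toeplitz_adj_def)

lemma Q_bdd: "bounded_op H2 H2 Q" and Q_sa: "selfadjoint_on H2 Q"
  and QQ: "h \<in> hcarrier H2 \<Longrightarrow> Q (Q h) = defect h"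
  unfolding Q_def defect_def
  using hilbert.sqrt_op_properties[OF hilbert_H2 TTs, of "\<lambda>f. f - T (Ts f)"] by auto

lemma defect_mem: "h \<in> hcarrier H2 \<Longrightarrow> defect h \<in> hcarrier H2"
  by (simp add: defect_def H2.diff_mem T_mem Ts_mem)

lemma N_eq: "h \<in> hcarrier H2 \<Longrightarrow> hinner H2 (defect h) h = of_real (N h)"
  by (simp add: defect_def N_def H2.inner_diff_left T_mem Ts_mem Ts_adj H2.inner_self)

lemma hnorm_Q: assumes h: "h \<in> hcarrier H2" shows "hnorm H2 (Q h) = sqrt (N h)"
proof -
  have Qh: "Q h \<in> hcarrier H2" using Q_bdd h by (auto simp: bounded_op_def)
  have "hinner H2 (Q h) (Q h) = hinner H2 (Q (Q h)) h"
    using Q_sa h Qh by (auto simp: selfadjoint_on_def)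
  hence "(hnorm H2 (Q h))\<^sup>2 = N h"
    using QQ[OF h] N_eq[OF h] H2.hnorm_sq[OF Qh] by simp
  thus ?thesis using H2.hnorm_ge0[OF Qh] by (simp add: real_sqrt_unique[symmetric])
qed

lemma N_ge0: "h \<in> hcarrier H2 \<Longrightarrow> 0 \<le> N h"
  using Ts_norm[of h] H2.hnorm_ge0[OF Ts_mem[of h]] by (simp add: N_def power_mono)

lemma hilbert_dBR: "hilbert HB"
  unfolding dBR_eq by (rule hilbert.hilbert_range[OF hilbert_H2 Q_bdd Q_sa])

sublocale dBR: hilbert "dBR B" by (rule hilbert_dBR)

lemma dBR_H2: "f \<in> hcarrier HB \<Longrightarrow> f \<in> hcarrier H2"
  unfolding dBR_eq by (rule hilbert.range_carrier[OF hilbert_H2 Q_bdd Q_sa])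

lemma dBR_bound:
  "f \<in> hcarrier HB \<Longrightarrow> h \<in> hcarrier H2 \<Longrightarrow> cmod (hinner H2 f h) \<le> hnorm HB f * sqrt (N h)"
  using hilbert.range_bound[OF hilbert_H2 Q_bdd Q_sa] unfolding dBR_eq by (simp add: hnorm_Q)

lemma dBR_boundI:
  assumes "f \<in> hcarrier H2" "0 \<le> K"
    and "\<And>h. h \<in> hcarrier H2 \<Longrightarrow> cmod (hinner H2 f h) \<le> K * sqrt (N h)"
  shows "f \<in> hcarrier HB" "hnorm HB f \<le> K"
  using hilbert.range_boundI[OF hilbert_H2 Q_bdd Q_sa assms(1,2)] assms(3) unfolding dBR_eq
  by (simp_all add: hnorm_Q)

text \<open>These vectors take over the role of kernel functions: for \<open>h\<close> a Szego
  kernel, \<open>defect h\<close> is the reproducing kernel of \<open>HB\<close>.\<close>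

lemma dBR_defect:
  assumes h: "h \<in> hcarrier H2"
  shows "defect h \<in> hcarrier HB" "hnorm HB (defect h) = sqrt (N h)"
    and "f \<in> hcarrier HB \<Longrightarrow> hinner HB f (defect h) = hinner H2 f h"
proof -
  have "(0::complex fps) \<in> hcarrier HB" by (rule dBR.zero_mem)
  thus "defect h \<in> hcarrier HB" "hnorm HB (defect h) = sqrt (N h)"
    "f \<in> hcarrier HB \<Longrightarrow> hinner HB f (defect h) = hinner H2 f h"
    using hilbert.range_inner_Q2[OF hilbert_H2 Q_bdd Q_sa _ h]
      hilbert.hnorm_range_Q2[OF hilbert_H2 Q_bdd Q_sa h]
    unfolding dBR_eq by (auto simp: QQ h hnorm_Q)
qed

lemma hnorm_le_dBR:
  assumes f: "f \<in> hcarrier HB"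
  shows "hnorm H2 f \<le> hnorm HB f"
proof -
  have fH: "f \<in> hcarrier H2" using f by (rule dBR_H2)
  have "(hnorm H2 f)\<^sup>2 = cmod (hinner H2 f f)" using fH by (simp add: H2.inner_self norm_power)
  also have "\<dots> \<le> hnorm HB f * sqrt (N f)" by (rule dBR_bound[OF f fH])
  also have "\<dots> \<le> hnorm HB f * hnorm H2 f"
    using fH by (intro mult_left_mono dBR.hnorm_ge0 f real_le_lsqrt) (auto simp: N_def H2.hnorm_ge0)
  finally show ?thesis using H2.hnorm_ge0[OF fH] dBR.hnorm_ge0[OF f]
    by (cases "hnorm H2 f = 0") (auto simp: power2_eq_square)
qed

lemma subspace_defect: "cvec.subspace (defect ` hcarrier H2)"
proof (rule cvec.subspaceI)
  have add: "defect x + defect y = defect (x + y)" if "x \<in> hcarrier H2" "y \<in> hcarrier H2" for x y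
    using that by (simp add: defect_def Ts_add T_add Ts_mem algebra_simps)
  have scale: "c *\<^sub>C defect x = defect (c *\<^sub>C x)" if "x \<in> hcarrier H2" for x c
    using that by (simp add: defect_def Ts_scale T_scale Ts_mem cvec.scale_right_diff_distrib)
  show "0 \<in> defect ` hcarrier H2" using scale[OF H2.zero_mem, of 0] H2.zero_mem by force
  show "x + y \<in> defect ` hcarrier H2" if "x \<in> defect ` hcarrier H2" "y \<in> defect ` hcarrier H2" for x y
    using that by (auto simp: add H2.add_mem)
  show "c *\<^sub>C x \<in> defect ` hcarrier H2" if "x \<in> defect ` hcarrier H2" for c x
    using that by (auto simp: scale H2.scale_mem)
qed

text \<open>A vector \<open>g\<close> orthogonal to all of them is orthogonal to
  \<open>defect g\<close>, and that inner product is the square of its Hardy norm.\<close>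

lemma dense_defect: "hclosure HB (defect ` hcarrier H2) = hcarrier HB"
proof (rule dBR.dense_if_orthogonal_trivial)
  show "defect ` hcarrier H2 \<subseteq> hcarrier HB" using dBR_defect by auto
  fix g assume g: "g \<in> hcarrier HB" and 0: "\<And>v. v \<in> defect ` hcarrier H2 \<Longrightarrow> hinner HB g v = 0"
  have "hinner H2 g g = hinner HB g (defect g)" using g by (simp add: dBR_defect dBR_H2)
  also have "\<dots> = 0" using g by (intro 0) (auto simp: dBR_H2)
  finally show "g = 0" by (rule H2.inner_definite[OF dBR_H2[OF g]])
qed (rule subspace_defect)

lemma defect_approx:
  assumes "f \<in> hcarrier HB"
  obtains x where "\<And>n. x n \<in> hcarrier H2" "(\<lambda>n. hnorm HB (defect (x n) - f)) \<longlonglongrightarrow> 0"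
proof -
  have f: "f \<in> hclosure HB (defect ` hcarrier H2)" using assms by (simp add: dense_defect)
  have "\<forall>n. \<exists>x. x \<in> hcarrier H2 \<and> hnorm HB (f - defect x) < inverse (real (Suc n))"
  proof
    fix n
    have "\<exists>s\<in>defect ` hcarrier H2. hnorm HB (f - s) < inverse (real (Suc n))"
      using f by (simp add: hclosure_def del: of_nat_Suc)
    thus "\<exists>x. x \<in> hcarrier H2 \<and> hnorm HB (f - defect x) < inverse (real (Suc n))" by blast
  qed
  from choice[OF this] obtain x where x: "\<And>n. x n \<in> hcarrier H2"
    "\<And>n. hnorm HB (f - defect (x n)) < inverse (real (Suc n))" by blast
  have "(\<lambda>n. hnorm HB (defect (x n) - f)) \<longlonglongrightarrow> 0"
  proof (rule Lim_null_comparison[OF _ LIMSEQ_inverse_real_of_nat])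
    show "\<forall>\<^sub>F n in sequentially. norm (hnorm HB (defect (x n) - f)) \<le> inverse (real (Suc n))"
      using x assms dBR.hnorm_minus_commute[OF dBR_defect(1)[OF x(1)] assms] less_imp_le[OF x(2)]
      by (intro always_eventually allI) (auto simp: dBR.hnorm_ge0 dBR.diff_mem dBR_defect)
  qed
  thus thesis using that x by blast
qed

lemma T_upshift: assumes g: "g \<in> hcarrier H2" shows "T (upshift k g) = fps_X ^ k * T g"
proof (rule fps_eqI_disc)
  show "fps_conv_radius (T (upshift k g)) \<ge> 1" by (intro eval_toeplitz[OF B] upshift_H2 g)
  show "fps_conv_radius (fps_X ^ k * T g) \<ge> 1"
    by (intro fps_conv_radius_H2 fps_X_power_H2 T_mem g)
  fix z :: complex assume z: "cmod z < 1"
  have "eval_fps (fps_X ^ k * T g) z = z ^ k * eval_fps (T g) z"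
    using z by (subst eval_fps_mult) (auto intro!: conv_radius_gt eval_toeplitz(1)[OF B g])
  thus "eval_fps (T (upshift k g)) z = eval_fps (fps_X ^ k * T g) z"
    using z g by (simp add: eval_toeplitz[OF B] upshift_H2 eval_upshift schur_classD[OF B])
qed

text \<open>Adjoint form of \<open>T_upshift\<close>: multiplication by \<open>z^k\<close> has the
  backward shift as its adjoint.\<close>

lemma Ts_shift: assumes h: "h \<in> hcarrier H2" shows "Ts (fps_shift k h) = fps_shift k (Ts h)"
proof (rule H2.inner_eqI)
  fix u :: "'d fps" assume u: "u \<in> hcarrier H2"
  have "hinner H2 u (Ts (fps_shift k h)) = hinner H2 (T u) (fps_shift k h)"
    using u h by (simp add: Ts_adj shift_H2)
  also have "\<dots> = hinner H2 (T (upshift k u)) h"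
    using u h by (simp add: T_upshift hinner_upshift[symmetric] T_mem upshift_complex)
  also have "\<dots> = hinner H2 u (fps_shift k (Ts h))"
    using u h by (simp add: Ts_adj upshift_H2 hinner_upshift Ts_mem)
  finally show "hinner H2 u (Ts (fps_shift k h)) = hinner H2 u (fps_shift k (Ts h))" .
qed (use h in \<open>auto simp: shift_H2 Ts_mem\<close>)

text \<open>The sequences \<open>Ts (z^j h)\<close> fit together: raising \<open>j\<close> by one
  prepends one coefficient. The prepended coefficients are collected in \<open>hankel\<close>
  below.\<close>

lemma Ts_X_power:
  assumes h: "h \<in> hcarrier H2"
  shows "fps_shift k (Ts (fps_X ^ (k + m) * h)) = Ts (fps_X ^ m * h)"
proof -
  have "fps_shift k (fps_X ^ (k + m) * h) = fps_X ^ m * h"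
    by (simp add: fps_eq_iff fps_X_power_mult_nth)
  thus ?thesis using Ts_shift[of "fps_X ^ (k + m) * h" k] h by (simp add: fps_X_power_H2)
qed

text \<open>Dually, the test vector \<open>h\<close> is replaced by \<open>z h\<close>. This does
  not increase \<open>N\<close>: the norm of \<open>h\<close> is kept, while \<open>Ts h\<close> is
  the backward shift of \<open>Ts (z h)\<close> and so has the smaller norm.\<close>

lemma shift_dBR:
  assumes f: "f \<in> hcarrier HB"
  shows "fps_shift 1 f \<in> hcarrier HB" "hnorm HB (fps_shift 1 f) \<le> hnorm HB f"
proof -
  have fH: "f \<in> hcarrier H2" using f by (rule dBR_H2)
  have "cmod (hinner H2 (fps_shift 1 f) h) \<le> hnorm HB f * sqrt (N h)" if h: "h \<in> hcarrier H2" for h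
  proof -
    have Xh: "fps_X * h \<in> hcarrier H2" "hnorm H2 (fps_X * h) = hnorm H2 h"
      using fps_X_power_H2[OF h, of 1] by auto
    have "hinner H2 (fps_shift 1 f) h = cnj (hinner H2 h (fps_shift 1 f))"
      using fH h by (intro H2.inner_commute shift_H2)
    also have "\<dots> = cnj (hinner H2 (fps_X * h) f)"
      using hinner_upshift[OF h fH, of 1] by (simp add: upshift_complex)
    also have "\<dots> = hinner H2 f (fps_X * h)" using fH Xh H2.inner_commute[of f "fps_X * h"] by simp
    finally have "cmod (hinner H2 (fps_shift 1 f) h) \<le> hnorm HB f * sqrt (N (fps_X * h))"
      using dBR_bound[OF f Xh(1)] by simp
    also have "\<dots> \<le> hnorm HB f * sqrt (N h)"
    proof -
      have "Ts h = fps_shift 1 (Ts (fps_X * h))" using Ts_X_power[OF h, of 1 0] by simp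
      hence "hnorm H2 (Ts h) \<le> hnorm H2 (Ts (fps_X * h))"
        using shift_H2(3)[OF Ts_mem[OF Xh(1)], of 1] by simp
      hence "(hnorm H2 (Ts h))\<^sup>2 \<le> (hnorm H2 (Ts (fps_X * h)))\<^sup>2"
        using H2.hnorm_ge0[OF Ts_mem[OF h]] by (rule power_mono)
      thus ?thesis using dBR.hnorm_ge0[OF f] by (intro mult_left_mono real_sqrt_le_mono) (auto simp: N_def Xh)
    qed
    finally show ?thesis .
  qed
  from dBR_boundI[OF shift_H2(1)[OF fH] dBR.hnorm_ge0[OF f] this]
  show "fps_shift 1 f \<in> hcarrier HB" "hnorm HB (fps_shift 1 f) \<le> hnorm HB f" by auto
qed

text \<open>Expanding the squared norm of \<open>x - T (Ts x)\<close> writes \<open>N x\<close> as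
  the sum of the two left hand sides, both of which are nonnegative.\<close>

lemma N_Ts_le:
  assumes x: "x \<in> hcarrier H2"
  shows "(hnorm H2 (Ts x))\<^sup>2 - (hnorm H2 (T (Ts x)))\<^sup>2 \<le> N x" "(hnorm H2 (defect x))\<^sup>2 \<le> N x"
proof -
  have "hinner H2 x (T (Ts x)) = hinner H2 (T (Ts x)) x" using TTs(2) x by (auto simp: selfadjoint_on_def)
  also have "\<dots> = of_real ((hnorm H2 (Ts x))\<^sup>2)" using x by (simp add: Ts_adj Ts_mem H2.inner_self)
  finally have eq: "(hnorm H2 (defect x))\<^sup>2 = N x - ((hnorm H2 (Ts x))\<^sup>2 - (hnorm H2 (T (Ts x)))\<^sup>2)"
    using x by (simp add: defect_def H2.hnorm_diff_sq T_mem Ts_mem N_def)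
  moreover have "(hnorm H2 (T (Ts x)))\<^sup>2 \<le> (hnorm H2 (Ts x))\<^sup>2"
    using x by (intro power_mono T_norm H2.hnorm_ge0 T_mem Ts_mem)
  ultimately show "(hnorm H2 (defect x))\<^sup>2 \<le> N x" by simp
  show "(hnorm H2 (Ts x))\<^sup>2 - (hnorm H2 (T (Ts x)))\<^sup>2 \<le> N x"
    using eq zero_le_power2[of "hnorm H2 (defect x)"] by linarith
qed

end

section \<open>Polynomial multiples, pairings of coefficient sequences and scalar multiples of
  vector series\<close>

lemma fps_of_poly_mult_sum:
  fixes f :: "complex fps"
  shows "fps_of_poly p * f = (\<Sum>j\<le>degree p. poly.coeff p j *\<^sub>C (fps_X ^ j * f))"
proof -
  have "fps_of_poly p = fps_of_poly (\<Sum>j\<le>degree p. monom (poly.coeff p j) j)"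
    by (simp add: poly_as_sum_of_monoms)
  also have "\<dots> = (\<Sum>j\<le>degree p. fps_const (poly.coeff p j) * fps_X ^ j)"
    by (simp add: fps_of_poly_sum fps_of_poly_monom)
  finally show ?thesis by (simp add: sum_distrib_right scaleC_fps_complex mult.assoc)
qed

lemma subspace_poly_multiples:
  fixes f :: "complex fps" shows "cvec.subspace {fps_of_poly p * f |p. True}"
proof (rule cvec.subspaceI)
  have "0 = fps_of_poly 0 * f" by simp
  thus "0 \<in> {fps_of_poly p * f |p. True}" by blast
  show "x + y \<in> {fps_of_poly p * f |p. True}"
    if x: "x \<in> {fps_of_poly p * f |p. True}" and y: "y \<in> {fps_of_poly p * f |p. True}" for x y
  proof -
    obtain p where "x = fps_of_poly p * f" using x by blast
    moreover obtain q where "y = fps_of_poly q * f" using y by blast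
    ultimately have "x + y = fps_of_poly (p + q) * f" by (simp add: fps_of_poly_add distrib_right)
    thus ?thesis by blast
  qed
  show "c *\<^sub>C x \<in> {fps_of_poly p * f |p. True}" if x: "x \<in> {fps_of_poly p * f |p. True}" for c x
  proof -
    obtain p where "x = fps_of_poly p * f" using x by blast
    hence "c *\<^sub>C x = fps_of_poly (smult c p) * f" by (simp add: scaleC_fps_complex fps_of_poly_smult mult.assoc)
    thus ?thesis by blast
  qed
qed

lemma poly_mult_H2:
  fixes f :: "complex fps"
  shows "f \<in> hcarrier H2 \<Longrightarrow> fps_of_poly p * f \<in> hcarrier H2"
  unfolding fps_of_poly_mult_sum by (intro H2.sum_mem H2.scale_mem fps_X_power_H2)

lemma circ_mean_cnj:
  fixes g :: "complex \<Rightarrow> 'b::euclidean_space"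
  assumes "continuous_on (sphere 0 1) g"
  shows "circ_mean (\<lambda>z. g (cnj z)) = circ_mean g"
proof -
  have cont: "continuous_on {0..2*pi} (\<lambda>t. g (cis t))"
    by (intro continuous_on_compose2[OF assms] continuous_intros) auto
  have int: "integral {0..2*pi} (\<lambda>t. g (cis t)) = (LINT t|circle. g (cis t))"
    using integrable_circle[OF assms] by (simp add: lebesgue_integral_eq_integral)
  have "((\<lambda>t. g (cis t)) has_integral integral {0..2*pi} (\<lambda>t. g (cis t))) (cbox 0 (2*pi))"
    using integrable_continuous_real[OF cont] by (simp add: has_integral_integral)
  from has_integral_affinity[OF this, of "-1" "2*pi"]
  have "((\<lambda>t. g (cis (2*pi - t))) has_integral integral {0..2*pi} (\<lambda>t. g (cis t))) ((\<lambda>t. 2*pi - t) ` {0..2*pi})"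
    by simp
  also have "(\<lambda>t. 2*pi - t) ` {0..2*pi} = {0..2*pi}" by (simp add: image_diff_atLeastAtMost)
  finally have "((\<lambda>t. g (cis (2*pi - t))) has_integral integral {0..2*pi} (\<lambda>t. g (cis t))) {0..2*pi}" .
  moreover have "cis (2*pi - t) = cnj (cis t)" for t by (simp add: complex_eq_iff)
  ultimately have "integral {0..2*pi} (\<lambda>t. g (cnj (cis t))) = integral {0..2*pi} (\<lambda>t. g (cis t))"
    by (intro integral_unique) simp
  moreover have "integral {0..2*pi} (\<lambda>t. g (cnj (cis t))) = (LINT t|circle. g (cnj (cis t)))"
  proof -
    have "continuous_on (sphere 0 1) (\<lambda>z. g (cnj z))"
      by (intro continuous_on_compose2[OF assms] continuous_intros) auto
    from integrable_circle[OF this] show ?thesis by (simp add: lebesgue_integral_eq_integral)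
  qed
  ultimately show ?thesis using int by (simp add: circ_mean_def)
qed

text \<open>The indices add up instead of agreeing, as in the coefficient of a product. This shape
  arises because the Hankel part consists of reversed blocks of one sequence.\<close>

definition pairing :: "'d::complex_inner fps \<Rightarrow> 'd fps \<Rightarrow> nat \<Rightarrow> complex" where
  "pairing \<eta> q j = (\<Sum>i\<le>j. cinner (fps_nth \<eta> i) (fps_nth q (j - i)))"

text \<open>Evaluating \<open>\<eta>\<close> at the conjugate point leaves only powers of
  \<open>cnj z\<close> in the inner product; the mean against \<open>z ^ j\<close> selects the pairs
  of exponents with sum \<open>j\<close>.\<close>

lemma circ_mean_pairing:
  fixes \<eta> q :: "'d::complex_hilbert fps"
  assumes \<eta>: "\<eta> \<in> hcarrier H2" and q: "q \<in> hcarrier H2" and s: "0 \<le> s" "s < 1"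
  shows "circ_mean (\<lambda>z. z ^ j * cinner (eval_vfps \<eta> (of_real s * cnj z)) (eval_vfps q (of_real s * z)))
    = of_real (s ^ j) * pairing \<eta> q j"
proof -
  define F where "F = (\<lambda>N (z::complex). \<Sum>i<N. (of_real s * cnj z) ^ i *\<^sub>C fps_nth \<eta> i)"
  define G where "G = (\<lambda>N (z::complex). \<Sum>i<N. (of_real s * z) ^ i *\<^sub>C fps_nth q i)"
  have z: "cmod (complex_of_real s * z) \<le> s" "cmod (complex_of_real s * cnj z) \<le> s" if "cmod z = 1" for z
    using that s by (auto simp: norm_mult)
  note sm = summable_norm_H2[OF \<eta> s] summable_norm_H2[OF q s]
  have lim: "(\<lambda>N. circ_mean (\<lambda>z. z ^ j * cinner (F N z) (G N z))) \<longlonglongrightarrow>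
      circ_mean (\<lambda>z. z ^ j * cinner (eval_vfps \<eta> (of_real s * cnj z)) (eval_vfps q (of_real s * z)))"
  proof (rule circ_mean_lim)
    fix N show "continuous_on (sphere 0 1) (\<lambda>z. z ^ j * cinner (F N z) (G N z))"
      unfolding F_def G_def
      by (intro continuous_intros cinner.continuous_on continuous_on_sum scaleC.continuous_on)
    fix z :: complex assume z1: "cmod z = 1"
    have "norm (cinner (F N z) (G N z)) \<le> (\<Sum>n. s ^ n * norm (fps_nth \<eta> n)) * (\<Sum>n. s ^ n * norm (fps_nth q n))"
      unfolding F_def G_def using norm_partial_sum_le[OF sm(1) z(2)[OF z1]] norm_partial_sum_le[OF sm(2) z(1)[OF z1]]
      by (intro order_trans[OF cinner.cauchy_schwarz] mult_mono)
         (auto intro: order_trans[OF norm_ge_zero])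
    thus "norm (z ^ j * cinner (F N z) (G N z)) \<le> (\<Sum>n. s ^ n * norm (fps_nth \<eta> n)) * (\<Sum>n. s ^ n * norm (fps_nth q n))"
      using z1 by (simp add: norm_mult norm_power)
  next
    fix z :: complex assume z1: "cmod z = 1"
    show "(\<lambda>n. z ^ j * cinner (F n z) (G n z)) \<longlonglongrightarrow>
        z ^ j * cinner (eval_vfps \<eta> (of_real s * cnj z)) (eval_vfps q (of_real s * z))"
      unfolding F_def G_def
      by (intro tendsto_intros cinner.tendsto partial_sum_tendsto[OF sm(1) z(2)[OF z1]] partial_sum_tendsto[OF sm(2) z(1)[OF z1]])
  qed
  \<comment> \<open>The truncated means are exact as soon as the truncation contains all indices up
    to \<open>j\<close>.\<close>
  have "circ_mean (\<lambda>z. z ^ j * cinner (F N z) (G N z)) = of_real (s ^ j) * pairing \<eta> q j" if N: "j < N" for N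
  proof -
    have "circ_mean (\<lambda>z. z ^ j * cinner (F N z) (G N z)) =
      circ_mean (\<lambda>z. \<Sum>i<N. \<Sum>k<N. (of_real (s ^ (i + k)) * cinner (fps_nth \<eta> i) (fps_nth q k)) * (z ^ j * cnj z ^ (i + k)))"
      unfolding F_def G_def
      unfolding cinner_sum_left unfolding cinner_sum_right
      by (simp add: cinner_scaleC_left cinner.inner_scale_right power_add power_mult_distrib sum_distrib_left mult_ac)
    also have "\<dots> = (\<Sum>i<N. \<Sum>k<N. (of_real (s ^ (i + k)) * cinner (fps_nth \<eta> i) (fps_nth q k)) * (if j = i + k then 1 else 0))"
      by (simp add: circ_mean_sum continuous_intros circ_mean_cmult circ_mean_cis)
    also have "\<dots> = (\<Sum>i<N. if i \<le> j then of_real (s ^ j) * cinner (fps_nth \<eta> i) (fps_nth q (j - i)) else 0)"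
    proof (intro sum.cong refl)
      fix i assume "i \<in> {..<N}"
      show "(\<Sum>k<N. (of_real (s ^ (i + k)) * cinner (fps_nth \<eta> i) (fps_nth q k)) * (if j = i + k then 1 else 0))
          = (if i \<le> j then of_real (s ^ j) * cinner (fps_nth \<eta> i) (fps_nth q (j - i)) else 0)"
      proof (cases "i \<le> j")
        case True
        hence "(\<Sum>k<N. (of_real (s ^ (i + k)) * cinner (fps_nth \<eta> i) (fps_nth q k)) * (if j = i + k then 1 else 0))
          = (\<Sum>k<N. if k = j - i then of_real (s ^ j) * cinner (fps_nth \<eta> i) (fps_nth q (j - i)) else 0)"
          by (intro sum.cong refl) auto
        thus ?thesis using True N by simp
      qed auto
    qed
    also have "\<dots> = of_real (s ^ j) * pairing \<eta> q j"
    proof -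
      have "{i\<in>{..<N}. i \<le> j} = {..j}" using N by auto
      thus ?thesis by (simp add: pairing_def sum_distrib_left sum.If_cases Int_def)
    qed
    finally show ?thesis .
  qed
  hence "(\<lambda>N. circ_mean (\<lambda>z. z ^ j * cinner (F N z) (G N z))) \<longlonglongrightarrow> of_real (s ^ j) * pairing \<eta> q j"
    by (intro tendsto_eventually eventually_sequentiallyI[of "Suc j"]) auto
  with lim show ?thesis by (rule LIMSEQ_unique)
qed

text \<open>Serves to view \<open>a q\<close> as one vector-valued analytic function, whose circle
  means grow with the radius.\<close>

definition vmul :: "complex fps \<Rightarrow> 'd::complex_vector fps \<Rightarrow> 'd fps" where
  "vmul a q = Abs_fps (\<lambda>n. \<Sum>i\<le>n. fps_nth a i *\<^sub>C fps_nth q (n - i))"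

lemma vmul_eval:
  fixes q :: "'d::complex_hilbert fps"
  assumes a: "fps_conv_radius a \<ge> 1" and q: "q \<in> hcarrier H2" and s: "0 \<le> s" "s < 1"
  shows "summable (\<lambda>n. s ^ n * norm (fps_nth (vmul a q) n))"
    and "cmod z \<le> s \<Longrightarrow> eval_vfps (vmul a q) z = eval_fps a z *\<^sub>C eval_vfps q z"
proof -
  show sm: "summable (\<lambda>n. s ^ n * norm (fps_nth (vmul a q) n))"
  proof (rule summable_comparison_test')
    have 1: "summable (\<lambda>n. norm (s ^ n * norm (fps_nth a n)))"
      using summable_fps_disc[OF a s] s by simp
    have 2: "summable (\<lambda>n. norm (s ^ n * norm (fps_nth q n)))"
      using summable_norm_H2[OF q s] s by simp
    show "summable (\<lambda>n. \<Sum>i\<le>n. (s ^ i * norm (fps_nth a i)) * (s ^ (n - i) * norm (fps_nth q (n - i))))"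
      by (rule summable_Cauchy_product[OF 1 2])
    fix n
    have "s ^ n * norm (fps_nth (vmul a q) n) \<le> s ^ n * (\<Sum>i\<le>n. norm (fps_nth a i *\<^sub>C fps_nth q (n - i)))"
      unfolding vmul_def using s by (intro mult_left_mono) (auto intro: norm_sum)
    also have "\<dots> = (\<Sum>i\<le>n. (s ^ i * norm (fps_nth a i)) * (s ^ (n - i) * norm (fps_nth q (n - i))))"
      unfolding sum_distrib_left
    proof (intro sum.cong refl)
      fix i assume "i \<in> {..n}"
      hence "s ^ n = s ^ i * s ^ (n - i)" by (simp flip: power_add)
      thus "s ^ n * norm (fps_nth a i *\<^sub>C fps_nth q (n - i)) =
          (s ^ i * norm (fps_nth a i)) * (s ^ (n - i) * norm (fps_nth q (n - i)))"
        by (simp add: norm_scaleC)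
    qed
    finally show "norm (s ^ n * norm (fps_nth (vmul a q) n)) \<le>
        (\<Sum>i\<le>n. (s ^ i * norm (fps_nth a i)) * (s ^ (n - i) * norm (fps_nth q (n - i))))"
      using s by simp
  qed
  assume z: "cmod z \<le> s"
  show "eval_vfps (vmul a q) z = eval_fps a z *\<^sub>C eval_vfps q z"
  \<comment> \<open>Testing against vectors \<open>y\<close> reduces the claim to a scalar Cauchy
    product.\<close>
  proof (rule cinner.inner_eqI; (rule UNIV_I)?)
    fix y :: 'd
    have z1: "cmod z < 1" using z s by simp
    have smz: "summable (\<lambda>n. z ^ n *\<^sub>C fps_nth (vmul a q) n)"
    proof (rule summable_norm_cancel, rule summable_comparison_test'[OF sm])
      fix n show "norm (norm (z ^ n *\<^sub>C fps_nth (vmul a q) n)) \<le> s ^ n * norm (fps_nth (vmul a q) n)"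
        using z s by (auto simp: norm_scaleC norm_power intro!: mult_right_mono power_mono)
    qed
    have "(\<lambda>n. cinner (z ^ n *\<^sub>C fps_nth (vmul a q) n) y) sums cinner (eval_vfps (vmul a q) z) y"
      unfolding eval_vfps_def
      by (intro bounded_linear.sums[OF cinner.bounded_linear_left] summable_sums smz)
    moreover have "(\<lambda>n. \<Sum>i\<le>n. (fps_nth a i * z ^ i) * cinner (z ^ (n - i) *\<^sub>C fps_nth q (n - i)) y) sums
        ((\<Sum>n. fps_nth a n * z ^ n) * (\<Sum>n. cinner (z ^ n *\<^sub>C fps_nth q n) y))"
    proof (rule Cauchy_product_sums)
      show "summable (\<lambda>n. norm (fps_nth a n * z ^ n))"
        using conv_radius_gt[OF a z1] by (rule norm_summable_fps)
      show "summable (\<lambda>n. norm (cinner (z ^ n *\<^sub>C fps_nth q n) y))"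
      proof (rule summable_comparison_test')
        show "summable (\<lambda>n. s ^ n * norm (fps_nth q n) * norm y)"
          by (intro summable_mult2 summable_norm_H2 q s)
        fix n
        have "norm (cinner (z ^ n *\<^sub>C fps_nth q n) y) \<le> norm (z ^ n *\<^sub>C fps_nth q n) * norm y"
          by (rule cinner.cauchy_schwarz) auto
        also have "\<dots> \<le> s ^ n * norm (fps_nth q n) * norm y"
          using z by (auto simp: norm_scaleC norm_power intro!: mult_right_mono power_mono)
        finally show "norm (norm (cinner (z ^ n *\<^sub>C fps_nth q n) y)) \<le> s ^ n * norm (fps_nth q n) * norm y" by simp
      qed
    qed
    moreover have "(\<Sum>i\<le>n. (fps_nth a i * z ^ i) * cinner (z ^ (n - i) *\<^sub>C fps_nth q (n - i)) y)
        = cinner (z ^ n *\<^sub>C fps_nth (vmul a q) n) y" for n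
      unfolding vmul_def fps_nth_Abs_fps cinner_scaleC_left cinner_sum_left sum_distrib_left
    proof (intro sum.cong refl)
      fix i assume "i \<in> {..n}"
      hence "z ^ n = z ^ i * z ^ (n - i)" by (simp flip: power_add)
      thus "fps_nth a i * z ^ i * (z ^ (n - i) * cinner (fps_nth q (n - i)) y) =
         z ^ n * (fps_nth a i * cinner (fps_nth q (n - i)) y)" by simp
    qed
    moreover have "(\<Sum>n. cinner (z ^ n *\<^sub>C fps_nth q n) y) = cinner (eval_vfps q z) y"
      by (intro sums_unique[symmetric] bounded_linear.sums[OF cinner.bounded_linear_left] eval_vfps_sums q z1)
    ultimately have "cinner (eval_vfps (vmul a q) z) y = eval_fps a z * cinner (eval_vfps q z) y"
      by (simp add: eval_fps_def sums_iff)
    hence "cinner (eval_vfps (vmul a q) z) y = cinner (eval_fps a z *\<^sub>C eval_vfps q z) y"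
      by (simp add: cinner_scaleC_left)
    thus "cinner y (eval_vfps (vmul a q) z) = cinner y (eval_fps a z *\<^sub>C eval_vfps q z)"
      by (metis cinner_commute)
  qed
qed

text \<open>Collects the properties of the mate on which the operator-theoretic argument rests, all
  stated inside the disc. Their derivation from boundary values is given in the last
  section.\<close>

locale schur_mate = schur B for B :: "complex \<Rightarrow> 'd::complex_hilbert \<Rightarrow> complex" +
  fixes a :: "complex fps"
  assumes a_rad: "fps_conv_radius a \<ge> 1"
    and a_nz: "cmod z < 1 \<Longrightarrow> eval_fps a z \<noteq> 0"
    and row_contractive: "cmod z < 1 \<Longrightarrow> (cmod (eval_fps a z * c + B z x))\<^sup>2 \<le> (cmod c)\<^sup>2 + (norm x)\<^sup>2"
begin

lemma a_le_1: assumes "cmod z < 1" shows "cmod (eval_fps a z) \<le> 1"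
proof -
  have "B z 0 = 0" using schur_classD(2)[OF B assms, of 0 0] by simp
  hence "(cmod (eval_fps a z))\<^sup>2 \<le> 1" using row_contractive[OF assms, of 1 0] by simp
  thus ?thesis by (simp add: power_le_one_iff abs_square_le_1)
qed

text \<open>Row contractivity is applied to \<open>c = t * cnj (eval_fps a z) * B z x\<close> with a
  free real \<open>t\<close>. With \<open>p\<close>, \<open>b\<close>, \<open>X\<close> for the
  squared sizes of \<open>a\<close> at \<open>z\<close>, of \<open>B z x\<close> and of
  \<open>x\<close>, the choice \<open>t = 1 / (1 - p)\<close> yields
  \<open>b \<le> (1 - p) * X\<close>.\<close>

lemma mate_pointwise:
  assumes z: "cmod z < 1"
  shows "(cmod (eval_fps a z))\<^sup>2 * (norm x)\<^sup>2 \<le> (norm x)\<^sup>2 - (cmod (B z x))\<^sup>2"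
proof -
  define p where "p = (cmod (eval_fps a z))\<^sup>2"
  define b where "b = (cmod (B z x))\<^sup>2"
  define X where "X = (norm x)\<^sup>2"
  have p: "0 \<le> p" "p \<le> 1" using a_le_1[OF z] by (auto simp: p_def power_le_one)
  have b0: "b \<ge> 0" by (simp add: b_def)
  have ineq: "b * (1 + t * p)\<^sup>2 \<le> t\<^sup>2 * p * b + X" for t :: real
  proof -
    let ?c = "of_real t * cnj (eval_fps a z) * B z x"
    have "eval_fps a z * ?c + B z x = of_real t * (eval_fps a z * cnj (eval_fps a z)) * B z x + B z x"
      by (simp add: mult_ac)
    also have "\<dots> = complex_of_real (1 + t * p) * B z x"
      unfolding complex_norm_square[symmetric] p_def by (simp add: algebra_simps)
    finally have "(cmod (eval_fps a z * ?c + B z x))\<^sup>2 = (1 + t * p)\<^sup>2 * b"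
      by (simp add: norm_mult power_mult_distrib b_def del: of_real_add of_real_mult)
    moreover have "(cmod ?c)\<^sup>2 = t\<^sup>2 * p * b"
      by (simp add: norm_mult power_mult_distrib b_def p_def)
    ultimately show ?thesis using row_contractive[OF z, of ?c x] by (simp add: X_def mult.commute)
  qed
  have "p * X \<le> X - b"
  proof (cases "p = 1")
    case True
    have "b = 0"
    proof (rule ccontr)
      assume "b \<noteq> 0"
      hence "b > 0" using b0 by simp
      \<comment> \<open>For \<open>p = 1\<close> the inequality reads
        \<open>b + 2 * t * b \<le> X\<close>, which fails at this \<open>t\<close>.\<close>
      define t where "t = X / b"
      have "t * b = X" using \<open>b > 0\<close> by (simp add: t_def)
      moreover have "b + 2 * (t * b) + t\<^sup>2 * b \<le> t\<^sup>2 * b + X"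
        using ineq[of t] True by (simp add: power2_eq_square algebra_simps)
      ultimately have "b + X \<le> 0" by linarith
      moreover have "X \<ge> 0" by (simp add: X_def)
      ultimately show False using \<open>b > 0\<close> by linarith
    qed
    thus ?thesis using True by simp
  next
    case False
    hence p1: "1 - p > 0" using p by simp
    have "b * (1 + 1 / (1 - p) * p)\<^sup>2 \<le> (1 / (1 - p))\<^sup>2 * p * b + X" by (rule ineq)
    also have "1 + 1 / (1 - p) * p = 1 / (1 - p)" using p1 by (simp add: field_simps)
    finally have "b * (1 / (1 - p))\<^sup>2 * (1 - p) \<le> X" by (simp add: algebra_simps)
    moreover have "b * (1 / (1 - p))\<^sup>2 * (1 - p) = b / (1 - p)"
      using p1 by (simp add: power2_eq_square)
    ultimately have "b \<le> X * (1 - p)" using p1 by (simp add: pos_divide_le_eq)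
    thus ?thesis by (simp add: algebra_simps)
  qed
  thus ?thesis by (simp add: p_def b_def X_def)
qed

text \<open>The pointwise row inequality, integrated over circles, makes the row of the two
  multiplication operators a contraction.\<close>

lemma mate_row_norm:
  assumes h: "h \<in> hcarrier H2" and y: "y \<in> hcarrier H2"
  shows "a * h + T y \<in> hcarrier H2" "(hnorm H2 (a * h + T y))\<^sup>2 \<le> (hnorm H2 h)\<^sup>2 + (hnorm H2 y)\<^sup>2"
proof -
  let ?C = "sqrt ((hnorm H2 h)\<^sup>2 + (hnorm H2 y)\<^sup>2)"
  have r: "fps_conv_radius (a * h + T y) \<ge> 1"
    by (intro fps_conv_radius_add_ge fps_conv_radius_mult_ge a_rad fps_conv_radius_H2 h T_mem y)
  have sm: "summable (\<lambda>n. s ^ n * norm (fps_nth (a * h + T y) n))" if "0 \<le> s" "s < 1" for s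
    using that by (intro summable_fps_disc r)
  have ev: "eval_fps (a * h + T y) w = eval_fps a w * eval_fps h w + B w (eval_vfps y w)" if w: "cmod w < 1" for w
  proof -
    have "cmod w < fps_conv_radius (a * h)"
      by (intro conv_radius_gt w fps_conv_radius_mult_ge a_rad fps_conv_radius_H2 h)
    hence "eval_fps (a * h + T y) w = eval_fps (a * h) w + eval_fps (T y) w"
      by (intro eval_fps_add conv_radius_gt[OF fps_conv_radius_H2 w] T_mem y)
         (use H2_mult_bounded(1)[OF h a_rad a_le_1] in auto)
    also have "eval_fps (a * h) w = eval_fps a w * eval_fps h w"
      by (intro eval_fps_mult conv_radius_gt w fps_conv_radius_H2 h a_rad)
    finally show ?thesis using eval_toeplitz(2)[OF B y w] by simp
  qed
  have bd: "circ_mean (\<lambda>z. (norm (eval_vfps (a * h + T y) (of_real (rad n) * z)))\<^sup>2) \<le> ?C\<^sup>2" for n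
  proof -
    have s: "0 \<le> rad n" "rad n < 1" using rad_bounds by auto
    have c: "continuous_on (sphere 0 1) (\<lambda>z. (norm (eval_vfps h (of_real (rad n) * z)))\<^sup>2)"
      "continuous_on (sphere 0 1) (\<lambda>z. (norm (eval_vfps y (of_real (rad n) * z)))\<^sup>2)"
      by (intro continuous_intros continuous_eval_H2 h y s)+
    have "circ_mean (\<lambda>z. (norm (eval_vfps (a * h + T y) (of_real (rad n) * z)))\<^sup>2) \<le>
        circ_mean (\<lambda>z. (norm (eval_vfps h (of_real (rad n) * z)))\<^sup>2 + (norm (eval_vfps y (of_real (rad n) * z)))\<^sup>2)"
    proof (rule circ_mean_mono)
      show "continuous_on (sphere 0 1) (\<lambda>z. (norm (eval_vfps (a * h + T y) (of_real (rad n) * z)))\<^sup>2)"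
        using s by (intro continuous_intros continuous_on_cball_sphere continuous_eval_vfps sm)
      show "continuous_on (sphere 0 1) (\<lambda>z. (norm (eval_vfps h (of_real (rad n) * z)))\<^sup>2 + (norm (eval_vfps y (of_real (rad n) * z)))\<^sup>2)"
        by (intro continuous_on_add c)
      fix z :: complex assume "cmod z = 1"
      hence w: "cmod (of_real (rad n) * z) < 1" using s by (simp add: norm_mult)
      show "(norm (eval_vfps (a * h + T y) (of_real (rad n) * z)))\<^sup>2
          \<le> (norm (eval_vfps h (of_real (rad n) * z)))\<^sup>2 + (norm (eval_vfps y (of_real (rad n) * z)))\<^sup>2"
        using row_contractive[OF w] unfolding eval_vfps_complex ev[OF w] by blast
    qed
    also have "\<dots> = circ_mean (\<lambda>z. (norm (eval_vfps h (of_real (rad n) * z)))\<^sup>2)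
        + circ_mean (\<lambda>z. (norm (eval_vfps y (of_real (rad n) * z)))\<^sup>2)"
      by (rule circ_mean_add[OF c])
    also have "\<dots> \<le> (hnorm H2 h)\<^sup>2 + (hnorm H2 y)\<^sup>2"
      by (intro add_mono circ_mean_le_hnorm_H2 h y s)
    finally show ?thesis by simp
  qed
  have "?C \<ge> 0" by simp
  from H2_circ_mean_boundI[OF sm this bd]
  have *: "a * h + T y \<in> hcarrier H2" "hnorm H2 (a * h + T y) \<le> ?C" by auto
  show "a * h + T y \<in> hcarrier H2" by (rule *(1))
  show "(hnorm H2 (a * h + T y))\<^sup>2 \<le> (hnorm H2 h)\<^sup>2 + (hnorm H2 y)\<^sup>2"
    using power_mono[OF *(2) H2.hnorm_ge0[OF *(1)], of 2] by simp
qed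

text \<open>The adjoint of a contractive row is contractive, so what \<open>u\<close> contributes
  through \<open>a\<close> is bounded by \<open>N u\<close>. Only the component along
  \<open>h\<close> enters, and the adjoint of multiplication by \<open>a\<close> need not be
  formed.\<close>

lemma mate_mult_dBR:
  assumes h: "h \<in> hcarrier H2"
  shows "a * h \<in> hcarrier HB" "hnorm HB (a * h) \<le> hnorm H2 h"
proof -
  have ah: "a * h \<in> hcarrier H2" using H2_mult_bounded(1)[OF h a_rad a_le_1] by simp
  have "cmod (hinner H2 (a * h) u) \<le> hnorm H2 h * sqrt (N u)" if u: "u \<in> hcarrier H2" for u
  proof (cases "hnorm H2 h = 0")
    case True
    hence "h = 0" using H2.hnorm_eq0[OF h] by simp
    thus ?thesis using u by simp
  next
    case False
    hence hpos: "hnorm H2 h > 0" using H2.hnorm_ge0[OF h] by simp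
    define \<alpha> where "\<alpha> = hinner H2 (a * h) u"
    define r where "r = (cmod \<alpha>)\<^sup>2 / (hnorm H2 h)\<^sup>2"
    \<comment> \<open>\<open>c *\<^sub>C h\<close> is the projection onto the line through
      \<open>h\<close> of the adjoint multiplication by \<open>a\<close> applied to
      \<open>u\<close>; its squared norm is \<open>r\<close>.\<close>
    define c where "c = cnj \<alpha> / of_real ((hnorm H2 h)\<^sup>2)"
    let ?v = "a * (c *\<^sub>C h) + T (Ts u)"
    have v: "?v \<in> hcarrier H2" "(hnorm H2 ?v)\<^sup>2 \<le> (hnorm H2 (c *\<^sub>C h))\<^sup>2 + (hnorm H2 (Ts u))\<^sup>2"
      using mate_row_norm[OF H2.scale_mem[OF h] Ts_mem[OF u]] by auto
    have "cmod c = cmod \<alpha> / (hnorm H2 h)\<^sup>2" by (simp add: c_def norm_divide norm_power)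
    hence ch: "(hnorm H2 (c *\<^sub>C h))\<^sup>2 = r"
      using hpos by (simp add: H2.hnorm_scale h power_mult_distrib r_def power_divide power2_eq_square)
    have "hinner H2 ?v u = c * \<alpha> + of_real ((hnorm H2 (Ts u))\<^sup>2)"
    proof -
      have "a * (c *\<^sub>C h) = c *\<^sub>C (a * h)" by (simp add: scaleC_fps_complex mult_ac)
      thus ?thesis using ah u by (simp add: H2.inner_add_left H2.scale_mem T_mem Ts_mem
            H2.inner_scale_left Ts_adj H2.inner_self \<alpha>_def)
    qed
    also have "c * \<alpha> = of_real r"
      using complex_norm_square[of \<alpha>] by (simp add: c_def r_def mult.commute)
    finally have "hinner H2 ?v u = of_real (r + (hnorm H2 (Ts u))\<^sup>2)" by simp
    moreover have r0: "r \<ge> 0" by (simp add: r_def)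
    ultimately have "r + (hnorm H2 (Ts u))\<^sup>2 \<le> hnorm H2 ?v * hnorm H2 u"
      using H2.cauchy_schwarz[OF v(1) u] by (simp del: of_real_add)
    hence "(r + (hnorm H2 (Ts u))\<^sup>2)\<^sup>2 \<le> (hnorm H2 ?v * hnorm H2 u)\<^sup>2"
      using r0 by (intro power_mono) auto
    also have "\<dots> \<le> (r + (hnorm H2 (Ts u))\<^sup>2) * (hnorm H2 u)\<^sup>2"
      using v(2) ch by (simp add: power_mult_distrib mult_right_mono)
    finally have sq: "(r + (hnorm H2 (Ts u))\<^sup>2)\<^sup>2 \<le> (r + (hnorm H2 (Ts u))\<^sup>2) * (hnorm H2 u)\<^sup>2" .
    have "r + (hnorm H2 (Ts u))\<^sup>2 \<le> (hnorm H2 u)\<^sup>2"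
    proof -
      define A where "A = r + (hnorm H2 (Ts u))\<^sup>2"
      from sq have "A * A \<le> A * (hnorm H2 u)\<^sup>2" by (simp add: A_def power2_eq_square)
      moreover have "A \<ge> 0" using r0 by (simp add: A_def)
      ultimately have "A \<le> (hnorm H2 u)\<^sup>2" by (cases "A = 0") (auto simp: mult_le_cancel_left)
      thus ?thesis by (simp add: A_def)
    qed
    hence "r \<le> N u" by (simp add: N_def)
    hence "(cmod \<alpha>)\<^sup>2 \<le> (hnorm H2 h)\<^sup>2 * N u" using hpos by (simp add: r_def field_simps)
    hence "sqrt ((cmod \<alpha>)\<^sup>2) \<le> sqrt ((hnorm H2 h)\<^sup>2 * N u)" by (rule real_sqrt_le_mono)
    thus ?thesis using hpos by (simp add: real_sqrt_mult \<alpha>_def)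
  qed
  from dBR_boundI[OF ah H2.hnorm_ge0[OF h] this]
  show "a * h \<in> hcarrier HB" "hnorm HB (a * h) \<le> hnorm H2 h" by auto
qed

text \<open>The counterpart of \<open>N\<close> on the vector-valued side: the quadratic form of the
  identity minus the adjoint of \<open>T\<close> composed with \<open>T\<close>.\<close>

definition D2 :: "'d fps \<Rightarrow> real" where "D2 q = (hnorm H2 q)\<^sup>2 - (hnorm H2 (T q))\<^sup>2"

lemma D2_ge0: "q \<in> hcarrier H2 \<Longrightarrow> D2 q \<ge> 0"
  using T_norm[of q] by (simp add: D2_def power_mono H2.hnorm_ge0 T_mem)

lemma continuous_eval_a: "0 \<le> s \<Longrightarrow> s < 1 \<Longrightarrow> continuous_on (sphere 0 1) (\<lambda>z. eval_fps a (of_real s * z))"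
  using continuous_on_cball_sphere[OF continuous_eval_vfps[of s a]] summable_fps_disc[OF a_rad, of s]
  by (simp add: eval_vfps_complex)

lemma continuous_eval_T: "q \<in> hcarrier H2 \<Longrightarrow> 0 \<le> s \<Longrightarrow> s < 1 \<Longrightarrow>
    continuous_on (sphere 0 1) (\<lambda>z. B (of_real s * z) (eval_vfps q (of_real s * z)))"
proof -
  assume *: "q \<in> hcarrier H2" "0 \<le> s" "s < 1"
  have "continuous_on (sphere 0 1) (\<lambda>z. eval_vfps (T q) (of_real s * z))"
    by (intro continuous_eval_H2 T_mem *)
  thus ?thesis
    by (rule continuous_on_cong[THEN iffD1, rotated 2])
       (use * in \<open>auto simp: eval_vfps_complex eval_toeplitz[OF B] norm_mult\<close>)
qed

lemma circ_mean_D2: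
  assumes q: "q \<in> hcarrier H2"
  shows "(\<lambda>k. circ_mean (\<lambda>z. (norm (eval_vfps q (of_real (rad k) * z)))\<^sup>2
      - (cmod (B (of_real (rad k) * z) (eval_vfps q (of_real (rad k) * z))))\<^sup>2)) \<longlonglongrightarrow> D2 q"
proof -
  have "circ_mean (\<lambda>z. (norm (eval_vfps q (of_real (rad k) * z)))\<^sup>2
      - (cmod (B (of_real (rad k) * z) (eval_vfps q (of_real (rad k) * z))))\<^sup>2)
    = circ_mean (\<lambda>z. (norm (eval_vfps q (of_real (rad k) * z)))\<^sup>2)
      - circ_mean (\<lambda>z. (norm (eval_vfps (T q) (of_real (rad k) * z)))\<^sup>2)" for k
  proof -
    have s: "0 \<le> rad k" "rad k < 1" using rad_bounds by auto
    have "circ_mean (\<lambda>z. (norm (eval_vfps (T q) (of_real (rad k) * z)))\<^sup>2) =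
      circ_mean (\<lambda>z. (cmod (B (of_real (rad k) * z) (eval_vfps q (of_real (rad k) * z))))\<^sup>2)"
      unfolding circ_mean_def using s q by (simp add: eval_vfps_complex eval_toeplitz[OF B] norm_mult)
    thus ?thesis using q s
      by (subst circ_mean_diff) (auto intro!: continuous_intros continuous_eval_H2 continuous_eval_T)
  qed
  thus ?thesis unfolding D2_def by (simp add: tendsto_diff circ_mean_norm_tendsto q T_mem)
qed

text \<open>\<open>D2 q\<close> is a limit over radii tending to 1. The mean of \<open>a q\<close>
  increases with the radius by Parseval, so it may be moved from \<open>s\<close> to a radius
  \<open>rad k > s\<close>, where \<open>mate_pointwise\<close> applies under the integral.\<close>

lemma circ_mean_mate_le:
  assumes q: "q \<in> hcarrier H2" and s: "0 \<le> s" "s < 1"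
  shows "circ_mean (\<lambda>z. (cmod (eval_fps a (of_real s * z)) * norm (eval_vfps q (of_real s * z)))\<^sup>2) \<le> D2 q"
proof (rule LIMSEQ_le_const[OF circ_mean_D2[OF q]])
  have eq: "(cmod (eval_fps a (of_real r * z)) * norm (eval_vfps q (of_real r * z)))\<^sup>2
      = (norm (eval_vfps (vmul a q) (of_real r * z)))\<^sup>2" if "0 \<le> r" "r < 1" "cmod z = 1" for r z
    using vmul_eval(2)[OF a_rad q that(1,2), of "of_real r * z"] that by (simp add: norm_mult norm_scaleC)
  have eq': "circ_mean (\<lambda>z. (cmod (eval_fps a (of_real r * z)) * norm (eval_vfps q (of_real r * z)))\<^sup>2)
      = circ_mean (\<lambda>z. (norm (eval_vfps (vmul a q) (of_real r * z)))\<^sup>2)" if "0 \<le> r" "r < 1" for r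
    unfolding circ_mean_def using eq[OF that] by simp
  have "eventually (\<lambda>k. s < rad k) sequentially" using rad_tendsto s(2) by (rule order_tendstoD)
  then obtain N0 where N0: "\<And>k. k \<ge> N0 \<Longrightarrow> s < rad k" by (auto simp: eventually_sequentially)
  have "circ_mean (\<lambda>z. (cmod (eval_fps a (of_real s * z)) * norm (eval_vfps q (of_real s * z)))\<^sup>2)
    \<le> circ_mean (\<lambda>z. (norm (eval_vfps q (of_real (rad k) * z)))\<^sup>2
      - (cmod (B (of_real (rad k) * z) (eval_vfps q (of_real (rad k) * z))))\<^sup>2)" if k: "k \<ge> N0" for k
  proof -
    have r: "0 \<le> rad k" "rad k < 1" using rad_bounds by auto
    have "circ_mean (\<lambda>z. (norm (eval_vfps (vmul a q) (of_real s * z)))\<^sup>2)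
        \<le> circ_mean (\<lambda>z. (norm (eval_vfps (vmul a q) (of_real (rad k) * z)))\<^sup>2)"
      by (rule sums_le[OF _ parseval_norm_sums parseval_norm_sums])
         (use s r N0[OF k] in \<open>auto intro!: mult_right_mono power_mono vmul_eval a_rad q\<close>)
    also have "\<dots> = circ_mean (\<lambda>z. (cmod (eval_fps a (of_real (rad k) * z)) * norm (eval_vfps q (of_real (rad k) * z)))\<^sup>2)"
      using eq'[OF r] by simp
    also have "\<dots> \<le> circ_mean (\<lambda>z. (norm (eval_vfps q (of_real (rad k) * z)))\<^sup>2
      - (cmod (B (of_real (rad k) * z) (eval_vfps q (of_real (rad k) * z))))\<^sup>2)"
    proof (rule circ_mean_mono)
      fix z :: complex assume "cmod z = 1"
      hence "cmod (of_real (rad k) * z) < 1" using r by (simp add: norm_mult)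
      from mate_pointwise[OF this, of "eval_vfps q (of_real (rad k) * z)"]
      show "(cmod (eval_fps a (of_real (rad k) * z)) * norm (eval_vfps q (of_real (rad k) * z)))\<^sup>2
        \<le> (norm (eval_vfps q (of_real (rad k) * z)))\<^sup>2
          - (cmod (B (of_real (rad k) * z) (eval_vfps q (of_real (rad k) * z))))\<^sup>2"
        by (simp add: power_mult_distrib)
    qed (intro continuous_intros continuous_eval_H2 continuous_eval_T continuous_eval_a q r)+
    finally show ?thesis using eq'[OF s] by simp
  qed
  thus "\<exists>N. \<forall>n\<ge>N. circ_mean (\<lambda>z. (cmod (eval_fps a (of_real s * z)) * norm (eval_vfps q (of_real s * z)))\<^sup>2)
    \<le> circ_mean (\<lambda>z. (norm (eval_vfps q (of_real (rad n) * z)))\<^sup>2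
      - (cmod (B (of_real (rad n) * z) (eval_vfps q (of_real (rad n) * z))))\<^sup>2)" by blast
qed

text \<open>The sum is the circle mean of \<open>\<psi>\<close> at \<open>s z\<close> times an inner
  product of \<open>\<eta>\<close> and \<open>q\<close>. Of the factor \<open>s^(2j)\<close>, one
  half comes from evaluating \<open>\<psi>\<close> at \<open>s z\<close>, the other from
  \<open>circ_mean_pairing\<close>. Bounding \<open>\<psi>\<close> by \<open>K\<close> times
  \<open>a\<close> leaves \<open>a q\<close>, which \<open>circ_mean_mate_le\<close>
  controls.\<close>

lemma pairing_bound:
  assumes \<eta>: "\<eta> \<in> hcarrier H2" and q: "q \<in> hcarrier H2" and s: "0 \<le> s" "s < 1" and K: "K > 0"
    and \<psi>: "\<And>z. cmod z = s \<Longrightarrow> cmod (poly \<psi> z) \<le> K * cmod (eval_fps a z)"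
  shows "cmod (\<Sum>j\<le>degree \<psi>. poly.coeff \<psi> j * of_real (s ^ (2 * j)) * pairing \<eta> q j) \<le> K * hnorm H2 \<eta> * sqrt (D2 q)"
proof -
  let ?E = "\<lambda>z. eval_vfps \<eta> (of_real s * cnj z)" and ?q = "\<lambda>z. eval_vfps q (of_real s * z)"
  let ?a = "\<lambda>z. eval_fps a (of_real s * z)"
  have cE0: "continuous_on (sphere 0 1) (\<lambda>z. eval_vfps \<eta> (of_real s * z))" by (intro continuous_eval_H2 \<eta> s)
  have cE: "continuous_on (sphere 0 1) ?E"
    by (rule continuous_on_compose2[OF cE0, where f = cnj]) (auto intro!: continuous_intros)
  have cq: "continuous_on (sphere 0 1) ?q" by (intro continuous_eval_H2 q s)
  have ca: "continuous_on (sphere 0 1) ?a" by (intro continuous_eval_a s)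
  have "(\<Sum>j\<le>degree \<psi>. poly.coeff \<psi> j * of_real (s ^ (2 * j)) * pairing \<eta> q j)
      = (\<Sum>j\<le>degree \<psi>. (poly.coeff \<psi> j * of_real (s ^ j)) * circ_mean (\<lambda>z. z ^ j * cinner (?E z) (?q z)))"
    unfolding circ_mean_pairing[OF \<eta> q s]
    by (intro sum.cong refl) (simp only: mult_2 power_add of_real_mult mult.assoc)
  also have "\<dots> = circ_mean (\<lambda>z. \<Sum>j\<le>degree \<psi>. (poly.coeff \<psi> j * of_real (s ^ j)) * (z ^ j * cinner (?E z) (?q z)))"
    unfolding circ_mean_cmult[symmetric]
    by (intro circ_mean_sum[symmetric] continuous_intros cinner.continuous_on cE cq)
  also have "\<dots> = circ_mean (\<lambda>z. poly \<psi> (of_real s * z) * cinner (?E z) (?q z))"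
    unfolding poly_altdef sum_distrib_right
    by (intro arg_cong[of _ _ circ_mean] ext sum.cong refl) (simp add: power_mult_distrib mult_ac)
  finally have eq: "(\<Sum>j\<le>degree \<psi>. poly.coeff \<psi> j * of_real (s ^ (2 * j)) * pairing \<eta> q j)
      = circ_mean (\<lambda>z. poly \<psi> (of_real s * z) * cinner (?E z) (?q z))" .
  show ?thesis
  proof (rule le_mult_of_amgm)
    show "0 \<le> K * hnorm H2 \<eta>" "0 \<le> sqrt (D2 q)" using K H2.hnorm_ge0[OF \<eta>] D2_ge0[OF q] by auto
    fix l :: real assume l: "l > 0"
    \<comment> \<open>With this weight the coefficients \<open>K * ?lK\<close> and
      \<open>K / ?lK\<close> become \<open>l * K^2\<close> and \<open>1 / l\<close>, as
      \<open>le_mult_of_amgm\<close> requires.\<close>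
    let ?lK = "l * K"
    have lK: "?lK > 0" using l K by simp
    have "2 * cmod (circ_mean (\<lambda>z. poly \<psi> (of_real s * z) * cinner (?E z) (?q z)))
        \<le> 2 * circ_mean (\<lambda>z. cmod (poly \<psi> (of_real s * z) * cinner (?E z) (?q z)))"
      by (intro mult_left_mono circ_mean_norm_le) auto
    also have "\<dots> = circ_mean (\<lambda>z. 2 * cmod (poly \<psi> (of_real s * z) * cinner (?E z) (?q z)))"
      by (simp add: circ_mean_rmult)
    also have "\<dots> \<le> circ_mean (\<lambda>z. (K * ?lK) * (norm (?E z))\<^sup>2 + (K / ?lK) * (cmod (?a z) * norm (?q z))\<^sup>2)"
    proof (rule circ_mean_mono)
      fix z :: complex assume z: "cmod z = 1"
      have "cmod (poly \<psi> (of_real s * z) * cinner (?E z) (?q z)) \<le> (K * cmod (?a z)) * (norm (?E z) * norm (?q z))"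
        unfolding norm_mult using s z K
        by (intro mult_mono \<psi> cinner.cauchy_schwarz) (auto simp: norm_mult)
      hence "2 * cmod (poly \<psi> (of_real s * z) * cinner (?E z) (?q z)) \<le> K * (2 * norm (?E z) * (cmod (?a z) * norm (?q z)))"
        by (simp add: mult_ac)
      also have "2 * norm (?E z) * (cmod (?a z) * norm (?q z))
          \<le> ?lK * (norm (?E z))\<^sup>2 + (cmod (?a z) * norm (?q z))\<^sup>2 / ?lK"
      proof -
        define u where "u = norm (?E z)"
        define v where "v = cmod (?a z) * norm (?q z)"
        have "0 \<le> (?lK * u - v)\<^sup>2 / ?lK" using lK by simp
        also have "\<dots> = ?lK * u\<^sup>2 + v\<^sup>2 / ?lK - 2 * u * v"
          using lK l K by (simp add: power2_diff divide_simps) (simp add: power2_eq_square algebra_simps)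
        finally show ?thesis by (simp add: u_def v_def)
      qed
      finally show "2 * cmod (poly \<psi> (of_real s * z) * cinner (?E z) (?q z))
          \<le> (K * ?lK) * (norm (?E z))\<^sup>2 + (K / ?lK) * (cmod (?a z) * norm (?q z))\<^sup>2"
        using K by (simp add: algebra_simps)
    qed (intro continuous_intros cinner.continuous_on cE cq ca)+
    also have "\<dots> = (K * ?lK) * circ_mean (\<lambda>z. (norm (?E z))\<^sup>2) + (K / ?lK) * circ_mean (\<lambda>z. (cmod (?a z) * norm (?q z))\<^sup>2)"
      by (subst circ_mean_add) (use l in \<open>auto simp: circ_mean_rmult intro!: continuous_intros cE cq ca\<close>)
    also have "circ_mean (\<lambda>z. (norm (?E z))\<^sup>2) = circ_mean (\<lambda>z. (norm (eval_vfps \<eta> (of_real s * z)))\<^sup>2)"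
      using circ_mean_cnj[of "\<lambda>z. (norm (eval_vfps \<eta> (of_real s * z)))\<^sup>2"] cE0 by (simp add: continuous_intros)
    also have "(K * ?lK) * \<dots> + (K / ?lK) * circ_mean (\<lambda>z. (cmod (?a z) * norm (?q z))\<^sup>2)
        \<le> (K * ?lK) * (hnorm H2 \<eta>)\<^sup>2 + (K / ?lK) * D2 q"
      using K lK l by (intro add_mono mult_left_mono circ_mean_le_hnorm_H2 circ_mean_mate_le \<eta> q s) auto
    also have "\<dots> = l * (K * hnorm H2 \<eta>)\<^sup>2 + (sqrt (D2 q))\<^sup>2 / l"
      using K l D2_ge0[OF q] by (simp add: power2_eq_square field_simps)
    finally show "2 * cmod (\<Sum>j\<le>degree \<psi>. poly.coeff \<psi> j * of_real (s ^ (2 * j)) * pairing \<eta> q j)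
        \<le> l * (K * hnorm H2 \<eta>)\<^sup>2 + (sqrt (D2 q))\<^sup>2 / l" unfolding eq .
  qed
qed

lemma defect_form:
  assumes "cmod z < 1"
  shows "hform \<lparr>hcarrier = (UNIV :: 'd set), hinner = (\<lambda>x y. cinner x y - B z x * cnj (B z y))\<rparr>"
proof
  fix x y v :: 'd and c
  show "0 \<le> Re (hinner \<lparr>hcarrier = (UNIV :: 'd set), hinner = (\<lambda>x y. cinner x y - B z x * cnj (B z y))\<rparr> x x)"
    using schur_classD(3)[OF B assms, of x] unfolding complex_norm_square[symmetric]
    by (simp add: cinner_self complex_norm_square[symmetric] power_mono)
qed (auto simp: cinner_add_left cinner_scaleC_left schur_classD(1,2)[OF B assms] algebra_simps
    cinner_commute[symmetric])

text \<open>At each point the form from \<open>defect_form\<close> is nonnegative, so its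
  Cauchy-Schwarz inequality applies under the integral and the factor \<open>p\<close> costs its
  supremum. The means of the two diagonal terms converge to \<open>D2 g\<close> and
  \<open>D2 q\<close>.\<close>

lemma defect_form_bound:
  assumes g: "g \<in> hcarrier H2" and q: "q \<in> hcarrier H2" and M: "M > 0"
    and p: "\<And>z. cmod z < 1 \<Longrightarrow> cmod (poly p z) \<le> M"
  shows "cmod (\<Sum>j\<le>degree p. poly.coeff p j * (hinner H2 (upshift j g) q - hinner H2 (upshift j (T g)) (T q)))
    \<le> M * sqrt (D2 g) * sqrt (D2 q)"
proof -
  let ?S = "\<Sum>j\<le>degree p. poly.coeff p j * (hinner H2 (upshift j g) q - hinner H2 (upshift j (T g)) (T q))"
  let ?F = "\<lambda>w. cinner (eval_vfps g w) (eval_vfps q w) - B w (eval_vfps g w) * cnj (B w (eval_vfps q w))"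
  let ?n = "\<lambda>q w. (norm (eval_vfps q w))\<^sup>2 - (cmod (B w (eval_vfps q w)))\<^sup>2"
  let ?w = "\<lambda>k z. complex_of_real (rad k) * z"
  have r: "0 \<le> rad k" "rad k < 1" for k using rad_bounds by auto
  have w: "cmod (?w k z) < 1" if "cmod z = 1" for k z using r that by (simp add: norm_mult)
  have cF: "continuous_on (sphere 0 1) (\<lambda>z. ?F (?w k z))" for k
    by (intro continuous_intros cinner.continuous_on continuous_eval_H2 continuous_eval_T g q r)
  have cn: "continuous_on (sphere 0 1) (\<lambda>z. ?n u (?w k z))" if "u \<in> hcarrier H2" for k u
    by (intro continuous_intros continuous_eval_H2 continuous_eval_T that r)
  have lim: "(\<lambda>k. circ_mean (\<lambda>z. poly p (?w k z) * ?F (?w k z))) \<longlonglongrightarrow> ?S"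
  proof -
    have "circ_mean (\<lambda>z. poly p (?w k z) * ?F (?w k z)) =
      (\<Sum>j\<le>degree p. poly.coeff p j *
        (circ_mean (\<lambda>z. cinner (eval_vfps (upshift j g) (?w k z)) (eval_vfps q (?w k z)))
         - circ_mean (\<lambda>z. cinner (eval_vfps (upshift j (T g)) (?w k z)) (eval_vfps (T q) (?w k z)))))" for k
    proof -
      have "circ_mean (\<lambda>z. poly p (?w k z) * ?F (?w k z)) =
         circ_mean (\<lambda>z. \<Sum>j\<le>degree p. poly.coeff p j *
          (cinner (eval_vfps (upshift j g) (?w k z)) (eval_vfps q (?w k z))
          - cinner (eval_vfps (upshift j (T g)) (?w k z)) (eval_vfps (T q) (?w k z))))"
        unfolding circ_mean_def
      proof (intro arg_cong2[of _ _ _ _ scaleR] refl Bochner_Integration.integral_cong)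
        fix t :: real
        have w1: "cmod (?w k (cis t)) < 1" using w by simp
        have "cinner (eval_vfps (upshift j g) (?w k (cis t))) (eval_vfps q (?w k (cis t)))
          - cinner (eval_vfps (upshift j (T g)) (?w k (cis t))) (eval_vfps (T q) (?w k (cis t)))
          = ?w k (cis t) ^ j * ?F (?w k (cis t))" for j
          unfolding eval_upshift[OF g w1] eval_upshift[OF T_mem[OF g] w1] cinner_scaleC_left
            eval_vfps_complex[of "T g"] eval_vfps_complex[of "T q"]
            eval_toeplitz(2)[OF B g w1] eval_toeplitz(2)[OF B q w1] cinner_complex
          by (simp only: right_diff_distrib mult.assoc scaleC_complex)
        thus "poly p (?w k (cis t)) * ?F (?w k (cis t)) = (\<Sum>j\<le>degree p. poly.coeff p j *
          (cinner (eval_vfps (upshift j g) (?w k (cis t))) (eval_vfps q (?w k (cis t)))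
          - cinner (eval_vfps (upshift j (T g)) (?w k (cis t))) (eval_vfps (T q) (?w k (cis t)))))"
          by (simp only: poly_altdef sum_distrib_right mult.assoc)
      qed
      also have "\<dots> = (\<Sum>j\<le>degree p. poly.coeff p j *
        circ_mean (\<lambda>z. cinner (eval_vfps (upshift j g) (?w k z)) (eval_vfps q (?w k z))
          - cinner (eval_vfps (upshift j (T g)) (?w k z)) (eval_vfps (T q) (?w k z))))"
        unfolding circ_mean_cmult[symmetric]
        by (intro circ_mean_sum continuous_intros cinner.continuous_on continuous_eval_H2 upshift_H2 g q T_mem r)
      also have "\<dots> = (\<Sum>j\<le>degree p. poly.coeff p j *
        (circ_mean (\<lambda>z. cinner (eval_vfps (upshift j g) (?w k z)) (eval_vfps q (?w k z)))
         - circ_mean (\<lambda>z. cinner (eval_vfps (upshift j (T g)) (?w k z)) (eval_vfps (T q) (?w k z)))))"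
        by (intro sum.cong refl arg_cong2[of _ _ _ _ "(*)"] circ_mean_diff
            cinner.continuous_on continuous_eval_H2 upshift_H2 g q T_mem r)
      finally show ?thesis .
    qed
    thus ?thesis
      by (simp del: cinner_complex) (intro tendsto_sum tendsto_mult_left tendsto_diff circ_mean_cinner_tendsto upshift_H2 g q T_mem)
  qed
  show ?thesis
  proof (rule le_mult_of_amgm)
    show "0 \<le> M * sqrt (D2 g)" "0 \<le> sqrt (D2 q)" using M D2_ge0 g q by auto
    fix l :: real assume l: "l > 0"
    let ?l = "l * M"
    have lp: "?l > 0" using l M by simp
    have "2 * cmod ?S \<le> M * (?l * D2 g + D2 q / ?l)"
    proof (rule LIMSEQ_le)
      show "(\<lambda>k. 2 * cmod (circ_mean (\<lambda>z. poly p (?w k z) * ?F (?w k z)))) \<longlonglongrightarrow> 2 * cmod ?S"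
        by (intro tendsto_intros lim)
      show "(\<lambda>k. M * (?l * circ_mean (\<lambda>z. ?n g (?w k z)) + circ_mean (\<lambda>z. ?n q (?w k z)) / ?l))
          \<longlonglongrightarrow> M * (?l * D2 g + D2 q / ?l)"
        using lp by (intro tendsto_intros circ_mean_D2 g q) auto
      have "2 * cmod (circ_mean (\<lambda>z. poly p (?w k z) * ?F (?w k z))) \<le>
          M * (?l * circ_mean (\<lambda>z. ?n g (?w k z)) + circ_mean (\<lambda>z. ?n q (?w k z)) / ?l)" for k
      proof -
        have "2 * cmod (circ_mean (\<lambda>z. poly p (?w k z) * ?F (?w k z)))
            \<le> circ_mean (\<lambda>z. 2 * cmod (poly p (?w k z) * ?F (?w k z)))"
          unfolding circ_mean_rmult by (intro mult_left_mono circ_mean_norm_le) auto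
        also have "\<dots> \<le> circ_mean (\<lambda>z. (M * ?l) * ?n g (?w k z) + (M / ?l) * ?n q (?w k z))"
        proof (rule circ_mean_mono)
          fix z :: complex assume z: "cmod z = 1"
          interpret F: hform "\<lparr>hcarrier = (UNIV :: 'd set), hinner = (\<lambda>x y. cinner x y - B (?w k z) x * cnj (B (?w k z) y))\<rparr>"
            by (rule defect_form[OF w[OF z]])
          let ?W = "\<lparr>hcarrier = (UNIV :: 'd set), hinner = (\<lambda>x y. cinner x y - B (?w k z) x * cnj (B (?w k z) y))\<rparr>"
          have nn: "(hnorm ?W x)\<^sup>2 = (norm x)\<^sup>2 - (cmod (B (?w k z) x))\<^sup>2" for x
            by (simp add: F.hnorm_sq cinner_self complex_norm_square[symmetric])
          define u where "u = hnorm ?W (eval_vfps g (?w k z))"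
          define v where "v = hnorm ?W (eval_vfps q (?w k z))"
          have "cmod (poly p (?w k z) * ?F (?w k z)) \<le> M * (u * v)"
            unfolding norm_mult u_def v_def using M
              F.cauchy_schwarz[of "eval_vfps g (?w k z)" "eval_vfps q (?w k z)"]
            by (intro mult_mono p w z) auto
          hence "2 * cmod (poly p (?w k z) * ?F (?w k z)) \<le> M * (2 * u * v)" by simp
          also have "2 * u * v \<le> ?l * u\<^sup>2 + v\<^sup>2 / ?l"
          proof -
            have "0 \<le> (?l * u - v)\<^sup>2 / ?l" using lp by simp
            also have "\<dots> = ?l * u\<^sup>2 + v\<^sup>2 / ?l - 2 * u * v"
              using lp l M by (simp add: power2_diff divide_simps) (simp add: power2_eq_square algebra_simps)
            finally show ?thesis by simp
          qed
          finally show "2 * cmod (poly p (?w k z) * ?F (?w k z)) \<le> (M * ?l) * ?n g (?w k z) + (M / ?l) * ?n q (?w k z)"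
            using M nn by (simp add: u_def v_def distrib_left)
        next
          show "continuous_on (sphere 0 1) (\<lambda>z. 2 * cmod (poly p (?w k z) * ?F (?w k z)))"
            by (intro continuous_intros cinner.continuous_on continuous_eval_H2 continuous_eval_T g q r)
          show "continuous_on (sphere 0 1) (\<lambda>z. (M * ?l) * ?n g (?w k z) + (M / ?l) * ?n q (?w k z))"
            by (intro continuous_on_add continuous_on_mult continuous_on_const cn g q)
        qed
        also have "\<dots> = (M * ?l) * circ_mean (\<lambda>z. ?n g (?w k z)) + (M / ?l) * circ_mean (\<lambda>z. ?n q (?w k z))"
          unfolding circ_mean_rmult[symmetric]
          by (rule circ_mean_add) (intro continuous_on_mult continuous_on_const cn g q)+
        finally show ?thesis using M by (simp add: distrib_left)
      qed
      thus "\<exists>N. \<forall>n\<ge>N. 2 * cmod (circ_mean (\<lambda>z. poly p (?w n z) * ?F (?w n z)))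
          \<le> M * (?l * circ_mean (\<lambda>z. ?n g (?w n z)) + circ_mean (\<lambda>z. ?n q (?w n z)) / ?l)" by blast
    qed
    also have "M * (?l * D2 g + D2 q / ?l) = l * (M * sqrt (D2 g))\<^sup>2 + (sqrt (D2 q))\<^sup>2 / l"
      using M l D2_ge0[OF g] D2_ge0[OF q] by (simp add: power2_eq_square field_simps)
    finally show "2 * cmod ?S \<le> l * (M * sqrt (D2 g))\<^sup>2 + (sqrt (D2 q))\<^sup>2 / l" .
  qed
qed

end

section \<open>Hankel coefficients and polynomial multipliers of H(B)\<close>

context schur_mate begin

text \<open>Extends \<open>Ts x\<close> to negative indices: the entry at \<open>-n\<close> is the
  constant coefficient of \<open>Ts (z^n x)\<close>. Index 0 is set to zero since that entry belongs
  to \<open>Ts x\<close> itself.\<close>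

definition hankel :: "complex fps \<Rightarrow> 'd fps" where
  "hankel x = Abs_fps (\<lambda>n. if n = 0 then 0 else fps_nth (Ts (fps_X ^ n * x)) 0)"

lemma hankel_0: "fps_nth (hankel x) 0 = 0"
  by (simp add: hankel_def)

lemma Ts_X_power_nth:
  assumes x: "x \<in> hcarrier H2"
  shows "fps_nth (Ts (fps_X ^ j * x)) n =
    (if n < j then fps_nth (hankel x) (j - n) else fps_nth (Ts x) (n - j))"
proof (cases "n < j")
  case True
  thus ?thesis using arg_cong[OF Ts_X_power[OF x, of n "j - n"], of "\<lambda>f. fps_nth f 0"]
    by (simp add: hankel_def)
next
  case False
  thus ?thesis using arg_cong[OF Ts_X_power[OF x, of j 0], of "\<lambda>f. fps_nth f (n - j)"] by simp
qed

text \<open>Multiplication by \<open>z^k\<close> keeps the norm of \<open>x\<close>, while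
  \<open>Ts (z^k x)\<close> consists of \<open>k\<close> Hankel coefficients followed by
  \<open>Ts x\<close>. Contractivity of \<open>Ts\<close> leaves at most \<open>N x\<close> for the
  Hankel coefficients.\<close>

lemma hankel_H2:
  assumes x: "x \<in> hcarrier H2"
  shows "hankel x \<in> hcarrier H2" "hnorm H2 (hankel x) \<le> sqrt (N x)"
proof -
  have "(\<Sum>n<M. (norm (fps_nth (hankel x) n))\<^sup>2) \<le> (sqrt (N x))\<^sup>2" for M
  proof (cases M)
    case (Suc k)
    have Xx: "fps_X ^ k * x \<in> hcarrier H2" "hnorm H2 (fps_X ^ k * x) = hnorm H2 x"
      using fps_X_power_H2[OF x] by auto
    have "(\<Sum>n<Suc k. (norm (fps_nth (hankel x) n))\<^sup>2) = (\<Sum>n<k. (norm (fps_nth (hankel x) (Suc n)))\<^sup>2)"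
      by (subst sum.lessThan_Suc_shift) (simp add: hankel_def)
    \<comment> \<open>The Hankel coefficients occur in \<open>Ts (z^k x)\<close> in reversed
      order.\<close>
    also have "\<dots> = (\<Sum>n<k. (norm (fps_nth (hankel x) (Suc (k - Suc n))))\<^sup>2)"
      by (rule sum.nat_diff_reindex[symmetric])
    also have "\<dots> = (\<Sum>n<k. (norm (fps_nth (Ts (fps_X ^ k * x)) n))\<^sup>2)"
      by (intro sum.cong refl) (auto simp: Ts_X_power_nth x Suc_diff_Suc)
    also have "\<dots> = (hnorm H2 (Ts (fps_X ^ k * x)))\<^sup>2 - (hnorm H2 (Ts x))\<^sup>2"
      using shift_H2(2)[OF Ts_mem[OF Xx(1)], of k] Ts_X_power[OF x, of k 0] by simp
    also have "\<dots> \<le> N x"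
      using power_mono[OF Ts_norm[OF Xx(1)] H2.hnorm_ge0[OF Ts_mem[OF Xx(1)]], of 2]
      by (simp add: N_def Xx)
    finally show ?thesis using Suc N_ge0[OF x] by simp
  qed (use N_ge0[OF x] in simp)
  from H2_boundI[OF _ this] N_ge0[OF x]
  show "hankel x \<in> hcarrier H2" "hnorm H2 (hankel x) \<le> sqrt (N x)" by auto
qed

lemma hinner_Ts_X_power:
  assumes x: "x \<in> hcarrier H2" and q: "q \<in> hcarrier H2"
  shows "hinner H2 (Ts (fps_X ^ j * x)) q = hinner H2 (upshift j (Ts x)) q + pairing (hankel x) q j"
proof -
  let ?d = "Ts (fps_X ^ j * x) - upshift j (Ts x)"
  have mem: "Ts (fps_X ^ j * x) \<in> hcarrier H2" "upshift j (Ts x) \<in> hcarrier H2"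
    using x by (auto intro: Ts_mem fps_X_power_H2 upshift_H2)
  have d: "fps_nth ?d n = (if n \<le> j then fps_nth (hankel x) (j - n) else 0)" for n
    using Ts_X_power_nth[OF x, of j n] by (auto simp: hankel_0)
  have "hinner H2 ?d q = (\<Sum>n\<le>j. cinner (fps_nth ?d n) (fps_nth q n))"
    unfolding hinner_H2 by (rule suminf_finite) (auto simp: d simp del: fps_sub_nth)
  also have "\<dots> = (\<Sum>n\<le>j. cinner (fps_nth (hankel x) (j - n)) (fps_nth q n))"
    by (intro sum.cong refl) (simp add: d del: fps_sub_nth)
  also have "\<dots> = pairing (hankel x) q j"
    unfolding pairing_def by (rule sum.reindex_bij_witness[of _ "\<lambda>i. j - i" "\<lambda>i. j - i"]) auto
  finally show ?thesis using mem q by (simp add: H2.inner_diff_left algebra_simps)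
qed

lemma Ts_adj': "u \<in> hcarrier H2 \<Longrightarrow> y \<in> hcarrier H2 \<Longrightarrow> hinner H2 y (T u) = hinner H2 (Ts y) u"
  using H2.inner_commute[of y "T u"] H2.inner_commute[of "Ts y" u] by (simp add: T_mem Ts_mem Ts_adj)

lemma fps_conv_radius_of_poly: "fps_conv_radius (fps_of_poly p :: complex fps) \<ge> 1"
  by simp

text \<open>Decompose \<open>h = defect h + T q\<close> with \<open>q = Ts h\<close>. Against
  \<open>defect h\<close> the supremum of \<open>\<phi>\<close> suffices. Against
  \<open>T q\<close>, moving the powers of \<open>z\<close> across the adjoint leaves a shifted
  part, covered by \<open>defect_form_bound\<close>, and a Hankel part, covered by
  \<open>pairing_bound\<close>.\<close>

lemma defect_mult_bound:
  assumes x: "x \<in> hcarrier H2" and h: "h \<in> hcarrier H2"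
    and s: "0 < s" "s < 1" and coeff: "\<And>j. poly.coeff \<phi> j = poly.coeff \<psi> j * of_real (s ^ (2 * j))"
    and M: "M > 0" "\<And>z. cmod z < 1 \<Longrightarrow> cmod (poly \<phi> z) \<le> M"
    and K: "K > 0" "\<And>z. cmod z = s \<Longrightarrow> cmod (poly \<psi> z) \<le> K * cmod (eval_fps a z)"
  shows "cmod (hinner H2 (fps_of_poly \<phi> * defect x) h) \<le> (2 * M + K) * sqrt (N x) * sqrt (N h)"
proof -
  have "poly.coeff \<phi> j = 0 \<longleftrightarrow> poly.coeff \<psi> j = 0" for j using coeff[of j] s by simp
  hence deg: "degree \<phi> = degree \<psi>" by (simp add: degree_def)
  define g where "g = Ts x"
  define q where "q = Ts h"
  have g: "g \<in> hcarrier H2" and q: "q \<in> hcarrier H2" using x h by (auto simp: g_def q_def Ts_mem)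
  have dx: "defect x \<in> hcarrier H2" and dh: "defect h \<in> hcarrier H2" using x h defect_mem by auto
  have Xd: "fps_X ^ j * defect x \<in> hcarrier H2" for j using dx by (rule fps_X_power_H2)
  have pd: "fps_of_poly \<phi> * defect x \<in> hcarrier H2" "hnorm H2 (fps_of_poly \<phi> * defect x) \<le> M * hnorm H2 (defect x)"
    using H2_mult_bounded[OF dx fps_conv_radius_of_poly, of \<phi> M] M(2) by auto
  have sq: "sqrt (D2 g) \<le> sqrt (N x)" "sqrt (D2 q) \<le> sqrt (N h)"
    using N_Ts_le(1)[OF x] N_Ts_le(1)[OF h] by (auto simp: D2_def g_def q_def)
  have summand: "hinner H2 (fps_X ^ j * defect x) (T q) =
      (hinner H2 (upshift j g) q - hinner H2 (upshift j (T g)) (T q)) + pairing (hankel x) q j" for j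
  proof -
    have m: "fps_X ^ j * x \<in> hcarrier H2" "fps_X ^ j * T g \<in> hcarrier H2" "T q \<in> hcarrier H2"
      using x g q by (auto intro: fps_X_power_H2 T_mem)
    have "fps_X ^ j * defect x = fps_X ^ j * x - fps_X ^ j * T g"
      by (simp add: defect_def g_def right_diff_distrib)
    hence "hinner H2 (fps_X ^ j * defect x) (T q) = hinner H2 (fps_X ^ j * x) (T q) - hinner H2 (fps_X ^ j * T g) (T q)"
      using m by (simp add: H2.inner_diff_left)
    also have "hinner H2 (fps_X ^ j * x) (T q) = hinner H2 (upshift j g) q + pairing (hankel x) q j"
      using m q x by (simp add: Ts_adj' hinner_Ts_X_power g_def)
    finally show ?thesis by (simp add: upshift_complex)
  qed
  have "hinner H2 (fps_of_poly \<phi> * defect x) (T q) =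
      (\<Sum>j\<le>degree \<phi>. poly.coeff \<phi> j * hinner H2 (fps_X ^ j * defect x) (T q))"
    unfolding fps_of_poly_mult_sum using Xd T_mem[OF q]
    by (simp add: H2.inner_sum_left H2.inner_scale_left H2.scale_mem)
  also have "\<dots> = (\<Sum>j\<le>degree \<phi>. poly.coeff \<phi> j * (hinner H2 (upshift j g) q - hinner H2 (upshift j (T g)) (T q)))
      + (\<Sum>j\<le>degree \<psi>. poly.coeff \<psi> j * of_real (s ^ (2 * j)) * pairing (hankel x) q j)"
    unfolding summand deg by (simp add: coeff sum.distrib distrib_left)
  finally have eq: "hinner H2 (fps_of_poly \<phi> * defect x) (T q) =
      (\<Sum>j\<le>degree \<phi>. poly.coeff \<phi> j * (hinner H2 (upshift j g) q - hinner H2 (upshift j (T g)) (T q)))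
      + (\<Sum>j\<le>degree \<psi>. poly.coeff \<psi> j * of_real (s ^ (2 * j)) * pairing (hankel x) q j)" .
  have b1: "cmod (\<Sum>j\<le>degree \<phi>. poly.coeff \<phi> j * (hinner H2 (upshift j g) q - hinner H2 (upshift j (T g)) (T q)))
      \<le> M * sqrt (D2 g) * sqrt (D2 q)"
    by (rule defect_form_bound[OF g q M(1)]) (rule M(2))
  have b2: "cmod (\<Sum>j\<le>degree \<psi>. poly.coeff \<psi> j * of_real (s ^ (2 * j)) * pairing (hankel x) q j)
      \<le> K * hnorm H2 (hankel x) * sqrt (D2 q)"
    by (rule pairing_bound[OF hankel_H2(1)[OF x] q less_imp_le[OF s(1)] s(2) K(1)]) (rule K(2))
  have "cmod (hinner H2 (fps_of_poly \<phi> * defect x) (T q)) \<le>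
      M * sqrt (D2 g) * sqrt (D2 q) + K * hnorm H2 (hankel x) * sqrt (D2 q)"
    unfolding eq by (rule order_trans[OF norm_triangle_ineq add_mono[OF b1 b2]])
  also have "\<dots> \<le> M * sqrt (N x) * sqrt (N h) + K * sqrt (N x) * sqrt (N h)"
    using sq hankel_H2(2)[OF x] M(1) K(1) N_ge0[OF x] D2_ge0[OF g] D2_ge0[OF q] H2.hnorm_ge0[OF hankel_H2(1)[OF x]]
    by (intro add_mono mult_mono) auto
  finally have 1: "cmod (hinner H2 (fps_of_poly \<phi> * defect x) (T q)) \<le>
      M * sqrt (N x) * sqrt (N h) + K * sqrt (N x) * sqrt (N h)" .
  have "cmod (hinner H2 (fps_of_poly \<phi> * defect x) (defect h)) \<le> hnorm H2 (fps_of_poly \<phi> * defect x) * hnorm H2 (defect h)"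
    by (intro H2.cauchy_schwarz pd dh)
  also have "\<dots> \<le> (M * sqrt (N x)) * sqrt (N h)"
  proof (intro mult_mono)
    have "hnorm H2 (defect x) \<le> sqrt (N x)" "hnorm H2 (defect h) \<le> sqrt (N h)"
      using N_Ts_le(2)[OF x] N_Ts_le(2)[OF h] by (auto intro: real_le_rsqrt)
    thus "hnorm H2 (defect h) \<le> sqrt (N h)" "hnorm H2 (fps_of_poly \<phi> * defect x) \<le> M * sqrt (N x)"
      using M(1) by (auto intro: order_trans[OF pd(2)] mult_left_mono)
  qed (use M(1) N_ge0[OF x] H2.hnorm_ge0[OF dh] in auto)
  finally have 2: "cmod (hinner H2 (fps_of_poly \<phi> * defect x) (defect h)) \<le> (M * sqrt (N x)) * sqrt (N h)" .
  have "h = defect h + T q" by (simp add: defect_def q_def)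
  hence "hinner H2 (fps_of_poly \<phi> * defect x) h = hinner H2 (fps_of_poly \<phi> * defect x) (defect h)
      + hinner H2 (fps_of_poly \<phi> * defect x) (T q)"
    using H2.inner_add_right[OF pd(1) dh T_mem[OF q]] by simp
  with 1 2 norm_triangle_ineq[of "hinner H2 (fps_of_poly \<phi> * defect x) (defect h)"
      "hinner H2 (fps_of_poly \<phi> * defect x) (T q)"]
  show ?thesis by (simp add: algebra_simps)
qed

definition multiplier :: "complex poly \<Rightarrow> real \<Rightarrow> bool" where
  "multiplier p C \<longleftrightarrow> (\<forall>f\<in>hcarrier HB. fps_of_poly p * f \<in> hcarrier HB \<and>
     hnorm HB (fps_of_poly p * f) \<le> C * hnorm HB f)"

text \<open>The estimate is known on defect vectors, which are dense. Approximation in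
  \<open>HB\<close> gives Hardy space convergence after multiplication by the bounded polynomial,
  which is enough to pass to the limit in the dual bound.\<close>

lemma multiplierI:
  assumes s: "0 < s" "s < 1" and coeff: "\<And>j. poly.coeff \<phi> j = poly.coeff \<psi> j * of_real (s ^ (2 * j))"
    and M: "M > 0" "\<And>z. cmod z < 1 \<Longrightarrow> cmod (poly \<phi> z) \<le> M"
    and K: "K > 0" "\<And>z. cmod z = s \<Longrightarrow> cmod (poly \<psi> z) \<le> K * cmod (eval_fps a z)"
  shows "multiplier \<phi> (2 * M + K)"
  unfolding multiplier_def
proof
  fix f assume f: "f \<in> hcarrier HB"
  have fH: "f \<in> hcarrier H2" using f by (rule dBR_H2)
  let ?C = "2 * M + K" and ?p = "fps_of_poly \<phi>"
  have pm: "?p * u \<in> hcarrier H2" "hnorm H2 (?p * u) \<le> M * hnorm H2 u" if "u \<in> hcarrier H2" for u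
    using H2_mult_bounded[OF that fps_conv_radius_of_poly, of \<phi> M] M(2) by auto
  obtain x where x: "\<And>n. x n \<in> hcarrier H2" "(\<lambda>n. hnorm HB (defect (x n) - f)) \<longlonglongrightarrow> 0"
    using defect_approx[OF f] by blast
  note dB = dBR_defect(1)[OF x(1)] and dH = defect_mem[OF x(1)]
  have lim: "(\<lambda>n. hnorm H2 (?p * defect (x n) - ?p * f)) \<longlonglongrightarrow> 0"
  proof (rule Lim_null_comparison)
    show "(\<lambda>n. M * hnorm HB (defect (x n) - f)) \<longlonglongrightarrow> 0" using tendsto_mult_left[OF x(2), of M] by simp
    show "\<forall>\<^sub>F n in sequentially. norm (hnorm H2 (?p * defect (x n) - ?p * f)) \<le> M * hnorm HB (defect (x n) - f)"
    proof (intro always_eventually allI)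
      fix n
      have "hnorm H2 (?p * (defect (x n) - f)) \<le> M * hnorm H2 (defect (x n) - f)"
        by (intro pm H2.diff_mem dH fH)
      also have "\<dots> \<le> M * hnorm HB (defect (x n) - f)"
        using M(1) by (intro mult_left_mono hnorm_le_dBR dBR.diff_mem dB f) auto
      finally show "norm (hnorm H2 (?p * defect (x n) - ?p * f)) \<le> M * hnorm HB (defect (x n) - f)"
        using pm(1) dH[of n] fH by (simp add: right_diff_distrib H2.hnorm_ge0 H2.diff_mem)
    qed
  qed
  have bd: "cmod (hinner H2 (?p * f) h) \<le> ?C * hnorm HB f * sqrt (N h)" if h: "h \<in> hcarrier H2" for h
  proof (rule LIMSEQ_le)
    show "(\<lambda>n. cmod (hinner H2 (?p * defect (x n)) h)) \<longlonglongrightarrow> cmod (hinner H2 (?p * f) h)"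
      by (intro tendsto_norm H2.tendsto_inner_left pm dH fH h lim)
    show "(\<lambda>n. ?C * hnorm HB (defect (x n)) * sqrt (N h)) \<longlonglongrightarrow> ?C * hnorm HB f * sqrt (N h)"
      by (intro tendsto_intros dBR.tendsto_hnorm dB f x)
    have "cmod (hinner H2 (?p * defect (x n)) h) \<le> ?C * hnorm HB (defect (x n)) * sqrt (N h)" for n
      using defect_mult_bound[OF x(1) h s coeff M K] by (simp add: dBR_defect(2)[OF x(1)])
    thus "\<exists>N'. \<forall>n\<ge>N'. cmod (hinner H2 (?p * defect (x n)) h) \<le> ?C * hnorm HB (defect (x n)) * sqrt (N h)"
      by blast
  qed
  have "0 \<le> ?C * hnorm HB f" using M(1) K(1) dBR.hnorm_ge0[OF f] by simp
  from dBR_boundI[OF pm(1)[OF fH] this bd]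
  show "?p * f \<in> hcarrier HB \<and> hnorm HB (?p * f) \<le> ?C * hnorm HB f" by auto
qed

lemma mate_lower_bound:
  assumes s: "0 \<le> s" "s < 1"
  obtains c where "c > 0" "\<And>z. cmod z = s \<Longrightarrow> c \<le> cmod (eval_fps a z)"
proof -
  have cont: "continuous_on (sphere 0 1) (\<lambda>z. cmod (eval_fps a (of_real s * z)))"
    by (intro continuous_intros continuous_eval_a s)
  obtain z0 where z0: "cmod z0 = 1"
    "\<And>z. cmod z = 1 \<Longrightarrow> cmod (eval_fps a (of_real s * z0)) \<le> cmod (eval_fps a (of_real s * z))"
    using continuous_attains_inf[OF compact_sphere _ cont] by auto
  let ?c = "cmod (eval_fps a (of_real s * z0))"
  have "?c > 0" using a_nz[of "of_real s * z0"] z0(1) s by (simp add: norm_mult)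
  moreover have "?c \<le> cmod (eval_fps a z)" if z: "cmod z = s" for z
  proof (cases "s = 0")
    case False
    hence "z = of_real s * (z / of_real s)" "cmod (z / of_real s) = 1" using z s by (auto simp: norm_divide)
    thus ?thesis using z0(2) by metis
  qed (use z z0 in auto)
  ultimately show thesis using that by blast
qed

text \<open>Take \<open>\<psi> = z^j / s^(2j)\<close>: its dilation is \<open>z^j\<close>, and its
  modulus on radius \<open>s\<close> is \<open>s^(-j)\<close>, comparable to \<open>a\<close> there
  because \<open>a\<close> is bounded below on that circle.\<close>

lemma X_power_multiplier:
  assumes s: "0 < s" "s < 1"
  obtains c where "c > 0"
    "\<And>j f. f \<in> hcarrier HB \<Longrightarrow> fps_X ^ j * f \<in> hcarrier HB"
    "\<And>j f. f \<in> hcarrier HB \<Longrightarrow> hnorm HB (fps_X ^ j * f) \<le> (2 + c * (1 / s) ^ j) * hnorm HB f"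
proof -
  obtain c where c: "c > 0" "\<And>z. cmod z = s \<Longrightarrow> c \<le> cmod (eval_fps a z)"
    using mate_lower_bound[of s] s by auto
  have "multiplier (monom 1 j) (2 * 1 + (1 / c) * (1 / s) ^ j)" for j
  proof (rule multiplierI[OF s, where \<psi> = "monom (of_real (1 / s ^ (2 * j))) j"])
    show "poly.coeff (monom 1 j) i = poly.coeff (monom (of_real (1 / s ^ (2 * j))) j) i * complex_of_real (s ^ (2 * i))" for i
      using s by (simp flip: of_real_mult)
    show "cmod (poly (monom 1 j) z) \<le> 1" if "cmod z < 1" for z
      using that by (simp add: poly_monom norm_power power_le_one)
    show "0 < (1 / c) * (1 / s) ^ j" using c s by simp
    fix z assume z: "cmod z = s"
    have "cmod (poly (monom (of_real (1 / s ^ (2 * j))) j) z) = s ^ j / s ^ (2 * j)"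
      using s z by (simp add: poly_monom norm_mult norm_power norm_divide)
    also have "\<dots> = (1 / s) ^ j" using s by (simp add: mult_2 power_add power_divide)
    also have "\<dots> \<le> (1 / s) ^ j * (cmod (eval_fps a z) / c)"
    proof -
      have "(1 / s) ^ j * 1 \<le> (1 / s) ^ j * (cmod (eval_fps a z) / c)"
        using s c(1) c(2)[OF z] by (intro mult_left_mono) auto
      thus ?thesis by simp
    qed
    finally show "cmod (poly (monom (of_real (1 / s ^ (2 * j))) j) z) \<le> (1 / c) * (1 / s) ^ j * cmod (eval_fps a z)"
      by simp
  qed simp
  thus thesis using that[of "1 / c"] c(1) by (auto simp: multiplier_def fps_of_poly_monom)
qed

lemma poly_mult_dBR:
  assumes f: "f \<in> hcarrier HB" shows "fps_of_poly p * f \<in> hcarrier HB"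
proof -
  obtain c where "\<And>j f. f \<in> hcarrier HB \<Longrightarrow> fps_X ^ j * f \<in> hcarrier HB"
    using X_power_multiplier[of "1/2"] by auto
  thus ?thesis unfolding fps_of_poly_mult_sum using f by (intro dBR.sum_mem dBR.scale_mem)
qed

text \<open>\<open>\<phi>\<close> is a Taylor polynomial \<open>\<psi>\<close> of \<open>a\<close>
  evaluated at \<open>s^2 z\<close>. The constant \<open>6 = 2 * 2 + 2\<close> is independent of
  \<open>s\<close>: both the supremum of \<open>\<phi>\<close> and the ratio of
  \<open>\<psi>\<close> to \<open>a\<close> on radius \<open>s\<close> are at most 2.\<close>

lemma mate_approximation:
  obtains p where "\<And>n. multiplier (p n) 6" "\<And>k. (\<lambda>n. poly.coeff (p n) k) \<longlonglongrightarrow> fps_nth a k"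
proof -
  have "\<exists>p. multiplier p 6 \<and> (\<forall>k\<le>n. poly.coeff p k = fps_nth a k * of_real (rad n ^ (2 * k)))" for n
  proof -
    define s where "s = rad n"
    have s: "0 < s" "s < 1" using rad_bounds by (auto simp: s_def)
    obtain c where c: "c > 0" "\<And>z. cmod z = s \<Longrightarrow> c \<le> cmod (eval_fps a z)"
      using mate_lower_bound[of s] s by auto
    have sm: "summable (\<lambda>j. s ^ j * norm (fps_nth a j))" using s by (intro summable_fps_disc a_rad) auto
    \<comment> \<open>Precision \<open>c\<close> makes \<open>\<psi>\<close> at most twice as large
      as \<open>a\<close> on radius \<open>s\<close>; precision 1 makes \<open>\<phi>\<close> at
      most 2 in the disc.\<close>
    have "min c 1 > 0" using c by simp
    then obtain J0 where J0: "\<And>J. J \<ge> J0 \<Longrightarrow> norm (\<Sum>i. s ^ (i + J) * norm (fps_nth a (i + J))) < min c 1"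
      using suminf_exist_split[OF _ sm] by blast
    \<comment> \<open>At least \<open>n + 1\<close> terms are kept, so that the coefficients up to
      index \<open>n\<close> are the intended ones.\<close>
    define J where "J = max J0 (Suc n)"
    define \<psi> where "\<psi> = (\<Sum>j<J. monom (fps_nth a j) j)"
    define \<phi> where "\<phi> = (\<Sum>j<J. monom (fps_nth a j * of_real (s ^ (2 * j))) j)"
    have c\<psi>: "poly.coeff \<psi> j = (if j < J then fps_nth a j else 0)" for j
      by (simp add: \<psi>_def coeff_sum if_distrib cong: if_cong)
    have c\<phi>: "poly.coeff \<phi> j = (if j < J then fps_nth a j * of_real (s ^ (2 * j)) else 0)" for j
      by (simp add: \<phi>_def coeff_sum if_distrib cong: if_cong)
    have near: "cmod (poly \<psi> z - eval_fps a z) \<le> min c 1" if z: "cmod z \<le> s" for z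
    proof -
      have z1: "cmod z < 1" using z s by simp
      have sa: "summable (\<lambda>j. norm (fps_nth a j * z ^ j))" using conv_radius_gt[OF a_rad z1] by (rule norm_summable_fps)
      have smJ: "summable (\<lambda>i. s ^ (i + J) * norm (fps_nth a (i + J)))"
        using sm by (subst summable_iff_shift[of _ J])
      have saJ: "summable (\<lambda>i. norm (fps_nth a (i + J) * z ^ (i + J)))"
        using sa by (subst summable_iff_shift[of _ J])
      have "eval_fps a z = (\<Sum>i. fps_nth a (i + J) * z ^ (i + J)) + (\<Sum>j<J. fps_nth a j * z ^ j)"
        unfolding eval_fps_def by (rule suminf_split_initial_segment[OF summable_norm_cancel[OF sa]])
      moreover have "poly \<psi> z = (\<Sum>j<J. fps_nth a j * z ^ j)" by (simp add: \<psi>_def poly_sum poly_monom)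
      ultimately have "cmod (poly \<psi> z - eval_fps a z) = cmod (\<Sum>i. fps_nth a (i + J) * z ^ (i + J))"
        by (simp add: norm_minus_commute)
      also have "\<dots> \<le> (\<Sum>i. norm (fps_nth a (i + J) * z ^ (i + J)))" by (rule summable_norm[OF saJ])
      also have "\<dots> \<le> (\<Sum>i. s ^ (i + J) * norm (fps_nth a (i + J)))"
        unfolding norm_mult norm_power mult.commute[of "cmod (fps_nth a _)"]
        by (intro suminf_le smJ saJ[unfolded norm_mult norm_power mult.commute[of "cmod (fps_nth a _)"]])
          (use z s in \<open>auto simp: norm_mult norm_power intro!: mult_right_mono power_mono\<close>)
      also have "\<dots> \<le> norm (\<Sum>i. s ^ (i + J) * norm (fps_nth a (i + J)))" by simp
      also have "\<dots> \<le> min c 1" by (rule less_imp_le[OF J0]) (simp add: J_def)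
      finally show ?thesis .
    qed
    have "multiplier \<phi> (2 * 2 + 2)"
    proof (rule multiplierI[OF s, where \<psi> = \<psi>])
      show "poly.coeff \<phi> j = poly.coeff \<psi> j * complex_of_real (s ^ (2 * j))" for j by (simp add: c\<psi> c\<phi>)
      show "cmod (poly \<phi> z) \<le> 2" if z: "cmod z < 1" for z
      proof -
        let ?w = "of_real (s\<^sup>2) * z"
        have "s\<^sup>2 * cmod z \<le> s * 1" unfolding power2_eq_square using s z
          by (intro mult_mono) (auto intro: mult_left_le)
        hence w: "cmod ?w \<le> s" using s by (simp add: norm_mult norm_power)
        have e: "poly \<phi> z = poly \<psi> ?w"
          by (simp add: \<phi>_def \<psi>_def poly_sum poly_monom power_mult_distrib mult_ac flip: power_mult)
        have "cmod (poly \<phi> z) \<le> cmod (poly \<psi> ?w - eval_fps a ?w) + cmod (eval_fps a ?w)"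
          unfolding e using norm_triangle_ineq[of "poly \<psi> ?w - eval_fps a ?w" "eval_fps a ?w"] by simp
        also have "\<dots> \<le> 1 + 1" using near[OF w] w s a_le_1[of ?w] by (intro add_mono) auto
        finally show ?thesis by simp
      qed
      show "cmod (poly \<psi> z) \<le> 2 * cmod (eval_fps a z)" if z: "cmod z = s" for z
        using norm_triangle_ineq[of "poly \<psi> z - eval_fps a z" "eval_fps a z"] near[of z] c(2)[OF z] z by simp
    qed auto
    moreover have "poly.coeff \<phi> k = fps_nth a k * of_real (rad n ^ (2 * k))" if "k \<le> n" for k
      using that by (simp add: c\<phi> J_def s_def)
    ultimately show ?thesis by auto
  qed
  hence "\<forall>n. \<exists>p. multiplier p 6 \<and> (\<forall>k\<le>n. poly.coeff p k = fps_nth a k * of_real (rad n ^ (2 * k)))" by blast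
  from choice[OF this] obtain p where p: "\<And>n. multiplier (p n) 6"
    "\<And>n k. k \<le> n \<Longrightarrow> poly.coeff (p n) k = fps_nth a k * of_real (rad n ^ (2 * k))" by blast
  have "(\<lambda>n. poly.coeff (p n) k) \<longlonglongrightarrow> fps_nth a k" for k
  proof (rule Lim_transform_eventually)
    have "(\<lambda>n. fps_nth a k * of_real (rad n ^ (2 * k))) \<longlonglongrightarrow> fps_nth a k * of_real (1 ^ (2 * k))"
      by (intro tendsto_intros rad_tendsto)
    thus "(\<lambda>n. fps_nth a k * of_real (rad n ^ (2 * k))) \<longlonglongrightarrow> fps_nth a k" by simp
    show "\<forall>\<^sub>F n in sequentially. fps_nth a k * of_real (rad n ^ (2 * k)) = poly.coeff (p n) k"
      using p(2) by (intro eventually_sequentiallyI[of k]) auto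
  qed
  thus thesis using that p by blast
qed

text \<open>Splitting off the constant coefficients of \<open>h\<close> and \<open>q = Ts h\<close>
  and using \<open>N \<ge> 0\<close> for the backward shift of \<open>h\<close> gives
  \<open>|h_0|^2 \<le> N h + |q_0|^2\<close>. Radius 0 in \<open>circ_mean_mate_le\<close> bounds
  \<open>|a_0 q_0|^2\<close> by \<open>N h\<close>, and \<open>a_0\<close> is nonzero.\<close>

lemma one_dBR: "1 \<in> hcarrier HB"
proof -
  define A where "A = (cmod (fps_nth a 0))\<^sup>2"
  have A: "A > 0" using a_nz[of 0] by (simp add: A_def eval_fps_at_0)
  have "cmod (hinner H2 1 h) \<le> sqrt (1 + 1 / A) * sqrt (N h)" if h: "h \<in> hcarrier H2" for h
  proof -
    define q where "q = Ts h"
    have q: "q \<in> hcarrier H2" using h by (simp add: q_def Ts_mem)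
    have "eval_vfps q 0 = fps_nth q 0"
      unfolding eval_vfps_def by (subst suminf_finite[of "{0}"]) (auto simp: power_0_left scaleC_one)
    hence "A * (norm (fps_nth q 0))\<^sup>2 \<le> D2 q"
      using circ_mean_mate_le[OF q, of 0]
      by (simp add: eval_fps_at_0 A_def power_mult_distrib)
    also have "\<dots> \<le> N h" using N_Ts_le(1)[OF h] by (simp add: D2_def q_def)
    finally have 1: "(norm (fps_nth q 0))\<^sup>2 \<le> N h / A" using A by (simp add: field_simps)
    have "(hnorm H2 h)\<^sup>2 = (cmod (fps_nth h 0))\<^sup>2 + (hnorm H2 (fps_shift 1 h))\<^sup>2"
      using shift_H2(2)[OF h, of 1] by simp
    moreover have "(hnorm H2 q)\<^sup>2 = (norm (fps_nth q 0))\<^sup>2 + (hnorm H2 (fps_shift 1 q))\<^sup>2"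
      using shift_H2(2)[OF q, of 1] by simp
    moreover have "N (fps_shift 1 h) \<ge> 0" using h by (intro N_ge0 shift_H2)
    ultimately have "(cmod (fps_nth h 0))\<^sup>2 \<le> N h + (norm (fps_nth q 0))\<^sup>2"
      using Ts_shift[OF h, of 1] by (simp add: N_def q_def)
    also have "\<dots> \<le> (1 + 1 / A) * N h" using 1 by (simp add: algebra_simps)
    finally have "sqrt ((cmod (fps_nth h 0))\<^sup>2) \<le> sqrt ((1 + 1 / A) * N h)" by (rule real_sqrt_le_mono)
    thus ?thesis by (simp add: hinner_one real_sqrt_mult)
  qed
  from dBR_boundI(1)[OF one_H2 _ this] A show ?thesis by simp
qed

lemma poly_dBR: "fps_of_poly p \<in> hcarrier HB"
  using poly_mult_dBR[OF one_dBR, of p] by simp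

end

section \<open>Eigenvectors and cyclicity\<close>

text \<open>Minimal polynomial of the orbit of \<open>x\<close>, for a map that is linear on
  \<open>K\<close> only. Finite dimension gives an annihilating polynomial; from one of least degree
  a factor \<open>X - \<mu>\<close> is split off, and the cofactor sends \<open>x\<close> to an
  eigenvector.\<close>

lemma exists_eigenvector:
  fixes A :: "'v::complex_vector \<Rightarrow> 'v"
  assumes K: "cvec.subspace K" "K \<subseteq> W" and W: "finite_dimensional W" and x: "x \<in> K" "x \<noteq> 0"
    and A: "\<And>v. v \<in> K \<Longrightarrow> A v \<in> K" "\<And>u v. u \<in> K \<Longrightarrow> v \<in> K \<Longrightarrow> A (u + v) = A u + A v"
      "\<And>c v. v \<in> K \<Longrightarrow> A (c *\<^sub>C v) = c *\<^sub>C A v"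
  obtains k \<mu> where "k \<in> K" "k \<noteq> 0" "A k = \<mu> *\<^sub>C k"
proof -
  define v where "v i = (A ^^ i) x" for i
  have vK: "v i \<in> K" for i by (induction i) (auto simp: v_def x A)
  define app where "app N p = (\<Sum>i\<le>N. poly.coeff p i *\<^sub>C v i)" for N and p :: "complex poly"
  have appK: "app N p \<in> K" for N p
    unfolding app_def by (intro cvec.subspace_sum cvec.subspace_scale K vK)
  have app_eq: "app N p = app (degree p) p" if "degree p \<le> N" for N p
  proof -
    have "app N p = (\<Sum>i\<in>{..degree p}. poly.coeff p i *\<^sub>C v i)"
      unfolding app_def using that by (intro sum.mono_neutral_right) (auto simp: coeff_eq_0)
    thus ?thesis by (simp add: app_def)
  qed
  obtain S where S: "finite S" "cvec.span S = W" using W by (auto simp: finite_dimensional_def)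
  obtain N p where p: "p \<noteq> 0" "degree p \<le> N" "app N p = 0"
  \<comment> \<open>A repetition in the orbit is treated apart: linear dependence is a property of
    the set of vectors and does not see it.\<close>
  proof (cases "inj_on v {..card S}")
    case False
    then obtain i j where ij: "i \<noteq> j" "v i = v j" by (auto simp: inj_on_def)
    define N where "N = max i j"
    define p where "p = monom (1::complex) i - monom 1 j"
    have c: "poly.coeff p k = (if k = i then 1 else 0) - (if k = j then 1 else 0)" for k by (simp add: p_def)
    have "app N p = (\<Sum>k\<le>N. (if k = i then v i else 0) - (if k = j then v j else 0))"
      unfolding app_def c by (intro sum.cong refl) (auto simp: cvec.scale_left_diff_distrib scaleC_one)
    also have "\<dots> = 0" using ij by (simp add: sum_subtractf N_def)
    finally have "app N p = 0" .
    moreover have "poly.coeff p i \<noteq> 0" unfolding c using ij by simp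
    hence "p \<noteq> 0" by auto
    moreover have "degree p \<le> N" by (rule degree_le) (auto simp: c N_def)
    ultimately show ?thesis using that by blast
  next
    case True
    let ?V = "v ` {..card S}"
    have "card ?V = Suc (card S)" using True by (simp add: card_image)
    moreover have "?V \<subseteq> cvec.span S" using vK K(2) S(2) by auto
    ultimately have "cvec.dependent ?V" using cvec.independent_span_bound[OF S(1), of ?V] by auto
    then obtain u w where u: "w \<in> ?V" "u w \<noteq> 0" "(\<Sum>y\<in>?V. u y *\<^sub>C y) = 0"
      by (auto simp: cvec.dependent_finite)
    define p where "p = (\<Sum>i\<le>card S. monom (u (v i)) i)"
    have c: "poly.coeff p k = (if k \<le> card S then u (v k) else 0)" for k
      by (simp add: p_def coeff_sum if_distrib cong: if_cong)
    have "app (card S) p = (\<Sum>i\<le>card S. u (v i) *\<^sub>C v i)"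
      unfolding app_def by (intro sum.cong) (auto simp: c)
    also have "\<dots> = 0" using u(3) by (simp add: sum.reindex[OF True])
    finally have "app (card S) p = 0" .
    moreover have "p \<noteq> 0"
    proof -
      obtain i where "i \<le> card S" "w = v i" using u(1) by auto
      hence "poly.coeff p i \<noteq> 0" using u(2) by (simp add: c)
      thus ?thesis by auto
    qed
    moreover have "degree p \<le> card S" by (rule degree_le) (auto simp: c)
    ultimately show ?thesis using that by blast
  qed
  define P where "P n \<longleftrightarrow> (\<exists>p. p \<noteq> 0 \<and> degree p = n \<and> app n p = 0)" for n
  have "P (degree p)" unfolding P_def using p(1,3) app_eq[OF p(2)] by (intro exI[of _ p]) simp
  then obtain n where n: "P n" and least: "\<And>m. m < n \<Longrightarrow> \<not> P m" using exists_least_iff[of P] by blast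
  obtain r where r: "r \<noteq> 0" "degree r = n" "app n r = 0" using n by (auto simp: P_def)
  have "n \<noteq> 0"
  proof
    assume "n = 0"
    hence "poly.coeff r 0 *\<^sub>C x = 0" using r by (simp add: app_def v_def)
    moreover have "poly.coeff r 0 \<noteq> 0" using leading_coeff_0_iff[of r] r(1,2) \<open>n = 0\<close> by simp
    ultimately show False using x by simp
  qed
  hence "\<exists>i\<in>{1..n}. poly.coeff r i \<noteq> 0" using r(1,2) by (intro bexI[of _ n]) auto
  then obtain \<mu> where "(\<Sum>i\<le>n. poly.coeff r i * \<mu> ^ i) = 0"
    using fundamental_theorem_of_algebra[of "poly.coeff r" n] by blast
  hence "poly r \<mu> = 0" using r(2) by (simp add: poly_altdef)
  then obtain q where q: "r = [:-\<mu>, 1:] * q" using poly_eq_0_iff_dvd by (auto simp: dvd_def)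
  have q0: "q \<noteq> 0" using r q by auto
  have "degree r = degree [:-\<mu>, 1:] + degree q" unfolding q using q0 by (intro degree_mult_eq) auto
  hence degq: "n = Suc (degree q)" using r(2) by simp
  define k where "k = app (degree q) q"
  \<comment> \<open>By minimality of the degree the cofactor \<open>q\<close> does not annihilate
    \<open>x\<close>.\<close>
  have "k \<noteq> 0" using least[of "degree q"] degq q0 by (auto simp: P_def k_def)
  have Asum: "A (\<Sum>i\<le>m. c i *\<^sub>C v i) = (\<Sum>i\<le>m. c i *\<^sub>C v (Suc i))" for m c
  proof (induction m)
    case (Suc m)
    have "(\<Sum>i\<le>m. c i *\<^sub>C v i) \<in> K" by (intro cvec.subspace_sum cvec.subspace_scale K vK)
    thus ?case using Suc vK K(1) by (simp add: A cvec.subspace_scale) (simp add: v_def)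
  qed (simp add: A vK x, simp add: v_def)
  have "poly.coeff r i = poly.coeff (pCons 0 q) i - \<mu> * poly.coeff q i" for i by (simp add: q)
  hence "app n r = (\<Sum>i\<le>n. poly.coeff (pCons 0 q) i *\<^sub>C v i) - \<mu> *\<^sub>C app n q"
    by (simp add: app_def cvec.scale_left_diff_distrib sum_subtractf cvec.scale_sum_right)
  also have "(\<Sum>i\<le>n. poly.coeff (pCons 0 q) i *\<^sub>C v i) = A k"
    unfolding degq k_def app_def Asum by (subst sum.atMost_Suc_shift) simp
  also have "app n q = k" using app_eq[of q n] degq by (simp add: k_def)
  finally have "A k = \<mu> *\<^sub>C k" using r(3) by simp
  thus thesis using that \<open>k \<noteq> 0\<close> appK k_def by blast
qed

lemma geometric_growth_contradiction:
  fixes A C D x y :: real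
  assumes "A > 0" "1 \<le> y" "y < x" and le: "\<And>n. A * x ^ n \<le> C + D * y ^ n"
  shows False
proof -
  have y: "y > 0" using assms by simp
  have "A * (x / y) ^ n \<le> \<bar>C\<bar> + D" for n
  proof -
    have "A * (x / y) ^ n = A * x ^ n / y ^ n" by (simp add: power_divide)
    also have "\<dots> \<le> (C + D * y ^ n) / y ^ n" using le y by (intro divide_right_mono) auto
    also have "\<dots> = C / y ^ n + D" using y by (simp add: add_divide_distrib)
    also have "C / y ^ n \<le> \<bar>C\<bar> / 1"
      using assms(2) by (intro frac_le) (auto simp: one_le_power)
    finally show ?thesis by simp
  qed
  moreover have "x / y > 1" using assms y by simp
  then obtain n where "(\<bar>C\<bar> + D) / A < (x / y) ^ n" using real_arch_pow by blast
  hence "\<bar>C\<bar> + D < A * (x / y) ^ n" using assms(1) by (simp add: field_simps)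
  ultimately show False by (meson not_le)
qed

lemma poly_shift_one: "fps_shift 1 (fps_of_poly p) = fps_of_poly (poly_shift 1 p)"
  by (simp add: fps_eq_iff coeff_poly_shift)

lemma fps_cutoff_poly: "fps_cutoff n f = fps_of_poly (\<Sum>i<n. monom (fps_nth f i) i)" for f :: "complex fps"
  by (simp add: fps_eq_iff coeff_sum fps_cutoff_def if_distrib cong: if_cong)

lemma cyclic_H2_one: "cyclic_in H2 (1 :: complex fps)"
proof -
  have "f \<in> hclosure H2 {fps_of_poly p * 1 |p. True}" if f: "f \<in> hcarrier H2" for f :: "complex fps"
    unfolding hclosure_def
  proof (intro CollectI conjI f allI impI)
    fix e :: real assume e: "e > 0"
    obtain n where n: "hnorm H2 (f - fps_cutoff n f) < e"
      using order_tendstoD(2)[OF hnorm_H2_cutoff_tendsto[OF f] e] by (auto simp: eventually_sequentially)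
    have "fps_cutoff n f \<in> {fps_of_poly p * 1 |p. True}" unfolding fps_cutoff_poly by auto
    thus "\<exists>s\<in>{fps_of_poly p * 1 |p. True}. hnorm H2 (f - s) < e" using n by blast
  qed
  thus ?thesis using H2.hclosure_carrier by (auto simp: cyclic_in_def)
qed

section \<open>Uniqueness of nontangential limits\<close>

lemma stolz_nontrivial:
  assumes \<zeta>: "cmod \<zeta> = 1" shows "at \<zeta> within stolz 2 \<zeta> \<noteq> bot"
  unfolding trivial_limit_within islimpt_approachable
proof (intro notI)
  assume not: "\<not> (\<forall>e>0. \<exists>x'\<in>stolz 2 \<zeta>. x' \<noteq> \<zeta> \<and> dist x' \<zeta> < e)"
  have "\<exists>x'\<in>stolz 2 \<zeta>. x' \<noteq> \<zeta> \<and> dist x' \<zeta> < e" if e: "e > 0" for e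
  proof -
    define d where "d = min (e / 2) (1 / 2)"
    have d: "0 < d" "d < e" "d < 1" using e by (auto simp: d_def)
    let ?x = "of_real (1 - d) * \<zeta>"
    have "?x - \<zeta> = - (of_real d * \<zeta>)" by (simp add: algebra_simps)
    hence 1: "cmod (?x - \<zeta>) = d" using \<zeta> d by (simp add: norm_mult)
    have 2: "cmod ?x = 1 - d" using \<zeta> d by (simp add: norm_mult del: of_real_diff)
    have "?x \<in> stolz 2 \<zeta>" "?x \<noteq> \<zeta>" "dist ?x \<zeta> < e"
      using 1 2 d by (auto simp: stolz_def dist_norm)
    thus ?thesis by blast
  qed
  thus False using not by blast
qed

lemma has_nt_limit_unique:
  assumes "has_nt_limit f \<zeta> l" "has_nt_limit f \<zeta> l'" "cmod \<zeta> = 1"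
  shows "l = l'"
  using assms tendsto_unique[OF stolz_nontrivial[OF assms(3)], of f l l'] by (simp add: has_nt_limit_def)

lemma nt_lim_eqI: "has_nt_limit f \<zeta> l \<Longrightarrow> cmod \<zeta> = 1 \<Longrightarrow> nt_lim f \<zeta> = l"
  unfolding nt_lim_def by (rule the_equality) (auto intro: has_nt_limit_unique)

section \<open>The adjoint of multiplication by z and the annihilator of a cyclic candidate\<close>

context schur_mate begin

lemma X_power_growth:
  assumes y: "y > 1"
  shows "\<exists>c. \<forall>j. \<forall>f\<in>hcarrier HB. fps_X ^ j * f \<in> hcarrier HB \<and>
    hnorm HB (fps_X ^ j * f) \<le> (2 + c * y ^ j) * hnorm HB f"
proof (rule X_power_multiplier[of "1 / y"])
  show "0 < 1 / y" "1 / y < 1" using y by auto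
  fix c assume "\<And>j f. f \<in> hcarrier HB \<Longrightarrow> fps_X ^ j * f \<in> hcarrier HB"
    "\<And>j f. f \<in> hcarrier HB \<Longrightarrow>
      hnorm HB (fps_X ^ j * f) \<le> (2 + c * (1 / (1 / y)) ^ j) * hnorm HB f"
  thus ?thesis by (intro exI[of _ c]) simp
qed

lemma bounded_op_Mz: "bounded_op HB HB Mz"
proof -
  obtain c where c: "\<forall>j. \<forall>f\<in>hcarrier HB. fps_X ^ j * f \<in> hcarrier HB \<and>
    hnorm HB (fps_X ^ j * f) \<le> (2 + c * 2 ^ j) * hnorm HB f"
    using X_power_growth[of 2] by auto
  show ?thesis
    unfolding bounded_op_def Mz_def using spec[OF c, of 1]
    by (intro conjI ballI allI exI[of _ "2 + c * 2"])
       (auto simp: distrib_left scaleC_fps_complex mult_ac)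
qed

lemmas Mz_adj_mem = adj_exists(1)[OF hilbert_dBR dBR.prehilbert_axioms bounded_op_Mz, folded Mz_adj_def]

lemma Mz_adj:
  "f \<in> hcarrier HB \<Longrightarrow> k \<in> hcarrier HB \<Longrightarrow>
    hinner HB (fps_X * f) k = hinner HB f (Mz_adj B k)"
  using adj_exists(2)[OF hilbert_dBR dBR.prehilbert_axioms bounded_op_Mz, folded Mz_adj_def]
  by (simp add: Mz_def)

lemma Xf_mem: "f \<in> hcarrier HB \<Longrightarrow> fps_X * f \<in> hcarrier HB"
  using bounded_op_Mz by (auto simp: bounded_op_def Mz_def)

lemma Mz_adj_add:
  assumes "u \<in> hcarrier HB" "v \<in> hcarrier HB"
  shows "Mz_adj B (u + v) = Mz_adj B u + Mz_adj B v"
  using assms by (intro dBR.inner_eqI)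
    (auto simp: dBR.mem_intros Mz_adj_mem dBR.inner_add_right Xf_mem simp flip: Mz_adj)

lemma Mz_adj_scale:
  assumes "v \<in> hcarrier HB"
  shows "Mz_adj B (c *\<^sub>C v) = c *\<^sub>C Mz_adj B v"
  using assms by (intro dBR.inner_eqI)
    (auto simp: dBR.mem_intros Mz_adj_mem dBR.inner_scale_right Xf_mem simp flip: Mz_adj)

lemma eigenvector_X_power:
  assumes k: "k \<in> hcarrier HB" "Mz_adj B k = cnj \<nu> *\<^sub>C k" and f: "f \<in> hcarrier HB"
  shows "fps_X ^ n * f \<in> hcarrier HB" "hinner HB (fps_X ^ n * f) k = \<nu> ^ n * hinner HB f k"
proof (induction n)
  case (Suc n)
  case 1 show ?case using Xf_mem[OF Suc(1)] by (simp add: mult.assoc)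
  case 2 show ?case using Mz_adj[OF Suc(1) k(1)] Suc k by (simp add: dBR.inner_scale_right mult.assoc)
qed (use f in auto)

lemma eigenvector_poly:
  assumes k: "k \<in> hcarrier HB" "Mz_adj B k = cnj \<nu> *\<^sub>C k" and f: "f \<in> hcarrier HB"
  shows "hinner HB (fps_of_poly p * f) k = poly p \<nu> * hinner HB f k"
  unfolding fps_of_poly_mult_sum using eigenvector_X_power[OF k f] k(1)
  by (simp add: dBR.inner_sum_left dBR.scale_mem dBR.inner_scale_left poly_altdef sum_distrib_right mult.assoc)

text \<open>The pairing of \<open>z^n f\<close> with an eigenvector has size proportional to the
  \<open>n\<close>-th power of \<open>cmod \<nu>\<close>, whereas the norms of these vectors grow at
  most like \<open>y ^ n\<close> for a \<open>y\<close> strictly between 1 and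
  \<open>cmod \<nu>\<close>.\<close>

lemma eigenvalue_le_1:
  assumes k: "k \<in> hcarrier HB" "Mz_adj B k = cnj \<nu> *\<^sub>C k" and f: "f \<in> hcarrier HB"
    and nz: "hinner HB f k \<noteq> 0"
  shows "cmod \<nu> \<le> 1"
proof (rule ccontr)
  assume "\<not> cmod \<nu> \<le> 1"
  hence l: "cmod \<nu> > 1" by simp
  define y where "y = (1 + cmod \<nu>) / 2"
  have y: "1 < y" "y < cmod \<nu>" using l by (auto simp: y_def)
  obtain c where c: "\<forall>j. \<forall>f\<in>hcarrier HB. fps_X ^ j * f \<in> hcarrier HB \<and>
    hnorm HB (fps_X ^ j * f) \<le> (2 + c * y ^ j) * hnorm HB f"
    using X_power_growth[OF y(1)] by auto
  define F where "F = hnorm HB f * hnorm HB k"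
  have "cmod (hinner HB f k) * cmod \<nu> ^ n \<le> 2 * F + (c * F) * y ^ n" for n
  proof -
    have "cmod (hinner HB f k) * cmod \<nu> ^ n = cmod (hinner HB (fps_X ^ n * f) k)"
      unfolding eigenvector_X_power(2)[OF k f] norm_mult norm_power by (rule mult.commute)
    also have "\<dots> \<le> hnorm HB (fps_X ^ n * f) * hnorm HB k"
      by (intro dBR.cauchy_schwarz eigenvector_X_power[OF k f] k)
    also have "\<dots> \<le> (2 + c * y ^ n) * hnorm HB f * hnorm HB k"
      using c f by (intro mult_right_mono dBR.hnorm_ge0 k) simp
    finally show ?thesis by (simp add: F_def algebra_simps)
  qed
  from geometric_growth_contradiction[OF _ _ y(2) this] nz y show False by simp
qed

definition annihilator :: "complex fps \<Rightarrow> complex fps set" where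
  "annihilator f = {g \<in> hcarrier HB. \<forall>p. hinner HB (fps_of_poly p * f) g = 0}"

lemma subspace_annihilator:
  assumes "f \<in> hcarrier HB" shows "cvec.subspace (annihilator f)"
  using poly_mult_dBR[OF assms]
  by (intro cvec.subspaceI) (auto simp: annihilator_def dBR.mem_intros dBR.inner_add_right dBR.inner_scale_right)

lemma Mz_adj_annihilator:
  assumes f: "f \<in> hcarrier HB" and g: "g \<in> annihilator f"
  shows "Mz_adj B g \<in> annihilator f"
proof -
  have gC: "g \<in> hcarrier HB" using g by (simp add: annihilator_def)
  have "hinner HB (fps_of_poly p * f) (Mz_adj B g) = 0" for p
  proof -
    have "hinner HB (fps_of_poly p * f) (Mz_adj B g) = hinner HB (fps_X * (fps_of_poly p * f)) g"
      using Mz_adj[OF poly_mult_dBR[OF f] gC] by simp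
    also have "fps_X * (fps_of_poly p * f) = fps_of_poly (pCons 0 p) * f"
      by (simp add: fps_of_poly_pCons mult_ac)
    finally show ?thesis using g by (simp add: annihilator_def)
  qed
  thus ?thesis using gC Mz_adj_mem by (simp add: annihilator_def)
qed

lemma cyclic_if_annihilator_trivial:
  assumes f: "f \<in> hcarrier HB" and "annihilator f \<subseteq> {0}"
  shows "cyclic_in HB f"
  unfolding cyclic_in_def
proof (rule dBR.dense_if_orthogonal_trivial[OF subspace_poly_multiples])
  show "{fps_of_poly p * f |p. True} \<subseteq> hcarrier HB" using poly_mult_dBR[OF f] by auto
  fix g assume g: "g \<in> hcarrier HB" and 0: "\<And>v. v \<in> {fps_of_poly p * f |p. True} \<Longrightarrow> hinner HB g v = 0"
  have "hinner HB (fps_of_poly p * f) g = 0" for p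
  proof -
    have "hinner HB g (fps_of_poly p * f) = 0" by (rule 0) blast
    thus ?thesis using dBR.inner_commute[OF poly_mult_dBR[OF f] g, of p] by simp
  qed
  hence "g \<in> annihilator f" using g by (simp add: annihilator_def)
  thus "g = 0" using assms(2) by blast
qed

text \<open>The multipliers \<open>p n\<close> are uniformly bounded by 6, so testing against defect
  vectors suffices, and there the inner product of \<open>HB\<close> is one of the Hardy space. The
  same polynomials serve both limits; \<open>eigenvalue_circle\<close> compares the two.\<close>

lemma mate_weak_limit:
  "\<exists>p. (\<forall>f\<in>hcarrier HB. \<forall>g\<in>hcarrier HB.
      (\<lambda>n. hinner HB (fps_of_poly (p n) * f) g) \<longlonglongrightarrow> hinner HB (a * f) g) \<and>
    (\<forall>f\<in>hcarrier HB. \<forall>g\<in>hcarrier H2.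
      (\<lambda>n. hinner H2 (fps_of_poly (p n) * f) g) \<longlonglongrightarrow> hinner H2 (a * f) g)"
proof -
  obtain p where p: "\<And>n. multiplier (p n) 6" "\<And>k. (\<lambda>n. poly.coeff (p n) k) \<longlonglongrightarrow> fps_nth a k"
    using mate_approximation by blast
  have H2lim: "(\<lambda>n. hinner H2 (fps_of_poly (p n) * f) g) \<longlonglongrightarrow> hinner H2 (a * f) g"
    if f: "f \<in> hcarrier HB" and g: "g \<in> hcarrier H2" for f g
  proof (rule H2_weak_limit(3)[OF _ _ _ g])
    have m: "fps_of_poly (p n) * f \<in> hcarrier HB" "hnorm HB (fps_of_poly (p n) * f) \<le> 6 * hnorm HB f" for n
      using p(1)[of n] f by (auto simp: multiplier_def)
    show "fps_of_poly (p n) * f \<in> hcarrier H2" for n by (rule dBR_H2[OF m(1)])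
    show "hnorm H2 (fps_of_poly (p n) * f) \<le> 6 * hnorm HB f" for n
      by (rule order_trans[OF hnorm_le_dBR[OF m(1)] m(2)])
    show "(\<lambda>n. fps_nth (fps_of_poly (p n) * f) k) \<longlonglongrightarrow> fps_nth (a * f) k" for k
      unfolding fps_mult_nth by (intro tendsto_sum tendsto_mult tendsto_const) (simp add: p(2))
  qed
  have "(\<lambda>n. hinner HB (fps_of_poly (p n) * f) g) \<longlonglongrightarrow> hinner HB (a * f) g"
    if f: "f \<in> hcarrier HB" and g: "g \<in> hcarrier HB" for f g
  proof (rule LIMSEQ_I)
    fix e :: real assume e: "e > 0"
    let ?X = "\<lambda>n. fps_of_poly (p n) * f - a * f"
    have af: "a * f \<in> hcarrier HB" "hnorm HB (a * f) \<le> hnorm HB f"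
      using mate_mult_dBR[OF dBR_H2[OF f]] hnorm_le_dBR[OF f] by auto
    have m: "fps_of_poly (p n) * f \<in> hcarrier HB" "hnorm HB (fps_of_poly (p n) * f) \<le> 6 * hnorm HB f" for n
      using p(1)[of n] f by (auto simp: multiplier_def)
    have X: "?X n \<in> hcarrier HB" "hnorm HB (?X n) \<le> 7 * hnorm HB f" for n
      using m[of n] af dBR.hnorm_triangle_diff[OF m(1)[of n] af(1)] by (auto simp: dBR.diff_mem)
    \<comment> \<open>The multiples by \<open>p n\<close> have norm at most six times that of
      \<open>f\<close>, and \<open>a f\<close> at most that of \<open>f\<close>; the extra 1 keeps
      \<open>F\<close> positive.\<close>
    define F where "F = 7 * hnorm HB f + 1"
    have F: "F > 0" using dBR.hnorm_ge0[OF f] by (simp add: F_def)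
    have "g \<in> hclosure HB (defect ` hcarrier H2)" using g by (simp add: dense_defect)
    hence "\<exists>s\<in>defect ` hcarrier H2. hnorm HB (g - s) < e / (2 * F)"
      using e F unfolding hclosure_def by simp
    then obtain x where x: "x \<in> hcarrier H2" "hnorm HB (g - defect x) < e / (2 * F)" by blast
    have dx: "defect x \<in> hcarrier HB" using x by (simp add: dBR_defect)
    have "(\<lambda>n. hinner H2 (fps_of_poly (p n) * f) x) \<longlonglongrightarrow> hinner H2 (a * f) x" by (rule H2lim[OF f x(1)])
    then obtain n0 where n0: "\<And>n. n \<ge> n0 \<Longrightarrow> cmod (hinner H2 (fps_of_poly (p n) * f) x - hinner H2 (a * f) x) < e / 2"
      using LIMSEQ_D[of _ _ "e/2"] e by (metis half_gt_zero)
    have "cmod (hinner HB (fps_of_poly (p n) * f) g - hinner HB (a * f) g) < e" if n: "n \<ge> n0" for n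
    proof -
      have "hinner HB (fps_of_poly (p n) * f) g - hinner HB (a * f) g
          = hinner HB (?X n) (g - defect x) + hinner HB (?X n) (defect x)"
        using m[of n] af(1) g dx by (simp add: dBR.inner_diff_left dBR.inner_diff_right dBR.diff_mem)
      also have "cmod \<dots> \<le> cmod (hinner HB (?X n) (g - defect x)) + cmod (hinner HB (?X n) (defect x))"
        by (rule norm_triangle_ineq)
      also have "cmod (hinner HB (?X n) (g - defect x)) \<le> hnorm HB (?X n) * hnorm HB (g - defect x)"
        by (intro dBR.cauchy_schwarz X dBR.diff_mem g dx)
      also have "\<dots> \<le> F * (e / (2 * F))"
        using X[of n] x(2) F dBR.hnorm_ge0[OF X(1)] dBR.hnorm_ge0[OF dBR.diff_mem[OF g dx]]
        by (intro mult_mono) (auto simp: F_def)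
      also have "hinner HB (?X n) (defect x) = hinner H2 (fps_of_poly (p n) * f) x - hinner H2 (a * f) x"
        using dBR_defect(3)[OF x(1) X(1)] m(1)[of n] af(1) x(1) by (simp add: H2.inner_diff_left dBR_H2)
      finally show ?thesis using n0[OF n] F by simp
    qed
    thus "\<exists>no. \<forall>n\<ge>no. norm (hinner HB (fps_of_poly (p n) * f) g - hinner HB (a * f) g) < e" by blast
  qed
  thus ?thesis using H2lim by blast
qed

lemma annihilator_mate:
  assumes f: "f \<in> hcarrier HB" and g: "g \<in> annihilator f"
  shows "hinner HB (a * f) g = 0"
proof -
  obtain p where p: "\<forall>f\<in>hcarrier HB. \<forall>g\<in>hcarrier HB.
      (\<lambda>n. hinner HB (fps_of_poly (p n) * f) g) \<longlonglongrightarrow> hinner HB (a * f) g"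
    and p2: "\<forall>f\<in>hcarrier HB. \<forall>g\<in>hcarrier H2.
      (\<lambda>n. hinner H2 (fps_of_poly (p n) * f) g) \<longlonglongrightarrow> hinner H2 (a * f) g"
    using mate_weak_limit by blast
  have "g \<in> hcarrier HB" using g by (simp add: annihilator_def)
  from p[rule_format, OF f this] have "(\<lambda>n. hinner HB (fps_of_poly (p n) * f) g) \<longlonglongrightarrow> hinner HB (a * f) g" .
  moreover have "hinner HB (fps_of_poly (p n) * f) g = 0" for n using g by (simp add: annihilator_def)
  ultimately show ?thesis using LIMSEQ_unique[OF _ tendsto_const] by fastforce
qed

text \<open>\<open>annihilator_mate\<close>, applied to every multiple \<open>p f\<close>, shows
  that \<open>g\<close> is orthogonal to all \<open>a p f\<close>. The \<open>p f\<close> are dense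
  in the Hardy space, and multiplication by \<open>a\<close> is contractive from there into
  \<open>HB\<close>.\<close>

lemma annihilator_subset_perp:
  assumes f: "f \<in> hcarrier HB" and cyc: "cyclic_in H2 f"
  shows "annihilator f \<subseteq> aH2_perp B a"
proof
  fix g assume g: "g \<in> annihilator f"
  hence gC: "g \<in> hcarrier HB" by (simp add: annihilator_def)
  have pf: "hinner HB (a * (fps_of_poly p * f)) g = 0" for p
  proof (rule annihilator_mate[OF poly_mult_dBR[OF f]])
    have "hinner HB (fps_of_poly (q * p) * f) g = 0" for q
      using g unfolding annihilator_def by blast
    thus "g \<in> annihilator (fps_of_poly p * f)" using gC by (simp add: annihilator_def fps_of_poly_mult mult.assoc)
  qed
  have "hinner HB (a * h) g = 0" if h: "h \<in> hcarrier H2" for h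
  proof -
    have "cmod (hinner HB (a * h) g) \<le> e" if e: "e > 0" for e
    proof -
      have "h \<in> hclosure H2 {fps_of_poly p * f |p. True}" using cyc h by (simp add: cyclic_in_def)
      moreover have "e / (hnorm HB g + 1) > 0" using e dBR.hnorm_ge0[OF gC] by simp
      ultimately obtain p where p: "hnorm H2 (h - fps_of_poly p * f) < e / (hnorm HB g + 1)"
        unfolding hclosure_def by blast
      have pfH: "fps_of_poly p * f \<in> hcarrier H2" by (rule dBR_H2[OF poly_mult_dBR[OF f]])
      have "hinner HB (a * h) g = hinner HB (a * (h - fps_of_poly p * f)) g"
        using mate_mult_dBR(1)[OF h] mate_mult_dBR(1)[OF pfH] pf gC by (simp add: right_diff_distrib dBR.inner_diff_left)
      also have "cmod \<dots> \<le> hnorm HB (a * (h - fps_of_poly p * f)) * hnorm HB g"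
        by (intro dBR.cauchy_schwarz mate_mult_dBR H2.diff_mem h pfH gC)
      also have "\<dots> \<le> hnorm H2 (h - fps_of_poly p * f) * (hnorm HB g + 1)"
        using mate_mult_dBR[OF H2.diff_mem[OF h pfH]] H2.hnorm_ge0[OF H2.diff_mem[OF h pfH]]
        by (intro mult_mono) (auto simp: dBR.hnorm_ge0 gC)
      also have "\<dots> \<le> e" using p dBR.hnorm_ge0[OF gC] by (simp add: field_simps)
      finally show ?thesis .
    qed
    hence "cmod (hinner HB (a * h) g) \<le> 0" by (rule dense_ge)
    thus ?thesis by simp
  qed
  hence "hinner HB g (a * h) = 0" if "h \<in> hcarrier H2" for h
    using dBR.inner_commute[OF gC mate_mult_dBR(1)[OF that]] that by simp
  thus "g \<in> aH2_perp B a" using gC by (auto simp: aH2_perp_def orth_compl_def)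
qed

end

section \<open>Density of polynomials, unimodular eigenvalues and nontangential values\<close>

locale schur_mate_finite = schur_mate +
  assumes finite_perp: "finite_dimensional (aH2_perp B a)"
begin

lemma annihilator_eigenvector:
  assumes f: "f \<in> hcarrier HB" and cyc: "cyclic_in H2 f" and "\<not> annihilator f \<subseteq> {0}"
  obtains k \<mu> where "k \<in> annihilator f" "k \<noteq> 0" "Mz_adj B k = \<mu> *\<^sub>C k"
proof -
  obtain x where x: "x \<in> annihilator f" "x \<noteq> 0" using assms(3) by auto
  have C: "v \<in> hcarrier HB" if "v \<in> annihilator f" for v using that by (simp add: annihilator_def)
  show thesis
  proof (rule exists_eigenvector[OF subspace_annihilator[OF f] annihilator_subset_perp[OF f cyc] finite_perp x,
        where A = "Mz_adj B"])
    fix k \<mu> assume "k \<in> annihilator f" "k \<noteq> 0" "Mz_adj B k = \<mu> *\<^sub>C k"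
    thus thesis by (rule that)
  qed (auto simp: Mz_adj_annihilator f Mz_adj_add Mz_adj_scale C)
qed

text \<open>On the annihilator of the polynomials the adjoint of the backward shift is inverse to \<open>M\<^sub>z\<^sup>*\<close>. Since the
  backward shift is a contraction without unimodular eigenvalues and \<open>M\<^sub>z\<close> has spectral radius at most
  one, neither of the two adjoints can have an eigenvector there.\<close>

lemma annihilator_one: "annihilator 1 = {0}"
proof (rule ccontr)
  assume ne: "annihilator 1 \<noteq> {0}"
  let ?H = "dBR B"
  let ?L = "fps_shift 1 :: complex fps \<Rightarrow> complex fps"
  define Ls where "Ls = adj ?H ?H ?L"
  have Lbdd: "bounded_op ?H ?H ?L"
    unfolding bounded_op_def
    using shift_dBR by (intro conjI ballI allI exI[of _ 1]) (auto simp: fps_shift_add fps_eq_iff)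
  have Lm: "Ls k \<in> hcarrier ?H" if "k \<in> hcarrier ?H" for k
    unfolding Ls_def using adj_exists(1)[OF hilbert_dBR dBR.prehilbert_axioms Lbdd that] .
  have La: "hinner ?H (?L f) k = hinner ?H f (Ls k)" if "f \<in> hcarrier ?H" "k \<in> hcarrier ?H" for f k
    unfolding Ls_def using adj_exists(2)[OF hilbert_dBR dBR.prehilbert_axioms Lbdd that(2,1)] .
  have C: "v \<in> hcarrier ?H" if "v \<in> annihilator 1" for v using that by (simp add: annihilator_def)
  obtain x where x: "x \<in> annihilator 1" "x \<noteq> 0"
    using ne cvec.subspace_0[OF subspace_annihilator[OF one_dBR]] by auto
  \<comment> \<open>The constant 1 is cyclic in the Hardy space, so this annihilator lies in the
    finite-dimensional complement. It is invariant under \<open>Ls\<close> because the backward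
    shift maps polynomials to polynomials.\<close>
  obtain k \<mu> where k: "k \<in> annihilator 1" "k \<noteq> 0" "Ls k = \<mu> *\<^sub>C k"
  proof (rule exists_eigenvector[OF subspace_annihilator[OF one_dBR]
        annihilator_subset_perp[OF one_dBR cyclic_H2_one] finite_perp x, where A = Ls])
    fix v assume v: "v \<in> annihilator 1"
    have "hinner ?H (fps_of_poly p * 1) (Ls v) = hinner ?H (fps_of_poly (poly_shift 1 p) * 1) v" for p
      using La[OF poly_dBR C[OF v], of p] by (simp add: poly_shift_one[symmetric])
    moreover have "hinner ?H (fps_of_poly (poly_shift 1 p) * 1) v = 0" for p
      using v unfolding annihilator_def by blast
    ultimately show "Ls v \<in> annihilator 1" using Lm[OF C[OF v]] by (simp add: annihilator_def)
  next
    fix u v assume uv: "u \<in> annihilator 1" "v \<in> annihilator 1"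
    show "Ls (u + v) = Ls u + Ls v"
      using uv[THEN C] by (intro dBR.inner_eqI)
        (auto simp: dBR.mem_intros Lm dBR.inner_add_right shift_dBR(1)[unfolded One_nat_def] simp flip: La[unfolded One_nat_def])
  next
    fix c v assume v: "v \<in> annihilator 1"
    show "Ls (c *\<^sub>C v) = c *\<^sub>C Ls v"
      using C[OF v] by (intro dBR.inner_eqI)
        (auto simp: dBR.mem_intros Lm dBR.inner_scale_right shift_dBR(1)[unfolded One_nat_def] simp flip: La[unfolded One_nat_def])
  qed blast
  have kC: "k \<in> hcarrier ?H" using k(1) by (rule C)
  have kn: "hnorm ?H k > 0" using dBR.hnorm_ge0[OF kC] dBR.hnorm_eq0[OF kC] k(2) by simp
  \<comment> \<open>The backward shift undoes multiplication by \<open>z\<close>; taking adjoints,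
    the adjoint of \<open>Mz\<close> undoes \<open>Ls\<close>.\<close>
  have Mk: "Mz_adj B (\<mu> *\<^sub>C k) = k"
  proof (rule dBR.inner_eqI)
    fix f assume f: "f \<in> hcarrier ?H"
    have "hinner ?H f (Mz_adj B (\<mu> *\<^sub>C k)) = hinner ?H (fps_X * f) (Ls k)"
      using Mz_adj[OF f dBR.scale_mem[OF kC]] k(3) by simp
    also have "\<dots> = hinner ?H (?L (fps_X * f)) k" using La[OF Xf_mem[OF f] kC] by simp
    also have "?L (fps_X * f) = f" by (simp add: fps_eq_iff)
    finally show "hinner ?H f (Mz_adj B (\<mu> *\<^sub>C k)) = hinner ?H f k" .
  qed (use kC in \<open>auto simp: Mz_adj_mem dBR.scale_mem\<close>)
  hence Mk': "\<mu> *\<^sub>C Mz_adj B k = k" by (simp add: Mz_adj_scale kC)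
  have \<mu>0: "\<mu> \<noteq> 0" using Mk' k(2) by auto
  have "Mz_adj B k = (1 / \<mu>) *\<^sub>C (\<mu> *\<^sub>C Mz_adj B k)" using \<mu>0 by (simp add: scaleC_scaleC scaleC_one)
  hence "Mz_adj B k = cnj (cnj (1 / \<mu>)) *\<^sub>C k" using Mk' by simp
  \<comment> \<open>\<open>1 / \<mu>\<close> is an eigenvalue of the adjoint of \<open>Mz\<close>;
    pairing \<open>k\<close> with itself meets the non-vanishing condition.\<close>
  from eigenvalue_le_1[OF kC this kC] dBR.inner_self[OF kC] kn have "cmod (1 / \<mu>) \<le> 1" by (simp add: norm_divide)
  hence ge: "cmod \<mu> \<ge> 1" using \<mu>0 by (simp add: norm_divide divide_le_eq)
  have LkC: "?L k \<in> hcarrier ?H" "hnorm ?H (?L k) \<le> hnorm ?H k" using shift_dBR[OF kC] by auto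
  have Lkk: "hinner ?H (?L k) k = cnj \<mu> * of_real ((hnorm ?H k)\<^sup>2)"
    using La[OF kC kC] k(3) by (simp add: dBR.inner_scale_right kC dBR.inner_self)
  have "cmod \<mu> * (hnorm ?H k)\<^sup>2 = cmod (hinner ?H (?L k) k)" unfolding Lkk by (simp add: norm_mult norm_power)
  also have "\<dots> \<le> hnorm ?H (?L k) * hnorm ?H k" by (intro dBR.cauchy_schwarz LkC kC)
  also have "\<dots> \<le> hnorm ?H k * hnorm ?H k" using LkC kn by (intro mult_right_mono) auto
  finally have "cmod \<mu> \<le> 1" using kn by (simp add: power2_eq_square)
  with ge have \<mu>1: "cmod \<mu> = 1" by simp
  \<comment> \<open>Equality case of Cauchy-Schwarz: the contraction \<open>?L\<close> attains
    modulus 1 on \<open>k\<close>, so \<open>?L k\<close> is a multiple of \<open>k\<close>. The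
    coefficients of \<open>k\<close> then have constant modulus, which for
    \<open>k \<noteq> 0\<close> contradicts square summability.\<close>
  have "(hnorm ?H (?L k - cnj \<mu> *\<^sub>C k))\<^sup>2 \<le> 0"
  proof -
    have "hinner ?H (?L k) (cnj \<mu> *\<^sub>C k) = of_real ((hnorm ?H k)\<^sup>2)"
      using complex_norm_square[of \<mu>] \<mu>1 by (simp add: dBR.inner_scale_right LkC(1)[unfolded One_nat_def] kC Lkk[unfolded One_nat_def])
    hence "(hnorm ?H (?L k - cnj \<mu> *\<^sub>C k))\<^sup>2 = (hnorm ?H (?L k))\<^sup>2 + (hnorm ?H k)\<^sup>2 - 2 * (hnorm ?H k)\<^sup>2"
      using LkC(1) kC \<mu>1 by (subst dBR.hnorm_diff_sq) (auto simp: dBR.scale_mem dBR.hnorm_scale)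
    thus ?thesis using power_mono[OF LkC(2) dBR.hnorm_ge0[OF LkC(1)], of 2] by simp
  qed
  hence "hnorm ?H (?L k - cnj \<mu> *\<^sub>C k) = 0" by simp
  hence Lk: "?L k = cnj \<mu> *\<^sub>C k"
    using dBR.hnorm_eq0[OF dBR.diff_mem[OF LkC(1) dBR.scale_mem[OF kC]]] by simp
  have step: "fps_nth k (Suc n) = cnj \<mu> * fps_nth k n" for n
    using arg_cong[OF Lk, of "\<lambda>f. fps_nth f n"] by simp
  have abs: "cmod (fps_nth k n) = cmod (fps_nth k 0)" for n
    by (induction n) (auto simp: step norm_mult \<mu>1)
  have "summable (\<lambda>n. (cmod (fps_nth k n))\<^sup>2)" using dBR_H2[OF kC] by (simp add: mem_H2_iff)
  moreover have "(\<lambda>n. (cmod (fps_nth k n))\<^sup>2) = (\<lambda>n. (cmod (fps_nth k 0))\<^sup>2)"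
    by (rule ext) (subst abs, rule refl)
  ultimately have "summable (\<lambda>n::nat. (cmod (fps_nth k 0))\<^sup>2)" by simp
  hence 0: "cmod (fps_nth k 0) = 0" by (simp add: summable_const_iff)
  have "fps_nth k n = 0" for n using abs[of n] unfolding 0 by simp
  hence "k = 0" by (simp add: fps_eq_iff)
  thus False using k(2) by simp
qed

lemma polynomials_dense: "cyclic_in HB 1"
  by (rule cyclic_if_annihilator_trivial[OF one_dBR]) (simp add: annihilator_one)

text \<open>If this value vanished, \<open>eigenvector_poly\<close> would make \<open>k\<close>
  orthogonal to all polynomials.\<close>

lemma eigenvector_one:
  assumes k: "k \<in> hcarrier HB" "Mz_adj B k = cnj \<nu> *\<^sub>C k" "k \<noteq> 0"
  shows "hinner HB 1 k \<noteq> 0"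
proof
  assume "hinner HB 1 k = 0"
  hence "k \<in> annihilator 1" using eigenvector_poly[OF k(1,2) one_dBR] k(1) by (simp add: annihilator_def)
  thus False using annihilator_one k(3) by simp
qed

text \<open>For \<open>cmod \<nu> < 1\<close> the polynomials approximating \<open>a\<close>
  converge at \<open>\<nu>\<close> as well as weakly in \<open>HB\<close>. Hence
  \<open><a, k>\<close> equals the value of \<open>a\<close> at \<open>\<nu>\<close> times
  \<open><1, k>\<close>, which is nonzero although \<open>k\<close> is orthogonal to
  \<open>a\<close>.\<close>

lemma eigenvalue_circle:
  assumes k: "k \<in> aH2_perp B a" "Mz_adj B k = cnj \<nu> *\<^sub>C k" "k \<noteq> 0"
  shows "cmod \<nu> = 1"
proof (rule ccontr)
  have kC: "k \<in> hcarrier HB" using k(1) by (simp add: aH2_perp_def orth_compl_def)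
  have nz: "hinner HB 1 k \<noteq> 0" using eigenvector_one kC k by blast
  assume "cmod \<nu> \<noteq> 1"
  hence \<nu>: "cmod \<nu> < 1" using eigenvalue_le_1[OF kC k(2) one_dBR nz] by simp
  \<comment> \<open>The Szego kernel at \<open>\<nu>\<close>.\<close>
  define S where "S = Abs_fps (\<lambda>n. cnj \<nu> ^ n)"
  have "summable (\<lambda>n. ((cmod \<nu>)\<^sup>2) ^ n)" using \<nu> by (intro summable_geometric) (simp add: abs_square_less_1)
  hence S: "S \<in> hcarrier H2" by (simp add: S_def mem_H2_iff norm_power flip: power_mult) (simp add: mult.commute)
  have ev: "hinner H2 f S = eval_fps f \<nu>" for f by (simp add: hinner_H2 S_def eval_fps_def)
  obtain p where p: "\<forall>f\<in>hcarrier HB. \<forall>g\<in>hcarrier HB.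
      (\<lambda>n. hinner HB (fps_of_poly (p n) * f) g) \<longlonglongrightarrow> hinner HB (a * f) g"
    and p2: "\<forall>f\<in>hcarrier HB. \<forall>g\<in>hcarrier H2.
      (\<lambda>n. hinner H2 (fps_of_poly (p n) * f) g) \<longlonglongrightarrow> hinner H2 (a * f) g"
    using mate_weak_limit by blast
  have "(\<lambda>n. poly (p n) \<nu>) \<longlonglongrightarrow> eval_fps a \<nu>" using p2[rule_format, OF one_dBR S] by (simp add: ev)
  hence "(\<lambda>n. poly (p n) \<nu> * hinner HB 1 k) \<longlonglongrightarrow> eval_fps a \<nu> * hinner HB 1 k"
    by (intro tendsto_intros)
  moreover have "(\<lambda>n. poly (p n) \<nu> * hinner HB 1 k) \<longlonglongrightarrow> hinner HB (a * 1) k"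
    using p[rule_format, OF one_dBR kC] eigenvector_poly[OF kC k(2) one_dBR] by simp
  ultimately have "hinner HB (a * 1) k = eval_fps a \<nu> * hinner HB 1 k" using LIMSEQ_unique by blast
  moreover have "hinner HB (a * 1) k = 0"
  proof -
    have "hinner HB k (a * 1) = 0" using k(1) one_H2 by (auto simp: aH2_perp_def orth_compl_def)
    thus ?thesis using dBR.inner_commute[OF mate_mult_dBR(1)[OF one_H2] kC] by simp
  qed
  ultimately show False using nz a_nz[OF \<nu>] by simp
qed

text \<open>With \<open>F\<^sub>n = \<Sum>\<^bsub>i<n\<^esub> w\<^sup>i L\<^sup>i\<^sup>+\<^sup>1 f\<close> one has \<open>(z - w) F\<^sub>n = f - \<Sum>\<^bsub>i<n\<^esub> w\<^sup>i f\<^sub>i - w\<^sup>n L\<^sup>n f\<close>.\<close>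

lemma eigenvector_evaluation:
  assumes k: "k \<in> hcarrier HB" "Mz_adj B k = cnj \<nu> *\<^sub>C k" and f: "f \<in> hcarrier HB"
    and w: "cmod w < 1"
  shows "cmod (hinner HB f k - eval_fps f w * hinner HB 1 k)
    \<le> cmod (\<nu> - w) / (1 - cmod w) * (hnorm HB f * hnorm HB k)"
proof -
  let ?H = "dBR B"
  let ?FK = "hnorm ?H f * hnorm ?H k"
  have FK: "0 \<le> ?FK" using f k by (simp add: dBR.hnorm_ge0)
  have L: "fps_shift n f \<in> hcarrier ?H \<and> hnorm ?H (fps_shift n f) \<le> hnorm ?H f" for n
  proof (induction n)
    case (Suc n)
    have "fps_shift (Suc n) f = fps_shift 1 (fps_shift n f)" by (simp add: fps_eq_iff)
    thus ?case using shift_dBR[of "fps_shift n f"] Suc by auto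
  qed (use f in auto)
  note LC = conjunct1[OF L] and Ln = conjunct2[OF L]
  define c where "c n = hinner ?H (fps_shift n f) k" for n
  have cb: "cmod (c n) \<le> ?FK" for n
    unfolding c_def using dBR.cauchy_schwarz[OF LC k(1)] Ln dBR.hnorm_ge0[OF k(1)]
    by (meson mult_right_mono order_trans)
  \<comment> \<open>The \<open>n\<close>-th backward shift of \<open>f\<close> is its constant term
    plus \<open>z\<close> times the next shift; the eigenvector equation turns this into a recursion
    that telescopes.\<close>
  have rec: "c n = fps_nth f n * hinner ?H 1 k + \<nu> * c (Suc n)" for n
  proof -
    have "fps_shift n f = fps_nth f n *\<^sub>C 1 + fps_X * fps_shift (Suc n) f"
      unfolding scaleC_fps_complex by (auto simp: fps_eq_iff)
    hence "c n = hinner ?H (fps_nth f n *\<^sub>C 1 + fps_X * fps_shift (Suc n) f) k" by (simp add: c_def)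
    also have "\<dots> = fps_nth f n * hinner ?H 1 k + hinner ?H (fps_X * fps_shift (Suc n) f) k"
      using one_dBR Xf_mem[OF LC] k(1) by (simp add: dBR.inner_add_left dBR.scale_mem dBR.inner_scale_left)
    also have "hinner ?H (fps_X * fps_shift (Suc n) f) k = \<nu> * c (Suc n)"
      using eigenvector_X_power(2)[OF k LC, of 1 "Suc n"] by (simp add: c_def)
    finally show ?thesis .
  qed
  have tele: "c 0 - (\<Sum>i<n. w ^ i * fps_nth f i) * hinner ?H 1 k - w ^ n * c n = (\<nu> - w) * (\<Sum>i<n. w ^ i * c (Suc i))" for n
  proof (induction n)
    case (Suc n)
    show ?case using Suc rec[of n] by (simp add: algebra_simps)
  qed simp
  \<comment> \<open>A geometric series, as the backward shift is contractive. It produces the factor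
    \<open>1 / (1 - cmod w)\<close>, which a Stolz region compensates by
    \<open>cmod (\<nu> - w)\<close>.\<close>
  have bd: "cmod (c 0 - (\<Sum>i<n. w ^ i * fps_nth f i) * hinner ?H 1 k - w ^ n * c n) \<le> cmod (\<nu> - w) / (1 - cmod w) * ?FK" for n
  proof -
    have "cmod (\<Sum>i<n. w ^ i * c (Suc i)) \<le> (\<Sum>i<n. cmod w ^ i * ?FK)"
      by (intro sum_norm_le) (auto simp: norm_mult norm_power intro!: mult_left_mono cb)
    also have "\<dots> = (\<Sum>i<n. cmod w ^ i) * ?FK" by (simp add: sum_distrib_right)
    also have "\<dots> \<le> (1 / (1 - cmod w)) * ?FK"
    proof (intro mult_right_mono FK)
      show "(\<Sum>i<n. cmod w ^ i) \<le> 1 / (1 - cmod w)"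
        using w by (subst suminf_geometric[symmetric]) (auto intro!: sum_le_suminf summable_geometric)
    qed
    finally show ?thesis unfolding tele norm_mult
      by (auto dest: mult_left_mono[where c = "cmod (\<nu> - w)"])
  qed
  have "(\<lambda>n. c 0 - (\<Sum>i<n. w ^ i * fps_nth f i) * hinner ?H 1 k - w ^ n * c n)
      \<longlonglongrightarrow> c 0 - eval_fps f w * hinner ?H 1 k - 0"
  proof (intro tendsto_diff tendsto_mult tendsto_const)
    have "(\<lambda>i. w ^ i * fps_nth f i) sums eval_fps f w"
      using eval_vfps_sums[OF dBR_H2[OF f] w] by (simp add: eval_vfps_complex)
    thus "(\<lambda>n. \<Sum>i<n. w ^ i * fps_nth f i) \<longlonglongrightarrow> eval_fps f w" by (simp add: sums_def)
    show "(\<lambda>n. w ^ n * c n) \<longlonglongrightarrow> 0"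
    proof (rule Lim_null_comparison)
      show "\<forall>\<^sub>F n in sequentially. norm (w ^ n * c n) \<le> cmod w ^ n * ?FK"
        by (intro always_eventually allI) (auto simp: norm_mult norm_power intro!: mult_left_mono cb)
      show "(\<lambda>n. cmod w ^ n * ?FK) \<longlonglongrightarrow> 0"
        using tendsto_mult_right[OF LIMSEQ_realpow_zero[OF norm_ge_zero w], of ?FK] by simp
    qed
  qed
  hence "(\<lambda>n. cmod (c 0 - (\<Sum>i<n. w ^ i * fps_nth f i) * hinner ?H 1 k - w ^ n * c n))
      \<longlonglongrightarrow> cmod (c 0 - eval_fps f w * hinner ?H 1 k - 0)" by (rule tendsto_norm)
  hence "cmod (c 0 - eval_fps f w * hinner ?H 1 k - 0) \<le> cmod (\<nu> - w) / (1 - cmod w) * ?FK"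
    by (rule LIMSEQ_le_const2) (use bd in blast)
  thus ?thesis by (simp add: c_def)
qed

text \<open>On a fixed Stolz region \<open>eigenvector_evaluation\<close> bounds the difference
  between evaluation and the functional \<open>?E\<close> by a constant times the norm. Convergence,
  clear for polynomials, therefore extends to their closure.\<close>

lemma eigenvector_nt_limit:
  assumes k: "k \<in> hcarrier HB" "Mz_adj B k = cnj \<nu> *\<^sub>C k" "k \<noteq> 0" and f: "f \<in> hcarrier HB"
  shows "has_nt_limit (eval_fps f) \<nu> (hinner HB f k / hinner HB 1 k)"
  unfolding has_nt_limit_def
proof (intro allI impI)
  let ?H = "dBR B"
  let ?E = "\<lambda>f. hinner ?H f k / hinner ?H 1 k"
  have nz: "hinner ?H 1 k \<noteq> 0" by (rule eigenvector_one[OF k])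
  define C where "C = hnorm ?H k / cmod (hinner ?H 1 k)"
  have C: "C \<ge> 0" using dBR.hnorm_ge0[OF k(1)] by (simp add: C_def)
  fix \<alpha> :: real assume \<alpha>: "\<alpha> > 1"
  have bd: "cmod (?E u - eval_fps u z) \<le> \<alpha> * C * hnorm ?H u"
    if u: "u \<in> hcarrier ?H" and z: "z \<in> stolz \<alpha> \<nu>" for u z
  proof -
    have z1: "cmod z < 1" and "cmod (\<nu> - z) < \<alpha> * (1 - cmod z)"
      using z by (auto simp: stolz_def norm_minus_commute)
    hence q: "cmod (\<nu> - z) / (1 - cmod z) \<le> \<alpha>" by (simp add: divide_le_eq)
    have "cmod (hinner ?H u k - eval_fps u z * hinner ?H 1 k) \<le> \<alpha> * (hnorm ?H u * hnorm ?H k)"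
      by (rule order_trans[OF eigenvector_evaluation[OF k(1,2) u z1]])
         (intro mult_right_mono q mult_nonneg_nonneg dBR.hnorm_ge0 u k)
    moreover have "?E u - eval_fps u z = (hinner ?H u k - eval_fps u z * hinner ?H 1 k) / hinner ?H 1 k"
      using nz by (simp add: field_simps)
    ultimately show ?thesis using nz by (simp add: norm_divide C_def divide_right_mono mult_ac)
  qed
  show "(eval_fps f \<longlongrightarrow> ?E f) (at \<nu> within stolz \<alpha> \<nu>)"
    unfolding tendsto_iff
  proof (intro allI impI)
    fix e :: real assume e: "e > 0"
    have "f \<in> hclosure ?H {fps_of_poly p * 1 |p. True}" using f polynomials_dense by (simp add: cyclic_in_def)
    moreover have "e / (2 * (\<alpha> * C + 1)) > 0" using e \<alpha> C by (simp add: add_nonneg_pos)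
    ultimately obtain p where p: "hnorm ?H (f - fps_of_poly p) < e / (2 * (\<alpha> * C + 1))"
      unfolding hclosure_def by auto
    let ?p = "fps_of_poly p"
    have pC: "?p \<in> hcarrier ?H" by (rule poly_dBR)
    have Ep: "?E ?p = poly p \<nu>" using eigenvector_poly[OF k(1,2) one_dBR, of p] nz by simp
    have "(poly p \<longlongrightarrow> poly p \<nu>) (at \<nu> within stolz \<alpha> \<nu>)"
      by (rule tendsto_poly) (rule tendsto_ident_at)
    hence ev: "\<forall>\<^sub>F z in at \<nu> within stolz \<alpha> \<nu>. dist (poly p z) (poly p \<nu>) < e / 2"
      using e by (intro tendstoD) auto
    moreover have "\<forall>\<^sub>F z in at \<nu> within stolz \<alpha> \<nu>. z \<in> stolz \<alpha> \<nu>"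
      by (simp add: eventually_at_filter)
    ultimately show "\<forall>\<^sub>F z in at \<nu> within stolz \<alpha> \<nu>. dist (eval_fps f z) (?E f) < e"
    proof eventually_elim
      case (elim z)
      have z1: "cmod z < 1" using elim by (simp add: stolz_def)
      have "cmod (?E (f - ?p) - eval_fps (f - ?p) z) \<le> \<alpha> * C * hnorm ?H (f - ?p)"
        by (rule bd[OF dBR.diff_mem[OF f pC] elim(2)])
      also have "\<dots> \<le> (\<alpha> * C + 1) * hnorm ?H (f - ?p)"
        by (intro mult_right_mono dBR.hnorm_ge0 dBR.diff_mem f pC) simp
      also have "\<dots> < e / 2"
      proof -
        have "\<alpha> * C + 1 > 0" using \<alpha> C by (simp add: add_nonneg_pos)
        thus ?thesis using p by (simp add: field_simps)
      qed
      finally have 1: "cmod (?E (f - ?p) - eval_fps (f - ?p) z) < e / 2" .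
      have "?E (f - ?p) = ?E f - poly p \<nu>"
        unfolding Ep[symmetric] using f pC k(1) by (simp add: dBR.inner_diff_left diff_divide_distrib)
      moreover have "eval_fps (f - ?p) z = eval_fps f z - poly p z"
        by (subst eval_fps_diff) (auto intro!: conv_radius_gt[OF fps_conv_radius_H2[OF dBR_H2[OF f]] z1])
      ultimately have "eval_fps f z - ?E f = (poly p z - poly p \<nu>) - (?E (f - ?p) - eval_fps (f - ?p) z)"
        by simp
      also have "cmod \<dots> \<le> cmod (poly p z - poly p \<nu>) + cmod (?E (f - ?p) - eval_fps (f - ?p) z)"
        by (rule norm_triangle_ineq4)
      finally show ?case using 1 elim(1) by (simp add: dist_norm)
    qed
  qed
qed

text \<open>For necessity, cyclicity passes to the Hardy space because the inclusion is contractive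
  and polynomials are dense there. A zero of \<open>f\<close> at an eigenvalue would make the
  eigenvector orthogonal to \<open>[f]\<close>.\<close>

theorem cyclic_dBR_iff:
  assumes f: "f \<in> hcarrier HB"
  shows "cyclic_in HB f \<longleftrightarrow> cyclic_in H2 f \<and>
    (\<forall>\<nu>. cnj \<nu> \<in> eigenvalues_on (aH2_perp B a) (Mz_adj B) \<longrightarrow> nt_lim (eval_fps f) \<nu> \<noteq> 0)"
proof (intro iffI conjI allI impI)
  let ?H = "dBR B"
  have nt: "nt_lim (eval_fps f) \<nu> = hinner ?H f k / hinner ?H 1 k"
    if "k \<in> aH2_perp B a" "Mz_adj B k = cnj \<nu> *\<^sub>C k" "k \<noteq> 0" for k \<nu>
  proof (rule nt_lim_eqI)
    show "cmod \<nu> = 1" using that by (rule eigenvalue_circle)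
    have "k \<in> hcarrier ?H" using that(1) by (simp add: aH2_perp_def orth_compl_def)
    thus "has_nt_limit (eval_fps f) \<nu> (hinner ?H f k / hinner ?H 1 k)"
      using that(2,3) f by (rule eigenvector_nt_limit)
  qed
  {
    assume cyc: "cyclic_in ?H f"
    have "h \<in> hclosure H2 {fps_of_poly p * f |p. True}" if h: "h \<in> hcarrier H2" for h
      unfolding hclosure_def
    proof (intro CollectI conjI h allI impI)
      fix e :: real assume e: "e > 0"
      have "h \<in> hclosure H2 {fps_of_poly p * 1 |p. True}" using h cyclic_H2_one by (simp add: cyclic_in_def)
      moreover have e2: "e / 2 > 0" using e by simp
      ultimately obtain p where "hnorm H2 (h - fps_of_poly p * 1) < e / 2" unfolding hclosure_def by blast
      hence p: "hnorm H2 (h - fps_of_poly p) < e / 2" by simp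
      have "fps_of_poly p \<in> hclosure ?H {fps_of_poly p * f |p. True}"
        using poly_dBR cyc by (simp add: cyclic_in_def)
      then obtain q where q: "hnorm ?H (fps_of_poly p - fps_of_poly q * f) < e / 2"
        using e2 unfolding hclosure_def by blast
      have m: "fps_of_poly p \<in> hcarrier ?H" "fps_of_poly q * f \<in> hcarrier ?H"
        using poly_dBR poly_mult_dBR[OF f] by auto
      have "hnorm H2 (h - fps_of_poly q * f) \<le> hnorm H2 (h - fps_of_poly p) + hnorm H2 (fps_of_poly p - fps_of_poly q * f)"
        using m h by (intro H2.hnorm_diff_triangle) (auto intro: dBR_H2)
      also have "hnorm H2 (fps_of_poly p - fps_of_poly q * f) \<le> hnorm ?H (fps_of_poly p - fps_of_poly q * f)"
        using m by (intro hnorm_le_dBR dBR.diff_mem)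
      finally have "hnorm H2 (h - fps_of_poly q * f) < e" using p q by simp
      thus "\<exists>s\<in>{fps_of_poly p * f |p. True}. hnorm H2 (h - s) < e" by blast
    qed
    thus "cyclic_in H2 f" using H2.hclosure_carrier by (auto simp: cyclic_in_def)
  }
  {
    fix \<nu> assume cyc: "cyclic_in ?H f" and ev: "cnj \<nu> \<in> eigenvalues_on (aH2_perp B a) (Mz_adj B)"
    obtain k where k: "k \<in> aH2_perp B a" "Mz_adj B k = cnj \<nu> *\<^sub>C k" "k \<noteq> 0"
      using ev by (auto simp: eigenvalues_on_def)
    have kC: "k \<in> hcarrier ?H" using k(1) by (simp add: aH2_perp_def orth_compl_def)
    have "hinner ?H f k \<noteq> 0"
    proof
      assume 0: "hinner ?H f k = 0"
      have "hinner ?H k k = 0"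
      proof (rule dBR.inner_hclosure_eq0[where S = "{fps_of_poly p * f |p. True}"])
        show "k \<in> hclosure ?H {fps_of_poly p * f |p. True}" using cyc kC by (simp add: cyclic_in_def)
        fix s assume "s \<in> {fps_of_poly p * f |p. True}"
        thus "hinner ?H s k = 0" using eigenvector_poly[OF kC k(2) f] 0 by auto
      qed (use poly_mult_dBR[OF f] kC in auto)
      thus False using dBR.inner_definite[OF kC] k(3) by simp
    qed
    thus "nt_lim (eval_fps f) \<nu> \<noteq> 0" using nt[OF k] eigenvector_one[OF kC k(2,3)] by simp
  }
  assume asm: "cyclic_in H2 f \<and>
    (\<forall>\<nu>. cnj \<nu> \<in> eigenvalues_on (aH2_perp B a) (Mz_adj B) \<longrightarrow> nt_lim (eval_fps f) \<nu> \<noteq> 0)"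
  show "cyclic_in ?H f"
  proof (rule cyclic_if_annihilator_trivial[OF f], rule ccontr)
    assume "\<not> annihilator f \<subseteq> {0}"
    then obtain k \<mu> where k: "k \<in> annihilator f" "k \<noteq> 0" "Mz_adj B k = \<mu> *\<^sub>C k"
      using annihilator_eigenvector[OF f] asm by blast
    have kp: "k \<in> aH2_perp B a" using annihilator_subset_perp[OF f] asm k by blast
    have k': "Mz_adj B k = cnj (cnj \<mu>) *\<^sub>C k" using k(3) by simp
    have "cnj (cnj \<mu>) \<in> eigenvalues_on (aH2_perp B a) (Mz_adj B)"
      using kp k by (auto simp: eigenvalues_on_def)
    hence "nt_lim (eval_fps f) (cnj \<mu>) \<noteq> 0" using asm by blast
    hence "hinner ?H f k \<noteq> 0" using nt[OF kp k' k(2)] by auto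
    moreover have "hinner ?H (fps_of_poly 1 * f) k = 0" using k(1) unfolding annihilator_def by blast
    ultimately show False by simp
  qed
qed

end

section \<open>Lebesgue points\<close>

text \<open>Differentiation along intervals starting at \<open>x\<close> is applied to
  \<open>F\<close> and to its reflection, and the two one-sided windows are joined; the null set of
  the reflection is reflected back.\<close>

lemma lebesgue_differentiation_symmetric:
  fixes F :: "real \<Rightarrow> real"
  assumes F: "\<And>a b. F integrable_on {a..b}"
  shows "AE x in lebesgue. \<forall>e>0. \<exists>d>0. \<forall>h. 0 < h \<and> h < d \<longrightarrow>
    \<bar>integral {x-h..x+h} F - 2 * h * F x\<bar> \<le> e * h"
proof -
  obtain N1 where N1: "negligible N1" "\<And>x e. \<lbrakk>x \<notin> N1; 0 < e\<rbrakk> \<Longrightarrow> \<exists>d>0. \<forall>h. 0 < h \<and> h < d \<longrightarrow>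
      norm (integral (cbox x (x + h *\<^sub>R One)) F /\<^sub>R h ^ DIM(real) - F x) < e"
    using integrable_ccontinuous_explicit[of F] F by auto
  have "(\<lambda>x. F (- x)) integrable_on cbox a b" for a b
    using F[of "-b" "-a"] Henstock_Kurzweil_Integration.integrable_reflect_real[where f = F and a = "-b" and b = "-a"] by simp
  then obtain N2 where N2: "negligible N2" "\<And>x e. \<lbrakk>x \<notin> N2; 0 < e\<rbrakk> \<Longrightarrow> \<exists>d>0. \<forall>h. 0 < h \<and> h < d \<longrightarrow>
      norm (integral (cbox x (x + h *\<^sub>R One)) (\<lambda>x. F (-x)) /\<^sub>R h ^ DIM(real) - F (-x)) < e"
    using integrable_ccontinuous_explicit[of "\<lambda>x. F (- x)"] by auto
  have "negligible (uminus ` N2)"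
    by (rule negligible_differentiable_image_negligible[OF _ N2(1)])
       (auto intro!: differentiable_on_minus differentiable_on_id)
  with N1(1) have "N1 \<union> uminus ` N2 \<in> null_sets lebesgue"
    by (simp add: negligible_iff_null_sets[symmetric])
  moreover have "\<forall>e>0. \<exists>d>0. \<forall>h. 0 < h \<and> h < d \<longrightarrow> \<bar>integral {x-h..x+h} F - 2 * h * F x\<bar> \<le> e * h"
    if x: "x \<notin> N1 \<union> uminus ` N2" for x
  proof (intro allI impI)
    fix e :: real assume e: "e > 0"
    have xN: "x \<notin> N1" "-x \<notin> N2" using x imageI[of "-x" N2 uminus] by auto
    have e2: "0 < e / 2" using e by simp
    obtain d1 where d1: "d1 > 0" "\<And>h. 0 < h \<Longrightarrow> h < d1 \<Longrightarrow> \<bar>inverse h * integral {x..x+h} F - F x\<bar> < e/2"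
      using N1(2)[OF xN(1) e2] by auto
    obtain d2 where d2: "d2 > 0" "\<And>h. 0 < h \<Longrightarrow> h < d2 \<Longrightarrow> \<bar>inverse h * integral {-x..-x+h} (\<lambda>x. F (-x)) - F x\<bar> < e/2"
      using N2(2)[OF xN(2) e2] by auto
    have "\<bar>integral {x-h..x+h} F - 2 * h * F x\<bar> \<le> e * h" if h: "0 < h" "h < min d1 d2" for h
    proof -
      have r: "integral {-x..-x+h} (\<lambda>x. F (-x)) = integral {x-h..x} F"
        using Henstock_Kurzweil_Integration.integral_reflect_real[of x "x-h" F] by simp
      have c: "integral {x-h..x} F + integral {x..x+h} F = integral {x-h..x+h} F"
        using h by (intro Henstock_Kurzweil_Integration.integral_combine F) auto
      have "\<bar>integral {x..x+h} F - h * F x\<bar> \<le> e/2 * h" "\<bar>integral {x-h..x} F - h * F x\<bar> \<le> e/2 * h"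
        using d1(2)[of h] d2(2)[of h] h r by (auto simp: abs_le_iff abs_less_iff field_simps)
      thus ?thesis unfolding c[symmetric] abs_le_iff by (simp add: algebra_simps)
    qed
    thus "\<exists>d>0. \<forall>h. 0 < h \<and> h < d \<longrightarrow> \<bar>integral {x-h..x+h} F - 2 * h * F x\<bar> \<le> e * h"
      using d1(1) d2(1) by (intro exI[of _ "min d1 d2"]) auto
  qed
  ultimately show ?thesis by (intro AE_I'[of "N1 \<union> uminus ` N2"]) blast+
qed

text \<open>Lebesgue points of the open parameter interval, so that small windows do not wrap around
  the circle.\<close>

definition leb_pt :: "(real \<Rightarrow> 'b::euclidean_space) \<Rightarrow> real \<Rightarrow> bool" where
  "leb_pt f t \<longleftrightarrow> 0 < t \<and> t < 2 * pi \<and> (\<forall>e>0. \<exists>d>0. \<forall>h. 0 < h \<and> h < d \<longrightarrow>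
     (LINT x|circle. indicator {t-h..t+h} x * norm (f x - f t)) \<le> e * h)"

lemma integrable_circle_times_indicator:
  fixes g :: "real \<Rightarrow> real"
  assumes "integrable circle g"
  shows "integrable circle (\<lambda>x. indicator {a..b} x * g x)"
proof -
  have "{a..b} \<inter> {0..2*pi} \<in> sets circle" by (auto simp: sets_restrict_space)
  from integrable_real_mult_indicator[OF this assms] show ?thesis
    by (rule Bochner_Integration.integrable_cong[THEN iffD1, rotated -1]) (auto simp: indicator_def)
qed

lemma circle_integral_window:
  fixes g :: "real \<Rightarrow> real"
  assumes g: "integrable circle g" and "0 \<le> a" "b \<le> 2*pi"
  shows "(LINT x|circle. indicator {a..b} x * g x) = integral {a..b} g"
proof -
  have "(LINT x|circle. indicator {a..b} x * g x) = (LINT x|lebesgue. indicator {0..2*pi} x *\<^sub>R (indicator {a..b} x * g x))"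
    by (subst integral_restrict_space) auto
  also have "\<dots> = (LINT x|lebesgue. indicator {a..b} x *\<^sub>R g x)"
    using assms(2,3) by (intro Bochner_Integration.integral_cong) (auto simp: indicator_def)
  also have "\<dots> = (LINT x|lebesgue_on {a..b}. g x)"
    by (subst integral_restrict_space) auto
  also have "\<dots> = integral {a..b} g"
  proof (rule lebesgue_integral_eq_integral)
    show "integrable (lebesgue_on {a..b}) g"
      using assms(2,3) by (intro integrable_subinterval[OF g]) auto
  qed simp
  finally show ?thesis .
qed

text \<open>Differentiating \<open>norm (f x - q)\<close> for countably many dense \<open>q\<close>
  gives one common null set, while the constants \<open>f t\<close> themselves are uncountable in
  number.\<close>

lemma AE_leb_pt:
  fixes f :: "real \<Rightarrow> 'b::euclidean_space"
  assumes f: "integrable circle f"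
  shows "AE t in circle. leb_pt f t"
proof -
  obtain Q :: "'b set" where Q: "countable Q" "\<And>X. open X \<Longrightarrow> X \<noteq> {} \<Longrightarrow> \<exists>d\<in>Q. d \<in> X"
    using countable_dense_exists by auto
  define F where "F q x = (if x \<in> {0..2*pi} then norm (f x - q) else 0)" for q x
  have int: "integrable circle (\<lambda>x. norm (f x - q))" for q
    by (intro integrable_norm Bochner_Integration.integrable_diff f) simp
  have F: "F q integrable_on {a..b}" for q a b
  proof -
    have "(\<lambda>x. norm (f x - q)) absolutely_integrable_on {0..2*pi}"
      using int[of q] by (simp add: integrable_restrict_space set_integrable_def)
    hence "F q absolutely_integrable_on UNIV"
      unfolding F_def by (simp only: absolutely_integrable_restrict_UNIV)
    hence "F q integrable_on UNIV" by (rule set_lebesgue_integral_eq_integral(1))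
    thus ?thesis using integrable_on_subcbox[of "F q" UNIV a b] by simp
  qed
  define P where "P q t \<longleftrightarrow> (\<forall>e>0. \<exists>d>0. \<forall>h. 0 < h \<and> h < d \<longrightarrow>
      \<bar>integral {t-h..t+h} (F q) - 2 * h * F q t\<bar> \<le> e * h)" for q t
  have "AE t in lebesgue. \<forall>q\<in>Q. P q t"
    unfolding P_def using Q(1) lebesgue_differentiation_symmetric[OF F] by (intro AE_ball_countable[THEN iffD2]) auto
  moreover have "AE t in lebesgue. t \<noteq> 0 \<and> t \<noteq> 2 * pi"
    by (intro AE_I'[of "{0, 2*pi}"]) (auto intro: negligible_iff_null_sets[THEN iffD1])
  ultimately have "AE t in lebesgue. t \<in> {0..2*pi} \<longrightarrow> leb_pt f t"
  proof eventually_elim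
    case (elim t)
    show ?case
    proof
      assume "t \<in> {0..2*pi}"
      with elim have t: "0 < t" "t < 2*pi" by auto
      show "leb_pt f t" unfolding leb_pt_def
      proof (intro conjI t allI impI)
        fix e :: real assume e: "e > 0"
        \<comment> \<open>Budget per unit of \<open>h\<close>: \<open>e/4\<close> for the averaging
          error, \<open>e/4\<close> for \<open>F q t\<close> and \<open>e/4\<close> for replacing
          \<open>f t\<close> by \<open>q\<close>.\<close>
        obtain q where q: "q \<in> Q" "norm (f t - q) < e/8"
          using Q(2)[of "ball (f t) (e/8)"] e by (auto simp: dist_norm)
        obtain d where d: "d > 0" "\<And>h. 0 < h \<Longrightarrow> h < d \<Longrightarrow> \<bar>integral {t-h..t+h} (F q) - 2 * h * F q t\<bar> \<le> e/4 * h"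
          using elim q(1) e unfolding P_def by (metis zero_less_divide_iff zero_less_numeral)
        have "(LINT x|circle. indicator {t-h..t+h} x * norm (f x - f t)) \<le> e * h"
          if h: "0 < h" "h < Min {d, t, 2*pi-t}" for h
        proof -
          have w: "0 \<le> t-h" "t+h \<le> 2*pi" using h by auto
          have "(LINT x|circle. indicator {t-h..t+h} x * norm (f x - f t)) \<le>
              (LINT x|circle. indicator {t-h..t+h} x * (norm (f x - q) + e/8))"
          proof (intro integral_mono integrable_circle_times_indicator Bochner_Integration.integrable_add int)
            fix x show "indicator {t-h..t+h} x * norm (f x - f t) \<le> indicator {t-h..t+h} x * (norm (f x - q) + e/8)"
              using norm_triangle_ineq[of "f x - q" "q - f t"] q(2) by (auto simp: norm_minus_commute indicator_def)
          qed simp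
          also have "\<dots> = integral {t-h..t+h} (\<lambda>x. norm (f x - q) + e/8)"
            using w by (intro circle_integral_window Bochner_Integration.integrable_add int) auto
          also have "\<dots> = integral {t-h..t+h} (\<lambda>x. F q x + e/8)"
            using w by (intro integral_cong) (auto simp: F_def)
          also have "\<dots> = integral {t-h..t+h} (F q) + 2*h*(e/8)"
            using h by (subst integral_add[OF F]) auto
          also have "\<dots> \<le> e/4*h + 2*h*F q t + 2*h*(e/8)" using abs_le_D1[OF d(2)[of h]] h by simp
          also have "\<dots> \<le> e/4*h + 2*h*(e/8) + 2*h*(e/8)" using q(2) t h by (auto simp: F_def)
          also have "\<dots> \<le> e*h" using e h by simp
          finally show ?thesis .
        qed
        thus "\<exists>d>0. \<forall>h. 0 < h \<and> h < d \<longrightarrow> (LINT x|circle. indicator {t-h..t+h} x * norm (f x - f t)) \<le> e * h"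
          using d(1) t by (intro exI[of _ "Min {d, t, 2*pi-t}"]) auto
      qed
    qed
  qed
  thus ?thesis by (subst AE_restrict_space_iff) auto
qed


section \<open>Poisson integrals\<close>

definition pk :: "complex \<Rightarrow> complex \<Rightarrow> real" where
  "pk z \<zeta> = Re ((\<zeta> + z) / (\<zeta> - z))"

lemma pk_eq:
  assumes "cmod \<zeta> = 1"
  shows "pk z \<zeta> = (1 - (cmod z)\<^sup>2) / (cmod (\<zeta> - z))\<^sup>2"
proof -
  have "(\<zeta> + z) / (\<zeta> - z) = (\<zeta> + z) * cnj (\<zeta> - z) / of_real ((cmod (\<zeta> - z))\<^sup>2)"
    by (subst complex_div_cnj) simp
  moreover have "Re ((\<zeta> + z) * cnj (\<zeta> - z)) = (cmod \<zeta>)\<^sup>2 - (cmod z)\<^sup>2"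
    unfolding cmod_power2 by (simp add: algebra_simps power2_eq_square)
  ultimately show ?thesis using assms by (simp add: pk_def Re_divide_of_real)
qed

lemma dist_cis_disc:
  assumes "cmod \<zeta> = 1" "cmod z < 1"
  shows "1 - cmod z \<le> cmod (\<zeta> - z)" "\<zeta> \<noteq> z" "0 < cmod (\<zeta> - z)"
  using norm_triangle_ineq2[of \<zeta> z] assms by auto

lemma pk_ge0: "cmod \<zeta> = 1 \<Longrightarrow> cmod z < 1 \<Longrightarrow> 0 \<le> pk z \<zeta>"
  by (simp add: pk_eq power_le_one)

lemma continuous_on_pk: "cmod z < 1 \<Longrightarrow> continuous_on (sphere 0 1) (pk z)"
  unfolding pk_def by (intro continuous_intros) (auto simp: dist_cis_disc)

text \<open>\<open>G\<close> sums to \<open>1 / (1 - cnj z * \<zeta>)\<close>. On the circle its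
  squared modulus times \<open>1 - (cmod z)^2\<close> is the Poisson kernel, while the inner product
  of \<open>U = f * G\<close> with \<open>G\<close> evaluates \<open>U\<close> at \<open>z\<close>,
  where \<open>G\<close> equals \<open>1 / (1 - (cmod z)^2)\<close>. Parseval equates the
  two.\<close>

lemma poisson_abs_summable:
  fixes f :: "complex fps"
  assumes f: "summable (\<lambda>n. norm (fps_nth f n))" and z: "cmod z < 1"
  shows "circ_mean (\<lambda>\<zeta>. of_real (pk z \<zeta>) * eval_vfps f \<zeta>) = eval_vfps f z"
proof -
  define G where "G = Abs_fps (\<lambda>n. cnj z ^ n)"
  have Gs: "summable (\<lambda>n. norm (fps_nth G n))"
    using z by (simp add: G_def norm_power)
  have zz: "1 - z * cnj z \<noteq> 0"
  proof
    assume "1 - z * cnj z = 0"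
    hence "complex_of_real ((cmod z)\<^sup>2) = of_real 1" unfolding complex_norm_square by simp
    hence "(cmod z)\<^sup>2 = 1" by (simp only: of_real_eq_iff)
    thus False using z abs_square_less_1[of "cmod z"] by simp
  qed
  have G: "eval_vfps G \<zeta> = 1 / (1 - cnj z * \<zeta>)" if "cmod \<zeta> \<le> 1" for \<zeta>
  proof -
    have "cmod (cnj z * \<zeta>) < 1" using z that mult_left_le[of "cmod \<zeta>" "cmod z"] by (simp add: norm_mult)
    from suminf_geometric[OF this] show ?thesis
      by (simp add: eval_vfps_def G_def power_mult_distrib mult.commute)
  qed
  have le1: "norm (w ^ n * fps_nth h n) \<le> norm (fps_nth h n)" if "cmod w \<le> 1" for w n and h :: "complex fps"
    using that by (simp add: norm_mult norm_power mult_left_le_one_le power_le_one)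
  have sm: "summable (\<lambda>n. norm (w ^ n * fps_nth h n))" if "cmod w \<le> 1" "summable (\<lambda>n. norm (fps_nth h n))" for w and h :: "complex fps"
    by (rule summable_comparison_test'[OF that(2)]) (use le1[OF that(1)] in simp)
  define U where "U = f * G"
  have Us: "summable (\<lambda>n. norm (fps_nth U n))"
  proof (rule summable_comparison_test'[OF summable_Cauchy_product[of "\<lambda>n. norm (fps_nth f n)" "\<lambda>n. norm (fps_nth G n)"]])
    fix n show "norm (norm (fps_nth U n)) \<le> (\<Sum>i\<le>n. norm (fps_nth f i) * norm (fps_nth G (n - i)))"
      unfolding U_def fps_mult_nth atLeast0AtMost
      by (simp flip: norm_mult) (rule norm_sum)
  qed (use f Gs in auto)
  have U: "eval_vfps U w = eval_vfps f w * eval_vfps G w" if "cmod w \<le> 1" for w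
  proof -
    have "eval_vfps f w * eval_vfps G w =
        (\<Sum>k. \<Sum>i\<le>k. (w ^ i * fps_nth f i) * (w ^ (k - i) * fps_nth G (k - i)))"
      unfolding eval_vfps_def scaleC_complex
      by (rule Cauchy_product) (intro sm that f Gs)+
    also have "\<dots> = eval_vfps U w"
      unfolding eval_vfps_def scaleC_complex U_def fps_mult_nth atLeast0AtMost
      by (intro suminf_cong) (auto simp: sum_distrib_left mult_ac power_add[symmetric] intro!: sum.cong)
    finally show ?thesis by simp
  qed
  have "(\<lambda>n. of_real (1 ^ (2 * n)) * cinner (fps_nth U n) (fps_nth G n)) sums
      circ_mean (\<lambda>w. cinner (eval_vfps U (of_real 1 * w)) (eval_vfps G (of_real 1 * w)))"
    by (rule parseval_sums) (use Us Gs in auto)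
  moreover have "(\<lambda>n. of_real (1 ^ (2 * n)) * cinner (fps_nth U n) (fps_nth G n)) sums eval_vfps U z"
    using summable_sums[OF summable_norm_cancel[OF sm[OF _ Us, of z]]] z
    by (simp add: G_def eval_vfps_def mult.commute)
  ultimately have "circ_mean (\<lambda>w. eval_vfps U w * cnj (eval_vfps G w)) = eval_vfps U z"
    by (auto dest: sums_unique2)
  hence "(1 - z * cnj z) * circ_mean (\<lambda>w. eval_vfps U w * cnj (eval_vfps G w)) = eval_vfps f z"
    using z zz by (simp add: U G mult.commute)
  moreover have "(1 - z * cnj z) * circ_mean (\<lambda>w. eval_vfps U w * cnj (eval_vfps G w)) =
      circ_mean (\<lambda>\<zeta>. of_real (pk z \<zeta>) * eval_vfps f \<zeta>)"
  proof (subst circ_mean_cmult[symmetric], unfold circ_mean_def, rule arg_cong[of _ _ "scaleR _"], rule Bochner_Integration.integral_cong[OF refl])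
    fix t
    define \<zeta> where "\<zeta> = cis t"
    have c: "cmod \<zeta> = 1" "\<zeta> * cnj \<zeta> = 1" by (auto simp: \<zeta>_def cis_cnj cis_mult)
    have n: "1 - cnj z * \<zeta> = cnj (\<zeta> - z) * \<zeta>" "1 - z * cnj \<zeta> = (\<zeta> - z) * cnj \<zeta>"
      using c(2) by (auto simp: algebra_simps)
    have "complex_of_real ((cmod (\<zeta> - z))\<^sup>2) = (1 - cnj z * \<zeta>) * (1 - z * cnj \<zeta>)"
      unfolding complex_norm_square n using c(2) by (simp add: algebra_simps)
    moreover have "complex_of_real (1 - (cmod z)\<^sup>2) = 1 - z * cnj z"
      by (simp only: of_real_diff of_real_1 complex_norm_square)
    ultimately show "(1 - z * cnj z) * (eval_vfps U (cis t) * cnj (eval_vfps G (cis t))) = of_real (pk z (cis t)) * eval_vfps f (cis t)"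
      using c(1) unfolding \<zeta>_def[symmetric] pk_eq[OF c(1)] of_real_divide
      by (simp add: U G)
  qed
  ultimately show ?thesis by simp
qed

lemma poisson_formula:
  fixes f :: "complex fps"
  assumes f: "fps_conv_radius f \<ge> 1" and s: "0 \<le> s" "s < 1" and z: "cmod z < 1"
  shows "eval_fps f (of_real s * z) = circ_mean (\<lambda>\<zeta>. of_real (pk z \<zeta>) * eval_fps f (of_real s * \<zeta>))"
proof -
  have "summable (\<lambda>n. norm (fps_nth (dilate s f) n))"
    using summable_fps_disc[OF f s] s by (simp add: dilate_def norm_mult norm_power)
  from poisson_abs_summable[OF this z] show ?thesis
    by (simp add: eval_vfps_def dilate_def eval_fps_def power_mult_distrib mult_ac)
qed

definition poisson :: "(real \<Rightarrow> 'b::euclidean_space) \<Rightarrow> complex \<Rightarrow> 'b" where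
  "poisson u z = (1 / (2 * pi)) *\<^sub>R (LINT t|circle. pk z (cis t) *\<^sub>R u t)"

lemma pk_le:
  assumes "cmod \<zeta> = 1" "cmod z < 1"
  shows "pk z \<zeta> \<le> 2 / (1 - cmod z)"
proof -
  have "pk z \<zeta> \<le> (1 - (cmod z)\<^sup>2) / (1 - cmod z)\<^sup>2"
    unfolding pk_eq[OF assms(1)] using assms dist_cis_disc[OF assms]
    by (intro divide_left_mono power_mono mult_pos_pos) (auto simp: power_le_one)
  also have "\<dots> = (1 + cmod z) / (1 - cmod z)"
    using assms by (simp add: divide_simps) (simp add: algebra_simps power2_eq_square)
  also have "\<dots> \<le> 2 / (1 - cmod z)" using assms by (intro divide_right_mono) auto
  finally show ?thesis .
qed

lemma measurable_pk: "cmod z < 1 \<Longrightarrow> (\<lambda>t. pk z (cis t)) \<in> borel_measurable circle"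
  by (rule borel_measurable_integrable[OF integrable_circle[OF continuous_on_pk]])

lemma integrable_pk_scaleR:
  fixes u :: "real \<Rightarrow> 'b::euclidean_space"
  assumes "integrable circle u" "cmod z < 1"
  shows "integrable circle (\<lambda>t. pk z (cis t) *\<^sub>R u t)"
proof (rule Bochner_Integration.integrable_bound[where f = "\<lambda>t. (2 / (1 - cmod z)) *\<^sub>R u t"])
  show "(\<lambda>t. pk z (cis t) *\<^sub>R u t) \<in> borel_measurable circle"
    by (intro borel_measurable_scaleR measurable_pk assms borel_measurable_integrable)
  show "AE t in circle. norm (pk z (cis t) *\<^sub>R u t) \<le> norm ((2 / (1 - cmod z)) *\<^sub>R u t)"
  proof (intro AE_I2)
    fix t
    have "pk z (cis t) * norm (u t) \<le> 2 / (1 - cmod z) * norm (u t)"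
      by (intro mult_right_mono pk_le) (use assms in auto)
    thus "norm (pk z (cis t) *\<^sub>R u t) \<le> norm ((2 / (1 - cmod z)) *\<^sub>R u t)"
      using pk_ge0[of "cis t" z] assms(2) by simp
  qed
qed (intro integrable_scaleR_right assms)

lemma integral_pk: "cmod z < 1 \<Longrightarrow> (LINT t|circle. pk z (cis t)) = 2 * pi"
proof -
  assume z: "cmod z < 1"
  have "circ_mean (\<lambda>\<zeta>. of_real (pk z \<zeta>) * eval_fps 1 (of_real 0 * \<zeta>)) = (1::complex)"
    using poisson_formula[of 1 0 z] z by simp
  hence "complex_of_real (circ_mean (pk z)) = of_real 1" by (simp add: circ_mean_of_real)
  hence "circ_mean (pk z) = 1" by (simp only: of_real_eq_iff)
  thus ?thesis by (simp add: circ_mean_def field_simps)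
qed


lemma poisson_diff_le:
  fixes u :: "real \<Rightarrow> 'b::euclidean_space"
  assumes u: "integrable circle u" and z: "cmod z < 1"
  shows "norm (poisson u z - c) \<le> (LINT x|circle. pk z (cis x) * norm (u x - c))"
proof -
  have int: "integrable circle (\<lambda>x. pk z (cis x) *\<^sub>R (u x - c))"
    by (intro integrable_pk_scaleR z Bochner_Integration.integrable_diff u) simp
  have "(LINT x|circle. pk z (cis x) *\<^sub>R c) = (2*pi) *\<^sub>R c"
    using integral_pk[OF z] integrable_circle[OF continuous_on_pk[OF z]] by (simp add: integral_scaleR_left)
  hence "poisson u z - c = (1/(2*pi)) *\<^sub>R (LINT x|circle. pk z (cis x) *\<^sub>R (u x - c))"
    using integrable_pk_scaleR[OF u z] integrable_pk_scaleR[OF circle.integrable_const z, of c]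
    by (simp add: poisson_def scaleR_diff_right)
  hence "norm (poisson u z - c) = 1/(2*pi) * norm (LINT x|circle. pk z (cis x) *\<^sub>R (u x - c))"
    by simp
  also have "\<dots> \<le> 1 * (LINT x|circle. norm (pk z (cis x) *\<^sub>R (u x - c)))"
    using pi_gt3 by (intro mult_mono integral_norm_bound) auto
  also have "\<dots> = (LINT x|circle. pk z (cis x) * norm (u x - c))"
    using pk_ge0[OF _ z] by simp
  finally show ?thesis .
qed

text \<open>The chord is \<open>4 * \<bar>sin u * cos u\<bar>\<close> with
  \<open>u = \<bar>x - t\<bar> / 4\<close>. Since \<open>t\<close> is interior, \<open>u\<close>
  stays below some \<open>M < pi / 2\<close>, which gives the constant \<open>(cos M)^2\<close>. It
  degenerates as \<open>t\<close> approaches an endpoint, where the parametrisation closes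
  up.\<close>

lemma norm_cis_diff_ge:
  assumes "0 < t" "t < 2*pi"
  obtains m where "0 < m" "\<And>x. x \<in> {0..2*pi} \<Longrightarrow> m * \<bar>x - t\<bar> \<le> cmod (cis x - cis t)"
proof -
  define M where "M = max t (2*pi-t) / 4"
  have M: "0 \<le> M" "M < pi/2" using assms by (auto simp: M_def)
  have sin_ge: "u * cos M \<le> sin u" if u: "0 \<le> u" "u \<le> M" for u
  proof (cases "u = 0")
    case False
    with u have "0 < u" by simp
    from MVT2[OF this, of sin cos] obtain \<xi> where \<xi>: "0 < \<xi>" "\<xi> < u" "sin u - sin 0 = (u - 0) * cos \<xi>"
      by auto
    have "cos M \<le> cos \<xi>" using \<xi> u M by (intro cos_monotone_0_pi_le) auto
    thus ?thesis using \<xi> u by (auto intro: mult_left_mono)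
  qed simp
  have "(cos M)\<^sup>2 * \<bar>x - t\<bar> \<le> cmod (cis x - cis t)" if x: "x \<in> {0..2*pi}" for x
  proof -
    define u where "u = \<bar>x - t\<bar> / 4"
    have u: "0 \<le> u" "u \<le> M" using x by (auto simp: u_def M_def)
    have "cis x - cis t = cis t * (exp (\<i> * of_real (x - t)) - 1)"
      unfolding cis_conv_exp[symmetric] by (simp only: right_diff_distrib cis_mult mult_1_right add_diff_cancel_left' diff_add_cancel add_diff_cancel_left add.commute[of t])
    hence "cmod (cis x - cis t) = 2 * \<bar>sin ((x - t) / 2)\<bar>"
      by (simp only: norm_mult norm_cis dist_exp_i_1 mult_1)
    also have "\<bar>sin ((x - t) / 2)\<bar> = \<bar>sin (2 * u)\<bar>"
    proof -
      have "(x - t) / 2 = 2 * u \<or> (x - t) / 2 = - (2 * u)" by (auto simp: u_def abs_if field_simps)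
      thus ?thesis by (elim disjE) (simp_all only: sin_minus abs_minus_cancel)
    qed
    also have "2 * \<bar>sin (2 * u)\<bar> = 4 * \<bar>sin u * cos u\<bar>" by (simp add: sin_double)
    also have "\<dots> \<ge> 4 * ((u * cos M) * cos M)"
    proof -
      have c: "0 \<le> cos M" "cos M \<le> cos u" using u M by (auto intro: cos_monotone_0_pi_le cos_ge_zero)
      have "(u * cos M) * cos M \<le> sin u * cos u" using c u sin_ge[OF u] by (intro mult_mono) (auto intro: order_trans[OF _ sin_ge[OF u]])
      thus ?thesis by simp
    qed
    finally show ?thesis by (simp add: u_def power2_eq_square mult_ac)
  qed
  moreover have "0 < (cos M)\<^sup>2" using M by (intro zero_less_power cos_gt_zero_pi) auto
  ultimately show ?thesis by (rule that[rotated])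
qed

text \<open>In a Stolz region the distance from \<open>z\<close> to \<open>cis t\<close> is at most
  \<open>\<alpha>\<close> times that to the circle, hence at most \<open>\<alpha>\<close> times that
  to \<open>cis x\<close>. So \<open>cis x - z\<close> is at least a fixed fraction of
  \<open>x - t\<close> in modulus.\<close>

lemma pk_stolz_le:
  assumes m: "0 < m" "m * \<bar>x - t\<bar> \<le> cmod (cis x - cis t)" and x: "x \<noteq> t"
    and z: "z \<in> stolz \<alpha> (cis t)" and \<alpha>: "\<alpha> > 1"
  shows "pk z (cis x) \<le> 2 * (1 - cmod z) * ((1 + \<alpha>) / m)\<^sup>2 / \<bar>x - t\<bar>\<^sup>2"
proof -
  define \<delta> where "\<delta> = 1 - cmod z"
  have z1: "cmod z < 1" "0 < \<delta>" and z2: "cmod (z - cis t) < \<alpha> * \<delta>" using z by (auto simp: stolz_def \<delta>_def)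
  have d: "\<delta> \<le> cmod (cis x - z)" unfolding \<delta>_def using z1 by (intro dist_cis_disc) auto
  have "m * \<bar>x - t\<bar> \<le> cmod (cis x - z) + cmod (z - cis t)"
    using m(2) norm_triangle_ineq[of "cis x - z" "z - cis t"] by simp
  also have "\<dots> \<le> cmod (cis x - z) + \<alpha> * cmod (cis x - z)"
    using z2 \<alpha> mult_left_mono[OF d, of \<alpha>] by linarith
  also have "\<dots> = (1 + \<alpha>) * cmod (cis x - z)" by (simp add: algebra_simps)
  finally have D: "m * \<bar>x - t\<bar> / (1 + \<alpha>) \<le> cmod (cis x - z)" using \<alpha> by (simp add: field_simps)
  have pos: "0 < m * \<bar>x - t\<bar> / (1 + \<alpha>)" using m x \<alpha> by (intro divide_pos_pos mult_pos_pos) auto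
  have "pk z (cis x) \<le> (1 - (cmod z)\<^sup>2) / (m * \<bar>x - t\<bar> / (1 + \<alpha>))\<^sup>2"
    using z1 D pos by (subst pk_eq) (auto intro!: divide_left_mono power_mono mult_pos_pos simp: power_le_one)
  also have "\<dots> \<le> (2 * \<delta>) / (m * \<bar>x - t\<bar> / (1 + \<alpha>))\<^sup>2"
  proof (intro divide_right_mono)
    have "1 - (cmod z)\<^sup>2 = (1 + cmod z) * \<delta>" by (simp add: \<delta>_def algebra_simps power2_eq_square)
    also have "\<dots> \<le> 2 * \<delta>" using z1 by (intro mult_right_mono) auto
    finally show "1 - (cmod z)\<^sup>2 \<le> 2 * \<delta>" .
  qed simp
  also have "\<dots> = 2 * \<delta> * ((1 + \<alpha>) / m)\<^sup>2 / \<bar>x - t\<bar>\<^sup>2"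
    by (simp add: power_divide power_mult_distrib)
  finally show ?thesis by (simp add: \<delta>_def)
qed


text \<open>The kernel is dominated by boxes of half-width \<open>2 ^ k * \<delta>\<close> and
  height \<open>A / (4 ^ k * \<delta>)\<close>. Their total mass is bounded, since widths double
  while heights shrink fourfold.\<close>

lemma dyadic_kernel_bound:
  fixes y \<delta> A :: real
  assumes \<delta>: "0 < \<delta>" and y: "0 \<le> y" "y \<le> 2 ^ K * \<delta>" and A: "2 \<le> A"
    and p1: "p \<le> 2 / \<delta>" and p2: "y > 0 \<Longrightarrow> p \<le> A * \<delta> / y\<^sup>2 / 4"
  shows "p \<le> (\<Sum>k\<le>K. A / (4 ^ k * \<delta>) * (if y \<le> 2 ^ k * \<delta> then 1 else 0))"
proof -
  \<comment> \<open>The smallest box containing \<open>y\<close> already dominates: for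
    \<open>k > 0\<close> the preceding box misses \<open>y\<close>, so the quadratic decay in
    \<open>y\<close> gives the required height.\<close>
  define k where "k = (LEAST k. y \<le> 2 ^ k * \<delta>)"
  have k: "y \<le> 2 ^ k * \<delta>" "k \<le> K" unfolding k_def by (auto intro: LeastI Least_le y)
  have "p \<le> A / (4 ^ k * \<delta>)"
  proof (cases k)
    case 0
    have "2 / \<delta> \<le> A / \<delta>" using A \<delta> by (intro divide_right_mono) auto
    with p1 0 show ?thesis by simp
  next
    case (Suc j)
    have "\<not> y \<le> 2 ^ j * \<delta>" using not_less_Least[of j "\<lambda>k. y \<le> 2 ^ k * \<delta>"] Suc by (simp add: k_def)
    hence j: "2 ^ j * \<delta> < y" "0 < 2 ^ j * \<delta>" using \<delta> by auto
    have "p \<le> A * \<delta> / y\<^sup>2 / 4" by (intro p2 less_trans[OF j(2) j(1)])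
    also have "\<dots> \<le> A * \<delta> / (2 ^ j * \<delta>)\<^sup>2 / 4"
      using j A \<delta> less_trans[OF j(2) j(1)] by (intro divide_right_mono divide_left_mono power_mono mult_pos_pos zero_less_power) auto
    also have "\<dots> = A / (4 ^ k * \<delta>)"
    proof -
      have "(4::real) ^ j = 2 ^ j * 2 ^ j" by (simp flip: power_mult_distrib)
      thus ?thesis using \<delta> by (simp add: Suc power2_eq_square field_simps)
    qed
    finally show ?thesis .
  qed
  also have "\<dots> = A / (4 ^ k * \<delta>) * (if y \<le> 2 ^ k * \<delta> then 1 else 0)" using k(1) by simp
  also have "\<dots> \<le> (\<Sum>k\<le>K. A / (4 ^ k * \<delta>) * (if y \<le> 2 ^ k * \<delta> then 1 else 0))"
    using k(2) A \<delta> by (intro member_le_sum) auto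
  finally show ?thesis .
qed

text \<open>Fatou's theorem. Boxes of half-width below \<open>d\<close> are controlled by the
  Lebesgue point condition; the part farther than \<open>d / 2\<close> from \<open>t\<close> carries
  the factor \<open>1 - cmod z\<close>.\<close>

lemma poisson_nt_limit:
  fixes u :: "real \<Rightarrow> 'b::euclidean_space"
  assumes u: "integrable circle u" and t: "leb_pt u t" and \<alpha>: "\<alpha> > 1"
  shows "(poisson u \<longlongrightarrow> u t) (at (cis t) within stolz \<alpha> (cis t))"
proof -
  define g where "g x = norm (u x - u t)" for x
  have g: "integrable circle g" "\<And>x. g x \<ge> 0"
    unfolding g_def by (intro integrable_norm Bochner_Integration.integrable_diff u) auto
  define I where "I = (LINT x|circle. g x)"
  have I: "I \<ge> 0" unfolding I_def using g by (intro integral_nonneg_AE) auto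
  have t0: "0 < t" "t < 2*pi" using t by (auto simp: leb_pt_def)
  obtain m where m: "0 < m" "\<And>x. x \<in> {0..2*pi} \<Longrightarrow> m * \<bar>x - t\<bar> \<le> cmod (cis x - cis t)"
    using norm_cis_diff_ge[OF t0] by blast
  \<comment> \<open>The summand 2 covers the bound \<open>2 / \<delta>\<close> on the innermost box;
    the other is four times the constant of \<open>pk_stolz_le\<close>.\<close>
  define A where "A = 2 + 8 * ((1 + \<alpha>) / m)\<^sup>2"
  have A: "2 \<le> A" "2 * ((1 + \<alpha>) / m)\<^sup>2 \<le> A / 4" "A > 0" by (auto simp: A_def intro!: add_pos_nonneg)
  show ?thesis unfolding tendsto_iff
  proof (intro allI impI)
    fix e :: real assume e: "e > 0"
    \<comment> \<open>The boxes add up to at most \<open>2 * A * e'\<close>, which is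
      \<open>e / 2\<close>; the far part takes the other half.\<close>
    define e' where "e' = e / (4 * A)"
    have e': "e' > 0" using e A by (simp add: e'_def)
    obtain d where d: "d > 0" "\<And>h. 0 < h \<Longrightarrow> h < d \<Longrightarrow> (LINT x|circle. indicator {t-h..t+h} x * g x) \<le> e' * h"
      using t e' unfolding leb_pt_def g_def by blast
    define C where "C = A / d\<^sup>2"
    have C: "C \<ge> 0" using A by (simp add: C_def)
    have "norm (poisson u z - u t) < e"
      if z: "z \<in> stolz \<alpha> (cis t)" and zd: "1 - cmod z < d" and zC: "(1 - cmod z) * (C * I) < e / 2" for z
    proof -
      define \<delta> where "\<delta> = 1 - cmod z"
      have \<delta>: "0 < \<delta>" "\<delta> < d" and z1: "cmod z < 1" using z zd by (auto simp: stolz_def \<delta>_def)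
      \<comment> \<open>The largest box covers distance \<open>d / 2\<close> from \<open>t\<close>
        but keeps its half-width below \<open>d\<close>.\<close>
      define K where "K = (LEAST k. d / 2 \<le> 2 ^ k * \<delta>)"
      obtain k0 where "d / 2 / \<delta> < 2 ^ k0" using real_arch_pow[of 2 "d / 2 / \<delta>"] by auto
      hence "d / 2 \<le> 2 ^ k0 * \<delta>" using \<delta> by (simp add: field_simps)
      hence K1: "d / 2 \<le> 2 ^ K * \<delta>" unfolding K_def by (rule LeastI)
      have K2: "2 ^ K * \<delta> < d"
      proof (cases K)
        case (Suc j)
        thus ?thesis using not_less_Least[of j "\<lambda>k. d / 2 \<le> 2 ^ k * \<delta>"] by (simp add: K_def)
      qed (use \<delta> in simp)
      define k where "k x = (\<Sum>k\<le>K. A / (4 ^ k * \<delta>) * (indicator {t - 2 ^ k * \<delta>..t + 2 ^ k * \<delta>} x * g x))" for x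
      have bd: "pk z (cis x) * g x \<le> k x + \<delta> * C * g x" if x: "x \<in> {0..2*pi}" for x
      proof (cases "\<bar>x - t\<bar> \<le> d / 2")
        case True
        have "pk z (cis x) \<le> (\<Sum>k\<le>K. A / (4 ^ k * \<delta>) * (if \<bar>x - t\<bar> \<le> 2 ^ k * \<delta> then 1 else 0))"
        proof (rule dyadic_kernel_bound)
          show "pk z (cis x) \<le> 2 / \<delta>" unfolding \<delta>_def by (rule pk_le) (use z1 in auto)
          assume "0 < \<bar>x - t\<bar>"
          hence "pk z (cis x) \<le> 2 * \<delta> * ((1 + \<alpha>) / m)\<^sup>2 / \<bar>x - t\<bar>\<^sup>2"
            unfolding \<delta>_def by (intro pk_stolz_le m x z \<alpha>) auto
          also have "\<dots> = \<delta> * (2 * ((1 + \<alpha>) / m)\<^sup>2) / \<bar>x - t\<bar>\<^sup>2" by simp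
          also have "\<dots> \<le> \<delta> * (A / 4) / \<bar>x - t\<bar>\<^sup>2"
            using \<delta> A by (intro divide_right_mono mult_left_mono) auto
          finally show "pk z (cis x) \<le> A * \<delta> / \<bar>x - t\<bar>\<^sup>2 / 4" by (simp add: mult.commute)
        qed (use \<delta> A True K1 in auto)
        hence "pk z (cis x) * g x \<le> (\<Sum>k\<le>K. A / (4 ^ k * \<delta>) * (if \<bar>x - t\<bar> \<le> 2 ^ k * \<delta> then 1 else 0)) * g x"
          using g by (intro mult_right_mono)
        also have "\<dots> = k x" unfolding k_def sum_distrib_right
          by (intro sum.cong refl) (auto simp: indicator_def abs_le_iff)
        finally show ?thesis using \<delta> C g(2)[of x] by (simp add: add_increasing2)
      next
        case False
        hence "pk z (cis x) \<le> 2 * \<delta> * ((1 + \<alpha>) / m)\<^sup>2 / \<bar>x - t\<bar>\<^sup>2"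
          using d(1) unfolding \<delta>_def by (intro pk_stolz_le m x z \<alpha>) auto
        also have "\<dots> = \<delta> * (2 * ((1 + \<alpha>) / m)\<^sup>2) / \<bar>x - t\<bar>\<^sup>2" by simp
        also have "\<dots> \<le> \<delta> * (A / 4) / (d / 2)\<^sup>2"
          using \<delta> A False d(1) by (intro frac_le mult_left_mono power_mono) auto
        also have "\<dots> = \<delta> * C" by (simp add: C_def power2_eq_square)
        finally have "pk z (cis x) * g x \<le> \<delta> * C * g x" using g by (intro mult_right_mono)
        moreover have "0 \<le> k x" unfolding k_def using \<delta> A g by (intro sum_nonneg mult_nonneg_nonneg) auto
        ultimately show ?thesis by simp
      qed
      have ki: "integrable circle k"
        unfolding k_def by (intro Bochner_Integration.integrable_sum integrable_mult_right integrable_circle_times_indicator g)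
      have "norm (poisson u z - u t) \<le> (LINT x|circle. pk z (cis x) * g x)"
        unfolding g_def by (rule poisson_diff_le[OF u z1])
      also have "\<dots> \<le> (LINT x|circle. k x + \<delta> * C * g x)"
      proof (rule integral_mono)
        show "integrable circle (\<lambda>x. pk z (cis x) * g x)"
          using integrable_pk_scaleR[OF g(1) z1] by simp
      qed (use bd ki g in auto)
      also have "\<dots> = (LINT x|circle. k x) + \<delta> * C * I"
        using ki g by (simp add: I_def)
      also have "(LINT x|circle. k x) = (\<Sum>k\<le>K. A / (4 ^ k * \<delta>) * (LINT x|circle. indicator {t - 2 ^ k * \<delta>..t + 2 ^ k * \<delta>} x * g x))"
        unfolding k_def by (simp add: integrable_circle_times_indicator g)
      also have "\<dots> \<le> (\<Sum>k\<le>K. A / (4 ^ k * \<delta>) * (e' * (2 ^ k * \<delta>)))"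
      proof (intro sum_mono mult_left_mono d(2))
        fix k assume "k \<in> {..K}"
        hence "2 ^ k * \<delta> \<le> 2 ^ K * \<delta>" using \<delta> by (intro mult_right_mono power_increasing) auto
        thus "2 ^ k * \<delta> < d" using K2 by simp
      qed (use \<delta> A in auto)
      also have "\<dots> = (\<Sum>k\<le>K. A * e' * (1/2) ^ k)"
      proof (intro sum.cong refl)
        fix k
        have "(4::real) ^ k = 2 ^ k * 2 ^ k" by (simp flip: power_mult_distrib)
        thus "A / (4 ^ k * \<delta>) * (e' * (2 ^ k * \<delta>)) = A * e' * (1/2) ^ k"
          using \<delta> by (simp add: power_divide field_simps)
      qed
      also have "\<dots> \<le> A * e' * 2"
        unfolding sum_distrib_left[symmetric]
      proof (intro mult_left_mono)
        have "(\<Sum>k\<le>K. (1/2) ^ k) \<le> (\<Sum>k. (1/2::real) ^ k)"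
          by (rule sum_le_suminf) (auto intro: summable_geometric)
        thus "(\<Sum>k\<le>K. (1/2) ^ k) \<le> (2::real)" by (simp add: suminf_geometric)
      qed (use A e' in auto)
      also have "\<dots> = e / 2" using A by (simp add: e'_def)
      finally show ?thesis using zC by (simp add: \<delta>_def mult.assoc)
    qed
    note bound = this
    have lim: "((\<lambda>z. (1 - cmod z) * c) \<longlongrightarrow> (1 - cmod (cis t)) * c) (at (cis t) within stolz \<alpha> (cis t))" for c
      by (intro tendsto_intros)
    have "\<forall>\<^sub>F z in at (cis t) within stolz \<alpha> (cis t). z \<in> stolz \<alpha> (cis t)"
      by (simp add: eventually_at_filter)
    moreover have "\<forall>\<^sub>F z in at (cis t) within stolz \<alpha> (cis t). (1 - cmod z) * 1 < d"
      using d(1) by (intro order_tendstoD(2)[OF lim]) auto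
    moreover have "\<forall>\<^sub>F z in at (cis t) within stolz \<alpha> (cis t). (1 - cmod z) * (C * I) < e / 2"
      using e by (intro order_tendstoD(2)[OF lim]) auto
    ultimately show "\<forall>\<^sub>F z in at (cis t) within stolz \<alpha> (cis t). dist (poisson u z) (u t) < e"
      by eventually_elim (simp add: dist_norm bound)
  qed
qed

section \<open>Boundary functions\<close>

lemma fatou_integrable:
  fixes u :: "nat \<Rightarrow> 'a \<Rightarrow> real"
  assumes u: "\<And>n. integrable M (u n)" "\<And>n. AE x in M. 0 \<le> u n x"
    and lim: "AE x in M. (\<lambda>n. u n x) \<longlonglongrightarrow> v x" and v: "v \<in> borel_measurable M"
    and C: "\<And>n. (LINT x|M. u n x) \<le> C n" "C \<longlonglongrightarrow> c"
  shows "integrable M v" "(LINT x|M. v x) \<le> c"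
proof -
  note [measurable] = borel_measurable_integrable[OF u(1)] v
  have AE: "AE x in M. \<forall>n. 0 \<le> u n x" using u(2) by (simp add: AE_all_countable)
  from AE lim have v0: "AE x in M. 0 \<le> v x"
    by eventually_elim (auto intro: LIMSEQ_le_const)
  have C0: "0 \<le> C n" for n using order_trans[OF integral_nonneg_AE[OF u(2)] C(1)] .
  have c0: "0 \<le> c" using C0 C(2) by (intro LIMSEQ_le_const) auto
  from lim have lim': "AE x in M. liminf (\<lambda>n. ennreal (u n x)) = ennreal (v x)"
    by eventually_elim (intro lim_imp_Liminf tendsto_ennrealI sequentially_bot)
  have "(\<integral>\<^sup>+x. ennreal (v x) \<partial>M) = (\<integral>\<^sup>+x. liminf (\<lambda>n. ennreal (u n x)) \<partial>M)"
    using lim' by (intro nn_integral_cong_AE) auto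
  also have "\<dots> \<le> liminf (\<lambda>n. \<integral>\<^sup>+x. ennreal (u n x) \<partial>M)" by (rule nn_integral_liminf) simp
  also have "\<dots> \<le> liminf (\<lambda>n. ennreal (C n))"
    using C(1) by (intro Liminf_mono always_eventually allI) (simp add: nn_integral_eq_integral u ennreal_leI)
  also have "\<dots> = ennreal c" by (intro lim_imp_Liminf tendsto_ennrealI C sequentially_bot)
  finally have le: "(\<integral>\<^sup>+x. ennreal (v x) \<partial>M) \<le> ennreal c" .
  show vi: "integrable M v"
  proof (subst integrable_iff_bounded, intro conjI v)
    have "(\<integral>\<^sup>+x. norm (v x) \<partial>M) = (\<integral>\<^sup>+x. ennreal (v x) \<partial>M)"
      using v0 by (intro nn_integral_cong_AE) auto
    thus "(\<integral>\<^sup>+x. norm (v x) \<partial>M) < \<infinity>" using le by (auto intro: le_less_trans)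
  qed
  show "(LINT x|M. v x) \<le> c"
    using le c0 by (simp add: nn_integral_eq_integral[OF vi v0])
qed

lemma circle_L2_imp_L1:
  fixes h :: "real \<Rightarrow> complex"
  assumes h: "h \<in> borel_measurable circle" "integrable circle (\<lambda>t. (cmod (h t))\<^sup>2)"
  shows "integrable circle h"
    and "(LINT t|circle. cmod (h t))\<^sup>2 \<le> 2 * pi * (LINT t|circle. (cmod (h t))\<^sup>2)"
proof -
  note [measurable] = h(1)
  have i: "integrable circle (\<lambda>t. cmod (h t))"
    by (rule circle.square_integrable_imp_integrable[OF measurable_compose[OF h(1) borel_measurable_norm] h(2)])
  thus "integrable circle h" using h(1) by (simp only: integrable_norm_iff)
  \<comment> \<open>Cauchy-Schwarz on a finite measure space as nonnegativity of a variance;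
    \<open>2 * pi\<close> is the total mass.\<close>
  define m where "m = (LINT t|circle. cmod (h t))"
  have "0 \<le> (LINT t|circle. (cmod (h t) - m / (2 * pi))\<^sup>2)" by (intro integral_nonneg_AE) auto
  also have "\<dots> = (LINT t|circle. (cmod (h t))\<^sup>2 - (m / pi) * cmod (h t) + (m / (2 * pi))\<^sup>2)"
    by (intro Bochner_Integration.integral_cong) (auto simp: power2_eq_square algebra_simps)
  also have "\<dots> = (LINT t|circle. (cmod (h t))\<^sup>2) - m\<^sup>2 / (2 * pi)"
    using h(2) i by (simp add: m_def[symmetric] measure_restrict_space power2_eq_square divide_simps)
       (simp add: algebra_simps)
  finally show "m\<^sup>2 \<le> 2 * pi * (LINT t|circle. (cmod (h t))\<^sup>2)"
    by (simp add: field_simps)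
qed

lemma parseval_abs_summable:
  fixes f :: "complex fps"
  assumes "summable (\<lambda>n. norm (fps_nth f n))" "f \<in> hcarrier H2"
  shows "circ_mean (\<lambda>z. (norm (eval_vfps f z))\<^sup>2) = (hnorm H2 f)\<^sup>2"
  using parseval_norm_sums[of 1 f] sums_H2[OF assms(2)] assms(1) by (auto dest: sums_unique2)

lemma eval_dilate: "eval_vfps (dilate s f) z = eval_fps f (of_real s * z)" for f :: "complex fps"
  by (simp add: eval_vfps_def dilate_def eval_fps_def power_mult_distrib mult_ac)

lemma summable_dilate:
  fixes f :: "complex fps"
  assumes "fps_conv_radius f \<ge> 1" "0 \<le> s" "s < 1"
  shows "summable (\<lambda>n. norm (fps_nth (dilate s f) n))"
  using summable_fps_disc[OF assms] assms(2) by (simp add: dilate_def norm_mult norm_power)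

text \<open>Dilation does not increase the norm, so the squared distance is at most
  \<open>2 |f|^2 - 2 Re <f_r, f>\<close>, where \<open>f_r\<close> is the dilate; weak convergence
  makes this tend to zero.\<close>

lemma dilate_tendsto:
  fixes f :: "complex fps"
  assumes f: "f \<in> hcarrier H2"
  shows "(\<lambda>k. hnorm H2 (dilate (rad k) f - f)) \<longlonglongrightarrow> 0"
proof -
  have d: "dilate (rad k) f \<in> hcarrier H2" "hnorm H2 (dilate (rad k) f) \<le> hnorm H2 f" for k
    using dilate_H2[OF f] rad_bounds by auto
  have "(\<lambda>k. complex_of_real (rad k ^ n) *\<^sub>C fps_nth f n) \<longlonglongrightarrow> complex_of_real (1 ^ n) *\<^sub>C fps_nth f n" for n
    by (intro scaleC.tendsto tendsto_intros rad_tendsto)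
  hence "(\<lambda>k. hinner H2 (dilate (rad k) f) f) \<longlonglongrightarrow> hinner H2 f f"
    by (intro H2_weak_limit(3)[OF d _ f]) (simp add: dilate_def)
  hence "(\<lambda>k. 2 * (hnorm H2 f)\<^sup>2 - 2 * Re (hinner H2 (dilate (rad k) f) f)) \<longlonglongrightarrow> 2 * (hnorm H2 f)\<^sup>2 - 2 * Re (hinner H2 f f)"
    by (intro tendsto_intros)
  hence "(\<lambda>k. 2 * (hnorm H2 f)\<^sup>2 - 2 * Re (hinner H2 (dilate (rad k) f) f)) \<longlonglongrightarrow> 0"
    by (simp add: H2.hnorm_sq f)
  hence "(\<lambda>k. (hnorm H2 (dilate (rad k) f - f))\<^sup>2) \<longlonglongrightarrow> 0"
  proof (rule tendsto_sandwich[OF _ _ tendsto_const, rotated 2])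
    have "(hnorm H2 (dilate (rad k) f - f))\<^sup>2 \<le> 2 * (hnorm H2 f)\<^sup>2 - 2 * Re (hinner H2 (dilate (rad k) f) f)" for k
    proof -
      have "(hnorm H2 (dilate (rad k) f - f))\<^sup>2 = (hnorm H2 (dilate (rad k) f))\<^sup>2 + (hnorm H2 f)\<^sup>2 - 2 * Re (hinner H2 (dilate (rad k) f) f)"
        using d f by (intro H2.hnorm_diff_sq)
      also have "(hnorm H2 (dilate (rad k) f))\<^sup>2 \<le> (hnorm H2 f)\<^sup>2"
        using d H2.hnorm_ge0 by (intro power_mono) auto
      finally show ?thesis by simp
    qed
    thus "\<forall>\<^sub>F k in sequentially. (hnorm H2 (dilate (rad k) f - f))\<^sup>2 \<le> 2 * (hnorm H2 f)\<^sup>2 - 2 * Re (hinner H2 (dilate (rad k) f) f)"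
      by simp
  qed simp
  hence "(\<lambda>k. sqrt ((hnorm H2 (dilate (rad k) f - f))\<^sup>2)) \<longlonglongrightarrow> sqrt 0" by (rule tendsto_real_sqrt)
  thus ?thesis using H2.hnorm_ge0[OF H2.diff_mem[OF d(1) f]] by simp
qed

text \<open>Dilates have absolutely summable coefficients, so Parseval holds on the unit circle
  itself. For \<open>k \<le> l\<close> the powers satisfy
  \<open>rad l ^ n - rad k ^ n \<le> 1 - rad k ^ n\<close>, so the bound depends on \<open>k\<close>
  alone.\<close>

lemma circle_dilate_diff:
  fixes f :: "complex fps"
  assumes f: "f \<in> hcarrier H2" and kl: "k \<le> l"
  shows "(LINT t|circle. (cmod (eval_fps f (of_real (rad k) * cis t) - eval_fps f (of_real (rad l) * cis t)))\<^sup>2)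
    \<le> 2 * pi * (hnorm H2 (dilate (rad k) f - f))\<^sup>2"
proof -
  define d where "d = dilate (rad k) f - dilate (rad l) f"
  have H: "dilate (rad k) f \<in> hcarrier H2" for k
    using dilate_H2[OF f] rad_bounds by auto
  hence dH: "d \<in> hcarrier H2" unfolding d_def by (intro H2.diff_mem) auto
  have sm: "summable (\<lambda>n. norm (fps_nth (dilate (rad k) f) n))" for k
    using rad_bounds by (intro summable_dilate fps_conv_radius_H2 f)
  have "summable (\<lambda>n. norm (fps_nth d n))"
    by (rule summable_comparison_test'[OF summable_add[OF sm[of k] sm[of l]]]) (auto simp: d_def norm_triangle_ineq4)
  from parseval_abs_summable[OF this dH]
  have "circ_mean (\<lambda>z. (norm (eval_vfps d z))\<^sup>2) = (hnorm H2 d)\<^sup>2" .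
  moreover have "eval_vfps d z = eval_fps f (of_real (rad k) * z) - eval_fps f (of_real (rad l) * z)" if z: "cmod z = 1" for z
  proof -
    have "summable (\<lambda>n. norm (z ^ n * fps_nth (dilate (rad k) f) n))" for k
      using sm[of k] z by (simp add: norm_mult norm_power)
    hence "summable (\<lambda>n. z ^ n * fps_nth (dilate (rad k) f) n)" for k by (rule summable_norm_cancel)
    from suminf_diff[OF this[of k] this[of l]] show ?thesis
      unfolding eval_dilate[symmetric] by (simp add: d_def eval_vfps_def right_diff_distrib)
  qed
  moreover have "(hnorm H2 d)\<^sup>2 \<le> (hnorm H2 (dilate (rad k) f - f))\<^sup>2"
  proof -
    have "norm (fps_nth d n) \<le> norm (fps_nth (dilate (rad k) f - f) n)" for n
    proof -
      have r: "rad k \<le> rad l" using kl by (simp add: rad_def frac_le)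
      have p: "rad k ^ n \<le> rad l ^ n" "rad l ^ n \<le> 1"
        using r rad_bounds by (auto intro!: power_mono power_le_one)
      have e: "fps_nth d n = of_real (rad k ^ n - rad l ^ n) * fps_nth f n"
        "fps_nth (dilate (rad k) f - f) n = of_real (rad k ^ n - 1) * fps_nth f n"
        by (simp_all add: d_def dilate_def algebra_simps)
      show ?thesis unfolding e norm_mult norm_of_real using p by (intro mult_right_mono) auto
    qed
    thus ?thesis using sums_H2[OF dH] sums_H2[OF H2.diff_mem[OF H f]]
      by (elim sums_le[rotated]) (auto intro: power_mono)
  qed
  ultimately show ?thesis unfolding circ_mean_def by (simp add: field_simps)
qed

lemma poisson_tendsto:
  fixes u :: "nat \<Rightarrow> real \<Rightarrow> 'b::euclidean_space"
  assumes u: "\<And>n. integrable circle (u n)" and v: "integrable circle v"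
    and lim: "(\<lambda>n. LINT t|circle. norm (u n t - v t)) \<longlonglongrightarrow> 0" and z: "cmod z < 1"
  shows "(\<lambda>n. poisson (u n) z) \<longlonglongrightarrow> poisson v z"
proof -
  have "(\<lambda>n. 1 / pi / (1 - cmod z) * (LINT t|circle. norm (u n t - v t))) \<longlonglongrightarrow> 1 / pi / (1 - cmod z) * 0"
    by (intro tendsto_intros lim)
  hence *: "(\<lambda>n. 1 / pi / (1 - cmod z) * (LINT t|circle. norm (u n t - v t))) \<longlonglongrightarrow> 0" by simp
  have "norm (poisson (u n) z - poisson v z) \<le> 1 / pi / (1 - cmod z) * (LINT t|circle. norm (u n t - v t))" for n
  proof -
    have "poisson (u n) z - poisson v z = (1 / (2 * pi)) *\<^sub>R (LINT t|circle. pk z (cis t) *\<^sub>R (u n t - v t))"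
      using integrable_pk_scaleR[OF u[of n] z] integrable_pk_scaleR[OF v z]
      by (simp add: poisson_def scaleR_diff_right)
    hence "norm (poisson (u n) z - poisson v z) = 1 / (2 * pi) * norm (LINT t|circle. pk z (cis t) *\<^sub>R (u n t - v t))"
      by simp
    also have "\<dots> \<le> 1 / (2 * pi) * (LINT t|circle. 2 / (1 - cmod z) * norm (u n t - v t))"
    proof (intro mult_left_mono order_trans[OF integral_norm_bound] integral_mono)
      show "integrable circle (\<lambda>t. norm (pk z (cis t) *\<^sub>R (u n t - v t)))"
        by (intro integrable_norm integrable_pk_scaleR z Bochner_Integration.integrable_diff u v)
      show "integrable circle (\<lambda>t. 2 / (1 - cmod z) * norm (u n t - v t))"
        by (intro integrable_mult_right integrable_norm Bochner_Integration.integrable_diff u v)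
      fix t show "norm (pk z (cis t) *\<^sub>R (u n t - v t)) \<le> 2 / (1 - cmod z) * norm (u n t - v t)"
        unfolding norm_scaleR using z by (intro mult_right_mono) (auto simp: pk_ge0 pk_le)
    qed simp
    also have "\<dots> = 1 / pi / (1 - cmod z) * (LINT t|circle. norm (u n t - v t))" by (simp add: field_simps)
    finally show ?thesis .
  qed
  hence "(\<lambda>n. poisson (u n) z - poisson v z) \<longlonglongrightarrow> 0"
    by (intro Lim_null_comparison[OF _ *]) auto
  thus ?thesis by (simp add: LIM_zero_iff)
qed

text \<open>The functions on circles of radius \<open>rad k\<close> are Cauchy in
  \<open>L^2\<close>. An almost everywhere convergent subsequence defines \<open>g\<close>, Fatou's
  lemma extends the Cauchy estimate to \<open>g\<close>, and the Poisson formula passes to the limit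
  in \<open>L^1\<close>. Nontangential limits then come from Lebesgue points of
  \<open>g\<close>.\<close>

lemma H2_boundary_function:
  fixes f :: "complex fps"
  assumes f: "f \<in> hcarrier H2"
  obtains g where "integrable circle g" "integrable circle (\<lambda>t. (cmod (g t))\<^sup>2)"
    "\<And>z. cmod z < 1 \<Longrightarrow> eval_fps f z = poisson g z"
    "AE t in circle. has_nt_limit (eval_fps f) (cis t) (g t)"
    "(LINT t|circle. (cmod (g t))\<^sup>2) = 2 * pi * (hnorm H2 f)\<^sup>2"
    "(\<lambda>k. LINT t|circle. cmod (eval_fps f (of_real (rad k) * cis t) - g t)) \<longlonglongrightarrow> 0"
proof -
  define h where "h k t = eval_fps f (of_real (rad k) * cis t)" for k t
  define E where "E k = 2 * pi * (hnorm H2 (dilate (rad k) f - f))\<^sup>2" for k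
  have conv: "fps_conv_radius f \<ge> 1" by (rule fps_conv_radius_H2[OF f])
  have E: "E \<longlonglongrightarrow> 0" unfolding E_def[abs_def] using tendsto_mult[OF tendsto_const tendsto_power[OF dilate_tendsto[OF f]], of "2*pi" 2] by simp
  have hc: "continuous_on (sphere 0 1) (\<lambda>z. eval_fps f (of_real (rad k) * z))" for k
    using continuous_eval_H2[OF f, of "rad k"] rad_bounds by (simp add: eval_vfps_complex)
  have hi: "integrable circle (h k)" for k unfolding h_def by (rule integrable_circle[OF hc])
  have hdi: "integrable circle (\<lambda>t. (cmod (h k t - h l t))\<^sup>2)" for k l
    unfolding h_def by (rule integrable_circle[of "\<lambda>z. (cmod (eval_fps f (of_real (rad k) * z) - eval_fps f (of_real (rad l) * z)))\<^sup>2"]) (intro continuous_intros hc)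
  have hE: "(LINT t|circle. (cmod (h k t - h l t))\<^sup>2) \<le> E k" if "k \<le> l" for k l
    unfolding h_def E_def by (rule circle_dilate_diff[OF f that])
  note [measurable] = borel_measurable_integrable[OF hi]
  have hL1: "(LINT t|circle. cmod (h k t - h l t))\<^sup>2 \<le> 2 * pi * E k" if "k \<le> l" for k l
    using circle_L2_imp_L1(2)[OF _ hdi[of k l]] hE[OF that] pi_gt_zero
    by (auto intro!: order_trans[OF circle_L2_imp_L1(2)] hdi)
  obtain r where r: "strict_mono r" "AE t in circle. Cauchy (\<lambda>i. h (r i) t)"
  proof (rule cauchy_L1_AE_cauchy_subseq[OF hi])
    fix e :: real assume e: "e > 0"
    have "(\<lambda>k. 2 * pi * E k) \<longlonglongrightarrow> 2 * pi * 0" by (intro tendsto_intros E)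
    hence "\<forall>\<^sub>F k in sequentially. 2 * pi * E k < e\<^sup>2" by (rule order_tendstoD(2)) (use e in simp)
    then obtain N where N: "\<And>k. k \<ge> N \<Longrightarrow> 2 * pi * E k < e\<^sup>2" by (auto simp: eventually_sequentially)
    have "(LINT t|circle. norm (h k t - h l t)) < e" if "k \<ge> N" "l \<ge> N" "k \<le> l" for k l
      by (rule power_less_imp_less_base[OF le_less_trans[OF hL1[OF that(3)] N[OF that(1)]]]) (use e in simp)
    moreover have "(LINT t|circle. norm (h k t - h l t)) = (LINT t|circle. norm (h l t - h k t))" for k l
      by (simp add: norm_minus_commute)
    ultimately show "\<exists>N. \<forall>i\<ge>N. \<forall>j\<ge>N. (LINT t|circle. norm (h i t - h j t)) < e"
      by (metis linear)
  qed blast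
  define g where "g t = lim (\<lambda>i. h (r i) t)" for t
  have g_meas [measurable]: "g \<in> borel_measurable circle"
    unfolding g_def by (rule borel_measurable_lim_metric) simp
  from r(2) have g_lim: "AE t in circle. (\<lambda>i. h (r i) t) \<longlonglongrightarrow> g t"
    by eventually_elim (auto simp: g_def Cauchy_convergent_iff convergent_LIMSEQ_iff)
  have hg: "integrable circle (\<lambda>t. (cmod (h k t - g t))\<^sup>2)"
    "(LINT t|circle. (cmod (h k t - g t))\<^sup>2) \<le> E k" for k
  proof -
    define v where "v i t = (cmod (h k t - h (r (i + k)) t))\<^sup>2" for i t
    \<comment> \<open>The shift by \<open>k\<close> makes the Cauchy estimate applicable along the
      subsequence.\<close>
    have kr: "k \<le> r (i + k)" for i using seq_suble[OF r(1), of "i + k"] by simp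
    have a: "integrable circle (v i)" "AE t in circle. 0 \<le> v i t"
      "(LINT t|circle. v i t) \<le> E k" for i unfolding v_def using hdi hE[OF kr] by auto
    have b: "AE t in circle. (\<lambda>i. v i t) \<longlonglongrightarrow> (cmod (h k t - g t))\<^sup>2"
      using g_lim
    proof eventually_elim
      case (elim t)
      from LIMSEQ_ignore_initial_segment[OF this, of k] show ?case
        unfolding v_def by (intro tendsto_intros)
    qed
    note F = fatou_integrable[OF a(1,2) b _ a(3) tendsto_const]
    show "integrable circle (\<lambda>t. (cmod (h k t - g t))\<^sup>2)"
      "(LINT t|circle. (cmod (h k t - g t))\<^sup>2) \<le> E k" by (auto intro!: F)
  qed
  have hgi: "integrable circle (\<lambda>t. h k t - g t)" for k
    by (rule circle_L2_imp_L1(1)[OF _ hg(1)]) simp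
  have gi: "integrable circle g"
    using Bochner_Integration.integrable_diff[OF hi[of 0] hgi[of 0]] by simp
  have L1: "(\<lambda>k. LINT t|circle. cmod (h k t - g t)) \<longlonglongrightarrow> 0"
  proof -
    have "(LINT t|circle. cmod (h k t - g t)) \<le> sqrt (2 * pi * E k)" for k
    proof (rule real_le_rsqrt)
      have "(LINT t|circle. cmod (h k t - g t))\<^sup>2 \<le> 2 * pi * (LINT t|circle. (cmod (h k t - g t))\<^sup>2)"
        by (rule circle_L2_imp_L1(2)[OF _ hg(1)[of k]]) simp
      also have "\<dots> \<le> 2 * pi * E k" by (rule mult_left_mono[OF hg(2)]) simp
      finally show "(LINT t|circle. cmod (h k t - g t))\<^sup>2 \<le> 2 * pi * E k" .
    qed
    moreover have "(\<lambda>k. sqrt (2 * pi * E k)) \<longlonglongrightarrow> sqrt (2 * pi * 0)" by (intro tendsto_intros E)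
    hence "(\<lambda>k. sqrt (2 * pi * E k)) \<longlonglongrightarrow> 0" by simp
    moreover have "0 \<le> (LINT t|circle. cmod (h k t - g t))" for k by (rule Bochner_Integration.integral_nonneg) simp
    ultimately show ?thesis by (rule_tac Lim_null_comparison) simp_all
  qed
  have hsq: "integrable circle (\<lambda>t. (cmod (h k t))\<^sup>2)" for k
    unfolding h_def by (rule integrable_circle[of "\<lambda>z. (cmod (eval_fps f (of_real (rad k) * z)))\<^sup>2"]) (intro continuous_intros hc)
  \<comment> \<open>Weighted triangle inequality for comparing the \<open>L^2\<close> norms of
    \<open>h k\<close> and \<open>g\<close> in both directions; \<open>k\<close> tends to infinity
    first, then \<open>\<eta>\<close> to 0.\<close>
  have sq_le: "(cmod x)\<^sup>2 \<le> (1 + \<eta>) * (cmod y)\<^sup>2 + (1 + 1 / \<eta>) * (cmod (x - y))\<^sup>2" if "\<eta> > 0" for x y \<eta>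
  proof -
    have "0 \<le> (\<eta> * cmod y - cmod (x - y))\<^sup>2 / \<eta>" using that by simp
    also have "\<dots> = \<eta> * (cmod y)\<^sup>2 - 2 * cmod y * cmod (x - y) + (cmod (x - y))\<^sup>2 / \<eta>"
      using that by (simp add: power2_eq_square field_simps)
    finally have "2 * cmod y * cmod (x - y) \<le> \<eta> * (cmod y)\<^sup>2 + (cmod (x - y))\<^sup>2 / \<eta>" by simp
    moreover have "(cmod x)\<^sup>2 \<le> (cmod y + cmod (x - y))\<^sup>2"
      using norm_triangle_ineq[of y "x - y"] by (intro power_mono) auto
    ultimately show ?thesis by (simp add: power2_sum algebra_simps)
  qed
  have gsq: "integrable circle (\<lambda>t. (cmod (g t))\<^sup>2)"
  proof (rule Bochner_Integration.integrable_bound)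
    show "integrable circle (\<lambda>t. 2 * (cmod (h 0 t))\<^sup>2 + 2 * (cmod (h 0 t - g t))\<^sup>2)"
      using hsq[of 0] hg(1)[of 0] by simp
    show "AE t in circle. norm ((cmod (g t))\<^sup>2) \<le> norm (2 * (cmod (h 0 t))\<^sup>2 + 2 * (cmod (h 0 t - g t))\<^sup>2)"
      using sq_le[of 1 "g t" "h 0 t" for t] by (auto simp: norm_minus_commute)
  qed simp
  define I where "I = (LINT t|circle. (cmod (g t))\<^sup>2)"
  define J where "J k = (LINT t|circle. (cmod (h k t))\<^sup>2)" for k
  have "(\<lambda>k. (2 * pi) * circ_mean (\<lambda>z. (norm (eval_vfps f (of_real (rad k) * z)))\<^sup>2)) \<longlonglongrightarrow> 2 * pi * (hnorm H2 f)\<^sup>2"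
    by (intro tendsto_intros circ_mean_norm_tendsto f)
  hence Jl: "J \<longlonglongrightarrow> 2 * pi * (hnorm H2 f)\<^sup>2"
    by (simp add: circ_mean_def J_def[abs_def] h_def eval_vfps_complex)
  have JI: "J k \<le> (1 + \<eta>) * I + (1 + 1 / \<eta>) * E k" "I \<le> (1 + \<eta>) * J k + (1 + 1 / \<eta>) * E k" if \<eta>: "\<eta> > 0" for k \<eta>
  proof -
    have "J k \<le> (LINT t|circle. (1 + \<eta>) * (cmod (g t))\<^sup>2 + (1 + 1 / \<eta>) * (cmod (h k t - g t))\<^sup>2)"
      unfolding J_def using gsq hg(1)[of k] hsq[of k] sq_le[OF \<eta>] by (intro integral_mono) auto
    also have "\<dots> = (1 + \<eta>) * I + (1 + 1 / \<eta>) * (LINT t|circle. (cmod (h k t - g t))\<^sup>2)"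
      using gsq hg(1)[of k] by (simp add: I_def)
    also have "\<dots> \<le> (1 + \<eta>) * I + (1 + 1 / \<eta>) * E k"
      using hg(2)[of k] \<eta> by (intro add_left_mono mult_left_mono) auto
    finally show "J k \<le> (1 + \<eta>) * I + (1 + 1 / \<eta>) * E k" .
    have "I \<le> (LINT t|circle. (1 + \<eta>) * (cmod (h k t))\<^sup>2 + (1 + 1 / \<eta>) * (cmod (h k t - g t))\<^sup>2)"
      unfolding I_def using gsq hg(1)[of k] hsq[of k] sq_le[OF \<eta>, of "g t" "h k t" for t]
      by (intro integral_mono) (auto simp: norm_minus_commute)
    also have "\<dots> = (1 + \<eta>) * J k + (1 + 1 / \<eta>) * (LINT t|circle. (cmod (h k t - g t))\<^sup>2)"
      using hsq[of k] hg(1)[of k] by (simp add: J_def)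
    also have "\<dots> \<le> (1 + \<eta>) * J k + (1 + 1 / \<eta>) * E k"
      using hg(2)[of k] \<eta> by (intro add_left_mono mult_left_mono) auto
    finally show "I \<le> (1 + \<eta>) * J k + (1 + 1 / \<eta>) * E k" .
  qed
  have lim1: "2 * pi * (hnorm H2 f)\<^sup>2 \<le> (1 + \<eta>) * I" "I \<le> (1 + \<eta>) * (2 * pi * (hnorm H2 f)\<^sup>2)" if \<eta>: "\<eta> > 0" for \<eta>
  proof -
    have "(\<lambda>k. (1 + \<eta>) * I + (1 + 1 / \<eta>) * E k) \<longlonglongrightarrow> (1 + \<eta>) * I + (1 + 1 / \<eta>) * 0"
      by (intro tendsto_intros E)
    with Jl JI(1)[OF \<eta>] show "2 * pi * (hnorm H2 f)\<^sup>2 \<le> (1 + \<eta>) * I"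
      by (intro LIMSEQ_le[of J _ "\<lambda>k. (1 + \<eta>) * I + (1 + 1 / \<eta>) * E k"]) auto
    have "(\<lambda>k. (1 + \<eta>) * J k + (1 + 1 / \<eta>) * E k) \<longlonglongrightarrow> (1 + \<eta>) * (2 * pi * (hnorm H2 f)\<^sup>2) + (1 + 1 / \<eta>) * 0"
      by (intro tendsto_intros E Jl)
    with JI(2)[OF \<eta>] show "I \<le> (1 + \<eta>) * (2 * pi * (hnorm H2 f)\<^sup>2)"
      by (intro LIMSEQ_le_const[of "\<lambda>k. (1 + \<eta>) * J k + (1 + 1 / \<eta>) * E k"]) auto
  qed
  have lim0: "x \<le> y" if "\<And>\<eta>::real. \<eta> > 0 \<Longrightarrow> x \<le> (1 + \<eta>) * y" for x y
  proof (rule tendsto_lowerbound)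
    show "((\<lambda>\<eta>. (1 + \<eta>) * y) \<longlongrightarrow> y) (at_right 0)" by (auto intro!: tendsto_eq_intros)
    show "\<forall>\<^sub>F \<eta> in at_right 0. x \<le> (1 + \<eta>) * y"
      using that by (auto simp: eventually_at_right_field intro!: exI[of _ 1])
  qed simp
  have I: "I = 2 * pi * (hnorm H2 f)\<^sup>2" using lim0[OF lim1(1)] lim0[OF lim1(2)] by simp
  have P: "eval_fps f z = poisson g z" if z: "cmod z < 1" for z
  proof (rule LIMSEQ_unique)
    show "(\<lambda>k. poisson (h k) z) \<longlonglongrightarrow> poisson g z" by (rule poisson_tendsto[OF hi gi L1 z])
    have "poisson (h k) z = eval_fps f (of_real (rad k) * z)" for k
      using poisson_formula[OF conv _ _ z, of "rad k"] rad_bounds[of k]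
      by (simp add: poisson_def circ_mean_def h_def scaleR_conv_of_real)
    moreover have "(\<lambda>k. eval_fps f (of_real (rad k) * z)) \<longlonglongrightarrow> eval_fps f (of_real 1 * z)"
    proof (rule isCont_tendsto_compose[where g = "eval_fps f"])
      have "ereal (norm z) < fps_conv_radius f" using conv_radius_gt[OF conv z] .
      thus "isCont (eval_fps f) (of_real 1 * z)" by (intro continuous_on_interior[OF continuous_on_eval_fps]) (simp add: interior_open[OF open_eball])
    qed (intro tendsto_intros rad_tendsto)
    ultimately show "(\<lambda>k. poisson (h k) z) \<longlonglongrightarrow> eval_fps f z" by simp
  qed
  have "AE t in circle. has_nt_limit (eval_fps f) (cis t) (g t)"
    using AE_leb_pt[OF gi]
  proof eventually_elim
    case (elim t)
    show ?case unfolding has_nt_limit_def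
    proof (intro allI impI)
      fix \<alpha> :: real assume "\<alpha> > 1"
      from poisson_nt_limit[OF gi elim this]
      show "(eval_fps f \<longlongrightarrow> g t) (at (cis t) within stolz \<alpha> (cis t))"
        by (rule Lim_transform_within[OF _ zero_less_one]) (simp add: P stolz_def)
    qed
  qed
  from that[OF gi gsq P this I[unfolded I_def] L1[unfolded h_def]] show ?thesis .
qed

section \<open>Outer functions\<close>

definition herglotz :: "(real \<Rightarrow> real) \<Rightarrow> complex \<Rightarrow> complex" where
  "herglotz u z = 1 / (2 * of_real pi) *
     (LINT t|circle. (cis t + z) / (cis t - z) * complex_of_real (u t))"

lemma outer_fps_iff:
  "outer_fps f \<longleftrightarrow> fps_conv_radius f \<ge> 1 \<and> (\<exists>c u. cmod c = 1 \<and> integrable circle u \<and>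
     (\<forall>z\<in>ball 0 1. eval_fps f z = c * exp (herglotz u z)))"
  unfolding outer_fps_def herglotz_def ..

lemma integrable_herglotz:
  assumes u: "integrable circle u" and z: "cmod z < 1"
  shows "integrable circle (\<lambda>t. (cis t + z) / (cis t - z) * complex_of_real (u t))"
proof (rule Bochner_Integration.integrable_bound[where f = "\<lambda>t. (2 / (1 - cmod z)) *\<^sub>R u t"])
  have "continuous_on (sphere 0 1) (\<lambda>\<zeta>. (\<zeta> + z) / (\<zeta> - z))"
    using z by (intro continuous_intros) (auto simp: dist_cis_disc)
  hence "(\<lambda>t. (cis t + z) / (cis t - z)) \<in> borel_measurable circle"
    by (rule borel_measurable_integrable[OF integrable_circle])
  thus "(\<lambda>t. (cis t + z) / (cis t - z) * complex_of_real (u t)) \<in> borel_measurable circle"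
    using u by (intro borel_measurable_times) auto
  have "cmod ((cis t + z) / (cis t - z)) \<le> 2 / (1 - cmod z)" for t
    using dist_cis_disc[of "cis t" z] z norm_triangle_ineq[of "cis t" z]
    by (auto simp: norm_divide intro!: frac_le)
  from mult_right_mono[OF this abs_ge_zero]
  show "AE t in circle. norm ((cis t + z) / (cis t - z) * complex_of_real (u t)) \<le> norm ((2 / (1 - cmod z)) *\<^sub>R u t)"
    using z unfolding norm_mult[of "(cis _ + z) / (cis _ - z)"] by (intro AE_I2) (simp add: abs_mult)
qed (intro integrable_scaleR_right u)

lemma Re_herglotz:
  assumes "integrable circle u" "cmod z < 1"
  shows "Re (herglotz u z) = poisson u z"
proof -
  have "herglotz u z = (1 / (2 * pi)) *\<^sub>R (LINT t|circle. (cis t + z) / (cis t - z) * complex_of_real (u t))"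
    by (simp add: herglotz_def scaleR_conv_of_real)
  hence "Re (herglotz u z) = (1 / (2 * pi)) *\<^sub>R (LINT t|circle. Re ((cis t + z) / (cis t - z) * complex_of_real (u t)))"
    by (simp only: scaleR_complex.sel integral_Re[OF integrable_herglotz[OF assms]] real_scaleR_def)
  also have "\<dots> = poisson u z" unfolding poisson_def pk_def Re_complex_of_real times_complex.sel
    by (simp del: Re_divide)
  finally show ?thesis .
qed

lemma herglotz_diff:
  assumes "integrable circle u" "integrable circle v" "cmod z < 1"
  shows "herglotz (\<lambda>t. u t - v t) z = herglotz u z - herglotz v z"
  unfolding herglotz_def of_real_diff right_diff_distrib
    Bochner_Integration.integral_diff[OF integrable_herglotz[OF assms(1,3)] integrable_herglotz[OF assms(2,3)]] ..

lemma herglotz_minus: "herglotz (\<lambda>t. - u t) z = - herglotz u z"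
  by (simp add: herglotz_def)

lemma herglotz_0: "herglotz u 0 = of_real ((LINT t|circle. u t) / (2 * pi))"
  by (simp add: herglotz_def)

text \<open>The kernel is \<open>2 / (1 - q) - 1\<close> with \<open>q = z * cnj (cis t)\<close>, a
  geometric series up to its constant term. The resulting power series yields holomorphy.\<close>

lemma herglotz_sums:
  assumes u: "integrable circle u" and z: "cmod z < 1"
  defines "c \<equiv> \<lambda>n. 1 / (2 * of_real pi) * (LINT t|circle. (if n = 0 then 1 else 2) * cnj (cis t) ^ n * complex_of_real (u t))"
  shows "(\<lambda>n. c n * z ^ n) sums herglotz u z"
proof -
  define k where "k n t = (if n = 0 then 1 else 2) * (z * cnj (cis t)) ^ n" for n t
  have k: "(\<lambda>n. k n t) sums ((cis t + z) / (cis t - z))" for t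
  proof -
    define q where "q = z * cnj (cis t)"
    have q: "cmod q < 1" using z by (simp add: q_def norm_mult)
    hence "q \<noteq> 1" by auto
    have "(\<lambda>n. 2 * q ^ n - (if n = 0 then 1 else 0)) sums (2 * (1 / (1 - q)) - 1)"
      by (intro sums_diff sums_mult geometric_sums q sums_single)
    moreover have "2 * q ^ n - (if n = 0 then 1 else 0) = k n t" for n by (simp add: k_def q_def)
    moreover have "2 * (1 / (1 - q)) - 1 = (cis t + z) / (cis t - z)"
    proof -
      have "q * cis t = z" by (simp add: q_def cis_cnj mult.assoc cis_mult)
      hence "cis t + z = (1 + q) * cis t" "cis t - z = (1 - q) * cis t" by (auto simp: algebra_simps)
      thus ?thesis using \<open>q \<noteq> 1\<close> by (simp add: divide_simps)
    qed
    ultimately show ?thesis by simp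
  qed
  have kn: "norm (k n t) \<le> 2 * cmod z ^ n" for n t by (simp add: k_def norm_mult norm_power)
  have km: "integrable circle (k n)" for n
    unfolding k_def by (intro continuous_imp_integrable_real continuous_intros)
  have i: "integrable circle (\<lambda>t. k n t * of_real (u t))" for n
  proof (rule Bochner_Integration.integrable_bound[where f = "\<lambda>t. (2 * cmod z ^ n) *\<^sub>R u t"])
    show "AE t in circle. norm (k n t * of_real (u t)) \<le> norm ((2 * cmod z ^ n) *\<^sub>R u t)"
      using mult_right_mono[OF kn abs_ge_zero] by (intro AE_I2) (simp add: norm_mult abs_mult)
  qed (use u km in \<open>auto intro!: borel_measurable_times\<close>)
  have sk: "(\<lambda>n. norm (k n t * of_real (u t))) sums (\<Sum>n. norm (k n t * of_real (u t)))" for t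
  proof (rule summable_sums, rule summable_comparison_test')
    show "summable (\<lambda>n. 2 * cmod z ^ n * \<bar>u t\<bar>)" using z by (intro summable_mult2 summable_mult summable_geometric) simp
    show "norm (norm (k n t * of_real (u t))) \<le> 2 * cmod z ^ n * \<bar>u t\<bar>" for n
      using mult_right_mono[OF kn abs_ge_zero] by (simp add: norm_mult)
  qed
  have "(\<lambda>n. LINT t|circle. k n t * of_real (u t)) sums (LINT t|circle. (\<Sum>n. k n t * of_real (u t)))"
  proof (rule sums_integral[OF i])
    show "AE t in circle. summable (\<lambda>n. norm (k n t * of_real (u t)))"
      using sk by (simp add: sums_iff)
    show "summable (\<lambda>n. LINT t|circle. norm (k n t * of_real (u t)))"
    proof (rule summable_comparison_test')
      show "summable (\<lambda>n. 2 * cmod z ^ n * (LINT t|circle. \<bar>u t\<bar>))"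
        using z by (intro summable_mult2 summable_mult summable_geometric) simp
      have "(LINT t|circle. norm (k n t * of_real (u t))) \<le> (LINT t|circle. 2 * cmod z ^ n * \<bar>u t\<bar>)" for n
        using mult_right_mono[OF kn abs_ge_zero] u by (intro integral_mono integrable_norm i) (auto simp: norm_mult)
      thus "norm (LINT t|circle. norm (k n t * of_real (u t))) \<le> 2 * cmod z ^ n * (LINT t|circle. \<bar>u t\<bar>)" for n
        by (simp add: abs_of_nonneg)
    qed
  qed
  also have "(\<lambda>t. \<Sum>n. k n t * of_real (u t)) = (\<lambda>t. (cis t + z) / (cis t - z) * of_real (u t))"
    using sums_mult2[OF k] by (auto simp: sums_iff)
  finally have "(\<lambda>n. 1 / (2 * of_real pi) * (LINT t|circle. k n t * of_real (u t))) sums herglotz u z"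
    unfolding herglotz_def by (rule sums_mult)
  moreover have "(LINT t|circle. k n t * of_real (u t)) =
      z ^ n * (LINT t|circle. (if n = 0 then 1 else 2) * cnj (cis t) ^ n * complex_of_real (u t))" for n
    unfolding k_def power_mult_distrib
    by (subst integral_mult_right_zero[symmetric]) (simp only: mult_ac)
  ultimately show ?thesis by (simp add: c_def mult_ac)
qed

lemma holomorphic_herglotz:
  assumes "integrable circle u"
  shows "herglotz u holomorphic_on ball 0 1"
proof (rule power_series_holomorphic)
  fix w :: complex assume "w \<in> ball 0 1"
  thus "(\<lambda>n. (1 / (2 * of_real pi) * (LINT t|circle. (if n = 0 then 1 else 2) * cnj (cis t) ^ n * complex_of_real (u t))) * (w - 0) ^ n) sums herglotz u w"
    using herglotz_sums[OF assms, of w] by simp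
qed

text \<open>The outer function with modulus \<open>exp u\<close> on the circle, normalised to be
  positive at 0.\<close>

definition outer_fun :: "(real \<Rightarrow> real) \<Rightarrow> complex fps" where
  "outer_fun u = fps_expansion (\<lambda>z. exp (herglotz u z)) 0"

lemma outer_fun:
  assumes u: "integrable circle u"
  shows "fps_conv_radius (outer_fun u) \<ge> 1"
    and "cmod z < 1 \<Longrightarrow> eval_fps (outer_fun u) z = exp (herglotz u z)"
    and "cmod z < 1 \<Longrightarrow> cmod (eval_fps (outer_fun u) z) = exp (poisson u z)"
proof -
  have "(\<lambda>z. exp (herglotz u z)) holomorphic_on ball 0 1"
    by (intro holomorphic_intros holomorphic_herglotz u)
  from fps_expansion_disc[OF this] show "fps_conv_radius (outer_fun u) \<ge> 1"
    "cmod z < 1 \<Longrightarrow> eval_fps (outer_fun u) z = exp (herglotz u z)" by (auto simp: outer_fun_def)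
  thus "cmod z < 1 \<Longrightarrow> cmod (eval_fps (outer_fun u) z) = exp (poisson u z)"
    by (simp add: Re_herglotz u)
qed

lemma poisson_mono:
  fixes u v :: "real \<Rightarrow> real"
  assumes u: "integrable circle u" and v: "integrable circle v"
    and le: "AE t in circle. u t \<le> v t" and z: "cmod z < 1"
  shows "poisson u z \<le> poisson v z"
proof -
  have "AE t in circle. pk z (cis t) *\<^sub>R u t \<le> pk z (cis t) *\<^sub>R v t"
    using le by eventually_elim (auto intro!: mult_left_mono pk_ge0 z)
  thus ?thesis unfolding poisson_def
    by (intro scaleR_left_mono integral_mono_AE integrable_pk_scaleR u v z) auto
qed

lemma poisson_const: "cmod z < 1 \<Longrightarrow> poisson (\<lambda>_. c) z = (c :: real)"
  by (simp add: poisson_def integral_pk)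

lemma poisson_le_const:
  fixes u :: "real \<Rightarrow> real"
  assumes "integrable circle u" "AE t in circle. u t \<le> M" "cmod z < 1"
  shows "poisson u z \<le> M"
proof -
  show ?thesis using poisson_mono[OF assms(1) _ assms(2,3)] poisson_const[OF assms(3)] by simp
qed

lemma bounded_H2:
  fixes F :: "complex fps"
  assumes "fps_conv_radius F \<ge> 1" "\<And>z. cmod z < 1 \<Longrightarrow> cmod (eval_fps F z) \<le> M"
  shows "F \<in> hcarrier H2" "hnorm H2 F \<le> M"
  using H2_mult_bounded[OF one_H2 assms] by (simp_all add: hnorm_H2_one)

lemma has_nt_limit_cong:
  assumes "\<And>z. cmod z < 1 \<Longrightarrow> f z = g z"
  shows "has_nt_limit f \<zeta> l \<longleftrightarrow> has_nt_limit g \<zeta> l"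
  unfolding has_nt_limit_def
  by (intro all_cong1 imp_cong refl Lim_cong_within) (auto simp: stolz_def assms)

text \<open>The modulus is \<open>exp\<close> of a Poisson integral, so its limit is known at
  Lebesgue points. Existence of the limit is assumed here, because the argument of the function is
  not controlled by them.\<close>

lemma norm_nt_limit_herglotz:
  assumes u: "integrable circle u" "leb_pt u t"
    and l: "has_nt_limit (\<lambda>z. exp (herglotz u z)) (cis t) l"
  shows "cmod l = exp (u t)"
proof (rule tendsto_unique[OF stolz_nontrivial[of "cis t"]])
  show "((\<lambda>z. cmod (exp (herglotz u z))) \<longlongrightarrow> cmod l) (at (cis t) within stolz 2 (cis t))"
    using l by (intro tendsto_norm) (simp add: has_nt_limit_def)
  have "((\<lambda>z. exp (poisson u z)) \<longlongrightarrow> exp (u t)) (at (cis t) within stolz 2 (cis t))"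
    by (intro tendsto_exp poisson_nt_limit u) simp
  thus "((\<lambda>z. cmod (exp (herglotz u z))) \<longlongrightarrow> exp (u t)) (at (cis t) within stolz 2 (cis t))"
    by (rule Lim_transform_within[OF _ zero_less_one]) (auto simp: stolz_def Re_herglotz u)
qed simp

text \<open>For \<open>u \<le> 0\<close> the function is bounded and the Hardy space supplies the
  limits. In general \<open>u\<close> is a difference of two nonpositive functions and the function
  a quotient of bounded ones whose denominator has a nonzero limit.\<close>

lemma AE_nt_limit_herglotz:
  assumes u: "integrable circle u"
  shows "AE t in circle. \<exists>l. has_nt_limit (\<lambda>z. exp (herglotz u z)) (cis t) l \<and> cmod l = exp (u t)"
proof -
  have neg: "AE t in circle. \<exists>l. has_nt_limit (\<lambda>z. exp (herglotz u z)) (cis t) l \<and> cmod l = exp (u t)"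
    if u: "integrable circle u" and le: "AE t in circle. u t \<le> 0" for u
  proof -
    have "cmod (eval_fps (outer_fun u) z) \<le> 1" if "cmod z < 1" for z
      using poisson_le_const[OF u le that] by (simp add: outer_fun(3)[OF u that])
    from bounded_H2(1)[OF outer_fun(1)[OF u] this]
    obtain g where "AE t in circle. has_nt_limit (eval_fps (outer_fun u)) (cis t) (g t)"
      using H2_boundary_function by blast
    with AE_leb_pt[OF u] show ?thesis
    proof eventually_elim
      case (elim t)
      hence "has_nt_limit (\<lambda>z. exp (herglotz u z)) (cis t) (g t)"
        using has_nt_limit_cong[where f = "eval_fps (outer_fun u)" and g = "\<lambda>z. exp (herglotz u z)", OF outer_fun(2)[OF u]] by blast
      with norm_nt_limit_herglotz[OF u elim(1) this] show ?case by blast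
    qed
  qed
  define p n where "p t = - max (u t) 0" and "n t = - max (- u t) 0" for t
  have p: "integrable circle p" and n: "integrable circle n" unfolding p_def n_def using u by auto
  have eq: "exp (herglotz n z) / exp (herglotz p z) = exp (herglotz u z)" if "cmod z < 1" for z
  proof -
    have "(\<lambda>t. n t - p t) = u" by (auto simp: p_def n_def)
    with herglotz_diff[OF n p that] show ?thesis by (simp add: exp_diff)
  qed
  from neg[OF p] neg[OF n]
  have "AE t in circle. (\<exists>l. has_nt_limit (\<lambda>z. exp (herglotz p z)) (cis t) l \<and> cmod l = exp (p t)) \<and>
      (\<exists>l. has_nt_limit (\<lambda>z. exp (herglotz n z)) (cis t) l \<and> cmod l = exp (n t))"
    by (auto simp: p_def n_def)
  thus ?thesis
  proof eventually_elim
    case (elim t)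
    then obtain l1 l2 where l: "has_nt_limit (\<lambda>z. exp (herglotz p z)) (cis t) l1" "cmod l1 = exp (p t)"
      "has_nt_limit (\<lambda>z. exp (herglotz n z)) (cis t) l2" "cmod l2 = exp (n t)" by blast
    hence "l1 \<noteq> 0" by auto
    hence "has_nt_limit (\<lambda>z. exp (herglotz n z) / exp (herglotz p z)) (cis t) (l2 / l1)"
      using l(1,3) unfolding has_nt_limit_def by (auto intro!: tendsto_divide)
    hence "has_nt_limit (\<lambda>z. exp (herglotz u z)) (cis t) (l2 / l1)"
      using has_nt_limit_cong[where f = "\<lambda>z. exp (herglotz n z) / exp (herglotz p z)" and g = "\<lambda>z. exp (herglotz u z)", OF eq] by blast
    moreover have "cmod (l2 / l1) = exp (u t)"
      unfolding norm_divide l(2,4) exp_diff[symmetric] by (simp add: p_def n_def)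
    ultimately show ?case by blast
  qed
qed


lemma AE_nt_limit_outer_fun:
  assumes u: "integrable circle u"
  shows "AE t in circle. \<exists>l. has_nt_limit (eval_fps (outer_fun u)) (cis t) l \<and> cmod l = exp (u t)"
proof -
  have "has_nt_limit (eval_fps (outer_fun u)) \<zeta> l \<longleftrightarrow> has_nt_limit (\<lambda>z. exp (herglotz u z)) \<zeta> l" for \<zeta> l
    by (rule has_nt_limit_cong) (rule outer_fun(2)[OF u])
  thus ?thesis using AE_nt_limit_herglotz[OF u] by simp
qed

section \<open>Outer functions are cyclic in the Hardy space\<close>

text \<open>\<open>F\<close> is a bounded coefficientwise limit of its dilates, and each dilate one
  of polynomials; \<open>lim0\<close> is applied once for each of the two limits.\<close>

lemma inner_bounded_mult_eq0:
  fixes f F h :: "complex fps"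
  assumes f: "f \<in> hcarrier H2" and h: "h \<in> hcarrier H2"
    and perp: "\<And>p. hinner H2 (fps_of_poly p * f) h = 0"
    and F: "fps_conv_radius F \<ge> 1" "\<And>z. cmod z < 1 \<Longrightarrow> cmod (eval_fps F z) \<le> M"
  shows "hinner H2 (F * f) h = 0"
proof -
  have lim0: "hinner H2 (x * f) h = 0"
    if X: "\<And>n. fps_conv_radius (X n) \<ge> 1" "\<And>n z. cmod z < 1 \<Longrightarrow> cmod (eval_fps (X n) z) \<le> C"
      and lim: "\<And>k. (\<lambda>n. fps_nth (X n) k) \<longlonglongrightarrow> fps_nth x k" and 0: "\<And>n. hinner H2 (X n * f) h = 0" for X x C
  proof -
    have "(\<lambda>n. hinner H2 (X n * f) h) \<longlonglongrightarrow> hinner H2 (x * f) h"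
    proof (rule H2_weak_limit(3)[OF _ _ _ h])
      show "X n * f \<in> hcarrier H2" "hnorm H2 (X n * f) \<le> C * hnorm H2 f" for n
        using H2_mult_bounded[OF f X(1) X(2)] by auto
      show "(\<lambda>n. fps_nth (X n * f) k) \<longlonglongrightarrow> fps_nth (x * f) k" for k
        unfolding fps_mult_nth by (intro tendsto_intros lim)
    qed
    thus ?thesis unfolding 0 by (simp add: LIMSEQ_const_iff)
  qed
  have FH: "F \<in> hcarrier H2" by (rule bounded_H2[OF F])
  have d: "dilate (rad k) F \<in> hcarrier H2" for k using rad_bounds by (intro dilate_H2 FH) auto
  show ?thesis
  proof (rule lim0[where X = "\<lambda>k. dilate (rad k) F"])
    show "fps_conv_radius (dilate (rad k) F) \<ge> 1" for k by (rule fps_conv_radius_H2[OF d])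
    show "cmod (eval_fps (dilate (rad k) F) z) \<le> M" if "cmod z < 1" for k z
    proof -
      have "rad k * cmod z < 1" using that rad_bounds[of k] mult_left_le_one_le[of "cmod z" "rad k"] by simp
      thus ?thesis using eval_dilate[of "rad k" F z] F(2)[of "of_real (rad k) * z"] rad_bounds[of k]
        by (simp add: eval_vfps_complex norm_mult)
    qed
    fix k
    have "(\<lambda>n. complex_of_real (rad n ^ k) *\<^sub>C fps_nth F k) \<longlonglongrightarrow> complex_of_real (1 ^ k) *\<^sub>C fps_nth F k"
      by (intro scaleC.tendsto tendsto_intros rad_tendsto)
    thus "(\<lambda>n. fps_nth (dilate (rad n) F) k) \<longlonglongrightarrow> fps_nth F k" by (simp add: dilate_def)
    define D where "D = dilate (rad k) F"
    have sm: "summable (\<lambda>n. norm (fps_nth D n))"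
      unfolding D_def using rad_bounds by (intro summable_dilate F)
    show "hinner H2 (dilate (rad k) F * f) h = 0" unfolding D_def[symmetric]
    proof (rule lim0[where X = "\<lambda>n. fps_cutoff n D"])
      show "fps_conv_radius (fps_cutoff n D) \<ge> 1" for n by (rule fps_conv_radius_H2) simp
      show "hinner H2 (fps_cutoff n D * f) h = 0" for n unfolding fps_cutoff_poly by (rule perp)
      show "(\<lambda>n. fps_nth (fps_cutoff n D) j) \<longlonglongrightarrow> fps_nth D j" for j
        by (rule tendsto_eventually) (auto simp: eventually_sequentially intro!: exI[of _ "Suc j"])
      have s1: "summable (\<lambda>i. 1 ^ i * norm (fps_nth (fps_cutoff n D) i))" for n
        by (rule summable_finite[of "{..<n}"]) auto
      show "cmod (eval_fps (fps_cutoff n D) z) \<le> (\<Sum>i. norm (fps_nth D i))" if "cmod z < 1" for n z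
      proof -
        have "norm (eval_vfps (fps_cutoff n D) z) \<le> (\<Sum>i. 1 ^ i * norm (fps_nth (fps_cutoff n D) i))"
          by (rule norm_eval_vfps_le[OF s1]) (use that in simp)
        also have "\<dots> \<le> (\<Sum>i. norm (fps_nth D i))" using s1 sm by (intro suminf_le) auto
        finally show ?thesis by (simp add: eval_vfps_complex)
      qed
    qed
  qed
qed

lemma hinner_X_power: "hinner H2 (fps_X ^ k) h = cnj (fps_nth (h :: complex fps) k)"
  unfolding hinner_H2 by (subst suminf_finite[of "{k}"]) (auto simp: fps_X_power_nth)

lemma outer_imp_cyclic_H2:
  assumes f: "f \<in> hcarrier H2" and outer: "outer_fps f"
  shows "cyclic_in H2 f"
  unfolding cyclic_in_def
proof (rule hilbert.dense_if_orthogonal_trivial[OF hilbert_H2 subspace_poly_multiples])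
  note pf = poly_mult_H2[OF f]
  thus "{fps_of_poly p * f |p. True} \<subseteq> hcarrier H2" by auto
  fix h assume h: "h \<in> hcarrier H2" and perp: "\<And>v. v \<in> {fps_of_poly p * f |p. True} \<Longrightarrow> hinner H2 h v = 0"
  have perp': "hinner H2 (fps_of_poly p * f) h = 0" for p
  proof -
    have "hinner H2 h (fps_of_poly p * f) = 0" by (rule perp) blast
    thus ?thesis using H2.inner_commute[OF pf h] by simp
  qed
  obtain c u where fr: "fps_conv_radius f \<ge> 1" and cu: "cmod c = 1" "integrable circle u"
    and fu': "\<forall>z\<in>ball 0 1. eval_fps f z = c * exp (herglotz u z)"
    using outer unfolding outer_fps_iff by blast
  have fu: "eval_fps f z = c * exp (herglotz u z)" if "cmod z < 1" for z using fu' that by simp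
  \<comment> \<open>Multiplying \<open>f\<close> by the outer function of \<open>v n\<close>, which
    is bounded by \<open>exp n\<close>, stays in \<open>[f]\<close>. The product
    \<open>\<phi> n\<close> has boundary log modulus \<open>min (u + n) 0\<close>, hence is bounded
    by 1.\<close>
  define v where "v n t = - max (u t) (- real n)" for n :: nat and t
  have v: "integrable circle (v n)" for n unfolding v_def using cu(2) by simp
  define \<phi> where "\<phi> n = outer_fun (v n) * f" for n
  have \<phi>r: "fps_conv_radius (\<phi> n) \<ge> 1" for n
    unfolding \<phi>_def by (intro fps_conv_radius_mult_ge outer_fun v fr)
  have uv: "integrable circle (\<lambda>t. u t - - v n t)" for n using cu(2) v by simp
  have \<phi>e: "eval_fps (\<phi> n) z = c * exp (herglotz (\<lambda>t. u t - - v n t) z)" if z: "cmod z < 1" for n z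
  proof -
    have "eval_fps (\<phi> n) z = exp (herglotz (v n) z) * (c * exp (herglotz u z))"
      unfolding \<phi>_def by (simp add: eval_fps_mult conv_radius_gt outer_fun v fr z fu)
    moreover have "herglotz (\<lambda>t. u t - - v n t) z = herglotz u z - herglotz (\<lambda>t. - v n t) z"
      using cu(2) v z by (intro herglotz_diff) auto
    ultimately show ?thesis by (simp add: herglotz_minus exp_add)
  qed
  have \<phi>1: "cmod (eval_fps (\<phi> n) z) \<le> 1" if z: "cmod z < 1" for n z
  proof -
    have "poisson (\<lambda>t. u t - - v n t) z \<le> 0"
      by (rule poisson_le_const[OF uv _ z]) (auto simp: v_def)
    thus ?thesis using Re_herglotz[OF uv z] by (simp add: \<phi>e[OF z] norm_mult cu(1))
  qed
  note \<phi>H = bounded_H2[OF \<phi>r \<phi>1]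
  have v_le: "cmod (eval_fps (outer_fun (v n)) z) \<le> exp (real n)" if z: "cmod z < 1" for n z
    using poisson_le_const[OF v _ z, of n "real n"] by (simp add: outer_fun(3)[OF v z] v_def)
  have \<phi>perp: "hinner H2 (fps_X ^ k * \<phi> n) h = 0" for k n
  proof -
    have "hinner H2 (outer_fun (v n) * (fps_X ^ k * f)) h = 0"
    proof (rule inner_bounded_mult_eq0[OF fps_X_power_H2(1)[OF f] h _ outer_fun(1)[OF v] v_le])
      fix p
      have "fps_of_poly p * (fps_X ^ k * f) = fps_of_poly (p * monom 1 k) * f"
        by (simp add: fps_of_poly_mult fps_of_poly_monom mult.assoc)
      thus "hinner H2 (fps_of_poly p * (fps_X ^ k * f)) h = 0" by (simp only: perp')
    qed
    thus ?thesis by (simp add: \<phi>_def mult_ac)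
  qed
  define c1 where "c1 = (c *\<^sub>C 1 :: complex fps)"
  have c1H: "c1 \<in> hcarrier H2" unfolding c1_def by (intro H2.scale_mem one_H2)
  have "(\<lambda>n. LINT t|circle. u t - - v n t) \<longlonglongrightarrow> (LINT t|circle. 0)"
  proof (rule integral_dominated_convergence[where w = "\<lambda>t. \<bar>u t\<bar>"])
    show "AE t in circle. (\<lambda>n. u t - - v n t) \<longlonglongrightarrow> 0"
    proof (intro AE_I2 tendsto_eventually)
      fix t
      obtain N where "- u t \<le> real N" using real_arch_simple by blast
      thus "\<forall>\<^sub>F n in sequentially. u t - - v n t = 0"
        unfolding eventually_sequentially v_def by (intro exI[of _ N]) auto
    qed
    show "AE t in circle. norm (u t - - v n t) \<le> \<bar>u t\<bar>" for n by (auto simp: v_def)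
  qed (use cu(2) uv in auto)
  hence "(\<lambda>n. c * exp (of_real ((LINT t|circle. u t - - v n t) / (2 * pi)))) \<longlonglongrightarrow> c * exp (of_real (0 / (2 * pi)))"
    by (intro tendsto_intros) simp_all
  hence \<phi>0: "(\<lambda>n. fps_nth (\<phi> n) 0) \<longlonglongrightarrow> c"
    using \<phi>e[of 0] by (simp add: herglotz_0 eval_fps_at_0)
  hence "(\<lambda>n. 2 - 2 * Re (cnj c * fps_nth (\<phi> n) 0)) \<longlonglongrightarrow> 2 - 2 * Re (cnj c * c)" by (intro tendsto_intros)
  moreover have "cnj c * c = 1" using complex_norm_square[of c] cu(1) by (simp add: mult.commute)
  ultimately have lim0: "(\<lambda>n. 2 - 2 * Re (cnj c * fps_nth (\<phi> n) 0)) \<longlonglongrightarrow> 0" by simp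
  \<comment> \<open>Vectors of norm at most 1 converge to the unit vector \<open>c1\<close> once
    their inner products with it tend to 1; that inner product is \<open>cnj c\<close> times the
    value at 0.\<close>
  have "(\<lambda>n. (hnorm H2 (\<phi> n - c1))\<^sup>2) \<longlonglongrightarrow> 0"
  proof (rule Lim_null_comparison[OF _ lim0], rule always_eventually, rule allI)
    fix n
    have "hinner H2 (\<phi> n) c1 = cnj c * fps_nth (\<phi> n) 0"
      using H2.inner_commute[OF \<phi>H(1)[of n] one_H2] hinner_one[of "\<phi> n"]
      by (simp add: c1_def H2.inner_scale_right \<phi>H one_H2)
    moreover have "hnorm H2 c1 = 1" unfolding c1_def using cu(1)
      by (simp add: H2.hnorm_scale one_H2 hnorm_H2_one)
    moreover have "(hnorm H2 (\<phi> n))\<^sup>2 \<le> 1" using \<phi>H(2)[of n] H2.hnorm_ge0[OF \<phi>H(1)[of n]] by (simp add: power_le_one)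
    ultimately show "norm ((hnorm H2 (\<phi> n - c1))\<^sup>2) \<le> 2 - 2 * Re (cnj c * fps_nth (\<phi> n) 0)"
      unfolding real_norm_def abs_power2 using H2.hnorm_diff_sq[OF \<phi>H(1)[of n] c1H] by simp
  qed
  hence "(\<lambda>n. sqrt ((hnorm H2 (\<phi> n - c1))\<^sup>2)) \<longlonglongrightarrow> sqrt 0" by (rule tendsto_real_sqrt)
  hence "(\<lambda>n. hnorm H2 (\<phi> n - c1)) \<longlonglongrightarrow> 0"
    using H2.hnorm_ge0[OF H2.diff_mem[OF \<phi>H(1) c1H]] by simp
  hence lim: "(\<lambda>n. hnorm H2 (\<phi> n - c1) * hnorm H2 h) \<longlonglongrightarrow> 0" by (rule tendsto_mult_left_zero)
  have "fps_nth h k = 0" for k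
  proof -
    have "(\<lambda>n. hinner H2 (fps_X ^ k * (\<phi> n - c1)) h) \<longlonglongrightarrow> 0"
    proof (rule Lim_null_comparison[OF _ lim], rule always_eventually, rule allI)
      fix n
      have d: "\<phi> n - c1 \<in> hcarrier H2" by (intro H2.diff_mem \<phi>H c1H)
      show "norm (hinner H2 (fps_X ^ k * (\<phi> n - c1)) h) \<le> hnorm H2 (\<phi> n - c1) * hnorm H2 h"
        using H2.cauchy_schwarz[OF fps_X_power_H2(1)[OF d] h] fps_X_power_H2(2)[OF d] by simp
    qed
    moreover have "hinner H2 (fps_X ^ k * (\<phi> n - c1)) h = - (c * cnj (fps_nth h k))" for n
    proof -
      have "fps_X ^ k * (\<phi> n - c1) = fps_X ^ k * \<phi> n - c *\<^sub>C fps_X ^ k"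
        by (simp add: c1_def scaleC_fps_complex algebra_simps)
      moreover have "(fps_X ^ k :: complex fps) \<in> hcarrier H2" using fps_X_power_H2(1)[OF one_H2, of k] by simp
      ultimately show ?thesis using h
        by (simp add: H2.inner_diff_left H2.inner_scale_left H2.scale_mem fps_X_power_H2 \<phi>H \<phi>perp hinner_X_power)
    qed
    ultimately have "c * cnj (fps_nth h k) = 0" by (simp add: LIMSEQ_const_iff)
    thus ?thesis using cu(1) by auto
  qed
  thus "h = 0" by (simp add: fps_eq_iff)
qed

section \<open>Cyclic vectors of the Hardy space are outer\<close>

lemma norm_eval_H2_le:
  fixes f :: "complex fps"
  assumes f: "f \<in> hcarrier H2" and z: "cmod z < 1"
  shows "cmod (eval_fps f z) \<le> hnorm H2 f / (1 - cmod z)"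
proof -
  have s: "summable (\<lambda>n. cmod z ^ n * hnorm H2 f)" using z by (intro summable_mult2 summable_geometric) simp
  have "cmod (eval_fps f z) \<le> (\<Sum>n. cmod z ^ n * norm (fps_nth f n))"
    using norm_eval_vfps_le[OF summable_norm_H2[OF f _ z]] by (simp add: eval_vfps_complex)
  also have "\<dots> \<le> (\<Sum>n. cmod z ^ n * hnorm H2 f)"
    using z s by (intro suminf_le summable_norm_H2 f mult_left_mono norm_nth_le_hnorm_H2) auto
  also have "\<dots> = hnorm H2 f / (1 - cmod z)"
    using z by (subst suminf_mult2[symmetric]) (auto simp: suminf_geometric summable_geometric)
  finally show ?thesis .
qed

lemma H2_boundary_norm:
  fixes f :: "complex fps"
  assumes f: "f \<in> hcarrier H2" and m: "m \<in> borel_measurable circle"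
    and lim: "AE t in circle. \<exists>l. has_nt_limit (eval_fps f) (cis t) l \<and> cmod l = m t"
  shows "integrable circle (\<lambda>t. (m t)\<^sup>2)" "(LINT t|circle. (m t)\<^sup>2) = 2 * pi * (hnorm H2 f)\<^sup>2"
proof -
  obtain g where g: "integrable circle (\<lambda>t. (cmod (g t))\<^sup>2)"
    "AE t in circle. has_nt_limit (eval_fps f) (cis t) (g t)"
    "(LINT t|circle. (cmod (g t))\<^sup>2) = 2 * pi * (hnorm H2 f)\<^sup>2"
    by (rule H2_boundary_function[OF f]) blast
  have eq: "AE t in circle. (cmod (g t))\<^sup>2 = (m t)\<^sup>2"
    using g(2) lim
  proof eventually_elim
    case (elim t)
    then obtain l where "has_nt_limit (eval_fps f) (cis t) l" "cmod l = m t" by blast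
    with has_nt_limit_unique[OF this(1) elim(1)] show ?case by simp
  qed
  have [measurable]: "(\<lambda>t. (m t)\<^sup>2) \<in> borel_measurable circle" using m by simp
  note [measurable] = borel_measurable_integrable[OF g(1)]
  show "integrable circle (\<lambda>t. (m t)\<^sup>2)"
    using g(1) by (rule integrable_cong_AE_imp) (use eq in \<open>auto elim: eventually_mono\<close>)
  show "(LINT t|circle. (m t)\<^sup>2) = 2 * pi * (hnorm H2 f)\<^sup>2"
    unfolding g(3)[symmetric] by (rule integral_cong_AE) (use eq in \<open>auto elim: eventually_mono\<close>)
qed

lemma has_nt_limit_radial:
  assumes l: "has_nt_limit f \<zeta> l" and \<zeta>: "cmod \<zeta> = 1"
  shows "(\<lambda>k. f (of_real (rad k) * \<zeta>)) \<longlonglongrightarrow> l"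
proof -
  have "(f \<longlongrightarrow> l) (at \<zeta> within stolz 2 \<zeta>)" using l by (simp add: has_nt_limit_def)
  moreover have "filterlim (\<lambda>k. of_real (rad k) * \<zeta>) (at \<zeta> within stolz 2 \<zeta>) sequentially"
    unfolding filterlim_at
  proof (intro conjI always_eventually allI)
    fix k
    have "of_real (rad k) * \<zeta> - \<zeta> = - (of_real (1 - rad k) * \<zeta>)" by (simp add: algebra_simps)
    hence 1: "cmod (of_real (rad k) * \<zeta> - \<zeta>) = 1 - rad k" using \<zeta> rad_bounds[of k]
      by (simp add: norm_mult del: of_real_diff)
    have 2: "cmod (of_real (rad k) * \<zeta>) = rad k" using \<zeta> rad_bounds[of k] by (simp add: norm_mult)
    show "of_real (rad k) * \<zeta> \<in> stolz 2 \<zeta>" using rad_bounds[of k] unfolding stolz_def mem_Collect_eq 1 2 by simp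
    show "of_real (rad k) * \<zeta> \<noteq> \<zeta>" using 1 rad_bounds[of k] by auto
    have "(\<lambda>k. of_real (rad k) * \<zeta>) \<longlonglongrightarrow> of_real 1 * \<zeta>" by (intro tendsto_intros rad_tendsto)
    thus "(\<lambda>k. of_real (rad k) * \<zeta>) \<longlonglongrightarrow> \<zeta>" by simp
  qed
  ultimately show ?thesis by (rule filterlim_compose)
qed

lemma eval_poly_mult:
  fixes f :: "complex fps"
  assumes "fps_conv_radius f \<ge> 1" "cmod z < 1"
  shows "eval_fps (fps_of_poly p * f) z = poly p z * eval_fps f z"
  by (subst eval_fps_mult) (auto simp: conv_radius_gt assms)

lemma has_nt_limit_poly_mult:
  fixes f :: "complex fps"
  assumes "fps_conv_radius f \<ge> 1" "has_nt_limit (eval_fps f) \<zeta> l"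
  shows "has_nt_limit (eval_fps (fps_of_poly p * f)) \<zeta> (poly p \<zeta> * l)"
proof -
  have "has_nt_limit (\<lambda>z. poly p z * eval_fps f z) \<zeta> (poly p \<zeta> * l)"
    using assms(2) unfolding has_nt_limit_def by (auto intro!: tendsto_intros)
  thus ?thesis
    using has_nt_limit_cong[of "eval_fps (fps_of_poly p * f)" "\<lambda>z. poly p z * eval_fps f z" \<zeta> "poly p \<zeta> * l"]
      eval_poly_mult[OF assms(1)] by blast
qed

text \<open>Turns \<open>L^1\<close> convergence of moduli on circles into \<open>L^1\<close>
  convergence of the positive parts of their logarithms.\<close>

lemma positive_part_exp_lipschitz: "\<bar>max x 0 - max y 0\<bar> \<le> \<bar>exp x - exp y\<bar>" for x y :: real
proof -
  have le: "max x 0 - max y 0 \<le> exp x - exp y" if "y \<le> x" for x y :: real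
  proof (cases "x \<le> 0")
    case False
    define Y where "Y = max y 0"
    have Y: "0 \<le> Y" "Y \<le> x" using that False by (auto simp: Y_def)
    have "x - Y \<le> exp (x - Y) - 1" using exp_ge_add_one_self[of "x - Y"] by linarith
    hence "1 * (x - Y) \<le> exp Y * (exp (x - Y) - 1)"
      using Y by (intro mult_mono) auto
    also have "\<dots> = exp x - exp Y" by (simp add: right_diff_distrib flip: exp_add)
    also have "\<dots> \<le> exp x - exp y" by (simp add: Y_def)
    finally show ?thesis using False by (simp add: Y_def)
  qed (use that in simp)
  show ?thesis using le[of x y] le[of y x] by (cases "y \<le> x") auto
qed

text \<open>Truncating \<open>v\<close> from above gives bounded outer functions, whose norms are
  read off from the boundary. On each fixed circle inside the disc they converge to
  \<open>outer_fun v\<close>, so the bound on the means survives.\<close>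

lemma outer_fun_mem_H2:
  assumes v: "integrable circle v" and sq: "integrable circle (\<lambda>t. (exp (v t))\<^sup>2)"
    and C: "(LINT t|circle. (exp (v t))\<^sup>2) \<le> 2 * pi * C\<^sup>2" "C \<ge> 0"
  shows "outer_fun v \<in> hcarrier H2"
proof -
  define w where "w n t = min (v t) (real n)" for n :: nat and t
  have w: "integrable circle (w n)" for n unfolding w_def using v by simp
  have FH: "outer_fun (w n) \<in> hcarrier H2" for n
  proof (rule bounded_H2(1)[OF outer_fun(1)[OF w]])
    show "cmod (eval_fps (outer_fun (w n)) z) \<le> exp (real n)" if "cmod z < 1" for z
      using poisson_le_const[OF w _ that, of n "real n"] by (simp add: outer_fun(3)[OF w that] w_def)
  qed
  have FC: "hnorm H2 (outer_fun (w n)) \<le> C" for n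
  proof -
    note n = H2_boundary_norm[OF FH _ AE_nt_limit_outer_fun[OF w[of n]]]
    have m: "(\<lambda>t. exp (w n t)) \<in> borel_measurable circle" using w by simp
    have "2 * pi * (hnorm H2 (outer_fun (w n)))\<^sup>2 = (LINT t|circle. (exp (w n t))\<^sup>2)" using n(2)[OF m] by simp
    also have "\<dots> \<le> (LINT t|circle. (exp (v t))\<^sup>2)"
      by (intro integral_mono n(1)[OF m] sq power_mono) (auto simp: w_def)
    also note C(1)
    finally have "(hnorm H2 (outer_fun (w n)))\<^sup>2 \<le> C\<^sup>2" by simp
    thus ?thesis using C(2) by (rule power2_le_imp_le)
  qed
  have L1: "(\<lambda>n. LINT t|circle. norm (w n t - v t)) \<longlonglongrightarrow> (LINT t|circle. 0)"
  proof (rule integral_dominated_convergence[where w = "\<lambda>t. \<bar>v t\<bar>"])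
    show "AE t in circle. (\<lambda>n. norm (w n t - v t)) \<longlonglongrightarrow> 0"
    proof (intro AE_I2 tendsto_eventually)
      fix t
      obtain N where "v t \<le> real N" using real_arch_simple by blast
      thus "\<forall>\<^sub>F n in sequentially. norm (w n t - v t) = 0"
        unfolding eventually_sequentially w_def by (intro exI[of _ N]) auto
    qed
    show "AE t in circle. norm (norm (w n t - v t)) \<le> \<bar>v t\<bar>" for n by (auto simp: w_def)
  qed (use v w in \<open>auto intro!: borel_measurable_abs borel_measurable_diff\<close>)
  have lim: "(\<lambda>n. (cmod (eval_fps (outer_fun (w n)) z))\<^sup>2) \<longlonglongrightarrow> (cmod (eval_fps (outer_fun v) z))\<^sup>2" if z: "cmod z < 1" for z
    unfolding outer_fun(3)[OF w z] outer_fun(3)[OF v z]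
    using L1 by (intro tendsto_intros poisson_tendsto w v z) simp
  have "circ_mean (\<lambda>z. (norm (eval_vfps (outer_fun v) (of_real (rad k) * z)))\<^sup>2) \<le> C\<^sup>2" for k
  proof (rule LIMSEQ_le_const2)
    have r: "cmod (of_real (rad k) * z) = rad k" "rad k < 1" if "cmod z = 1" for z :: complex
      using that rad_bounds[of k] by (auto simp: norm_mult)
    show "(\<lambda>n. circ_mean (\<lambda>z. (norm (eval_vfps (outer_fun (w n)) (of_real (rad k) * z)))\<^sup>2)) \<longlonglongrightarrow>
        circ_mean (\<lambda>z. (norm (eval_vfps (outer_fun v) (of_real (rad k) * z)))\<^sup>2)"
    proof (rule circ_mean_lim[where C = "(C / (1 - rad k))\<^sup>2"])
      show "continuous_on (sphere 0 1) (\<lambda>z. (norm (eval_vfps (outer_fun (w n)) (of_real (rad k) * z)))\<^sup>2)" for n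
        using rad_bounds by (intro continuous_intros continuous_eval_H2 FH)
      fix z :: complex assume z: "cmod z = 1"
      show "(\<lambda>n. (norm (eval_vfps (outer_fun (w n)) (of_real (rad k) * z)))\<^sup>2) \<longlonglongrightarrow> (norm (eval_vfps (outer_fun v) (of_real (rad k) * z)))\<^sup>2"
        unfolding eval_vfps_complex by (rule lim) (use r[OF z] in simp)
      fix n
      have "cmod (eval_fps (outer_fun (w n)) (of_real (rad k) * z)) \<le> hnorm H2 (outer_fun (w n)) / (1 - rad k)"
        using norm_eval_H2_le[OF FH[of n], of "of_real (rad k) * z"] unfolding r(1)[OF z] using r(2)[OF z] by simp
      also have "\<dots> \<le> C / (1 - rad k)" using FC[of n] r(2)[OF z] by (intro divide_right_mono) auto
      finally show "norm ((norm (eval_vfps (outer_fun (w n)) (of_real (rad k) * z)))\<^sup>2) \<le> (C / (1 - rad k))\<^sup>2"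
        unfolding eval_vfps_complex real_norm_def abs_power2 by (intro power_mono) auto
    qed
    have "circ_mean (\<lambda>z. (norm (eval_vfps (outer_fun (w n)) (of_real (rad k) * z)))\<^sup>2) \<le> C\<^sup>2" for n
      using rad_bounds FC[of n] H2.hnorm_ge0[OF FH[of n]]
      by (intro order_trans[OF circ_mean_le_hnorm_H2[OF FH]] power_mono) auto
    thus "\<exists>N. \<forall>n\<ge>N. circ_mean (\<lambda>z. (norm (eval_vfps (outer_fun (w n)) (of_real (rad k) * z)))\<^sup>2) \<le> C\<^sup>2" by blast
  qed
  thus ?thesis by (intro H2_circ_mean_boundI(1)[OF summable_fps_disc[OF outer_fun(1)[OF v]] C(2)])
qed


lemma cyclic_H2_imp_outer:
  assumes f: "f \<in> hcarrier H2" and cyc: "cyclic_in H2 f"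
  shows "outer_fps f"
proof -
  have fr: "fps_conv_radius f \<ge> 1" by (rule fps_conv_radius_H2[OF f])
  have approx: "\<exists>p. hnorm H2 (1 - fps_of_poly p * f) < e" if "e > 0" for e
  proof -
    have "1 \<in> hclosure H2 {fps_of_poly p * f |p. True}" using cyc one_H2 by (simp add: cyclic_in_def)
    thus ?thesis using that unfolding hclosure_def by blast
  qed
  have dH: "1 - fps_of_poly p * f \<in> hcarrier H2" for p by (intro H2.diff_mem one_H2 poly_mult_H2 f)
  have eval_d: "eval_fps (1 - fps_of_poly p * f) z = 1 - poly p z * eval_fps f z" if "cmod z < 1" for p z
    using that by (subst eval_fps_diff) (auto simp: conv_radius_gt fps_conv_radius_H2 poly_mult_H2 f eval_poly_mult fr)
  \<comment> \<open>At a zero of \<open>f\<close> every \<open>1 - p f\<close> takes the value 1,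
    which point evaluation excludes when its norm is small.\<close>
  have fnz: "eval_fps f z \<noteq> 0" if z: "cmod z < 1" for z
  proof
    assume 0: "eval_fps f z = 0"
    obtain p where p: "hnorm H2 (1 - fps_of_poly p * f) < 1 - cmod z" using approx[of "1 - cmod z"] z by auto
    have "1 \<le> hnorm H2 (1 - fps_of_poly p * f) / (1 - cmod z)"
      using norm_eval_H2_le[OF dH z, of p] eval_d[OF z, of p] 0 by simp
    thus False using p z by (simp add: field_simps)
  qed
  obtain g where g: "integrable circle g" "integrable circle (\<lambda>t. (cmod (g t))\<^sup>2)"
      "AE t in circle. has_nt_limit (eval_fps f) (cis t) (g t)"
      "(LINT t|circle. (cmod (g t))\<^sup>2) = 2 * pi * (hnorm H2 f)\<^sup>2"
      "(\<lambda>k. LINT t|circle. cmod (eval_fps f (of_real (rad k) * cis t) - g t)) \<longlonglongrightarrow> 0"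
    by (rule H2_boundary_function[OF f]) blast
  note [measurable] = borel_measurable_integrable[OF g(1)]
  \<comment> \<open>Where \<open>g\<close> vanishes, the boundary value of every
    \<open>1 - p f\<close> is 1, so the measure of that set is at most \<open>2 * pi * e^2\<close>
    for all \<open>e\<close>.\<close>
  have gnz: "AE t in circle. g t \<noteq> 0"
  proof -
    define Z where "Z t = (if g t = 0 then 1 else 0 :: real)" for t
    have Zm [measurable]: "Z \<in> borel_measurable circle" unfolding Z_def by measurable
    have Zi: "integrable circle Z"
      by (rule circle.integrable_const_bound[of _ 1]) (auto simp: Z_def)
    have "(LINT t|circle. Z t) \<le> 2 * pi * e\<^sup>2" if e: "e > 0" for e
    proof -
      obtain p where p: "hnorm H2 (1 - fps_of_poly p * f) < e" using approx[OF e] by blast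
      have lim: "AE t in circle. \<exists>l. has_nt_limit (eval_fps (1 - fps_of_poly p * f)) (cis t) l \<and>
          cmod l = cmod (1 - poly p (cis t) * g t)"
        using g(3)
      proof eventually_elim
        case (elim t)
        hence "has_nt_limit (\<lambda>z. 1 - poly p z * eval_fps f z) (cis t) (1 - poly p (cis t) * g t)"
          unfolding has_nt_limit_def by (auto intro!: tendsto_intros)
        moreover have "has_nt_limit (eval_fps (1 - fps_of_poly p * f)) (cis t) l \<longleftrightarrow>
            has_nt_limit (\<lambda>z. 1 - poly p z * eval_fps f z) (cis t) l" for l
          by (rule has_nt_limit_cong) (rule eval_d)
        ultimately show ?case by blast
      qed
      have pm: "(\<lambda>t. poly p (cis t)) \<in> borel_measurable circle"
        by (rule borel_measurable_integrable[OF integrable_circle]) (intro continuous_intros)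
      have m: "(\<lambda>t. cmod (1 - poly p (cis t) * g t)) \<in> borel_measurable circle"
        using pm by measurable
      note n = H2_boundary_norm[OF dH m lim]
      have "(LINT t|circle. Z t) \<le> (LINT t|circle. (cmod (1 - poly p (cis t) * g t))\<^sup>2)"
        by (intro integral_mono Zi n(1)) (simp add: Z_def)
      also have "\<dots> \<le> 2 * pi * e\<^sup>2"
        unfolding n(2) using p H2.hnorm_ge0[OF dH, of p] by (intro mult_left_mono power_mono) auto
      finally show ?thesis .
    qed
    note le = this
    have "(LINT t|circle. Z t) \<le> 0"
    proof (rule tendsto_lowerbound)
      show "((\<lambda>e. 2 * pi * e\<^sup>2) \<longlongrightarrow> 0) (at_right (0::real))" by (auto intro!: tendsto_eq_intros)
      show "\<forall>\<^sub>F e in at_right (0::real). (LINT t|circle. Z t) \<le> 2 * pi * e\<^sup>2"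
        using le by (auto simp: eventually_at_right_field intro!: exI[of _ 1])
    qed simp
    moreover have "0 \<le> (LINT t|circle. Z t)" by (rule Bochner_Integration.integral_nonneg) (simp add: Z_def)
    ultimately have "(LINT t|circle. Z t) = 0" by simp
    moreover have "(LINT t|circle. Z t) = 0 \<longleftrightarrow> (AE t in circle. Z t = 0)"
      by (rule integral_nonneg_eq_0_iff_AE[OF Zi]) (simp add: Z_def)
    ultimately have "AE t in circle. Z t = 0" by simp
    thus ?thesis by eventually_elim (auto simp: Z_def split: if_splits)
  qed
  \<comment> \<open>A logarithm of the zero-free \<open>f\<close> represents its log modulus on
    smaller circles by Poisson integrals of \<open>v n\<close>.\<close>
  have "eval_fps f holomorphic_on ball 0 1"
    using fr by (intro holomorphic_on_eval_fps holomorphic_on_subset[OF holomorphic_on_eval_fps]) (auto simp: conv_radius_gt)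
  moreover have "contractible (ball 0 1 :: complex set)" by (rule convex_imp_contractible) simp
  ultimately obtain L where L: "L holomorphic_on ball 0 1" "\<And>z. z \<in> ball 0 1 \<Longrightarrow> eval_fps f z = exp (L z)"
    by (rule contractible_imp_holomorphic_log[where f = "eval_fps f"]) (auto simp: fnz)
  define Lf where "Lf = fps_expansion L 0"
  have Lf: "fps_conv_radius Lf \<ge> 1" "\<And>z. cmod z < 1 \<Longrightarrow> exp (eval_fps Lf z) = eval_fps f z"
    using fps_expansion_disc[OF L(1)] L(2) by (auto simp: Lf_def)
  have norm_f: "cmod (eval_fps f z) = exp (Re (eval_fps Lf z))" if "cmod z < 1" for z
    using Lf(2)[OF that, symmetric] by simp
  define v where "v n t = Re (eval_fps Lf (of_real (rad n) * cis t))" for n t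
  have Lf_cont: "continuous_on (sphere 0 1) (\<lambda>z. eval_fps Lf (of_real (rad n) * z))" for n
    using continuous_on_cball_sphere[OF continuous_eval_vfps[OF summable_fps_disc[OF Lf(1)]], of "rad n"] rad_bounds[of n]
    by (simp add: eval_vfps_complex)
  have vi: "integrable circle (v n)" for n
    unfolding v_def by (rule integrable_circle) (intro continuous_intros Lf_cont)
  have exp_v: "exp (v n t) = cmod (eval_fps f (of_real (rad n) * cis t))" for n t
    unfolding v_def using rad_bounds[of n] by (intro norm_f[symmetric]) (simp add: norm_mult)
  have vP: "poisson (v n) z = Re (eval_fps Lf (of_real (rad n) * z))" if z: "cmod z < 1" for n z
  proof -
    have "Re (eval_fps Lf (of_real (rad n) * z)) = Re (circ_mean (\<lambda>\<zeta>. of_real (pk z \<zeta>) * eval_fps Lf (of_real (rad n) * \<zeta>)))"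
      using poisson_formula[OF Lf(1) _ _ z, of "rad n"] rad_bounds[of n] by simp
    also have "\<dots> = (1 / (2 * pi)) *\<^sub>R (LINT t|circle. Re (of_real (pk z (cis t)) * eval_fps Lf (of_real (rad n) * cis t)))"
      unfolding circ_mean_def
      by (subst integral_Re) (auto intro!: integrable_circle[of "\<lambda>\<zeta>. of_real (pk z \<zeta>) * eval_fps Lf (of_real (rad n) * \<zeta>)"] continuous_intros Lf_cont continuous_on_pk z)
    also have "\<dots> = poisson (v n) z" by (simp add: poisson_def v_def)
    finally show ?thesis by simp
  qed
  define w where "w t = ln (cmod (g t))" for t
  have wm [measurable]: "w \<in> borel_measurable circle" unfolding w_def by measurable
  have exp_w: "AE t in circle. exp (w t) = cmod (g t)"
    using gnz by eventually_elim (simp add: w_def)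
  have v_lim: "AE t in circle. (\<lambda>n. v n t) \<longlonglongrightarrow> w t"
    using g(3) gnz
  proof eventually_elim
    case (elim t)
    have "(\<lambda>n. ln (cmod (eval_fps f (of_real (rad n) * cis t)))) \<longlonglongrightarrow> ln (cmod (g t))"
      using elim(2) by (intro tendsto_ln tendsto_norm has_nt_limit_radial elim) auto
    thus ?case unfolding exp_v[symmetric] w_def by simp
  qed
  define vp vn where "vp n t = max (v n t) 0" and "vn n t = max (- v n t) 0" for n t
  define wp wn where "wp t = max (w t) 0" and "wn t = max (- w t) 0" for t
  have vpi: "integrable circle (vp n)" "integrable circle (vn n)" for n
    unfolding vp_def vn_def using vi by auto
  have wpm: "wp \<in> borel_measurable circle" "wn \<in> borel_measurable circle"
    unfolding wp_def wn_def by measurable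
  have wpi: "integrable circle wp"
  proof (rule Bochner_Integration.integrable_bound[OF g(1) wpm(1)])
    show "AE t in circle. norm (wp t) \<le> norm (g t)"
      using exp_w
    proof eventually_elim
      case (elim t)
      have "w t \<le> exp (w t)" using exp_ge_add_one_self[of "w t"] by linarith
      thus ?case using elim by (simp add: wp_def)
    qed
  qed
  \<comment> \<open>Only the positive parts are shown to converge in \<open>L^1\<close>; the
    negative parts may lose mass, and Fatou's lemma gives an inequality for them.\<close>
  have L1: "(\<lambda>n. LINT t|circle. norm (vp n t - wp t)) \<longlonglongrightarrow> 0"
  proof (rule Lim_null_comparison[OF _ g(5)], intro always_eventually allI)
    fix n
    have fi: "integrable circle (\<lambda>t. eval_fps f (of_real (rad n) * cis t))"
      using continuous_eval_H2[OF f, of "rad n"] rad_bounds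
      by (intro integrable_circle[of "\<lambda>z. eval_fps f (of_real (rad n) * z)"]) (simp add: eval_vfps_complex)
    have "norm (LINT t|circle. norm (vp n t - wp t)) = (LINT t|circle. norm (vp n t - wp t))"
      by (simp add: abs_of_nonneg)
    also have "\<dots> \<le> (LINT t|circle. cmod (eval_fps f (of_real (rad n) * cis t) - g t))"
    proof (rule integral_mono_AE)
      show "AE t in circle. norm (vp n t - wp t) \<le> cmod (eval_fps f (of_real (rad n) * cis t) - g t)"
        using exp_w
      proof eventually_elim
        case (elim t)
        have "norm (vp n t - wp t) \<le> \<bar>exp (v n t) - exp (w t)\<bar>"
          unfolding vp_def wp_def real_norm_def by (rule positive_part_exp_lipschitz)
        also have "\<dots> \<le> cmod (eval_fps f (of_real (rad n) * cis t) - g t)"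
          unfolding exp_v elim by (rule norm_triangle_ineq3)
        finally show ?case .
      qed
    qed (intro integrable_norm Bochner_Integration.integrable_diff vpi wpi fi g)+
    finally show "norm (LINT t|circle. norm (vp n t - wp t)) \<le> (LINT t|circle. cmod (eval_fps f (of_real (rad n) * cis t) - g t))" .
  qed
  \<comment> \<open>The Poisson integral of \<open>vn n\<close> is that of \<open>vp n\<close> minus
    the real part of the logarithm. In the limit, \<open>z = 0\<close> gives integrability of
    \<open>wn\<close>, and general \<open>z\<close> the domination of \<open>f\<close> by the outer
    function of \<open>w\<close>.\<close>
  have fatou: "integrable circle (\<lambda>t. pk z (cis t) * wn t)"
    "(LINT t|circle. pk z (cis t) * wn t) \<le> 2 * pi * (poisson wp z - Re (eval_fps Lf z))" if z: "cmod z < 1" for z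
  proof -
    define C where "C n = 2 * pi * (poisson (vp n) z - Re (eval_fps Lf (of_real (rad n) * z)))" for n
    have "isCont (eval_fps Lf) (of_real 1 * z)"
      using conv_radius_gt[OF Lf(1) z] by (intro continuous_on_interior[OF continuous_on_eval_fps]) (simp add: interior_open[OF open_eball])
    hence "(\<lambda>n. eval_fps Lf (of_real (rad n) * z)) \<longlonglongrightarrow> eval_fps Lf (of_real 1 * z)"
      by (rule isCont_tendsto_compose) (intro tendsto_intros rad_tendsto)
    hence C: "C \<longlonglongrightarrow> 2 * pi * (poisson wp z - Re (eval_fps Lf z))"
      unfolding C_def by (intro tendsto_intros poisson_tendsto vpi wpi L1 z) simp
    have a: "integrable circle (\<lambda>t. pk z (cis t) * vn n t)" for n
      using integrable_pk_scaleR[OF vpi(2) z] by simp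
    have b: "AE t in circle. 0 \<le> pk z (cis t) * vn n t" for n
      using z by (intro AE_I2 mult_nonneg_nonneg pk_ge0) (auto simp: vn_def)
    have c: "AE t in circle. (\<lambda>n. pk z (cis t) * vn n t) \<longlonglongrightarrow> pk z (cis t) * wn t"
      using v_lim unfolding vn_def wn_def by eventually_elim (intro tendsto_intros)
    have d: "(\<lambda>t. pk z (cis t) * wn t) \<in> borel_measurable circle"
      using measurable_pk[OF z] wpm(2) by measurable
    have e: "(LINT t|circle. pk z (cis t) * vn n t) \<le> C n" for n
    proof -
      have "poisson (vp n) z - poisson (v n) z = (1 / (2 * pi)) *\<^sub>R (LINT t|circle. pk z (cis t) *\<^sub>R vp n t - pk z (cis t) *\<^sub>R v n t)"
        unfolding poisson_def using integrable_pk_scaleR[OF vpi(1) z] integrable_pk_scaleR[OF vi z]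
        by (subst Bochner_Integration.integral_diff) (auto simp: scaleR_diff_right right_diff_distrib)
      also have "(\<lambda>t. pk z (cis t) *\<^sub>R vp n t - pk z (cis t) *\<^sub>R v n t) = (\<lambda>t. pk z (cis t) * vn n t)"
        by (auto simp: vp_def vn_def max_def algebra_simps)
      finally show ?thesis by (simp add: C_def vP[OF z, symmetric])
    qed
    show "integrable circle (\<lambda>t. pk z (cis t) * wn t)"
      "(LINT t|circle. pk z (cis t) * wn t) \<le> 2 * pi * (poisson wp z - Re (eval_fps Lf z))"
      using fatou_integrable[OF a b c d e C] by auto
  qed
  have wni: "integrable circle wn" using fatou(1)[of 0] by (simp add: pk_def)
  have w_eq: "w = (\<lambda>t. wp t - wn t)" by (auto simp: wp_def wn_def)
  have wi: "integrable circle w" unfolding w_eq by (intro Bochner_Integration.integrable_diff wpi wni)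
  have le_P: "Re (eval_fps Lf z) \<le> poisson w z" if z: "cmod z < 1" for z
  proof -
    have "poisson w z = poisson wp z - (1 / (2 * pi)) * (LINT t|circle. pk z (cis t) * wn t)"
      using integrable_pk_scaleR[OF wpi z] integrable_pk_scaleR[OF wni z]
      by (simp add: w_eq poisson_def right_diff_distrib diff_divide_distrib)
    moreover have "(1 / (2 * pi)) * (LINT t|circle. pk z (cis t) * wn t) \<le>
        (1 / (2 * pi)) * (2 * pi * (poisson wp z - Re (eval_fps Lf z)))"
      by (intro mult_left_mono fatou(2) z) simp
    ultimately show ?thesis by simp
  qed
  define F where "F = outer_fun w"
  have Fr: "fps_conv_radius F \<ge> 1" unfolding F_def by (rule outer_fun(1)[OF wi])
  have Fe: "eval_fps F z = exp (herglotz w z)" if "cmod z < 1" for z unfolding F_def by (rule outer_fun(2)[OF wi that])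
  have fF: "cmod (eval_fps f z) \<le> cmod (eval_fps F z)" if z: "cmod z < 1" for z
    unfolding norm_f[OF z] F_def outer_fun(3)[OF wi z] using le_P[OF z] by simp
  have sq: "AE t in circle. (cmod (g t))\<^sup>2 = (exp (w t))\<^sup>2" using exp_w by eventually_elim simp
  have sqm: "(\<lambda>t. (cmod (g t))\<^sup>2) \<in> borel_measurable circle" "(\<lambda>t. (exp (w t))\<^sup>2) \<in> borel_measurable circle"
    by measurable
  have FH: "F \<in> hcarrier H2" unfolding F_def
  proof (rule outer_fun_mem_H2[OF wi _ _ H2.hnorm_ge0[OF f]])
    show "integrable circle (\<lambda>t. (exp (w t))\<^sup>2)" by (rule integrable_cong_AE_imp[OF g(2) sqm(2)]) (use sq in \<open>auto elim: eventually_mono\<close>)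
    show "(LINT t|circle. (exp (w t))\<^sup>2) \<le> 2 * pi * (hnorm H2 f)\<^sup>2"
      unfolding g(4)[symmetric] using integral_cong_AE[OF sqm sq] by simp
  qed
  have F_lim: "AE t in circle. \<exists>l. has_nt_limit (eval_fps F) (cis t) l \<and> cmod l = exp (w t)"
    unfolding F_def by (rule AE_nt_limit_outer_fun[OF wi])
  have pF: "hnorm H2 (fps_of_poly p * F) = hnorm H2 (fps_of_poly p * f)" for p
  proof -
    have pm: "(\<lambda>t. poly p (cis t)) \<in> borel_measurable circle"
      by (rule borel_measurable_integrable[OF integrable_circle]) (intro continuous_intros)
    have m: "(\<lambda>t. cmod (poly p (cis t)) * cmod (g t)) \<in> borel_measurable circle"
      using pm by measurable
    have "AE t in circle. \<exists>l. has_nt_limit (eval_fps (fps_of_poly p * f)) (cis t) l \<and> cmod l = cmod (poly p (cis t)) * cmod (g t)"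
      using g(3) by eventually_elim (auto simp: norm_mult intro!: exI has_nt_limit_poly_mult[OF fr])
    note 1 = H2_boundary_norm(2)[OF poly_mult_H2[OF f] m this]
    have "AE t in circle. \<exists>l. has_nt_limit (eval_fps (fps_of_poly p * F)) (cis t) l \<and> cmod l = cmod (poly p (cis t)) * cmod (g t)"
      using F_lim exp_w
    proof eventually_elim
      case (elim t)
      then obtain l where "has_nt_limit (eval_fps F) (cis t) l" "cmod l = cmod (g t)" by auto
      with has_nt_limit_poly_mult[OF Fr this(1), of p] show ?case by (intro exI[of _ "poly p (cis t) * l"]) (simp add: norm_mult)
    qed
    note 2 = H2_boundary_norm(2)[OF poly_mult_H2[OF FH] m this]
    have "(hnorm H2 (fps_of_poly p * F))\<^sup>2 = (hnorm H2 (fps_of_poly p * f))\<^sup>2" using 1 2 by simp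
    thus ?thesis
      using power2_eq_imp_eq[OF _ H2.hnorm_ge0[OF poly_mult_H2[OF FH]] H2.hnorm_ge0[OF poly_mult_H2[OF f]]] by blast
  qed
  define \<phi> where "\<phi> z = eval_fps f z / eval_fps F z" for z
  have \<phi>le: "cmod (\<phi> z) \<le> 1" if z: "cmod z < 1" for z
    using fF[OF z] by (simp add: \<phi>_def norm_divide Fe[OF z])
  \<comment> \<open>The value of \<open>p f\<close> at 0 is within \<open>e\<close> of 1 and factors
    as that of \<open>p F\<close> times \<open>\<phi> 0\<close>. The first factor is at most the
    norm of \<open>p F\<close>, which equals that of \<open>p f\<close> and is at most
    \<open>1 + e\<close>.\<close>
  have "1 - e \<le> (1 + e) * cmod (\<phi> 0)" if e: "e > 0" for e
  proof -
    obtain p where p: "hnorm H2 (1 - fps_of_poly p * f) < e" using approx[OF e] by blast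
    have "cmod (1 - poly p 0 * eval_fps f 0) \<le> e"
      using norm_eval_H2_le[OF dH, of 0 p] eval_d[of 0 p] p by simp
    hence "1 - e \<le> cmod (poly p 0 * eval_fps f 0)"
      using norm_triangle_ineq2[of 1 "poly p 0 * eval_fps f 0"] norm_triangle_ineq3[of 1 "poly p 0 * eval_fps f 0"] by simp
    also have "poly p 0 * eval_fps f 0 = eval_fps (fps_of_poly p * F) 0 * \<phi> 0"
      using eval_poly_mult[OF Fr, of 0 p] Fe[of 0] by (simp add: \<phi>_def)
    also have "cmod \<dots> \<le> hnorm H2 (fps_of_poly p * F) * cmod (\<phi> 0)"
      using norm_eval_H2_le[OF poly_mult_H2[OF FH], of 0 p] by (simp add: norm_mult mult_right_mono)
    also have "hnorm H2 (fps_of_poly p * F) \<le> 1 + e"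
    proof -
      have "hnorm H2 (fps_of_poly p * f) = hnorm H2 (1 - (1 - fps_of_poly p * f))" by simp
      thus ?thesis
        unfolding pF using H2.hnorm_triangle_diff[OF one_H2 dH, of p] p by (simp add: hnorm_H2_one)
    qed
    finally show ?thesis by (simp add: mult_right_mono)
  qed
  note le = this
  have "1 - 0 \<le> (1 + 0) * cmod (\<phi> 0)"
  proof (rule tendsto_le[of "at_right 0"])
    show "((\<lambda>e::real. 1 - e) \<longlongrightarrow> 1 - 0) (at_right 0)" "((\<lambda>e::real. (1 + e) * cmod (\<phi> 0)) \<longlongrightarrow> (1 + 0) * cmod (\<phi> 0)) (at_right 0)"
      by (intro tendsto_intros)+
    show "\<forall>\<^sub>F e in at_right (0::real). 1 - e \<le> (1 + e) * cmod (\<phi> 0)"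
      using le by (auto simp: eventually_at_right_field intro!: exI[of _ 1])
  qed simp
  hence \<phi>0: "cmod (\<phi> 0) = 1" using \<phi>le[of 0] by simp
  have "\<phi> holomorphic_on ball 0 1"
    unfolding \<phi>_def using Fe
    by (intro holomorphic_on_divide holomorphic_on_subset[OF holomorphic_on_eval_fps]) (auto simp: conv_radius_gt fr Fr)
  hence "\<phi> constant_on ball 0 1"
    by (rule maximum_modulus_principle[where U = "ball 0 1" and \<xi> = 0]) (auto simp: \<phi>0 \<phi>le)
  then obtain c where c: "\<And>z. z \<in> ball 0 1 \<Longrightarrow> \<phi> z = c" by (auto simp: constant_on_def)
  have "cmod c = 1" using \<phi>0 c[of 0] by simp
  moreover have "eval_fps f z = c * exp (herglotz w z)" if "z \<in> ball 0 1" for z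
    using c[OF that] Fe[of z] that by (auto simp: \<phi>_def field_simps)
  ultimately show ?thesis unfolding outer_fps_iff using fr wi by blast
qed

section \<open>Contractivity of the row consisting of a mate and a Schur function\<close>

lemma norm_poisson_le:
  fixes g :: "real \<Rightarrow> 'b::euclidean_space"
  assumes g: "integrable circle g" and M: "AE t in circle. norm (g t) \<le> M" and z: "cmod z < 1"
  shows "norm (poisson g z) \<le> M"
proof -
  have "norm (poisson g z) = (1 / (2 * pi)) * norm (LINT t|circle. pk z (cis t) *\<^sub>R g t)"
    by (simp add: poisson_def)
  also have "\<dots> \<le> (1 / (2 * pi)) * (LINT t|circle. norm (pk z (cis t) *\<^sub>R g t))"
    by (intro mult_left_mono integral_norm_bound) simp
  also have "\<dots> = poisson (\<lambda>t. norm (g t)) z"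
    using z by (simp add: poisson_def pk_ge0)
  also have "\<dots> \<le> M" by (intro poisson_le_const integrable_norm g M z)
  finally show ?thesis .
qed

lemma H2_le_boundary:
  fixes F :: "complex fps"
  assumes F: "F \<in> hcarrier H2"
    and lim: "AE t in circle. \<exists>l. has_nt_limit (eval_fps F) (cis t) l \<and> cmod l \<le> M" and z: "cmod z < 1"
  shows "cmod (eval_fps F z) \<le> M"
proof -
  obtain g where g: "integrable circle g" "\<And>z. cmod z < 1 \<Longrightarrow> eval_fps F z = poisson g z"
      "AE t in circle. has_nt_limit (eval_fps F) (cis t) (g t)"
    by (rule H2_boundary_function[OF F]) blast
  have "AE t in circle. norm (g t) \<le> M"
    using g(3) lim
  proof eventually_elim
    case (elim t)
    then obtain l where "has_nt_limit (eval_fps F) (cis t) l" "cmod l \<le> M" by blast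
    with has_nt_limit_unique[OF elim(1) this(1)] show ?case by simp
  qed
  from norm_poisson_le[OF g(1) this z] show ?thesis by (simp add: g(2)[OF z])
qed

lemma bounded_holomorphic_nt_limit:
  assumes F: "F holomorphic_on ball 0 1" "\<And>z. cmod z < 1 \<Longrightarrow> cmod (F z) \<le> M"
  shows "AE t in circle. \<exists>l. has_nt_limit F (cis t) l"
proof -
  note e = fps_expansion_disc[OF F(1)]
  have "fps_expansion F 0 \<in> hcarrier H2"
    by (rule bounded_H2(1)[OF e(1), of M]) (simp add: e(2) F(2))
  then obtain g where "AE t in circle. has_nt_limit (eval_fps (fps_expansion F 0)) (cis t) (g t)"
    using H2_boundary_function by blast
  moreover have "has_nt_limit (eval_fps (fps_expansion F 0)) \<zeta> l \<longleftrightarrow> has_nt_limit F \<zeta> l" for \<zeta> l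
    by (rule has_nt_limit_cong) (rule e(2))
  ultimately show ?thesis by (auto elim: eventually_mono)
qed

lemma bounded_holomorphic_le_boundary:
  assumes F: "F holomorphic_on ball 0 1" "\<And>z. cmod z < 1 \<Longrightarrow> cmod (F z) \<le> C"
    and lim: "AE t in circle. \<exists>l. has_nt_limit F (cis t) l \<and> cmod l \<le> M" and z: "cmod z < 1"
  shows "cmod (F z) \<le> M"
proof -
  note e = fps_expansion_disc[OF F(1)]
  have H: "fps_expansion F 0 \<in> hcarrier H2"
    by (rule bounded_H2(1)[OF e(1), of C]) (simp add: e(2) F(2))
  have "has_nt_limit (eval_fps (fps_expansion F 0)) \<zeta> l \<longleftrightarrow> has_nt_limit F \<zeta> l" for \<zeta> l
    by (rule has_nt_limit_cong) (rule e(2))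
  with H2_le_boundary[OF H _ z, of M] lim show ?thesis by (simp add: e(2)[OF z])
qed

text \<open>Limits exist off a null set for finitely many spanning vectors, and linearity extends
  them to all vectors with the same null set. At such a point \<open>bdry_val\<close> is a bounded
  functional, represented by some \<open>y\<close>, and \<open>BBstar\<close> is the squared norm of
  \<open>y\<close>.\<close>

lemma BBstar_boundary:
  fixes B :: "complex \<Rightarrow> 'd::complex_hilbert \<Rightarrow> complex"
  assumes B: "B \<in> schur_class" and fin: "finite_dimensional (UNIV :: 'd set)"
  shows "AE t in circle. \<exists>\<beta>\<ge>0. BBstar B (cis t) = complex_of_real (\<beta>\<^sup>2) \<and>
    (\<forall>x. \<exists>l. has_nt_limit (\<lambda>z. B z x) (cis t) l \<and> cmod l \<le> \<beta> * norm x)"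
proof -
  obtain S :: "'d set" where S: "finite S" "module.span scaleC S = UNIV"
    using fin by (auto simp: finite_dimensional_def)
  have "AE t in circle. \<forall>x\<in>S. \<exists>l. has_nt_limit (\<lambda>z. B z x) (cis t) l"
    using S(1) schur_class_holomorphic[OF B] schur_classD(3)[OF B]
    by (intro AE_finite_allI bounded_holomorphic_nt_limit) auto
  thus ?thesis
  proof eventually_elim
    case (elim t)
    have add: "has_nt_limit (\<lambda>z. B z (x + y)) (cis t) (l + l')"
      if "has_nt_limit (\<lambda>z. B z x) (cis t) l" "has_nt_limit (\<lambda>z. B z y) (cis t) l'" for x y l l'
    proof -
      have "has_nt_limit (\<lambda>z. B z x + B z y) (cis t) (l + l')"
        using that unfolding has_nt_limit_def by (auto intro: tendsto_add)
      moreover have "has_nt_limit (\<lambda>z. B z (x + y)) (cis t) (l + l') \<longleftrightarrow> has_nt_limit (\<lambda>z. B z x + B z y) (cis t) (l + l')"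
        by (rule has_nt_limit_cong) (rule schur_classD[OF B])
      ultimately show ?thesis by blast
    qed
    have scale: "has_nt_limit (\<lambda>z. B z (c *\<^sub>C x)) (cis t) (c * l)" if "has_nt_limit (\<lambda>z. B z x) (cis t) l" for x c l
    proof -
      have "has_nt_limit (\<lambda>z. c * B z x) (cis t) (c * l)"
        using that unfolding has_nt_limit_def by (auto intro: tendsto_mult)
      moreover have "has_nt_limit (\<lambda>z. B z (c *\<^sub>C x)) (cis t) (c * l) \<longleftrightarrow> has_nt_limit (\<lambda>z. c * B z x) (cis t) (c * l)"
        by (rule has_nt_limit_cong) (rule schur_classD[OF B])
      ultimately show ?thesis by blast
    qed
    have "cvec.subspace {x. \<exists>l. has_nt_limit (\<lambda>z. B z x) (cis t) l}"
    proof (rule cvec.subspaceI)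
      have "has_nt_limit (\<lambda>z. B z 0) (cis t) 0 \<longleftrightarrow> has_nt_limit (\<lambda>z. 0) (cis t) 0"
        by (rule has_nt_limit_cong) (use schur_classD(3)[OF B, of _ 0] in simp)
      thus "0 \<in> {x. \<exists>l. has_nt_limit (\<lambda>z. B z x) (cis t) l}" by (auto simp: has_nt_limit_def)
    qed (use add scale in blast)+
    hence "cvec.span S \<subseteq> {x. \<exists>l. has_nt_limit (\<lambda>z. B z x) (cis t) l}"
      using elim by (intro cvec.span_minimal) auto
    hence ex: "\<exists>l. has_nt_limit (\<lambda>z. B z x) (cis t) l" for x using S(2) by auto
    define b where "b = bdry_val B (cis t)"
    have b: "has_nt_limit (\<lambda>z. B z x) (cis t) (b x)" for x
      using ex[of x] nt_lim_eqI by (auto simp: b_def bdry_val_def)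
    have b_add: "b (x + y) = b x + b y" for x y using has_nt_limit_unique[OF b add[OF b b]] by simp
    have b_scale: "b (c *\<^sub>C x) = c * b x" for c x using has_nt_limit_unique[OF b scale[OF b]] by simp
    have b_le: "cmod (b x) \<le> norm x" for x
    proof (rule LIMSEQ_le_const2)
      show "(\<lambda>k. cmod (B (of_real (rad k) * cis t) x)) \<longlonglongrightarrow> cmod (b x)"
        by (intro tendsto_norm has_nt_limit_radial[OF b]) simp
      show "\<exists>N. \<forall>n\<ge>N. cmod (B (of_real (rad n) * cis t) x) \<le> norm x"
        using rad_bounds by (intro exI[of _ 0] allI impI schur_classD(3)[OF B]) (simp add: norm_mult)
    qed
    have bop: "bounded_op type_hspace type_hspace b"
      unfolding bounded_op_def using b_add b_scale b_le by (auto intro!: exI[of _ 1])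
    define y where "y = adj type_hspace type_hspace b (1::complex)"
    have rep: "b x = cinner x y" for x
      using adj_exists(2)[OF hilbert_type_hspace cinner.prehilbert_axioms bop, of 1 x] by (simp add: y_def)
    have "BBstar B (cis t) = complex_of_real ((norm y)\<^sup>2)"
      unfolding BBstar_def b_def[symmetric] y_def[symmetric] by (simp add: rep cinner_self)
    moreover have "cmod (b x) \<le> norm y * norm x" for x
      using cinner.cauchy_schwarz[of x y] by (simp add: rep mult.commute)
    ultimately show ?case using b by (intro exI[of _ "norm y"]) auto
  qed
qed

text \<open>On the circle \<open>(cmod \<alpha>)^2 + \<beta>^2 = 1\<close>, so the row is
  contractive there by Cauchy-Schwarz in two variables. For fixed \<open>c\<close> and
  \<open>x\<close> it is a bounded holomorphic function and inherits the bound in the disc.\<close>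

lemma mate_row_contractive:
  fixes B :: "complex \<Rightarrow> 'd::complex_hilbert \<Rightarrow> complex"
  assumes B: "B \<in> schur_class" and fin: "finite_dimensional (UNIV :: 'd set)" and mate: "is_mate B a"
  shows "fps_conv_radius a \<ge> 1" "cmod z < 1 \<Longrightarrow> eval_fps a z \<noteq> 0"
    and "cmod z < 1 \<Longrightarrow> (cmod (eval_fps a z * c + B z x))\<^sup>2 \<le> (cmod c)\<^sup>2 + (norm x)\<^sup>2"
proof -
  have "outer_fps a" using mate by (simp add: is_mate_def)
  then obtain d u where ar: "fps_conv_radius a \<ge> 1" and du: "cmod d = 1" "integrable circle u"
    "\<forall>z\<in>ball 0 1. eval_fps a z = d * exp (herglotz u z)"
    unfolding outer_fps_iff by blast
  have au: "eval_fps a z = d * exp (herglotz u z)" if "cmod z < 1" for z using du(3) that by simp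
  show "fps_conv_radius a \<ge> 1" by (rule ar)
  show "eval_fps a z \<noteq> 0" if "cmod z < 1" using au[OF that] du(1) by auto
  have a_nt: "AE t in circle. \<exists>l. has_nt_limit (eval_fps a) (cis t) l \<and> cmod l = exp (u t)"
    using AE_nt_limit_herglotz[OF du(2)]
  proof eventually_elim
    case (elim t)
    then obtain l where l: "has_nt_limit (\<lambda>z. exp (herglotz u z)) (cis t) l" "cmod l = exp (u t)" by blast
    have "has_nt_limit (\<lambda>z. d * exp (herglotz u z)) (cis t) (d * l)"
      using l(1) unfolding has_nt_limit_def by (auto intro: tendsto_mult)
    moreover have "has_nt_limit (eval_fps a) (cis t) (d * l) \<longleftrightarrow> has_nt_limit (\<lambda>z. d * exp (herglotz u z)) (cis t) (d * l)"
      by (rule has_nt_limit_cong) (rule au)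
    ultimately show ?case using l(2) du(1) by (intro exI[of _ "d * l"]) (simp add: norm_mult)
  qed
  have mate': "AE t in circle. complex_of_real ((cmod (nt_lim (eval_fps a) (cis t)))\<^sup>2) + BBstar B (cis t) = 1"
    using mate by (simp add: is_mate_def)
  have key: "AE t in circle. \<exists>\<alpha> \<beta>. has_nt_limit (eval_fps a) (cis t) \<alpha> \<and> cmod \<alpha> = exp (u t) \<and>
      \<beta> \<ge> 0 \<and> (cmod \<alpha>)\<^sup>2 + \<beta>\<^sup>2 = 1 \<and> (\<forall>x. \<exists>l. has_nt_limit (\<lambda>z. B z x) (cis t) l \<and> cmod l \<le> \<beta> * norm x)"
    using a_nt mate' BBstar_boundary[OF B fin]
  proof eventually_elim
    case (elim t)
    obtain \<alpha> where \<alpha>: "has_nt_limit (eval_fps a) (cis t) \<alpha>" "cmod \<alpha> = exp (u t)" using elim(1) by blast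
    obtain \<beta> where \<beta>: "\<beta> \<ge> 0" "BBstar B (cis t) = complex_of_real (\<beta>\<^sup>2)"
      "\<forall>x. \<exists>l. has_nt_limit (\<lambda>z. B z x) (cis t) l \<and> cmod l \<le> \<beta> * norm x" using elim(3) by blast
    have "complex_of_real ((cmod \<alpha>)\<^sup>2 + \<beta>\<^sup>2) = of_real 1"
      using elim(2) unfolding nt_lim_eqI[OF \<alpha>(1) norm_cis] \<beta>(2) by simp
    hence "(cmod \<alpha>)\<^sup>2 + \<beta>\<^sup>2 = 1" by (simp only: of_real_eq_iff)
    with \<alpha> \<beta> show ?case by blast
  qed
  \<comment> \<open>The boundary identity bounds the modulus of \<open>a\<close> by 1 on the circle;
    the outer representation carries this into the disc.\<close>
  have u0: "AE t in circle. u t \<le> 0"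
    using key
  proof eventually_elim
    case (elim t)
    then obtain \<beta> where "(exp (u t))\<^sup>2 + \<beta>\<^sup>2 = 1" by auto
    hence "(exp (u t))\<^sup>2 \<le> 1\<^sup>2" using zero_le_power2[of \<beta>] unfolding one_power2 by linarith
    hence "exp (u t) \<le> 1" by (rule power2_le_imp_le) simp
    thus ?case by simp
  qed
  have a1: "cmod (eval_fps a z) \<le> 1" if z: "cmod z < 1" for z
    using poisson_le_const[OF du(2) u0 z] Re_herglotz[OF du(2) z] du(1) by (simp add: au[OF z] norm_mult)
  show "(cmod (eval_fps a z * c + B z x))\<^sup>2 \<le> (cmod c)\<^sup>2 + (norm x)\<^sup>2" if z: "cmod z < 1"
  proof -
    have "cmod (eval_fps a z * c + B z x) \<le> sqrt ((cmod c)\<^sup>2 + (norm x)\<^sup>2)"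
    proof (rule bounded_holomorphic_le_boundary[OF _ _ _ z])
      show "(\<lambda>z. eval_fps a z * c + B z x) holomorphic_on ball 0 1"
        using ar by (intro holomorphic_intros schur_class_holomorphic B holomorphic_on_subset[OF holomorphic_on_eval_fps])
          (auto simp: conv_radius_gt)
      show "cmod (eval_fps a w * c + B w x) \<le> cmod c + norm x" if w: "cmod w < 1" for w
        using a1[OF w] schur_classD(3)[OF B w, of x] mult_right_mono[OF a1[OF w], of "cmod c"]
        by (intro norm_triangle_le add_mono) (auto simp: norm_mult)
      show "AE t in circle. \<exists>l. has_nt_limit (\<lambda>z. eval_fps a z * c + B z x) (cis t) l \<and>
          cmod l \<le> sqrt ((cmod c)\<^sup>2 + (norm x)\<^sup>2)"
        using key
      proof eventually_elim
        case (elim t)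
        then obtain \<alpha> \<beta> where ab: "has_nt_limit (eval_fps a) (cis t) \<alpha>" "\<beta> \<ge> 0" "(cmod \<alpha>)\<^sup>2 + \<beta>\<^sup>2 = 1"
          "\<forall>x. \<exists>l. has_nt_limit (\<lambda>z. B z x) (cis t) l \<and> cmod l \<le> \<beta> * norm x" by blast
        then obtain l where l: "has_nt_limit (\<lambda>z. B z x) (cis t) l" "cmod l \<le> \<beta> * norm x" by blast
        have "has_nt_limit (\<lambda>z. eval_fps a z * c + B z x) (cis t) (\<alpha> * c + l)"
          using ab(1) l(1) unfolding has_nt_limit_def by (auto intro!: tendsto_intros)
        moreover have "cmod (\<alpha> * c + l) \<le> sqrt ((cmod c)\<^sup>2 + (norm x)\<^sup>2)"
        proof (rule real_le_rsqrt)
          have "cmod (\<alpha> * c + l) \<le> cmod \<alpha> * cmod c + \<beta> * norm x"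
            using norm_triangle_ineq[of "\<alpha> * c" l] l(2) by (simp add: norm_mult)
          hence "(cmod (\<alpha> * c + l))\<^sup>2 \<le> (cmod \<alpha> * cmod c + \<beta> * norm x)\<^sup>2" by (intro power_mono) auto
          \<comment> \<open>Lagrange's identity.\<close>
          also have "\<dots> + (cmod \<alpha> * norm x - \<beta> * cmod c)\<^sup>2 = ((cmod \<alpha>)\<^sup>2 + \<beta>\<^sup>2) * ((cmod c)\<^sup>2 + (norm x)\<^sup>2)"
            by (simp add: power2_eq_square algebra_simps)
          hence "(cmod \<alpha> * cmod c + \<beta> * norm x)\<^sup>2 \<le> (cmod c)\<^sup>2 + (norm x)\<^sup>2"
            unfolding ab(3) mult_1 using zero_le_power2[of "cmod \<alpha> * norm x - \<beta> * cmod c"] by linarith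
          finally show "(cmod (\<alpha> * c + l))\<^sup>2 \<le> (cmod c)\<^sup>2 + (norm x)\<^sup>2" .
        qed
        ultimately show ?case by blast
      qed
    qed
    from power_mono[OF this, of 2] show ?thesis by simp
  qed
qed

theorem theoremC:
  fixes B :: "complex \<Rightarrow> 'd::{complex_hilbert, second_countable_topology} \<Rightarrow> complex"
    and a :: "complex fps" and s :: nat and \<Lambda> :: "nat \<Rightarrow> complex"
  assumes "B \<in> schur_class"
    and "log_integrable B"
    and "is_mate B a"
    and "finite_dimensional (UNIV :: 'd set)"
    and "finite_dimensional (aH2_perp B a)"
    and "inj_on \<Lambda> {1..s}"
    and "(\<lambda>j. cnj (\<Lambda> j)) ` {1..s} = eigenvalues_on (aH2_perp B a) (Mz_adj B)"
  shows "(\<forall>j\<in>{1..s}. cnj (\<Lambda> j) \<in> sphere 0 1) \<and>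
    (\<forall>f\<in>hcarrier (dBR B).
       cyclic_in (dBR B) f \<longleftrightarrow>
         outer_fps f \<and> (\<forall>j\<in>{1..s}. nt_lim (eval_fps f) (\<Lambda> j) \<noteq> 0))"
proof -
  note row = mate_row_contractive[OF assms(1,4,3)]
  interpret schur_mate_finite B a
    by unfold_locales (use assms(1,5) row in auto)
  let ?E = "eigenvalues_on (aH2_perp B a) (Mz_adj B)"
  \<comment> \<open>\<open>\<Lambda>\<close> lists the conjugated eigenvalues, so the condition over
    all \<open>\<nu>\<close> in \<open>cyclic_dBR_iff\<close> becomes one over
    \<open>j\<close>.\<close>
  have mem: "cnj \<nu> \<in> ?E \<longleftrightarrow> (\<exists>j\<in>{1..s}. \<nu> = \<Lambda> j)" for \<nu>
    unfolding assms(7)[symmetric] by (auto simp: image_iff)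
  have "cnj (\<Lambda> j) \<in> sphere 0 1" if "j \<in> {1..s}" for j
  proof -
    have "cnj (\<Lambda> j) \<in> ?E" using that mem by blast
    then obtain k where "k \<in> aH2_perp B a" "Mz_adj B k = cnj (\<Lambda> j) *\<^sub>C k" "k \<noteq> 0"
      by (auto simp: eigenvalues_on_def)
    from eigenvalue_circle[OF this] show ?thesis by simp
  qed
  moreover have "cyclic_in (dBR B) f \<longleftrightarrow> outer_fps f \<and> (\<forall>j\<in>{1..s}. nt_lim (eval_fps f) (\<Lambda> j) \<noteq> 0)"
    if f: "f \<in> hcarrier (dBR B)" for f
  proof -
    have "cyclic_in H2 f \<longleftrightarrow> outer_fps f"
      using outer_imp_cyclic_H2[OF dBR_H2[OF f]] cyclic_H2_imp_outer[OF dBR_H2[OF f]] by blast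
    thus ?thesis unfolding cyclic_dBR_iff[OF f] mem by blast
  qed
  ultimately show ?thesis by blast
qed

end
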